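(* The module $V(T(\bar v))$ is a $1$-singular Gelfand-Tsetlin module. Moreover, for any $z\in\mathbb Z^{n(n-1)/2}$ and any $1\le s\le r\le n$ the following identities hold: (i) $c_{rs}(T(\bar v+z))=\mathcal D^{\bar v}\big((x-y)\,c_{rs}(T(v+z))\big)$; (ii) $c_{rs}(\mathcal DT(\bar v+z))=\mathcal D^{\bar v}\big(c_{rs}(T(v+z))\big)$ if $z\ne\tau(z)$.
   Context: Ground field $\mathbb C$; $E_{rs}$ are the elementary matrices in $\mathfrak{gl}(n)$. Fix $n$, integers $1\le i<j\le k\le n-1$ and $a_1,\dots,a_n\in\mathbb C$. A vector $v=(v_{rs})_{1\le s\le r\le n-1}\in\mathbb C^{n(n-1)/2}$ is extended by $v_{ns}=a_s$; vectors $z\in\mathbb Z^{n(n-1)/2}$ are extended by $z_{ns}=0$. $\delta^{rs}$ is the vector with $(r,s)$ entry $1$ and all others $0$. $v$ is generic if $v_{rs}-v_{ru}\notin\mathbb Z$ for all $1\le s<u\le r\le n-1$; it is $1$-singular if exactly one such difference is an integer. Fix $\bar v$ with $\bar v_{ki}=\bar v_{kj}$ and all other such differences non-integer. $\tau$ interchanges the $(k,i)$ and $(k,j)$ entries of a vector. Put $x=v_{ki}$, $y=v_{kj}$. Generic modules: for generic $v$, $V(T(v))$ is the $\mathfrak{gl}(n)$-module with basis the tableaux (symbols) $T(w)$, $w\in v+\mathbb Z^{n(n-1)/2}$, and action $$E_{p,p+1}T(w)=-\sum_{q=1}^{p}\frac{\prod_{u=1}^{p+1}(w_{pq}-w_{p+1,u})}{\prod_{u\ne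 q}(w_{pq}-w_{pu})}T(w+\delta^{pq}),\quad E_{p+1,p}T(w)=\sum_{q=1}^{p}\frac{\prod_{u=1}^{p-1}(w_{pq}-w_{p-1,u})}{\prod_{u\ne q}(w_{pq}-w_{pu})}T(w-\delta^{pq}),$$ $$E_{pp}T(w)=\Big(\sum_{q=1}^{p}(w_{pq}+q-1)-\sum_{q=1}^{p-1}(w_{p-1,q}+q-1)\Big)T(w)$$ (this determines all $E_{rs}$). For each $r,s$ and $z$, $E_{rs}T(v+z)$ is regarded as a finite combination of the $T(v+z')$ whose coefficients are rational functions of the variables $v_{pq}$. The coefficients of $(x-y)E_{rs}T(v+z)$ are regular at $\bar v$, and so are those of $E_{rs}T(v+w)$ if $\tau(w)\ne w$. $V(T(\bar v))$ is the vector space spanned by symbols $T(\bar v+z)$ and $\mathcal DT(\bar v+z)$, $z\in\mathbb Z^{n(n-1)/2}$, subject only to $T(\bar v+z)=T(\bar v+\tau(z))$ and $\mathcal DT(\bar v+z)=-\mathcal DT(\bar v+\tau(z))$. For a rational function $f$ of $v$ regular at $\bar v$ put $\mathcal D^{\bar v}(f)=\frac12\big(\frac{\partial f}{\partial x}-\frac{\partial f}{\partial y}\big)(\bar v)$, and extend linearly by $\mathcal D^{\bar v}(fT(v+z))=\mathcal D^{\bar v}(f)T(\bar v+z)+f(\bar v)\mathcal DT(\bar v+z)$. $V(T(\bar v))$ is a $\mathfrak{gl}(n)$-module via $E_{rs}(T(\bar v+z))=\mathcal D^{\bar v}((x-y)E_{rs}T(v+z))$ and $E_{rs}(\mathcal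 DT(\bar v+w))=\mathcal D^{\bar v}(E_{rs}T(v+w))$ for $\tau(w)\ne w$. Gelfand-Tsetlin subalgebra: $U=U(\mathfrak{gl}(n))$; for $1\le s\le r\le n$, $c_{rs}=\sum_{(i_1,\dots,i_s)\in\{1,\dots,r\}^s}E_{i_1i_2}E_{i_2i_3}\cdots E_{i_si_1}$; $\Gamma\subset U$ is the (polynomial) subalgebra generated by all $c_{rs}$. On generic tableaux $c_{rs}T(v+z)=\gamma_{rs}(v+z)T(v+z)$, where $\gamma_{rs}(w)=\sum_{p=1}^r(w_{rp}+r-1)^s\prod_{q\ne p}\big(1-\frac1{w_{rp}-w_{rq}}\big)$, which is a symmetric polynomial in $w_{r1},\dots,w_{rr}$. For a maximal ideal $\mathsf m$ of $\Gamma$ and a $U$-module $M$, $M(\mathsf m)=\{u\in M:\mathsf m^Nu=0\text{ for some }N\ge0\}$. A finitely generated $U$-module $M$ is a Gelfand-Tsetlin module if $M=\bigoplus_{\mathsf m\in\mathrm{Specm}\,\Gamma}M(\mathsf m)$. It is a $1$-singular Gelfand-Tsetlin module if $M(\mathsf m)\ne0$ for some $\mathsf m$ that is the kernel of a character $c_{rs}\mapsto\gamma_{rs}(\ell)$ with $\ell\in\mathbb C^{n(n+1)/2}$ whose rows $1,\dots,n-1$ form a $1$-singular vector. *)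

theory Defs
  imports
    "HOL-Analysis.Derivative"
    "HOL-Library.Poly_Mapping"
    "HOL-Library.Product_Lexorder"
    "HOL-Computational_Algebra.Fraction_Field"
    "HOL-Algebra.QuotRing"
    "HOL-Algebra.Module"
    "HOL-Algebra.Ideal_Product"
    "HOL-Algebra.Generated_Rings"
begin

section \<open>Finite linear combinations\<close>

text \<open>
  A finite linear combination of symbols of type 'b with coefficients in 'c is an element of
  the type of finitely supported functions from 'b to 'c.
\<close>

definition scale :: "'c \<Rightarrow> ('b \<Rightarrow>\<^sub>0 'c) \<Rightarrow> ('b \<Rightarrow>\<^sub>0 'c::comm_ring_1)" where
  "scale c f = Poly_Mapping.map ((*) c) f"

definition lin_extend :: "('b \<Rightarrow> ('d \<Rightarrow>\<^sub>0 'c)) \<Rightarrow> ('b \<Rightarrow>\<^sub>0 'c) \<Rightarrow> ('d \<Rightarrow>\<^sub>0 'c::comm_ring_1)" where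
  "lin_extend g f = (\<Sum>b\<in>Poly_Mapping.keys f. scale (Poly_Mapping.lookup f b) (g b))"


section \<open>Rational functions in the entries of a tableau\<close>

text \<open>
  The variables are indexed by pairs (row, column). The lexicographic order on pairs is imported
  only because the library needs a linear order on monomials for the integral domain instance.
\<close>

type_synonym idx = "nat \<times> nat"
type_synonym mpoly = "(idx \<Rightarrow>\<^sub>0 nat) \<Rightarrow>\<^sub>0 complex"
type_synonym ratfun = "mpoly fract"

definition rconst :: "complex \<Rightarrow> ratfun" where
  "rconst c = Fract (Poly_Mapping.single 0 c) 1"

definition rvar :: "idx \<Rightarrow> ratfun" where
  "rvar u = Fract (Poly_Mapping.single (Poly_Mapping.single u 1) 1) 1"

definition mpoly_eval :: "mpoly \<Rightarrow> (idx \<Rightarrow> complex) \<Rightarrow> complex" where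
  "mpoly_eval p v = (\<Sum>m\<in>Poly_Mapping.keys p.
     Poly_Mapping.lookup p m * (\<Prod>u\<in>Poly_Mapping.keys m. v u ^ Poly_Mapping.lookup m u))"

definition regular_at :: "ratfun \<Rightarrow> (idx \<Rightarrow> complex) \<Rightarrow> bool" where
  "regular_at f v \<longleftrightarrow> (\<exists>p q. f = Fract p q \<and> mpoly_eval q v \<noteq> 0)"

text \<open>Evaluation is meaningful at points of regularity only.\<close>

definition rf_eval :: "ratfun \<Rightarrow> (idx \<Rightarrow> complex) \<Rightarrow> complex" where
  "rf_eval f v = (THE c. \<exists>p q. f = Fract p q \<and> mpoly_eval q v \<noteq> 0 \<and>
                               c = mpoly_eval p v / mpoly_eval q v)"

definition partial_deriv :: "ratfun \<Rightarrow> idx \<Rightarrow> (idx \<Rightarrow> complex) \<Rightarrow> complex" where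
  "partial_deriv f u v = deriv (\<lambda>t. rf_eval f (v(u := t))) (v u)"

definition D_rf :: "nat \<Rightarrow> nat \<Rightarrow> nat \<Rightarrow> (idx \<Rightarrow> complex) \<Rightarrow> ratfun \<Rightarrow> complex" where
  "D_rf k i j v f = (partial_deriv f (k,i) v - partial_deriv f (k,j) v) / 2"


section \<open>The enveloping algebra of gl(n) and its Gelfand-Tsetlin subalgebra\<close>

text \<open>
  Words in the symbols E_rs, under concatenation. The monoid algebra of words is the free
  associative algebra.
\<close>

datatype gl_word = GW (letters: "idx list")

instantiation gl_word :: monoid_add
begin
definition zero_gl_word :: gl_word where "0 = GW []"
definition plus_gl_word :: "gl_word \<Rightarrow> gl_word \<Rightarrow> gl_word" where
  "u + w = GW (letters u @ letters w)"
instance by intro_classes (auto simp: zero_gl_word_def plus_gl_word_def)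
end

type_synonym gl_free = "gl_word \<Rightarrow>\<^sub>0 complex"
type_synonym gl_env = "gl_free set"

definition Efree :: "nat \<Rightarrow> nat \<Rightarrow> gl_free" where
  "Efree r s = Poly_Mapping.single (GW [(r,s)]) 1"

definition free_alg :: "nat \<Rightarrow> gl_free ring" where
  "free_alg n = \<lparr>carrier = {f. \<forall>w\<in>Poly_Mapping.keys f. set (letters w) \<subseteq> {1..n} \<times> {1..n}},
                 mult = (*), one = 1, zero = 0, add = (+)\<rparr>"

definition gl_relators :: "nat \<Rightarrow> gl_free set" where
  "gl_relators n = {Efree r s * Efree p q - Efree p q * Efree r s
       - ((if s = p then Efree r q else 0) - (if q = r then Efree p s else 0)) | r s p q.
       {r, s, p, q} \<subseteq> {1..n}}"

definition gl_ideal :: "nat \<Rightarrow> gl_free set" where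
  "gl_ideal n = Idl\<^bsub>free_alg n\<^esub> (gl_relators n)"

definition Ugl :: "nat \<Rightarrow> gl_env ring" where
  "Ugl n = free_alg n Quot gl_ideal n"

definition Ucls :: "nat \<Rightarrow> gl_free \<Rightarrow> gl_env" where
  "Ucls n f = gl_ideal n +>\<^bsub>free_alg n\<^esub> f"

text \<open>
  The word attached to a list [i_1, ..., i_s] below is E_(i_1 i_2) E_(i_2 i_3) ... E_(i_s i_1).
\<close>

definition c_free :: "nat \<Rightarrow> nat \<Rightarrow> gl_free" where
  "c_free r s = (\<Sum>is\<in>{is. length is = s \<and> set is \<subseteq> {1..r}}.
     Poly_Mapping.single (GW (zip is (rotate1 is))) 1)"

definition c_env :: "nat \<Rightarrow> nat \<Rightarrow> nat \<Rightarrow> gl_env" where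
  "c_env n r s = Ucls n (c_free r s)"

definition scalar_env :: "nat \<Rightarrow> complex \<Rightarrow> gl_env" where
  "scalar_env n c = Ucls n (Poly_Mapping.single 0 c)"

definition GTalg :: "nat \<Rightarrow> gl_env ring" where
  "GTalg n = (Ugl n)\<lparr>carrier := generate_ring (Ugl n)
     (range (scalar_env n) \<union> {c_env n r s | r s. 1 \<le> s \<and> s \<le> r \<and> r \<le> n})\<rparr>"

definition Specm :: "('x, 'y) ring_scheme \<Rightarrow> 'x set set" where
  "Specm R = {m. maximalideal m R}"

primrec ideal_pow :: "('x, 'y) ring_scheme \<Rightarrow> 'x set \<Rightarrow> nat \<Rightarrow> 'x set" where
  "ideal_pow R I 0 = carrier R"
| "ideal_pow R I (Suc N) = ideal_prod R I (ideal_pow R I N)"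

text \<open>The locale of modules in the library is confined to commutative rings.\<close>

locale left_module = R?: ring R + M?: abelian_group M
  for R :: "('x, 'y) ring_scheme" (structure) and M :: "('x, 'm, 'z) module_scheme" (structure) +
  assumes smult_closed:
      "\<lbrakk>x \<in> carrier R; u \<in> carrier M\<rbrakk> \<Longrightarrow> x \<odot>\<^bsub>M\<^esub> u \<in> carrier M"
    and smult_l_distr:
      "\<lbrakk>x \<in> carrier R; y \<in> carrier R; u \<in> carrier M\<rbrakk> \<Longrightarrow>
        (x \<oplus>\<^bsub>R\<^esub> y) \<odot>\<^bsub>M\<^esub> u = x \<odot>\<^bsub>M\<^esub> u \<oplus>\<^bsub>M\<^esub> y \<odot>\<^bsub>M\<^esub> u"
    and smult_r_distr:
      "\<lbrakk>x \<in> carrier R; u \<in> carrier M; w \<in> carrier M\<rbrakk> \<Longrightarrow>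
        x \<odot>\<^bsub>M\<^esub> (u \<oplus>\<^bsub>M\<^esub> w) = x \<odot>\<^bsub>M\<^esub> u \<oplus>\<^bsub>M\<^esub> x \<odot>\<^bsub>M\<^esub> w"
    and smult_assoc:
      "\<lbrakk>x \<in> carrier R; y \<in> carrier R; u \<in> carrier M\<rbrakk> \<Longrightarrow>
        (x \<otimes>\<^bsub>R\<^esub> y) \<odot>\<^bsub>M\<^esub> u = x \<odot>\<^bsub>M\<^esub> (y \<odot>\<^bsub>M\<^esub> u)"
    and smult_one:
      "u \<in> carrier M \<Longrightarrow> \<one>\<^bsub>R\<^esub> \<odot>\<^bsub>M\<^esub> u = u"

definition finitely_generated :: "('x, 'y) ring_scheme \<Rightarrow> ('x, 'm, 'z) module_scheme \<Rightarrow> bool" where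
  "finitely_generated R M \<longleftrightarrow> (\<exists>A. finite A \<and> A \<subseteq> carrier M \<and>
     (\<forall>u\<in>carrier M. \<exists>x. x \<in> A \<rightarrow> carrier R \<and> u = (\<Oplus>\<^bsub>M\<^esub>b\<in>A. x b \<odot>\<^bsub>M\<^esub> b)))"

definition GT_space :: "nat \<Rightarrow> (gl_env, 'm, 'z) module_scheme \<Rightarrow> gl_env set \<Rightarrow> 'm set" where
  "GT_space n M m = {u \<in> carrier M. \<exists>N. \<forall>x\<in>ideal_pow (GTalg n) m N. x \<odot>\<^bsub>M\<^esub> u = \<zero>\<^bsub>M\<^esub>}"

definition internal_direct_sum ::
  "('x, 'm, 'z) module_scheme \<Rightarrow> 'p set \<Rightarrow> ('p \<Rightarrow> 'm set) \<Rightarrow> bool" where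
  "internal_direct_sum M P S \<longleftrightarrow> (\<forall>p\<in>P. S p \<subseteq> carrier M) \<and>
     (\<forall>u\<in>carrier M. \<exists>!f. (\<forall>p\<in>P. f p \<in> S p) \<and> (\<forall>p. p \<notin> P \<longrightarrow> f p = \<zero>\<^bsub>M\<^esub>) \<and>
        finite {p. f p \<noteq> \<zero>\<^bsub>M\<^esub>} \<and> u = (\<Oplus>\<^bsub>M\<^esub>p\<in>{p. f p \<noteq> \<zero>\<^bsub>M\<^esub>}. f p))"

definition GT_module :: "nat \<Rightarrow> (gl_env, 'm, 'z) module_scheme \<Rightarrow> bool" where
  "GT_module n M \<longleftrightarrow> left_module (Ugl n) M \<and> finitely_generated (Ugl n) M \<and>
     internal_direct_sum M (Specm (GTalg n)) (GT_space n M)"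

definition complex_ring :: "complex ring" where
  "complex_ring = \<lparr>carrier = UNIV, mult = (*), one = 1, zero = 0, add = (+)\<rparr>"

definition GT_character :: "nat \<Rightarrow> (gl_env \<Rightarrow> complex) \<Rightarrow> bool" where
  "GT_character n ch \<longleftrightarrow> ch \<in> ring_hom (GTalg n) complex_ring \<and> (\<forall>c. ch (scalar_env n c) = c)"

text \<open>
  The fraction below is a polynomial, so it can be evaluated at every vector, in particular
  where entries of a row coincide.
\<close>

definition gamma :: "nat \<Rightarrow> nat \<Rightarrow> ratfun" where
  "gamma r s = (\<Sum>p=1..r. (rvar (r,p) + of_nat r - 1) ^ s *
     (\<Prod>q\<in>{1..r} - {p}. 1 - 1 / (rvar (r,p) - rvar (r,q))))"

definition one_singular :: "nat \<Rightarrow> (idx \<Rightarrow> complex) \<Rightarrow> bool" where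
  "one_singular n v \<longleftrightarrow> card {(r, s, u). 1 \<le> s \<and> s < u \<and> u \<le> r \<and> r \<le> n - 1 \<and>
     v (r,s) - v (r,u) \<in> \<int>} = 1"

definition one_singular_GT_module :: "nat \<Rightarrow> (gl_env, 'm, 'z) module_scheme \<Rightarrow> bool" where
  "one_singular_GT_module n M \<longleftrightarrow> GT_module n M \<and>
     (\<exists>m\<in>Specm (GTalg n). GT_space n M m \<noteq> {\<zero>\<^bsub>M\<^esub>} \<and>
        (\<exists>l ch. one_singular n l \<and> GT_character n ch \<and>
           (\<forall>r s. 1 \<le> s \<and> s \<le> r \<and> r \<le> n \<longrightarrow> ch (c_env n r s) = rf_eval (gamma r s) l) \<and>
           m = a_kernel (GTalg n) complex_ring ch))"


section \<open>The generic tableau module\<close>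

type_synonym zvec = "idx \<Rightarrow> int"

definition Zvecs :: "nat \<Rightarrow> zvec set" where
  "Zvecs n = {z. \<forall>r s. \<not> (1 \<le> s \<and> s \<le> r \<and> r \<le> n - 1) \<longrightarrow> z (r,s) = 0}"

text \<open>
  The symbol T(v+z), with v a vector of indeterminates, is represented by z. The following is the
  entry w_rs of w = v + z; the last row is the fixed vector a.
\<close>

type_synonym rtab = "zvec \<Rightarrow>\<^sub>0 ratfun"

definition entry :: "nat \<Rightarrow> (nat \<Rightarrow> complex) \<Rightarrow> zvec \<Rightarrow> nat \<Rightarrow> nat \<Rightarrow> ratfun" where
  "entry n a z r s = (if r = n then rconst (a s) else rvar (r,s) + of_int (z (r,s)))"

definition shift :: "zvec \<Rightarrow> idx \<Rightarrow> int \<Rightarrow> zvec" where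
  "shift z u d = z(u := z u + d)"

definition E_up :: "nat \<Rightarrow> (nat \<Rightarrow> complex) \<Rightarrow> nat \<Rightarrow> rtab \<Rightarrow> rtab" where
  "E_up n a p = lin_extend (\<lambda>z. - (\<Sum>q=1..p. Poly_Mapping.single (shift z (p,q) 1)
     ((\<Prod>u=1..p+1. entry n a z p q - entry n a z (p+1) u) /
      (\<Prod>u\<in>{1..p} - {q}. entry n a z p q - entry n a z p u))))"

definition E_down :: "nat \<Rightarrow> (nat \<Rightarrow> complex) \<Rightarrow> nat \<Rightarrow> rtab \<Rightarrow> rtab" where
  "E_down n a p = lin_extend (\<lambda>z. \<Sum>q=1..p. Poly_Mapping.single (shift z (p,q) (- 1))
     ((\<Prod>u=1..p-1. entry n a z p q - entry n a z (p-1) u) /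
      (\<Prod>u\<in>{1..p} - {q}. entry n a z p q - entry n a z p u)))"

definition E_diag :: "nat \<Rightarrow> (nat \<Rightarrow> complex) \<Rightarrow> nat \<Rightarrow> rtab \<Rightarrow> rtab" where
  "E_diag n a p = lin_extend (\<lambda>z. Poly_Mapping.single z
     ((\<Sum>q=1..p. entry n a z p q + of_nat q - 1) -
      (\<Sum>q=1..p-1. entry n a z (p-1) q + of_nat q - 1)))"

definition commutator :: "('v \<Rightarrow> 'v) \<Rightarrow> ('v \<Rightarrow> 'v) \<Rightarrow> 'v \<Rightarrow> 'v::ab_group_add" where
  "commutator A B x = A (B x) - B (A x)"

text \<open>
  E_up_far n a r d is the action of E_(r, r+d+1), and E_down_far n a s d that of E_(s+d+1, s).
\<close>

primrec E_up_far :: "nat \<Rightarrow> (nat \<Rightarrow> complex) \<Rightarrow> nat \<Rightarrow> nat \<Rightarrow> rtab \<Rightarrow> rtab" where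
  "E_up_far n a r 0 = E_up n a r"
| "E_up_far n a r (Suc d) = commutator (E_up_far n a r d) (E_up n a (r + d + 1))"

primrec E_down_far :: "nat \<Rightarrow> (nat \<Rightarrow> complex) \<Rightarrow> nat \<Rightarrow> nat \<Rightarrow> rtab \<Rightarrow> rtab" where
  "E_down_far n a s 0 = E_down n a s"
| "E_down_far n a s (Suc d) = commutator (E_down n a (s + d + 1)) (E_down_far n a s d)"

definition E_gen :: "nat \<Rightarrow> (nat \<Rightarrow> complex) \<Rightarrow> nat \<Rightarrow> nat \<Rightarrow> rtab \<Rightarrow> rtab" where
  "E_gen n a r s = (if r = s then E_diag n a r
     else if r < s then E_up_far n a r (s - r - 1) else E_down_far n a s (r - s - 1))"

definition free_act ::
  "(complex \<Rightarrow> 'v \<Rightarrow> 'v) \<Rightarrow> (nat \<Rightarrow> nat \<Rightarrow> 'v \<Rightarrow> 'v) \<Rightarrow> gl_free \<Rightarrow> 'v \<Rightarrow> 'v::ab_group_add" where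
  "free_act sc E f x = (\<Sum>w\<in>Poly_Mapping.keys f.
     sc (Poly_Mapping.lookup f w) (foldr (\<lambda>(r,s). E r s) (letters w) x))"

definition gen_act :: "nat \<Rightarrow> (nat \<Rightarrow> complex) \<Rightarrow> gl_free \<Rightarrow> rtab \<Rightarrow> rtab" where
  "gen_act n a = free_act (\<lambda>c. scale (rconst c)) (E_gen n a)"

definition gen_tab :: "zvec \<Rightarrow> rtab" where
  "gen_tab z = Poly_Mapping.single z 1"

definition regular_tab :: "rtab \<Rightarrow> (idx \<Rightarrow> complex) \<Rightarrow> bool" where
  "regular_tab F v \<longleftrightarrow> (\<forall>z. regular_at (Poly_Mapping.lookup F z) v)"


section \<open>The 1-singular tableau module\<close>

datatype tab_sym = Tsym zvec | DTsym zvec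

type_synonym tab_free = "tab_sym \<Rightarrow>\<^sub>0 complex"
type_synonym tab_vec = "tab_free set"

definition swap :: "nat \<Rightarrow> nat \<Rightarrow> nat \<Rightarrow> zvec \<Rightarrow> zvec" where
  "swap k i j z = z((k,i) := z (k,j), (k,j) := z (k,i))"

definition tab_relations :: "nat \<Rightarrow> nat \<Rightarrow> nat \<Rightarrow> nat \<Rightarrow> tab_free set" where
  "tab_relations n k i j = module.span scale
     ({Poly_Mapping.single (Tsym z) 1 - Poly_Mapping.single (Tsym (swap k i j z)) 1 | z. z \<in> Zvecs n} \<union>
      {Poly_Mapping.single (DTsym z) 1 + Poly_Mapping.single (DTsym (swap k i j z)) 1 | z. z \<in> Zvecs n})"

text \<open>V(T(v)) is the quotient of the free vector space on the symbols by the above subspace.\<close>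

definition tab_cls :: "nat \<Rightarrow> nat \<Rightarrow> nat \<Rightarrow> nat \<Rightarrow> tab_free \<Rightarrow> tab_vec" where
  "tab_cls n k i j f = {f + g | g. g \<in> tab_relations n k i j}"

definition Dtab_free :: "nat \<Rightarrow> nat \<Rightarrow> nat \<Rightarrow> (idx \<Rightarrow> complex) \<Rightarrow> rtab \<Rightarrow> tab_free" where
  "Dtab_free k i j v F = (\<Sum>z\<in>Poly_Mapping.keys F.
     Poly_Mapping.single (Tsym z) (D_rf k i j v (Poly_Mapping.lookup F z)) +
     Poly_Mapping.single (DTsym z) (rf_eval (Poly_Mapping.lookup F z) v))"

definition x_minus_y :: "nat \<Rightarrow> nat \<Rightarrow> nat \<Rightarrow> ratfun" where
  "x_minus_y k i j = rvar (k,i) - rvar (k,j)"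

text \<open>
  Lift of the action of E_rs to the free vector space. A symbol DT(v+z) with z fixed by the
  swap vanishes in the quotient, so it is sent to 0.
\<close>

fun E_sym :: "nat \<Rightarrow> nat \<Rightarrow> nat \<Rightarrow> nat \<Rightarrow> (nat \<Rightarrow> complex) \<Rightarrow> (idx \<Rightarrow> complex) \<Rightarrow>
    nat \<Rightarrow> nat \<Rightarrow> tab_sym \<Rightarrow> tab_free" where
  "E_sym n k i j a v r s (Tsym z) =
     Dtab_free k i j v (scale (x_minus_y k i j) (E_gen n a r s (gen_tab z)))"
| "E_sym n k i j a v r s (DTsym z) =
     (if swap k i j z = z then 0 else Dtab_free k i j v (E_gen n a r s (gen_tab z)))"

definition E_free :: "nat \<Rightarrow> nat \<Rightarrow> nat \<Rightarrow> nat \<Rightarrow> (nat \<Rightarrow> complex) \<Rightarrow> (idx \<Rightarrow> complex) \<Rightarrow>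
    nat \<Rightarrow> nat \<Rightarrow> tab_free \<Rightarrow> tab_free" where
  "E_free n k i j a v r s = lin_extend (E_sym n k i j a v r s)"

text \<open>
  Scalar multiplication is the action induced on cosets: the classes of x.f, for x and f running
  through all representatives, coincide. The module record of the library extends the ring
  record; its multiplication and unit play no role.
\<close>

definition V_sing :: "nat \<Rightarrow> nat \<Rightarrow> nat \<Rightarrow> nat \<Rightarrow> (nat \<Rightarrow> complex) \<Rightarrow> (idx \<Rightarrow> complex) \<Rightarrow>
    (gl_env, tab_vec) module" where
  "V_sing n k i j a v =
     \<lparr>carrier = tab_cls n k i j `
        {f. Poly_Mapping.keys f \<subseteq> Tsym ` Zvecs n \<union> DTsym ` Zvecs n},
      mult = undefined, one = undefined,
      zero = tab_cls n k i j 0,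
      add = (\<lambda>X Y. {f + g | f g. f \<in> X \<and> g \<in> Y}),
      smult = (\<lambda>x X. \<Union>y\<in>x. \<Union>f\<in>X.
        tab_cls n k i j (free_act scale (E_free n k i j a v) y f))\<rparr>"

definition T_sing :: "nat \<Rightarrow> nat \<Rightarrow> nat \<Rightarrow> nat \<Rightarrow> zvec \<Rightarrow> tab_vec" where
  "T_sing n k i j z = tab_cls n k i j (Poly_Mapping.single (Tsym z) 1)"

definition DT_sing :: "nat \<Rightarrow> nat \<Rightarrow> nat \<Rightarrow> nat \<Rightarrow> zvec \<Rightarrow> tab_vec" where
  "DT_sing n k i j z = tab_cls n k i j (Poly_Mapping.single (DTsym z) 1)"

definition Dtab :: "nat \<Rightarrow> nat \<Rightarrow> nat \<Rightarrow> nat \<Rightarrow> (idx \<Rightarrow> complex) \<Rightarrow> rtab \<Rightarrow> tab_vec" where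
  "Dtab n k i j v F = tab_cls n k i j (Dtab_free k i j v F)"

end

theory Submission
  imports Defs "HOL-Computational_Algebra.Formal_Laurent_Series"
begin

text \<open>
  On generic tableaux the relations of gl(n) and the eigenvalues of the Gelfand-Tsetlin generators
  are rational identities, so they hold for tableaux with entries in any field of characteristic
  zero in which the entries of a row have no integral differences. Take the field of Laurent series
  in t, with x = v(k,i) + t/2 and y = v(k,j) - t/2, so that t = x - y. The value of a regular
  function and the derivation D are its first two coefficients along this line. The vectors with
  at most simple poles that are symmetric under the exchange of the two singular entries combined
  with t \<mapsto> -t form a submodule L, and V is L modulo t^2 L: the tableau T(z) corresponds to
  T(z) + T(swap z), and DT(z) to (T(z) - T(swap z))/t. Thus all identities, the module axioms and
  the action of the Gelfand-Tsetlin subalgebra, which is diagonal on L, are read off before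
  passing to the quotient. For finite generation, a tableau whose rows lie far above each other
  is moved to any other one by raising rows from the top and lowering them from the bottom,
  isolating single summands with the Casimir elements of the smaller gl(p).
\<close>

section \<open>Linear combinations and additive operators\<close>

text \<open>The action on V cannot be composed directly: D is a derivation at a single point, and a
  product of two coefficients may be regular although its factors are not. Laurent series keep the
  pole, so generators compose honestly and only the result is truncated. The lattice is stable by
  parity: a matrix unit has a pole only at tableaux fixed by the swap, and there symmetry forbids a
  pole of the coefficient, so poles never multiply. Matrix units have at most simple poles because
  row k enters each iterated commutator at most once. The eigenvalues of the c_rs also need a proof.
  For independent entries the quadratic Casimirs of the smaller gl(p) separate the rows below r, so
  c_rs is diagonal; its eigenvalue is rational and periodic in each lower entry, hence constant in
  it; and copying row r into all lower rows makes the tableau a highest weight vector. Generation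
  starts from a vector of type DT, because the nilpotent part of a Casimir element leads from DT to
  T and not back.\<close>

lemma lookup_scale [simp]: "Poly_Mapping.lookup (scale c f) z = c * Poly_Mapping.lookup f z"
  unfolding scale_def by (simp add: Poly_Mapping.map.rep_eq when_def)

lemma scale_simps [simp]:
  "scale c (Poly_Mapping.single z d) = Poly_Mapping.single z (c * d)"
  "scale 1 f = f" "scale 0 f = 0" "scale c 0 = 0"
  "scale c (- f) = - scale c f"
  by (auto intro!: poly_mapping_eqI simp: lookup_single when_def)

lemma scale_add: "scale c (f + g) = scale c f + scale c g"
  by (intro poly_mapping_eqI) (simp add: lookup_add algebra_simps)

lemma scale_diff: "scale c (f - g) = scale c f - scale c g"
  by (intro poly_mapping_eqI) (simp add: lookup_minus algebra_simps)

lemma scale_left_add: "scale (c + d) f = scale c f + scale d f"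
  by (intro poly_mapping_eqI) (simp add: lookup_add algebra_simps)

lemma scale_left_diff: "scale (c - d) f = scale c f - scale d f"
  by (intro poly_mapping_eqI) (simp add: lookup_minus algebra_simps)

lemma scale_scale: "scale c (scale d f) = scale (c * d) f"
  by (intro poly_mapping_eqI) (simp add: algebra_simps)

lemma scale_sum: "scale c (sum f A) = (\<Sum>x\<in>A. scale c (f x))"
  by (induction A rule: infinite_finite_induct) (simp_all add: scale_add)

lemma module_scale: "Modules.module (scale :: 'c::comm_ring_1 \<Rightarrow> ('b \<Rightarrow>\<^sub>0 'c) \<Rightarrow> _)"
  by standard (simp_all add: scale_add scale_left_add scale_scale)

lemma lookup_sum: "Poly_Mapping.lookup (sum f A) z = (\<Sum>x\<in>A. Poly_Mapping.lookup (f x) z)"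
  by (induction A rule: infinite_finite_induct) (simp_all add: lookup_add)

lemma single_sum: "Poly_Mapping.single z (sum f A) = (\<Sum>x\<in>A. Poly_Mapping.single z (f x))"
  by (induction A rule: infinite_finite_induct) (simp_all add: single_add)

lemma poly_mapping_double_zero:
  fixes f :: "'b \<Rightarrow>\<^sub>0 'c::field_char_0"
  assumes "f + f = 0" shows "f = 0"
proof (rule poly_mapping_eqI)
  fix z
  have "Poly_Mapping.lookup (f + f) z = 0" using assms by simp
  then show "Poly_Mapping.lookup f z = Poly_Mapping.lookup 0 z"
    by (simp add: lookup_add flip: mult_2)
qed

lemma lin_extend_superset:
  assumes "finite A" "Poly_Mapping.keys f \<subseteq> A"
  shows "lin_extend g f = (\<Sum>b\<in>A. scale (Poly_Mapping.lookup f b) (g b))"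
  unfolding lin_extend_def using assms
  by (intro sum.mono_neutral_left) (auto simp: in_keys_iff)

lemma lin_extend_single [simp]: "lin_extend g (Poly_Mapping.single z c) = scale c (g z)"
  by (subst lin_extend_superset[of "{z}"]) (auto simp: lookup_single)

lemma lin_extend_add: "lin_extend g (f + f') = lin_extend g f + lin_extend g f'"
proof -
  let ?A = "Poly_Mapping.keys f \<union> Poly_Mapping.keys f'"
  have "finite ?A" "Poly_Mapping.keys (f + f') \<subseteq> ?A"
    using keys_add[of f f'] by auto
  then show ?thesis
    by (simp add: lin_extend_superset[of ?A] lookup_add scale_left_add sum.distrib)
qed

lemma lin_extend_scale: "lin_extend g (scale c f) = scale c (lin_extend g f)"
  by (subst (1 2) lin_extend_superset[of "Poly_Mapping.keys f"])
    (auto simp: in_keys_iff scale_sum scale_scale)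

lemma lin_extend_zero [simp]: "lin_extend g 0 = 0"
  by (simp add: lin_extend_def)

lemma lookup_lin_extend:
  assumes "finite A" "Poly_Mapping.keys f \<subseteq> A"
  shows "Poly_Mapping.lookup (lin_extend g f) z =
    (\<Sum>b\<in>A. Poly_Mapping.lookup f b * Poly_Mapping.lookup (g b) z)"
  by (simp add: lin_extend_superset[OF assms] lookup_sum)

lemma poly_mapping_sum_singles: "f = (\<Sum>b\<in>Poly_Mapping.keys f. Poly_Mapping.single b (Poly_Mapping.lookup f b))"
  by (rule poly_mapping_eqI) (simp add: lookup_sum lookup_single when_def in_keys_iff)

lemma lin_extend_unique:
  assumes "\<And>x y. F (x + y) = F x + F y" "\<And>z c. F (Poly_Mapping.single z c) = scale c (g z)"
  shows "F f = lin_extend g f"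
proof -
  have F0: "F 0 = 0" using assms(1)[of 0 0] by simp
  have "F (\<Sum>b\<in>A. Poly_Mapping.single b (h b)) = (\<Sum>b\<in>A. scale (h b) (g b))" for A h
    by (induction A rule: infinite_finite_induct) (simp_all add: F0 assms)
  then show ?thesis
    by (subst poly_mapping_sum_singles) (simp add: lin_extend_def)
qed

text \<open>As a type of class \<open>ring_1\<close>, linear operators can be manipulated by ring
  arithmetic, and commutators, matrix powers and abstract relations apply to them without carrying
  linearity as a side condition.\<close>

typedef (overloaded) ('b, 'c) lop =
  "{f :: ('b \<Rightarrow>\<^sub>0 'c::comm_ring_1) \<Rightarrow> ('b \<Rightarrow>\<^sub>0 'c). (\<forall>x y. f (x + y) = f x + f y) \<and> (\<forall>c x. f (scale c x) = scale c (f x))}"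
  morphisms app Lop by (intro exI[of _ "\<lambda>x. x"]) simp

setup_lifting type_definition_lop

instantiation lop :: (type, comm_ring_1) ring_1
begin
lift_definition zero_lop :: "('a, 'b) lop" is "\<lambda>_. 0" by simp
lift_definition one_lop :: "('a, 'b) lop" is "\<lambda>x. x" by simp
lift_definition plus_lop :: "('a, 'b) lop \<Rightarrow> ('a, 'b) lop \<Rightarrow> ('a, 'b) lop" is "\<lambda>f g x. f x + g x"
  by (simp add: scale_add)
lift_definition minus_lop :: "('a, 'b) lop \<Rightarrow> ('a, 'b) lop \<Rightarrow> ('a, 'b) lop" is "\<lambda>f g x. f x - g x"
  by (simp add: scale_diff)
lift_definition uminus_lop :: "('a, 'b) lop \<Rightarrow> ('a, 'b) lop" is "\<lambda>f x. - f x" by simp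
lift_definition times_lop :: "('a, 'b) lop \<Rightarrow> ('a, 'b) lop \<Rightarrow> ('a, 'b) lop" is "\<lambda>f g x. f (g x)" by simp
instance
proof
  show "(0::('a, 'b) lop) \<noteq> 1"
  proof
    assume "(0::('a, 'b) lop) = 1"
    then have "(\<lambda>_. 0) = (\<lambda>x::'a \<Rightarrow>\<^sub>0 'b. x)" by transfer
    then have "Poly_Mapping.single undefined 1 = (0 :: 'a \<Rightarrow>\<^sub>0 'b)" by (rule fun_cong[symmetric])
    then show False by (metis lookup_single_eq lookup_zero zero_neq_one)
  qed
qed (transfer; simp add: fun_eq_iff algebra_simps)+
end

lemma app_ops [simp]:
  "app 0 x = 0" "app 1 x = x" "app (f + g) x = app f x + app g x" "app (f - g) x = app f x - app g x"
  "app (- f) x = - app f x" "app (f * g) x = app f (app g x)"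
  by (transfer; simp)+

lemma app_add: "app f (x + y) = app f x + app f y"
  and app_scale: "app f (scale c x) = scale c (app f x)"
  by (transfer; simp)+

lemma app_zero [simp]: "app f 0 = 0"
  using app_add[of f 0 0] by simp

lemma app_uminus: "app f (- x) = - app f x"
  using app_add[of f x "- x"] by (simp add: eq_neg_iff_add_eq_0 add.commute)

lemma app_diff: "app f (x - y) = app f x - app f y"
  using app_add[of f x "- y"] by (simp add: app_uminus)

lemma app_sum: "app f (sum g A) = (\<Sum>x\<in>A. app f (g x))"
  by (induction A rule: infinite_finite_induct) (simp_all add: app_add)

lemma app_sum_left: "app (sum F A) x = (\<Sum>y\<in>A. app (F y) x)"
  by (induction A rule: infinite_finite_induct) simp_all

lift_definition lop_of :: "('b \<Rightarrow> ('b \<Rightarrow>\<^sub>0 'c)) \<Rightarrow> ('b, 'c::comm_ring_1) lop" is "lin_extend"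
  by (simp add: lin_extend_add lin_extend_scale)

lemma app_lop_of: "app (lop_of g) = lin_extend g"
  by transfer simp

lemma app_lop_of_single [simp]: "app (lop_of g) (Poly_Mapping.single z c) = scale c (g z)"
  by (simp add: app_lop_of)

abbreviation T :: "'b \<Rightarrow> ('b \<Rightarrow>\<^sub>0 'c::zero_neq_one)" where
  "T z \<equiv> Poly_Mapping.single z 1"

lemma app_single: "app f (Poly_Mapping.single z c) = scale c (app f (T z))"
  using app_scale[of f c "T z"] by simp

lemma app_eq_lin_extend: "app f = lin_extend (\<lambda>z. app f (T z))"
  by (rule ext, rule lin_extend_unique) (rule app_add, rule app_single)

lemma lop_eqI: "(\<And>z. app f (T z) = app g (T z)) \<Longrightarrow> f = g"
  using app_eq_lin_extend[of f] app_eq_lin_extend[of g] by (simp flip: app_inject)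

definition diag_op :: "('b \<Rightarrow> 'c) \<Rightarrow> ('b, 'c::comm_ring_1) lop" where
  "diag_op \<mu> = lop_of (\<lambda>z. Poly_Mapping.single z (\<mu> z))"

lemma app_diag_op [simp]: "app (diag_op \<mu>) (Poly_Mapping.single z c) = Poly_Mapping.single z (c * \<mu> z)"
  by (simp add: diag_op_def)

lemma diag_op_simps:
  "diag_op \<mu> + diag_op \<nu> = diag_op (\<lambda>z. \<mu> z + \<nu> z)"
  "diag_op \<mu> - diag_op \<nu> = diag_op (\<lambda>z. \<mu> z - \<nu> z)"
  "diag_op \<mu> * diag_op \<nu> = diag_op (\<lambda>z. \<mu> z * \<nu> z)"
  "- diag_op \<mu> = diag_op (\<lambda>z. - \<mu> z)"
  by (auto intro!: lop_eqI simp: single_add single_diff single_uminus mult.commute)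

lemma lop_double_zero:
  fixes f :: "('b, 'c::field_char_0) lop"
  assumes "f + f = 0" shows "f = 0"
proof (rule lop_eqI)
  fix z
  have "app f (T z) + app f (T z) = app (f + f) (T z)" by simp
  then show "app f (T z) = app 0 (T z)"
    using assms poly_mapping_double_zero[of "app f (T z)"] by simp
qed

section \<open>From Chevalley-Serre relations to the relations between all matrix units\<close>

definition lie :: "'a::ring \<Rightarrow> 'a \<Rightarrow> 'a" where
  "lie x y = x * y - y * x"

text \<open>\<open>up_far br e r d\<close> stands for the matrix unit E_(r, r+d+1), built by
  bracketing with the next simple root vector; this is the recursion of \<open>E_up_far\<close> for
  an arbitrary bracket.\<close>

primrec up_far :: "('a \<Rightarrow> 'a \<Rightarrow> 'a) \<Rightarrow> (nat \<Rightarrow> 'a) \<Rightarrow> nat \<Rightarrow> nat \<Rightarrow> 'a" where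
  "up_far br e r 0 = e r"
| "up_far br e r (Suc d) = br (up_far br e r d) (e (r + d + 1))"

primrec down_far :: "('a \<Rightarrow> 'a \<Rightarrow> 'a) \<Rightarrow> (nat \<Rightarrow> 'a) \<Rightarrow> nat \<Rightarrow> nat \<Rightarrow> 'a" where
  "down_far br f s 0 = f s"
| "down_far br f s (Suc d) = br (f (s + d + 1)) (down_far br f s d)"

definition mat_unit :: "('a \<Rightarrow> 'a \<Rightarrow> 'a) \<Rightarrow> (nat \<Rightarrow> 'a) \<Rightarrow> (nat \<Rightarrow> 'a) \<Rightarrow> (nat \<Rightarrow> 'a) \<Rightarrow> nat \<Rightarrow> nat \<Rightarrow> 'a" where
  "mat_unit br e f h r s = (if r = s then h r
     else if r < s then up_far br e r (s - r - 1) else down_far br f s (r - s - 1))"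

text \<open>
  The bracket is a parameter so that the transposition symmetry, which reverses it and exchanges
  e and f, is an instance.
\<close>

locale chevalley =
  fixes br :: "'a::ab_group_add \<Rightarrow> 'a \<Rightarrow> 'a" and n :: nat and e f h :: "nat \<Rightarrow> 'a"
  assumes br_add: "br (x + y) z = br x z + br y z"
    and br_antisym: "br x y = - br y x"
    and jacobi: "br (br x y) z = br x (br y z) - br y (br x z)"
    and double_zero: "x + x = (0::'a) \<Longrightarrow> x = 0"
    and br_hh: "\<lbrakk>p \<in> {1..n}; q \<in> {1..n}\<rbrakk> \<Longrightarrow> br (h p) (h q) = 0"
    and br_he: "\<lbrakk>p \<in> {1..n}; 1 \<le> q; q < n\<rbrakk> \<Longrightarrow>
      br (h p) (e q) = (if p = q then e q else 0) - (if p = q + 1 then e q else 0)"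
    and br_hf: "\<lbrakk>p \<in> {1..n}; 1 \<le> q; q < n\<rbrakk> \<Longrightarrow>
      br (h p) (f q) = (if p = q + 1 then f q else 0) - (if p = q then f q else 0)"
    and br_ef: "\<lbrakk>1 \<le> p; p < n; 1 \<le> q; q < n\<rbrakk> \<Longrightarrow>
      br (e p) (f q) = (if p = q then h p - h (p + 1) else 0)"
    and br_ee: "\<lbrakk>1 \<le> p; p < n; 1 \<le> q; q < n; p + 1 < q\<rbrakk> \<Longrightarrow> br (e p) (e q) = 0"
    and br_ff: "\<lbrakk>1 \<le> p; p < n; 1 \<le> q; q < n; p + 1 < q\<rbrakk> \<Longrightarrow> br (f p) (f q) = 0"
    and serre_e: "\<lbrakk>1 \<le> p; p + 1 < n\<rbrakk> \<Longrightarrow> br (e p) (br (e p) (e (p + 1))) = 0"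
      "\<lbrakk>1 \<le> p; p + 1 < n\<rbrakk> \<Longrightarrow> br (e (p + 1)) (br (e (p + 1)) (e p)) = 0"
    and serre_f: "\<lbrakk>1 \<le> p; p + 1 < n\<rbrakk> \<Longrightarrow> br (f p) (br (f p) (f (p + 1))) = 0"
      "\<lbrakk>1 \<le> p; p + 1 < n\<rbrakk> \<Longrightarrow> br (f (p + 1)) (br (f (p + 1)) (f p)) = 0"
begin

lemma br_add_right: "br z (x + y) = br z x + br z y"
  by (metis br_add br_antisym minus_add_distrib)

lemma br_zero [simp]: "br 0 x = 0" "br x 0 = 0"
  using br_add[of 0 0 x] br_add_right[of x 0 0] by auto

lemma br_minus [simp]: "br (- x) y = - br x y" "br x (- y) = - br x y"
  using br_add[of x "- x" y] br_add_right[of x y "- y"]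
  by (auto simp: eq_neg_iff_add_eq_0 add.commute)

lemma br_diff: "br (x - y) z = br x z - br y z" "br z (x - y) = br z x - br z y"
  using br_add[of x "- y" z] br_add_right[of z x "- y"] by auto

lemma br_self [simp]: "br x x = 0"
  by (rule double_zero) (metis br_antisym add.left_inverse)

lemma jacobi_right: "br x (br y z) = br (br x y) z + br y (br x z)"
  by (simp add: jacobi)

abbreviation E where "E \<equiv> mat_unit br e f h"

lemma E_simps:
  "E r r = h r" "E r (Suc r) = e r" "E (Suc r) r = f r"
  "r < s \<Longrightarrow> E r (Suc s) = br (E r s) (e s)"
  "s < r \<Longrightarrow> E (Suc r) s = br (f r) (E r s)"
proof -
  show "E r (Suc s) = br (E r s) (e s)" if "r < s"
  proof -
    obtain d where "s = Suc (r + d)" using \<open>_ < _\<close> less_imp_Suc_add by blast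
    then show ?thesis by (simp add: mat_unit_def)
  qed
  show "E (Suc r) s = br (f r) (E r s)" if "s < r"
  proof -
    obtain d where "r = Suc (s + d)" using \<open>_ < _\<close> less_imp_Suc_add by blast
    then show ?thesis by (simp add: mat_unit_def)
  qed
qed (simp_all add: mat_unit_def)

lemma less_induct_step [consumes 1, case_names base step]:
  assumes "r < (s::nat)" "P (Suc r)" "\<And>s. r < s \<Longrightarrow> P s \<Longrightarrow> P (Suc s)"
  shows "P s"
  using assms(1) by (induction s) (use assms(2,3) less_Suc_eq in auto)

lemma br_h_E_upper:
  assumes "p \<in> {1..n}" "1 \<le> r" "r < s" "s \<le> n"
  shows "br (h p) (E r s) = (if p = r then E r s else 0) - (if p = s then E r s else 0)"
  using assms(3,4)
proof (induction s rule: less_induct_step)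
  case base
  then show ?case using assms by (simp add: E_simps br_he)
next
  case (step s)
  then show ?case using assms
    by (auto simp: E_simps jacobi_right br_he br_diff)
qed

lemma br_h_E_lower:
  assumes "p \<in> {1..n}" "1 \<le> s" "s < r" "r \<le> n"
  shows "br (h p) (E r s) = (if p = r then E r s else 0) - (if p = s then E r s else 0)"
  using assms(3,4)
proof (induction r rule: less_induct_step)
  case base
  then show ?case using assms by (simp add: E_simps br_hf)
next
  case (step s)
  then show ?case using assms
    by (auto simp: E_simps jacobi_right br_hf br_diff)
qed

lemma br_h_E:
  assumes "p \<in> {1..n}" "r \<in> {1..n}" "s \<in> {1..n}"
  shows "br (h p) (E r s) = (if p = r then E r s else 0) - (if p = s then E r s else 0)"
  using br_h_E_upper[of p r s] br_h_E_lower[of p s r] assms br_hh[of p r]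
  by (cases r s rule: linorder_cases) (auto simp: E_simps)

lemma br_ee': "\<lbrakk>1 \<le> p; p < n; 1 \<le> q; q < n; q + 1 < p\<rbrakk> \<Longrightarrow> br (e p) (e q) = 0"
  using br_ee[of q p] br_antisym[of "e p" "e q"] by simp

lemma br_e_E_far:
  assumes "1 \<le> p" "p < n" "1 \<le> r" "r < s" "s \<le> n" "p + 1 < r \<or> s < p"
  shows "br (e p) (E r s) = 0"
  using assms(4,5,6)
  by (induction s rule: less_induct_step)
    (use assms in \<open>auto simp: E_simps jacobi_right[of "e _"] br_ee br_ee'\<close>)

lemma br_e_E_left:
  assumes "2 \<le> r" "r < s" "s \<le> n"
  shows "br (e (r - 1)) (E r s) = E (r - 1) s"
proof -
  obtain q where r: "r = Suc q" using assms by (cases r) auto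
  have "br (e q) (E r s) = E q s" using assms(2,3)
    by (induction s rule: less_induct_step)
      (use assms r in \<open>auto simp: E_simps jacobi_right[of "e _"] br_ee\<close>)
  then show ?thesis using r by simp
qed

text \<open>At the two ends, r = p and s = p + 1, the Serre relations give the result. For s = p + 2
  the bracket turns out to be its own negative, and for larger s the added \<open>e s\<close>
  commutes with \<open>e p\<close>.\<close>

lemma br_e_E_inner:
  assumes "1 \<le> r" "r \<le> p" "p < s" "s \<le> n"
  shows "br (e p) (E r s) = 0"
proof -
  have first: "br (e r) (E r s) = 0" if "r < s" "s \<le> n" for s
    using that
  proof (induction s rule: less_induct_step)
    case (step s)
    show ?case
    proof (cases "s = Suc r")
      case True
      then show ?thesis using serre_e(1)[of r] step assms by (simp add: E_simps)
    next
      case False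
      then show ?thesis using step assms br_ee[of r s] by (simp add: E_simps jacobi_right)
    qed
  qed (simp add: E_simps)
  show ?thesis
  proof (cases "r = p")
    case True
    then show ?thesis using first assms by simp
  next
    case False
    then obtain q where p: "p = Suc q" "r \<le> q" using assms by (cases p) auto
    have pn: "Suc q < n" using p assms by simp
    have last: "br (e p) (E r (Suc p)) = 0"
    proof (cases "r = q")
      case True
      then show ?thesis using serre_e(2)[of q] assms p
        by (simp add: E_simps br_antisym[of "e q" "e (Suc q)"])
    next
      case False
      have far: "br (E r q) (e p) = 0"
        using br_e_E_far[of p r q] assms p False br_antisym[of "E r q" "e p"] by simp
      \<comment> \<open>Regrouped so that the last two simple root vectors stand together and the
        second Serre relation applies.\<close>
      have "E r (Suc p) = br (E r q) (br (e q) (e p))"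
        using p False assms far by (simp add: E_simps jacobi)
      moreover have "br (e p) (br (e q) (e p)) = 0"
        using serre_e(2)[of q] p assms br_antisym[of "e q" "e (Suc q)"] by simp
      moreover have "br (e p) (E r q) = 0"
        using far br_antisym[of "E r q" "e p"] by simp
      ultimately show ?thesis by (simp add: jacobi_right[of "e p" "E r q"])
    qed
    show ?thesis using assms(3,4)
    proof (induction s rule: less_induct_step)
      case base
      then show ?case using last by simp
    next
      case (step s)
      show ?case
      proof (cases "s = Suc p")
        case True
        let ?x = "br (e p) (e (Suc p))"
        have Erp: "E r (Suc p) = br (E r p) (e p)" using p assms by (simp add: E_simps)
        have far: "br (E r p) (e (Suc p)) = 0"
          using br_e_E_far[of "Suc p" r p] assms p step True br_antisym[of "E r p" "e (Suc p)"] by simp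
        have Es: "E r (Suc s) = br (E r p) ?x"
          using p assms True far Erp by (simp add: E_simps jacobi)
        \<comment> \<open>The Serre relation removes the other Jacobi term. Since \<open>e p\<close>
          commutes with \<open>E r (Suc p)\<close> by the induction hypothesis, pulling it out again
          returns the negative of the left side, and \<open>double_zero\<close> applies.\<close>
        have "br (e p) (E r (Suc s)) = br (br (e p) (E r p)) ?x"
          using serre_e(1)[of p] assms step True unfolding Es by (simp add: jacobi_right[of "e p" "E r p"])
        also have "\<dots> = - br (E r (Suc p)) ?x"
          unfolding Erp by (subst br_antisym[of "e p"]) simp
        also have "\<dots> = - br (e p) (E r (Suc s))"
          using step True br_antisym[of "E r (Suc p)" "e p"] assms
          by (simp add: jacobi_right[of "E r (Suc p)"] E_simps)
        finally show ?thesis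
          by (metis double_zero add.left_inverse)
      next
        case False
        then show ?thesis using step assms br_ee[of p s] by (simp add: E_simps jacobi_right)
      qed
    qed
  qed
qed

lemma br_e_E_upper:
  assumes "1 \<le> p" "p < n" "1 \<le> r" "r < s" "s \<le> n"
  shows "br (e p) (E r s) = (if p + 1 = r then E p s else 0) - (if s = p then E r (p + 1) else 0)"
proof -
  consider "p + 1 < r \<or> s < p" | "p + 1 = r" | "r \<le> p" "p < s" | "s = p" by linarith
  then show ?thesis
  proof cases
    case 1
    then show ?thesis using br_e_E_far[of p r s] assms by auto
  next
    case 2
    then show ?thesis using br_e_E_left[of r s] assms by auto
  next
    case 3
    then show ?thesis using br_e_E_inner[of r p s] assms by auto
  next
    case 4
    then show ?thesis using assms br_antisym[of "E r p" "e p"] by (auto simp: E_simps)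
  qed
qed

lemma br_e_E_lower:
  assumes "1 \<le> p" "p < n" "1 \<le> s" "s < r" "r \<le> n"
  shows "br (e p) (E r s) = (if p + 1 = r then E p s else 0) - (if s = p then E r (p + 1) else 0)"
  using assms(4,5)
proof (induction r rule: less_induct_step)
  case base
  then show ?case using assms by (auto simp: E_simps br_ef)
next
  case (step r)
  have IH: "br (e p) (E r s) = (if p + 1 = r then E p s else 0) - (if s = p then E r (p + 1) else 0)"
    using step by simp
  consider "p = r" | "p + 1 = r" "p = s" | "p + 1 = r" "p \<noteq> s" | "p \<noteq> r" "p + 1 \<noteq> r" by blast
  then show ?case
  proof cases
    case 1
    then show ?thesis using step assms IH
      by (simp add: E_simps jacobi_right[of "e r"] br_ef br_diff br_h_E_lower)
  next
    case 2
    have "br (f r) (h p - h r) = - f r"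
      using br_hf[of p r] br_hf[of r r] assms step 2 br_antisym[of "f r" "h p"] br_antisym[of "f r" "h r"]
      by (simp add: br_diff)
    then show ?thesis using step assms IH 2
      by (auto simp add: E_simps jacobi_right[of "e s"] br_ef br_diff)
  next
    case 3
    \<comment> \<open>\<open>E p s\<close> is an iterated bracket of \<open>f s\<close>, ...,
      \<open>f (p - 1)\<close>, all of which are at distance at least two from
      \<open>f (p + 1)\<close>.\<close>
    have "br (f r) (E p s) = 0 " if "s < p" "r = Suc p"
    proof -
      have "br (f r) (E p' s) = 0" if "s < p'" "p' \<le> p" for p'
        using that
      proof (induction p' rule: less_induct_step)
        case base
        then show ?case using br_ff[of s r] br_antisym[of "f r" "f s"] assms step \<open>r = Suc p\<close>
          by (simp add: E_simps)
      next
        case (step q)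
        then show ?case using br_ff[of q r] br_antisym[of "f r" "f q"] assms \<open>r = Suc p\<close> \<open>Suc r \<le> n\<close>
          by (simp add: E_simps jacobi_right)
      qed
      then show ?thesis using that by simp
    qed
    then show ?thesis using step assms IH 3
      by (auto simp add: E_simps jacobi_right[of "e p"] br_ef)
  next
    case 4
    then show ?thesis using step assms IH
      by (auto simp: E_simps jacobi_right[of "e p"] br_ef br_diff)
  qed
qed

lemma br_e_E:
  assumes "1 \<le> p" "p < n" "r \<in> {1..n}" "s \<in> {1..n}"
  shows "br (e p) (E r s) = (if p + 1 = r then E p s else 0) - (if s = p then E r (p + 1) else 0)"
proof (cases r s rule: linorder_cases)
  case equal
  then show ?thesis using br_he[of r p] assms br_antisym[of "e p" "h r"] by (auto simp: E_simps)
qed (use br_e_E_upper[of p r s] br_e_E_lower[of p s r] assms in auto)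

end

lemma (in chevalley) transposed: "chevalley (\<lambda>x y. br y x) n f e h"
proof (unfold_locales, goal_cases)
  case (2 x y)
  then show ?case by (rule br_antisym)
next
  case (3 x y z)
  then show ?case using jacobi_right[of z y x] br_antisym[of "br z x" y] by (simp add: algebra_simps)
next
  case (6 p q)
  then show ?case using br_hf[of p q] br_antisym[of "f q" "h p"] by simp
next
  case (7 p q)
  then show ?case using br_he[of p q] br_antisym[of "e q" "h p"] by simp
next
  case (9 p q)
  then show ?case using br_ff[of p q] br_antisym[of "f q" "f p"] by simp
next
  case (10 p q)
  then show ?case using br_ee[of p q] br_antisym[of "e q" "e p"] by simp
next
  case (11 p)
  then show ?case using serre_f(1)[of p] br_antisym[of "br (f (p + 1)) (f p)" "f p"] br_antisym[of "f (p + 1)" "f p"] by simp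
next
  case (12 p)
  then show ?case using serre_f(2)[of p] br_antisym[of "br (f p) (f (p + 1))" "f (p + 1)"] br_antisym[of "f (p + 1)" "f p"] by simp
next
  case (13 p)
  then show ?case using serre_e(1)[of p] br_antisym[of "br (e (p + 1)) (e p)" "e p"] br_antisym[of "e (p + 1)" "e p"] by simp
next
  case (14 p)
  then show ?case using serre_e(2)[of p] br_antisym[of "br (e p) (e (p + 1))" "e (p + 1)"] br_antisym[of "e (p + 1)" "e p"] by simp
qed (auto simp: br_add_right br_hh br_ef intro: double_zero)

context chevalley
begin

lemma E_transposed: "mat_unit (\<lambda>x y. br y x) f e h r s = E s r"
proof -
  have "up_far (\<lambda>x y. br y x) f r d = down_far br f r d" "down_far (\<lambda>x y. br y x) e r d = up_far br e r d" for r d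
    by (induction d) auto
  then show ?thesis by (simp add: mat_unit_def)
qed

text \<open>This is \<open>br_e_E\<close> for the transposed structure, so the case analysis for the
  raising vectors is not repeated.\<close>

lemma br_f_E:
  assumes "1 \<le> p" "p < n" "r \<in> {1..n}" "s \<in> {1..n}"
  shows "br (f p) (E r s) = (if p = r then E (p + 1) s else 0) - (if s = p + 1 then E r p else 0)"
  using chevalley.br_e_E[OF transposed assms(1,2,4,3)] br_antisym[of "f p" "E r s"]
  by (simp add: E_transposed)

text \<open>By the Jacobi identity a bracket with E_(a, b+1) reduces to brackets with E_(a, b) and
  \<open>e b\<close>, so induction on the distance from the diagonal starts at the simple root
  vectors. The indices r and s are quantified inside the induction because the Jacobi identity
  produces brackets with other matrix units.\<close>

theorem gl_relations:
  assumes "a \<in> {1..n}" "b \<in> {1..n}" "r \<in> {1..n}" "s \<in> {1..n}"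
  shows "br (E a b) (E r s) = (if b = r then E a s else 0) - (if s = a then E r b else 0)"
proof (cases a b rule: linorder_cases)
  case equal
  then show ?thesis using br_h_E[of a r s] assms by (auto simp: E_simps)
next
  case less
  then have "\<forall>r\<in>{1..n}. \<forall>s\<in>{1..n}. br (E a b) (E r s) = (if b = r then E a s else 0) - (if s = a then E r b else 0)"
    using assms(2)
  proof (induction b rule: less_induct_step)
    case base
    then show ?case using br_e_E[of a] assms by (simp add: E_simps)
  next
    case (step b)
    have "br (E a (Suc b)) (E r s) = (if Suc b = r then E a s else 0) - (if s = a then E r (Suc b) else 0)"
      if rs: "r \<in> {1..n}" "s \<in> {1..n}" for r s
    proof -
      have J: "br (E a (Suc b)) (E r s) = br (E a b) (br (e b) (E r s)) - br (e b) (br (E a b) (E r s))"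
        using step by (simp add: E_simps jacobi)
      have "br (e b) (E x y) = (if b + 1 = x then E b y else 0) - (if y = b then E x (b + 1) else 0)"
        if "x \<in> {1..n}" "y \<in> {1..n}" for x y
        using br_e_E[of b x y] step assms that by simp
      note E1 = this
      have "br (E a b) (E x y) = (if b = x then E a y else 0) - (if y = a then E x b else 0)"
        if "x \<in> {1..n}" "y \<in> {1..n}" for x y
        using step that by simp
      note E2 = this
      have "b \<in> {1..n}" "a \<in> {1..n}" "Suc b \<in> {1..n}" "a < b" using step assms by auto
      note E = E1[OF rs] E2[OF rs] E1[OF \<open>a \<in> _\<close> rs(2)] E1[OF rs(1) \<open>b \<in> _\<close>]
        E2[OF \<open>b \<in> _\<close> rs(2)] E2[OF rs(1) \<open>Suc b \<in> _\<close>]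
      show ?thesis unfolding J E(1,2) using \<open>a < b\<close> E(3-6)
        by (cases "b = r"; cases "s = a"; cases "Suc b = r"; cases "s = b"; simp only: br_diff if_True if_False br_zero diff_zero; simp)
    qed
    then show ?case by blast
  qed
  then show ?thesis using assms by blast
next
  case greater
  then have "\<forall>r\<in>{1..n}. \<forall>s\<in>{1..n}. br (E a b) (E r s) = (if b = r then E a s else 0) - (if s = a then E r b else 0)"
    using assms(1)
  proof (induction a rule: less_induct_step)
    case base
    then show ?case using br_f_E[of b] assms by (simp add: E_simps)
  next
    case (step a)
    have "br (E (Suc a) b) (E r s) = (if b = r then E (Suc a) s else 0) - (if s = Suc a then E r b else 0)"
      if rs: "r \<in> {1..n}" "s \<in> {1..n}" for r s
    proof -
      have J: "br (E (Suc a) b) (E r s) = br (f a) (br (E a b) (E r s)) - br (E a b) (br (f a) (E r s))"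
        using step by (simp add: E_simps jacobi)
      have "br (f a) (E x y) = (if a = x then E (a + 1) y else 0) - (if y = a + 1 then E x a else 0)"
        if "x \<in> {1..n}" "y \<in> {1..n}" for x y
        using br_f_E[of a x y] step assms that by simp
      note E1 = this
      have "br (E a b) (E x y) = (if b = x then E a y else 0) - (if y = a then E x b else 0)"
        if "x \<in> {1..n}" "y \<in> {1..n}" for x y
        using step that by simp
      note E2 = this
      have "b \<in> {1..n}" "a \<in> {1..n}" "Suc a \<in> {1..n}" "b < a" using step assms by auto
      note E = E1[OF rs] E2[OF rs] E1[OF \<open>a \<in> _\<close> rs(2)] E1[OF rs(1) \<open>b \<in> _\<close>]
        E2[OF \<open>Suc a \<in> _\<close> rs(2)] E2[OF rs(1) \<open>a \<in> _\<close>]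
      show ?thesis unfolding J E(1,2) using \<open>b < a\<close> E(3-6)
        by (cases "b = r"; cases "s = a"; cases "a = r"; cases "s = Suc a"; simp only: br_diff if_True if_False br_zero diff_zero; simp)
    qed
    then show ?case by blast
  qed
  then show ?thesis using assms by blast
qed

end

section \<open>Lagrange interpolation and sums of residues\<close>

definition linprod :: "('i \<Rightarrow> 'a::comm_ring_1) \<Rightarrow> 'i set \<Rightarrow> 'a poly" where
  "linprod d I = (\<Prod>i\<in>I. [:- d i, 1:])"

lemma poly_linprod: "poly (linprod d I) x = (\<Prod>i\<in>I. x - d i)"
  by (simp add: linprod_def poly_prod)

lemma linprod_degree:
  assumes "finite I"
  shows "degree (linprod d I) \<le> card I" "coeff (linprod d I) (card I) = 1"
proof -
  have "degree (linprod d I) \<le> card I \<and> coeff (linprod d I) (card I) = 1"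
    using assms
  proof (induction I)
    case (insert x I)
    have eq: "linprod d (insert x I) = [:- d x, 1:] * linprod d I"
      using insert by (simp add: linprod_def)
    have "degree (linprod d (insert x I)) \<le> card (insert x I)"
      unfolding eq using insert degree_mult_le[of "[:- d x, 1:]" "linprod d I"] by simp
    moreover have "coeff (linprod d I) (Suc (card I)) = 0"
      using insert by (intro coeff_eq_0) simp
    ultimately show ?case using insert by (simp add: eq)
  qed (simp add: linprod_def)
  then show "degree (linprod d I) \<le> card I" "coeff (linprod d I) (card I) = 1" by auto
qed

lemma linprod_coeff1:
  assumes "finite I" "card I = Suc k"
  shows "coeff (linprod d I) k = - (\<Sum>i\<in>I. d i)"
  using assms
proof (induction I arbitrary: k)
  case (insert x I)
  have eq: "linprod d (insert x I) = [:- d x, 1:] * linprod d I"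
    using insert by (simp add: linprod_def)
  show ?case
  proof (cases k)
    case 0
    then have "I = {}" using insert by simp
    then show ?thesis using 0 by (simp add: linprod_def)
  next
    case (Suc l)
    then show ?thesis using insert linprod_degree(2)[of I d] by (simp add: eq)
  qed
qed simp

text \<open>The second elementary symmetric polynomial is expressed by power sums because these
  split over disjoint unions of nodes, the form in which the residue formula is applied.\<close>

lemma linprod_coeff2:
  fixes d :: "'i \<Rightarrow> 'a::field_char_0"
  assumes "finite I" "card I = Suc (Suc k)"
  shows "coeff (linprod d I) k = ((\<Sum>i\<in>I. d i)\<^sup>2 - (\<Sum>i\<in>I. (d i)\<^sup>2)) / 2"
  using assms
proof (induction I arbitrary: k)
  case (insert x I)
  have eq: "linprod d (insert x I) = [:- d x, 1:] * linprod d I"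
    using insert by (simp add: linprod_def)
  show ?case
  proof (cases k)
    case 0
    then obtain y where "I = {y}" using insert by (auto simp: card_Suc_eq)
    then show ?thesis using insert 0 by (auto simp: linprod_def power2_eq_square algebra_simps)
  next
    case (Suc l)
    then show ?thesis using insert linprod_coeff1[of I k d]
      by (simp add: eq field_simps power2_eq_square)
  qed
qed simp

text \<open>A polynomial of degree below the number of nodes equals its Lagrange interpolant; the
  sum is the top coefficient of the latter. In other words, the sum of the residues of R over the
  product of linear factors.\<close>

lemma lagrange_leading_coeff:
  fixes d :: "'i \<Rightarrow> 'a::field"
  assumes "finite I" "inj_on d I" "I \<noteq> {}" "degree R < card I"
  shows "(\<Sum>i\<in>I. poly R (d i) / (\<Prod>j\<in>I - {i}. d i - d j)) = coeff R (card I - 1)"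
proof -
  let ?c = "\<lambda>i. poly R (d i) / (\<Prod>j\<in>I - {i}. d i - d j)"
  define S where "S = (\<Sum>i\<in>I. smult (?c i) (linprod d (I - {i})))"
  have deg: "degree (smult (?c i) (linprod d (I - {i}))) < card I" if "i \<in> I" for i
  proof -
    have "degree (smult (?c i) (linprod d (I - {i}))) \<le> card (I - {i})"
      using linprod_degree(1)[of "I - {i}" d] assms(1) degree_smult_le order_trans by blast
    then show ?thesis using that assms(1) card_Diff1_less[of I i] by simp
  qed
  have "degree S < card I"
    unfolding S_def using assms deg by (intro degree_sum_less) (auto simp: card_gt_0_iff)
  moreover have "poly R x = poly S x" if x: "x \<in> d ` I" for x
  proof -
    obtain i where i: "i \<in> I" "x = d i" using x by auto
    have zero: "(\<Prod>l\<in>I - {j}. d i - d l) = 0" if "j \<in> I" "j \<noteq> i" for j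
      using i that assms(1) by auto
    have nz: "(\<Prod>j\<in>I - {i}. d i - d j) \<noteq> 0"
      using assms(1,2) i by (auto simp: inj_on_def)
    have "poly S x = (\<Sum>j\<in>I. if j = i then poly R x else 0)"
      unfolding S_def poly_sum using nz i
      by (intro sum.cong) (auto simp: zero poly_linprod)
    then show ?thesis using assms(1) i by simp
  qed
  moreover have "card (d ` I) = card I" using assms by (simp add: card_image)
  ultimately have "R = S" using assms by (intro poly_eqI_degree[of "d ` I"]) auto
  then have "coeff R (card I - 1) = coeff S (card I - 1)" by simp
  also have "\<dots> = (\<Sum>i\<in>I. ?c i * coeff (linprod d (I - {i})) (card I - 1))"
    unfolding S_def by (simp add: coeff_sum)
  also have "\<dots> = (\<Sum>i\<in>I. ?c i)"
  proof (rule sum.cong[OF refl])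
    fix i assume "i \<in> I"
    then show "?c i * coeff (linprod d (I - {i})) (card I - 1) = ?c i"
      using assms(1) linprod_degree(2)[of "I - {i}" d] by simp
  qed
  finally show ?thesis by simp
qed

text \<open>Subtracting the monic product with roots \<open>d i\<close> does not change the values
  at the nodes and lowers the degree of the numerator below the number of nodes, so the previous
  lemma reads off the next coefficient.\<close>

lemma residue_sum1:
  fixes d :: "'i \<Rightarrow> 'a::field"
  assumes I: "finite I" "inj_on d I" and J: "finite J" "card J = card I"
  shows "(\<Sum>i\<in>I. (\<Prod>j\<in>J. d i - m j) / (\<Prod>j\<in>I - {i}. d i - d j)) = (\<Sum>i\<in>I. d i) - (\<Sum>j\<in>J. m j)"
proof (cases "I = {}")
  case False
  then obtain k where k: "card I = Suc k" using I by (metis card_0_eq not0_implies_Suc)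
  let ?R = "linprod m J - linprod d I"
  have "degree ?R < card I"
    by (rule degree_lessI)
      (use k J I linprod_degree[of J m] linprod_degree[of I d] in
        \<open>auto simp: coeff_eq_0 le_less intro!: coeff_eq_0\<close>)
  moreover have "poly ?R (d i) = (\<Prod>j\<in>J. d i - m j)" if "i \<in> I" for i
    using I that by (auto simp: poly_linprod)
  ultimately show ?thesis
    using lagrange_leading_coeff[OF I False, of ?R] k J I linprod_coeff1[of J k m] linprod_coeff1[of I k d]
    by simp
qed (use assms in auto)

lemma residue_sum2:
  fixes d :: "'i \<Rightarrow> 'a::field_char_0"
  assumes I: "finite I" "inj_on d I" "I \<noteq> {}" and J: "finite J" "card J = Suc (card I)"
  shows "(\<Sum>i\<in>I. (\<Prod>j\<in>J. d i - m j) / (\<Prod>j\<in>I - {i}. d i - d j)) =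
    (((\<Sum>j\<in>J. m j) - (\<Sum>i\<in>I. d i))\<^sup>2 + (\<Sum>i\<in>I. (d i)\<^sup>2) - (\<Sum>j\<in>J. (m j)\<^sup>2)) / 2"
proof -
  obtain k where k: "card I = Suc k" using I by (metis card_0_eq not0_implies_Suc)
  \<comment> \<open>The numerator has one factor more than there are nodes, so division by the node
    polynomial has a linear quotient X + s; this s makes the two leading coefficients agree.\<close>
  define s where "s = (\<Sum>i\<in>I. d i) - (\<Sum>j\<in>J. m j)"
  let ?R = "linprod m J - [:s, 1:] * linprod d I"
  have cD: "coeff (linprod d I) l = 0" if "l > Suc k" for l
    using linprod_degree(1)[of I d] I k that by (intro coeff_eq_0) simp
  have cN: "coeff (linprod m J) l = 0" if "l > Suc (Suc k)" for l
    using linprod_degree(1)[of J m] J k that by (intro coeff_eq_0) simp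
  have top: "coeff (linprod d I) (Suc k) = 1" "coeff (linprod m J) (Suc (Suc k)) = 1"
    "coeff (linprod d I) k = - (\<Sum>i\<in>I. d i)" "coeff (linprod m J) (Suc k) = - (\<Sum>j\<in>J. m j)"
    "coeff (linprod m J) k = ((\<Sum>j\<in>J. m j)\<^sup>2 - (\<Sum>j\<in>J. (m j)\<^sup>2)) / 2"
    using linprod_degree(2)[of I d] linprod_degree(2)[of J m] linprod_coeff1[of I k d]
      linprod_coeff1[of J "Suc k" m] linprod_coeff2[of J k m] I J k by simp_all
  have "coeff ?R l = 0" if "l \<ge> Suc k" for l
  proof -
    consider "l = Suc k" | "l = Suc (Suc k)" | "l > Suc (Suc k)" using \<open>l \<ge> Suc k\<close> by linarith
    then show ?thesis
    proof cases
      case 3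
      then obtain l' where "l = Suc l'" "l' > Suc k" by (cases l) auto
      then show ?thesis using 3 cD cN by simp
    qed (simp_all add: top cD s_def)
  qed
  then have deg: "degree ?R < card I" using k by (intro degree_lessI) auto
  have "coeff ?R k = (((\<Sum>j\<in>J. m j) - (\<Sum>i\<in>I. d i))\<^sup>2 + (\<Sum>i\<in>I. (d i)\<^sup>2) - (\<Sum>j\<in>J. (m j)\<^sup>2)) / 2"
  proof (cases k)
    case 0
    then obtain x where "I = {x}" using k by (auto simp: card_Suc_eq)
    then show ?thesis using 0 top by (simp add: s_def field_simps power2_eq_square)
  next
    case (Suc l)
    then have "coeff (linprod d I) l = ((\<Sum>i\<in>I. d i)\<^sup>2 - (\<Sum>i\<in>I. (d i)\<^sup>2)) / 2"
      using linprod_coeff2[of I l d] k I by simp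
    then show ?thesis using Suc top by (simp add: s_def field_simps power2_eq_square)
  qed
  moreover have "poly ?R (d i) = (\<Prod>j\<in>J. d i - m j)" if "i \<in> I" for i
  proof -
    have "(\<Prod>j\<in>I. d i - d j) = 0" using I that by auto
    then show ?thesis by (simp add: poly_linprod)
  qed
  ultimately show ?thesis
    using lagrange_leading_coeff[OF I deg] k by simp
qed

section \<open>Shift operators\<close>

lemma shift_commute: "shift (shift z u d) w d' = shift (shift z w d') u d"
  by (auto simp: shift_def fun_eq_iff)

definition shop :: "nat \<Rightarrow> int \<Rightarrow> (nat \<Rightarrow> zvec \<Rightarrow> 'k) \<Rightarrow> (zvec, 'k::field_char_0) lop" where
  "shop p d c = lop_of (\<lambda>z. \<Sum>q=1..p. Poly_Mapping.single (shift z (p,q) d) (c q z))"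

lemma app_shop [simp]:
  "app (shop p d c) (Poly_Mapping.single z a) = (\<Sum>q=1..p. Poly_Mapping.single (shift z (p,q) d) (a * c q z))"
  by (simp add: shop_def scale_sum)

lemma shop_cong: "(\<And>q z. q \<in> {1..p} \<Longrightarrow> c q z = c' q z) \<Longrightarrow> shop p d c = shop p d c'"
  unfolding shop_def by (intro arg_cong[where f = lop_of] ext sum.cong) auto

lemma shop_linear:
  "shop p d c + shop p d c' = shop p d (\<lambda>q z. c q z + c' q z)"
  "shop p d c - shop p d c' = shop p d (\<lambda>q z. c q z - c' q z)"
  "- shop p d c = shop p d (\<lambda>q z. - c q z)"
  "shop p d (\<lambda>q z. 0) = 0"
  by (auto intro!: lop_eqI simp: single_add single_diff single_uminus sum.distrib sum_subtractf sum_negf)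

lemma lie_diag_shop:
  "lie (diag_op \<mu>) (shop p d c) = shop p d (\<lambda>q z. (\<mu> (shift z (p,q) d) - \<mu> z) * c q z)"
  by (rule lop_eqI)
    (simp add: lie_def app_sum sum_subtractf flip: single_diff, simp add: algebra_simps single_diff single_add flip: sum_subtractf)

text \<open>Shifts commute, so both orders of composition reach the same tableaux; it suffices to
  compare the coefficients of the two paths to each of them.\<close>

lemma lie_shop_zero:
  assumes "\<And>z i j. i \<in> {1..p} \<Longrightarrow> j \<in> {1..p'} \<Longrightarrow>
    c' j z * c i (shift z (p',j) d') = c i z * c' j (shift z (p,i) d)"
  shows "lie (shop p d c) (shop p' d' c') = 0"
proof (rule lop_eqI)
  fix z
  have "app (shop p d c * shop p' d' c') (T z) =
    (\<Sum>j=1..p'. \<Sum>i=1..p. Poly_Mapping.single (shift (shift z (p',j) d') (p,i) d) (c' j z * c i (shift z (p',j) d')))"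
    by (simp add: app_sum)
  also have "\<dots> = (\<Sum>j=1..p'. \<Sum>i=1..p. Poly_Mapping.single (shift (shift z (p,i) d) (p',j) d') (c i z * c' j (shift z (p,i) d)))"
    using assms by (intro sum.cong refl) (simp add: shift_commute)
  also have "\<dots> = app (shop p' d' c' * shop p d c) (T z)"
    by (subst sum.swap) (simp add: app_sum)
  finally show "app (lie (shop p d c) (shop p' d' c')) (T z) = app 0 (T z)"
    by (simp add: lie_def)
qed

text \<open>
  The three terms are the coefficients along the paths in which Y acts first, second and third;
  their endpoints are symmetric in i and i', so only the symmetrization has to vanish.
\<close>

lemma serre_shop:
  assumes "\<And>z j i i'. \<lbrakk>j \<in> {1..p'}; i \<in> {1..p}; i' \<in> {1..p}\<rbrakk> \<Longrightarrow> F z j i i' + F z j i' i = 0"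
    and F: "\<And>z j i i'. F z j i i' =
      c' j z * c i (shift z (p',j) d') * c i' (shift (shift z (p',j) d') (p,i) d)
      - 2 * (c i z * c' j (shift z (p,i) d) * c i' (shift (shift z (p,i) d) (p',j) d'))
      + c i z * c i' (shift z (p,i) d) * c' j (shift (shift z (p,i) d) (p,i') d)"
  shows "lie (shop p d c) (lie (shop p d c) (shop p' d' c')) = 0"
proof (rule lop_eqI)
  fix z
  let ?X = "shop p d c" and ?Y = "shop p' d' c'"
  define P where "P j i i' = shift (shift (shift z (p',j) d') (p,i) d) (p,i') d" for j i i'
  have P: "shift (shift (shift z (p,i) d) (p',j) d') (p,i') d = P j i i'"
    "shift (shift (shift z (p,i) d) (p,i') d) (p',j) d' = P j i i'" "P j i' i = P j i i'" for i j i'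
    by (auto simp: P_def shift_def fun_eq_iff)
  have a: "app (?X * ?X * ?Y) (T z) = (\<Sum>j=1..p'. \<Sum>i=1..p. \<Sum>i'=1..p. Poly_Mapping.single (P j i i')
      (c' j z * c i (shift z (p',j) d') * c i' (shift (shift z (p',j) d') (p,i) d)))"
    by (simp add: app_sum P_def mult.assoc)
  have b: "app (?X * ?Y * ?X) (T z) = (\<Sum>j=1..p'. \<Sum>i=1..p. \<Sum>i'=1..p. Poly_Mapping.single (P j i i')
      (c i z * c' j (shift z (p,i) d) * c i' (shift (shift z (p,i) d) (p',j) d')))"
    by (subst sum.swap) (simp add: app_sum P mult.assoc)
  have "app (?Y * ?X * ?X) (T z) = (\<Sum>i=1..p. \<Sum>i'=1..p. \<Sum>j=1..p'. Poly_Mapping.single (P j i i')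
      (c i z * c i' (shift z (p,i) d) * c' j (shift (shift z (p,i) d) (p,i') d)))"
    by (simp add: app_sum P mult.assoc)
  also have "\<dots> = (\<Sum>i=1..p. \<Sum>j=1..p'. \<Sum>i'=1..p. Poly_Mapping.single (P j i i')
      (c i z * c i' (shift z (p,i) d) * c' j (shift (shift z (p,i) d) (p,i') d)))"
    by (intro sum.cong refl sum.swap)
  also have "\<dots> = (\<Sum>j=1..p'. \<Sum>i=1..p. \<Sum>i'=1..p. Poly_Mapping.single (P j i i')
      (c i z * c i' (shift z (p,i) d) * c' j (shift (shift z (p,i) d) (p,i') d)))"
    by (rule sum.swap)
  finally have c: "app (?Y * ?X * ?X) (T z) = \<dots>" .
  define S where "S = (\<Sum>j=1..p'. \<Sum>i=1..p. \<Sum>i'=1..p. Poly_Mapping.single (P j i i') (F z j i i'))"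
  have "lie ?X (lie ?X ?Y) = ?X * ?X * ?Y - (?X * ?Y * ?X + ?X * ?Y * ?X) + ?Y * ?X * ?X"
    unfolding lie_def by (simp only: algebra_simps)
  then have "app (lie ?X (lie ?X ?Y)) (T z) = app (?X * ?X * ?Y) (T z) - (app (?X * ?Y * ?X) (T z) + app (?X * ?Y * ?X) (T z)) + app (?Y * ?X * ?X) (T z)"
    by (simp only: app_ops)
  also have "\<dots> = S"
    unfolding a b c S_def F
    by (simp only: single_add single_diff sum.distrib sum_subtractf mult_2)
  finally have S: "app (lie ?X (lie ?X ?Y)) (T z) = S" .
  have "S = (\<Sum>j=1..p'. \<Sum>i=1..p. \<Sum>i'=1..p. Poly_Mapping.single (P j i i') (F z j i' i))"
    unfolding S_def by (rule sum.cong[OF refl], subst sum.swap) (simp add: P)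
  then have "S + S = (\<Sum>j=1..p'. \<Sum>i=1..p. \<Sum>i'=1..p. Poly_Mapping.single (P j i i') (F z j i i' + F z j i' i))"
    unfolding single_add sum.distrib by (simp add: S_def)
  also have "\<dots> = 0" using assms(1) by (intro sum.neutral ballI) auto
  finally show "app (lie ?X (lie ?X ?Y)) (T z) = app 0 (T z)"
    using poly_mapping_double_zero[of S] S by simp
qed

section \<open>The generic tableau module over a field\<close>

definition ent :: "nat \<Rightarrow> (idx \<Rightarrow> 'k) \<Rightarrow> zvec \<Rightarrow> nat \<Rightarrow> nat \<Rightarrow> 'k::field_char_0" where
  "ent n e z r s = (if r = n then e (r,s) else e (r,s) + of_int (z (r,s)))"

text \<open>One formula for raising and lowering: p' is the neighbouring row that occurs in the
  numerator, m the number of its entries that are used, and \<open>\<kappa>\<close> the sign. Thus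
  each Serre computation serves for e and for f.\<close>

definition cf :: "nat \<Rightarrow> (idx \<Rightarrow> 'k) \<Rightarrow> 'k \<Rightarrow> nat \<Rightarrow> nat \<Rightarrow> nat \<Rightarrow> nat \<Rightarrow> zvec \<Rightarrow> 'k::field_char_0" where
  "cf n e \<kappa> p p' m q z = \<kappa> * (\<Prod>u=1..m. ent n e z p q - ent n e z p' u) /
     (\<Prod>u\<in>{1..p} - {q}. ent n e z p q - ent n e z p u)"

abbreviation cup where "cup n e p \<equiv> cf n e (-1) p (p + 1) (p + 1)"
abbreviation cdn where "cdn n e p \<equiv> cf n e 1 p (p - 1) (p - 1)"

definition wt :: "nat \<Rightarrow> (idx \<Rightarrow> 'k) \<Rightarrow> nat \<Rightarrow> zvec \<Rightarrow> 'k::field_char_0" where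
  "wt n e p z = (\<Sum>q=1..p. ent n e z p q + of_nat q - 1) - (\<Sum>q=1..p-1. ent n e z (p-1) q + of_nat q - 1)"

definition eop :: "nat \<Rightarrow> (idx \<Rightarrow> 'k) \<Rightarrow> nat \<Rightarrow> (zvec, 'k::field_char_0) lop" where
  "eop n e p = shop p 1 (cup n e p)"

definition fop :: "nat \<Rightarrow> (idx \<Rightarrow> 'k) \<Rightarrow> nat \<Rightarrow> (zvec, 'k::field_char_0) lop" where
  "fop n e p = shop p (- 1) (cdn n e p)"

definition hop :: "nat \<Rightarrow> (idx \<Rightarrow> 'k) \<Rightarrow> nat \<Rightarrow> (zvec, 'k::field_char_0) lop" where
  "hop n e p = diag_op (wt n e p)"

lemma ent_shift:
  "ent n e (shift z (p,q) d) r s = ent n e z r s + (if r = p \<and> s = q \<and> r \<noteq> n then of_int d else 0)"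
  by (auto simp: ent_def shift_def)

lemma ent_shift_other [simp]: "r \<noteq> p \<or> s \<noteq> q \<Longrightarrow> ent n e (shift z (p,q) d) r s = ent n e z r s"
  by (auto simp: ent_shift)

lemma ent_shift_same [simp]: "p \<noteq> n \<Longrightarrow> ent n e (shift z (p,q) d) p q = ent n e z p q + of_int d"
  by (auto simp: ent_shift)

lemma cf_shift_far [simp]: "r \<noteq> p \<Longrightarrow> r \<noteq> p' \<Longrightarrow> cf n e \<kappa> p p' m q (shift z (r,s) d) = cf n e \<kappa> p p' m q z"
  by (simp add: cf_def)

text \<open>\<open>cf\<close> without the factor of entry s of row p', the only factor that a shift
  of this entry changes.\<close>

definition cg :: "nat \<Rightarrow> (idx \<Rightarrow> 'k) \<Rightarrow> 'k \<Rightarrow> nat \<Rightarrow> nat \<Rightarrow> nat \<Rightarrow> nat \<Rightarrow> nat \<Rightarrow> zvec \<Rightarrow> 'k::field_char_0" where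
  "cg n e \<kappa> p p' m s q z = \<kappa> * (\<Prod>u\<in>{1..m} - {s}. ent n e z p q - ent n e z p' u) /
     (\<Prod>u\<in>{1..p} - {q}. ent n e z p q - ent n e z p u)"

lemma prod_remove1: "s \<in> {1..m::nat} \<Longrightarrow> (\<Prod>u=1..m. f u) = f s * (\<Prod>u\<in>{1..m} - {s}. f u)"
  by (rule prod.remove) simp_all

lemma cf_shift_target:
  assumes "p \<noteq> p'" "p' \<noteq> n" "s \<in> {1..m}"
  shows "cf n e \<kappa> p p' m q z = (ent n e z p q - ent n e z p' s) * cg n e \<kappa> p p' m s q z"
    and "cf n e \<kappa> p p' m q (shift z (p',s) d) = (ent n e z p q - ent n e z p' s - of_int d) * cg n e \<kappa> p p' m s q z"
  unfolding cf_def cg_def prod_remove1[OF assms(3)] using assms by (simp_all add: diff_diff_eq)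

lemma row_sum_shift:
  assumes "s \<in> {1..r}" "r \<noteq> n"
  shows "(\<Sum>q=1..p. ent n e (shift z (r,s) d) p q + of_nat q - 1) =
    (\<Sum>q=1..p. ent n e z p q + of_nat q - 1) + (if p = r then of_int d else 0)"
proof -
  have "(\<Sum>q=1..p. ent n e (shift z (r,s) d) p q + of_nat q - 1) =
    (\<Sum>q=1..p. (ent n e z p q + of_nat q - 1) + (if s = q then (if p = r then of_int d else 0) else 0))"
    using assms by (intro sum.cong) (auto simp: ent_shift)
  then show ?thesis using assms by (auto simp: sum.distrib)
qed

lemma wt_shift:
  assumes "s \<in> {1..r}" "r \<noteq> n" "1 \<le> p"
  shows "wt n e p (shift z (r,s) d) = wt n e p z + (if p = r then of_int d else 0) - (if p = r + 1 then of_int d else 0)"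
  unfolding wt_def row_sum_shift[OF assms(1,2)] using assms(3) by auto

locale generic_tableau =
  fixes n :: nat and e :: "idx \<Rightarrow> 'k::field_char_0"
  assumes generic: "\<lbrakk>1 \<le> s; s < u; u \<le> r; r < n\<rbrakk> \<Longrightarrow> e (r,s) - e (r,u) \<noteq> of_int m"
begin

abbreviation "W \<equiv> ent n e"

lemma ent_generic:
  assumes "s \<in> {1..r}" "u \<in> {1..r}" "s \<noteq> u" "r < n"
  shows "W z r s - W z r u \<noteq> of_int m"
proof -
  have "e (r,s) - e (r,u) \<noteq> of_int m'" for m'
  proof (cases "s < u")
    case False
    then have "e (r,u) - e (r,s) \<noteq> of_int (- m')" using assms by (intro generic) auto
    then show ?thesis by (auto simp: algebra_simps eq_neg_iff_add_eq_0)
  qed (use assms generic[of s u r m'] in auto)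
  from this[of "m - z (r,s) + z (r,u)"] show ?thesis
    using assms by (auto simp: ent_def algebra_simps)
qed

lemma ent_generic0: "s \<in> {1..r} \<Longrightarrow> u \<in> {1..r} \<Longrightarrow> s \<noteq> u \<Longrightarrow> r < n \<Longrightarrow> W z r s \<noteq> W z r u"
  using ent_generic[of s r u z 0] by auto

lemma cf_shift_own:
  assumes "p \<noteq> p'" "p < n" "q \<in> {1..p}" "j \<in> {1..p}" "j \<noteq> q"
  shows "cf n e \<kappa> p p' m q (shift z (p,j) d) =
    cf n e \<kappa> p p' m q z * (W z p q - W z p j) / (W z p q - W z p j - of_int d)"
proof -
  have "{1..p} - {q} = insert j ({1..p} - {q} - {j})" using assms by auto
  then have r: "(\<Prod>u\<in>{1..p} - {q}. f u) = f j * (\<Prod>u\<in>{1..p} - {q} - {j}. f u)" for f :: "nat \<Rightarrow> 'k"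
    by (metis finite_Diff finite_atLeastAtMost Diff_iff insertI1 prod.insert)
  have "W z p q - W z p j \<noteq> 0" using ent_generic[of q p j z 0] assms by auto
  moreover have "W z p q - W z p j - of_int d \<noteq> 0" using ent_generic[of q p j z d] assms by auto
  ultimately show ?thesis unfolding cf_def r using assms by simp
qed

text \<open>The case in which the repeated operator reads the row p' moved by the other one, while
  c' does not see row p: the pairs e_p, e_(p+1) and f_(p+1), f_p. After the dependence on the moved
  entries is extracted, the two orders of i and i' cancel.\<close>

lemma serre_A:
  assumes "p \<noteq> p'" "p < n" "p' < n" "\<And>j z i. i \<in> {1..p} \<Longrightarrow> c' j (shift z (p,i) d) = c' j z"
  shows "lie (shop p d (cf n e \<kappa> p p' p')) (lie (shop p d (cf n e \<kappa> p p' p')) (shop p' d c')) = 0"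
proof (rule serre_shop[OF _ refl])
  fix z j i i' assume jii: "j \<in> {1..p'}" "i \<in> {1..p}" "i' \<in> {1..p}"
  let ?c = "cf n e \<kappa> p p' p'"
  let ?g = "cg n e \<kappa> p p' p' j"
  have c: "?c q z = (W z p q - W z p' j) * ?g q z"
    "?c q (shift z (p',j) d) = (W z p q - W z p' j - of_int d) * ?g q z" for q z
    using cf_shift_target[of p p' n j p' e \<kappa> q z] assms jii by simp_all
  let ?F = "\<lambda>i i'. c' j z * ?c i (shift z (p',j) d) * ?c i' (shift (shift z (p',j) d) (p,i) d) -
      2 * (?c i z * c' j (shift z (p,i) d) * ?c i' (shift (shift z (p,i) d) (p',j) d)) +
      ?c i z * ?c i' (shift z (p,i) d) * c' j (shift (shift z (p,i) d) (p,i') d)"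
  have F: "?F i i' = of_int d * c' j z * ?g i z * ?g i' z * (W z p i - W z p i')"
    if i: "i \<in> {1..p}" "i' \<in> {1..p}" "i \<noteq> i'" for i i'
  proof -
    \<comment> \<open>The factor by which the coefficient at i' changes once entry i has moved. It
      cancels against the remaining bracket and leaves an expression that is antisymmetric in i and
      i'.\<close>
    define \<rho> where "\<rho> = (W z p i' - W z p i) / (W z p i' - W z p i - of_int d)"
    have \<rho>: "\<rho> * (W z p i - W z p i' + of_int d) = W z p i - W z p i'"
      using ent_generic[of i' p i z d] i assms(2) by (simp add: \<rho>_def divide_simps) (simp add: algebra_simps)
    have 1: "?c i' (shift z (p,i) d) = ?c i' z * \<rho>" "?c i' (shift (shift z (p',j) d) (p,i) d) = ?c i' (shift z (p',j) d) * \<rho>"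
      using i assms(1,2) by (simp_all add: cf_shift_own \<rho>_def)
    have Y: "c' j (shift z (p,i) d) = c' j z" "c' j (shift (shift z (p,i) d) (p,i') d) = c' j z"
      using i by (simp_all add: assms(4))
    have "?F i i' = of_int d * c' j z * ?g i z * ?g i' z * (\<rho> * (W z p i - W z p i' + of_int d))"
      unfolding shift_commute[of z "(p,i)" d "(p',j)" d] 1 Y
      unfolding c(2) unfolding c(1) by (simp add: algebra_simps)
    then show ?thesis unfolding \<rho> .
  qed
  show "?F i i' + ?F i' i = 0"
  proof (cases "i = i'")
    case True
    have 1: "?c i (shift (shift z (p,i) d) (p',j) d) = (W z p i - W z p' j) * ?g i (shift z (p,i) d)"
      "?c i (shift z (p,i) d) = (W z p i + of_int d - W z p' j) * ?g i (shift z (p,i) d)"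
      using c(2)[of i "shift z (p,i) d"] c(1)[of i "shift z (p,i) d"] assms jii by simp_all
    have Y: "c' j (shift z (p,i) d) = c' j z" "c' j (shift (shift z (p,i) d) (p,i) d) = c' j z"
      using jii by (simp_all add: assms(4))
    \<comment> \<open>Apart from common factors, the second difference of a linear function
      remains.\<close>
    have "?F i i = 0"
      unfolding shift_commute[of z "(p',j)" d "(p,i)" d] Y c(2)[of i z] c(1)[of i z] 1 by (simp add: algebra_simps)
    then show ?thesis using True by simp
  next
    case False
    show ?thesis unfolding F[OF jii(2,3) False] F[OF jii(3,2) False[symmetric]] by (simp add: algebra_simps)
  qed
qed

text \<open>The opposite case: c' reads row p, and the repeated operator does not see row p'. It
  covers e_(p+1), e_p and f_p, f_(p+1).\<close>

lemma serre_B: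
  assumes "p \<noteq> p'" "p < n" "p' < n" "p'' \<noteq> p'" "p'' \<noteq> p"
    "c' = cf n e \<kappa>' p' p p"
  shows "lie (shop p d (cf n e \<kappa> p p'' m)) (lie (shop p d (cf n e \<kappa> p p'' m)) (shop p' d c')) = 0"
proof (rule serre_shop[OF _ refl])
  fix z j i i' assume jii: "j \<in> {1..p'}" "i \<in> {1..p}" "i' \<in> {1..p}"
  let ?c = "cf n e \<kappa> p p'' m"
  have X: "?c q (shift z (p',s) d) = ?c q z" for q s z
    using assms by simp
  let ?F = "\<lambda>i i'. c' j z * ?c i (shift z (p',j) d) * ?c i' (shift (shift z (p',j) d) (p,i) d) -
      2 * (?c i z * c' j (shift z (p,i) d) * ?c i' (shift (shift z (p,i) d) (p',j) d)) +
      ?c i z * ?c i' (shift z (p,i) d) * c' j (shift (shift z (p,i) d) (p,i') d)"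
  show "?F i i' + ?F i' i = 0"
  proof (cases "i = i'")
    case True
    let ?g = "cg n e \<kappa>' p' p p i j"
    have g: "?g (shift z (p,i) d) = ?g z" using assms by (simp add: cg_def)
    have Y: "c' j z = (W z p' j - W z p i) * ?g z" "c' j (shift z (p,i) d) = (W z p' j - W z p i - of_int d) * ?g z" for z
      using cf_shift_target[OF assms(1)[symmetric] _ jii(2), of n] assms(2)
      unfolding assms(6) by (metis less_irrefl)+
    have YY: "c' j (shift (shift z (p,i) d) (p,i) d) = (W z p' j - W z p i - 2 * of_int d) * ?g z"
      unfolding Y(2) g using assms by simp
    have "?F i i = 0" unfolding shift_commute[of z "(p',j)" d "(p,i)" d] X YY
      unfolding Y(2)[of z] Y(1)[of z] by (simp add: algebra_simps)
    then show ?thesis using True by simp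
  next
    case False
    have "\<exists>y. c' j z = (W z p' j - W z p i) * (W z p' j - W z p i') * y \<and>
        c' j (shift z (p,i) d) = (W z p' j - W z p i - of_int d) * (W z p' j - W z p i') * y \<and>
        c' j (shift z (p,i') d) = (W z p' j - W z p i) * (W z p' j - W z p i' - of_int d) * y \<and>
        c' j (shift (shift z (p,i) d) (p,i') d) = (W z p' j - W z p i - of_int d) * (W z p' j - W z p i' - of_int d) * y"
    proof -
      \<comment> \<open>The part of the coefficient c' that is unaffected by moving entries i and i'
        of row p.\<close>
      define y where "y = \<kappa>' * (\<Prod>u\<in>{1..p} - {i} - {i'}. W z p' j - W z p u) / (\<Prod>u\<in>{1..p'} - {j}. W z p' j - W z p' u)"
      have "(\<Prod>u=1..p. f u) = f i * (f i' * (\<Prod>u\<in>{1..p} - {i} - {i'}. f u))" for f :: "nat \<Rightarrow> 'k"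
        unfolding prod_remove1[OF jii(2)] using jii(3) False by (subst prod.remove[of "{1..p} - {i}" i']) auto
      then have *: "c' j z' = \<kappa>' * ((W z' p' j - W z' p i) * ((W z' p' j - W z' p i') *
          (\<Prod>u\<in>{1..p} - {i} - {i'}. W z' p' j - W z' p u))) / (\<Prod>u\<in>{1..p'} - {j}. W z' p' j - W z' p' u)" for z'
        by (simp add: assms(6) cf_def)
      show ?thesis
        unfolding * by (rule exI[of _ y]) (use False assms(1-5) jii in \<open>simp add: y_def diff_diff_eq mult_ac\<close>)
    qed
    then obtain y where y: "c' j z = (W z p' j - W z p i) * (W z p' j - W z p i') * y"
        "c' j (shift z (p,i) d) = (W z p' j - W z p i - of_int d) * (W z p' j - W z p i') * y"
        "c' j (shift z (p,i') d) = (W z p' j - W z p i) * (W z p' j - W z p i' - of_int d) * y"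
        "c' j (shift (shift z (p,i) d) (p,i') d) = (W z p' j - W z p i - of_int d) * (W z p' j - W z p i' - of_int d) * y"
      by blast
    define k where "k = W z p i - W z p i'"
    define \<rho> where "\<rho> = (W z p i' - W z p i) / (W z p i' - W z p i - of_int d)"
    define \<rho>' where "\<rho>' = (W z p i - W z p i') / (W z p i - W z p i' - of_int d)"
    have \<rho>: "\<rho> * (W z p i - W z p i' + of_int d) = W z p i - W z p i'"
      "\<rho>' * (W z p i' - W z p i + of_int d) = W z p i' - W z p i"
      using ent_generic[of i' p i z d] ent_generic[of i p i' z d] jii assms(2) False
      by (simp_all add: \<rho>_def \<rho>'_def divide_simps) (simp_all add: algebra_simps)
    have 1: "?c i' (shift z (p,i) d) = ?c i' z * \<rho>" "?c i (shift z (p,i') d) = ?c i z * \<rho>'"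
      using jii assms False by (simp_all add: cf_shift_own \<rho>_def \<rho>'_def)
    have F1: "?F i i' = of_int d * ?c i z * ?c i' z * y * (\<rho> * (W z p i - W z p i' + of_int d))"
      unfolding shift_commute[of z "(p',j)" d "(p,i)" d] X 1 y by (simp add: algebra_simps)
    have F2: "?F i' i = of_int d * ?c i z * ?c i' z * y * (\<rho>' * (W z p i' - W z p i + of_int d))"
      unfolding shift_commute[of z "(p',j)" d "(p,i')" d] shift_commute[of z "(p,i')" d "(p,i)" d] X 1 y
      by (simp add: algebra_simps)
    show ?thesis unfolding F1 F2 \<rho> by (simp add: algebra_simps)
  qed
qed

text \<open>Paths that move two different entries cancel, since the two denominators change by the
  same factor; only the paths that return to the same tableau remain, so the commutator is diagonal.
  The constant weight 1 gives [e_p, f_p], the weight t + p the bracket needed for the quadratic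
  Casimir elements.\<close>

lemma weighted_ef:
  fixes p :: nat and g :: "'k \<Rightarrow> 'k"
  assumes "1 \<le> p" "p < n"
  defines "A \<equiv> shop p 1 (\<lambda>q z. g (W z p q) * cup n e p q z)"
  shows "lie A (fop n e p) = diag_op (\<lambda>z. \<Sum>q=1..p.
    g (W z p q - 1) * cdn n e p q z * cup n e p q (shift z (p,q) (- 1)) -
    g (W z p q) * cup n e p q z * cdn n e p q (shift z (p,q) 1))"
proof (rule lop_eqI)
  fix z
  let ?u = "cup n e p" and ?d = "cdn n e p"
  define P where "P i j = Poly_Mapping.single (shift (shift z (p,j) (-1)) (p,i) 1)
    (?d j z * (g (W (shift z (p,j) (-1)) p i) * ?u i (shift z (p,j) (-1))) - g (W z p i) * ?u i z * ?d j (shift z (p,i) 1))" for i j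
  have zero: "P i j = 0" if "i \<in> {1..p}" "j \<in> {1..p}" "i \<noteq> j" for i j
  proof -
    have 1: "?u i (shift z (p,j) (-1)) = ?u i z * (W z p i - W z p j) / (W z p i - W z p j + 1)"
      "?d j (shift z (p,i) 1) = ?d j z * (W z p j - W z p i) / (W z p j - W z p i - 1)"
      using cf_shift_own[of p "p + 1" i j "-1" "p + 1" z "-1"] cf_shift_own[of p "p - 1" j i 1 "p - 1" z 1] that assms(1,2)
      by auto
    have "W z p i - W z p j + 1 \<noteq> 0" "W z p j - W z p i - 1 \<noteq> 0"
      using ent_generic[of i p j z "-1"] ent_generic[of j p i z 1] that assms by (auto simp: algebra_simps)
    then have "(W z p j - W z p i) / (W z p j - W z p i - 1) = (W z p i - W z p j) / (W z p i - W z p j + 1)"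
      by (simp add: divide_simps) (simp add: algebra_simps)
    then show ?thesis using that unfolding P_def 1 times_divide_eq_right[symmetric] by simp
  qed
  have "app (lie A (fop n e p)) (T z) = (\<Sum>j=1..p. \<Sum>i=1..p. P i j)"
  proof -
    have "app (fop n e p * A) (T z) = (\<Sum>j=1..p. \<Sum>i=1..p. Poly_Mapping.single (shift (shift z (p,j) (-1)) (p,i) 1)
        (g (W z p i) * ?u i z * ?d j (shift z (p,i) 1)))"
      by (subst sum.swap) (simp add: app_sum A_def fop_def shift_commute[of z "(p,_)" 1])
    moreover have "app (A * fop n e p) (T z) = (\<Sum>j=1..p. \<Sum>i=1..p. Poly_Mapping.single (shift (shift z (p,j) (-1)) (p,i) 1)
        (?d j z * (g (W (shift z (p,j) (-1)) p i) * ?u i (shift z (p,j) (-1)))))"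
      by (simp add: app_sum A_def fop_def)
    ultimately show ?thesis by (simp add: lie_def P_def single_diff sum_subtractf)
  qed
  also have "\<dots> = (\<Sum>j=1..p. \<Sum>i=1..p. if i = j then P j j else 0)"
    using zero by (intro sum.cong refl) auto
  also have "\<dots> = (\<Sum>j=1..p. P j j)" by simp
  also have "\<dots> = (\<Sum>q=1..p. Poly_Mapping.single z (g (W z p q - 1) * ?d q z * ?u q (shift z (p,q) (- 1)) -
    g (W z p q) * ?u q z * ?d q (shift z (p,q) 1)))"
  proof (intro sum.cong refl)
    fix q assume "q \<in> {1..p}"
    moreover have "shift (shift z (p,q) (-1)) (p,q) 1 = z" by (simp add: shift_def fun_eq_iff)
    ultimately show "P q q = Poly_Mapping.single z (g (W z p q - 1) * ?d q z * ?u q (shift z (p,q) (- 1)) -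
      g (W z p q) * ?u q z * ?d q (shift z (p,q) 1))"
      using assms by (simp add: P_def mult.commute mult.left_commute)
  qed
  finally show "app (lie A (fop n e p)) (T z) = app (diag_op (\<lambda>z. \<Sum>q=1..p. g (W z p q - 1) * ?d q z * ?u q (shift z (p,q) (- 1)) -
    g (W z p q) * ?u q z * ?d q (shift z (p,q) 1))) (T z)"
    by (simp add: single_sum)
qed

text \<open>
  The summands are the residues of a rational function with simple poles at the entries of row p
  (left summands) and at the entries minus one (right summands).
\<close>

lemma weighted_ef_residues:
  fixes z :: zvec and p :: nat and X :: "'x set" and \<nu> :: "'x \<Rightarrow> 'k"
  assumes "1 \<le> p" "p < n" "finite X"
  defines "d \<equiv> case_sum (W z p) (\<lambda>q. W z p q - 1)"
    and "m \<equiv> case_sum (W z (p + 1)) (case_sum (\<lambda>u. W z (p - 1) u - 1) \<nu>)"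
    and "g \<equiv> \<lambda>t. \<Prod>x\<in>X. t - \<nu> x"
    and "I \<equiv> {1..p} <+> {1..p}" and "J \<equiv> {1..p+1} <+> ({1..p-1} <+> X)"
  shows "(\<Sum>q=1..p. g (W z p q - 1) * cdn n e p q z * cup n e p q (shift z (p,q) (- 1)) -
      g (W z p q) * cup n e p q z * cdn n e p q (shift z (p,q) 1)) =
      (\<Sum>i\<in>I. (\<Prod>j\<in>J. d i - m j) / (\<Prod>j\<in>I - {i}. d i - d j))"
    and "inj_on d I" "finite I" "I \<noteq> {}" "finite J" "card I = 2 * p" "card J = 2 * p + card X"
proof -
  have p1: "p - Suc 0 \<noteq> p" using assms(1) by simp
  have I: "I - {Inl q} = ({1..p} - {q}) <+> {1..p}" "I - {Inr q} = {1..p} <+> ({1..p} - {q})" for q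
    by (auto simp: I_def)
  have PJ: "(\<Prod>j\<in>J. t - m j) = (\<Prod>u=1..p+1. t - W z (p + 1) u) * ((\<Prod>u=1..p-1. t + 1 - W z (p - 1) u) * g t)" for t
    using assms(3) by (simp add: J_def prod.Plus m_def g_def algebra_simps)
  \<comment> \<open>The poles at the entries and at the entries minus one differ by one in the same
    column, so the factor u = q is 1 or -1.\<close>
  have own: "(\<Prod>u=1..p. W z p q - (W z p u - 1)) = (\<Prod>u\<in>{1..p} - {q}. W z p q + 1 - W z p u)"
    "(\<Prod>u=1..p. W z p q - 1 - W z p u) = - (\<Prod>u\<in>{1..p} - {q}. W z p q - 1 - W z p u)" if "q \<in> {1..p}" for q
    unfolding prod_remove1[OF that] by (simp_all add: algebra_simps)
  have "(\<Sum>i\<in>I. (\<Prod>j\<in>J. d i - m j) / (\<Prod>j\<in>I - {i}. d i - d j)) =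
    (\<Sum>q=1..p. - (g (W z p q) * cup n e p q z * cdn n e p q (shift z (p,q) 1))) +
    (\<Sum>q=1..p. g (W z p q - 1) * cdn n e p q z * cup n e p q (shift z (p,q) (- 1)))"
    (is "?l = ?r1 + ?r2")
  proof -
    have "(\<Prod>j\<in>J. d (Inl q) - m j) / (\<Prod>j\<in>I - {Inl q}. d (Inl q) - d j) =
        - (g (W z p q) * cup n e p q z * cdn n e p q (shift z (p,q) 1))"
      "(\<Prod>j\<in>J. d (Inr q) - m j) / (\<Prod>j\<in>I - {Inr q}. d (Inr q) - d j) =
        g (W z p q - 1) * cdn n e p q z * cup n e p q (shift z (p,q) (- 1))" if q: "q \<in> {1..p}" for q
    proof -
      have D: "(\<Prod>j\<in>I - {Inl q}. d (Inl q) - d j) = (\<Prod>u\<in>{1..p} - {q}. W z p q - W z p u) * (\<Prod>u\<in>{1..p} - {q}. W z p q + 1 - W z p u)"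
        "(\<Prod>j\<in>I - {Inr q}. d (Inr q) - d j) = - (\<Prod>u\<in>{1..p} - {q}. W z p q - 1 - W z p u) * (\<Prod>u\<in>{1..p} - {q}. W z p q - W z p u)"
        unfolding I using own[OF q] by (simp_all add: prod.Plus d_def)
      have c: "cup n e p q z = - (\<Prod>u=1..p+1. W z p q - W z (p+1) u) / (\<Prod>u\<in>{1..p} - {q}. W z p q - W z p u)"
        "cdn n e p q z = (\<Prod>u=1..p-1. W z p q - W z (p-1) u) / (\<Prod>u\<in>{1..p} - {q}. W z p q - W z p u)"
        "cdn n e p q (shift z (p,q) 1) = (\<Prod>u=1..p-1. W z p q + 1 - W z (p-1) u) / (\<Prod>u\<in>{1..p} - {q}. W z p q + 1 - W z p u)"
        "cup n e p q (shift z (p,q) (-1)) = - (\<Prod>u=1..p+1. W z p q - 1 - W z (p+1) u) / (\<Prod>u\<in>{1..p} - {q}. W z p q - 1 - W z p u)"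
        using assms(1,2) p1 by (simp_all add: cf_def)
      show "(\<Prod>j\<in>J. d (Inl q) - m j) / (\<Prod>j\<in>I - {Inl q}. d (Inl q) - d j) =
        - (g (W z p q) * cup n e p q z * cdn n e p q (shift z (p,q) 1))"
        unfolding D PJ c by (simp add: d_def)
      show "(\<Prod>j\<in>J. d (Inr q) - m j) / (\<Prod>j\<in>I - {Inr q}. d (Inr q) - d j) =
        g (W z p q - 1) * cdn n e p q z * cup n e p q (shift z (p,q) (- 1))"
        unfolding D PJ c by (simp add: d_def mult_ac)
    qed
    then show ?thesis
      by (subst I_def, subst sum.Plus) (auto intro!: arg_cong2[where f = "(+)"] sum.cong)
  qed
  then show "(\<Sum>q=1..p. g (W z p q - 1) * cdn n e p q z * cup n e p q (shift z (p,q) (- 1)) -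
      g (W z p q) * cup n e p q z * cdn n e p q (shift z (p,q) 1)) = ?l"
    by (simp add: sum_subtractf sum_negf)
  have eq: "q = u" if "W z p q - W z p u = of_int m" "q \<in> {1..p}" "u \<in> {1..p}" for q u m
    using ent_generic[of q p u z m] that assms(2) by blast
  show "inj_on d I"
  proof (rule inj_onI)
    fix x y assume xy: "x \<in> I" "y \<in> I" "d x = d y"
    show "x = y"
    proof (cases x; cases y)
      fix q u assume "x = Inl q" "y = Inr u"
      moreover from this have "W z p q - W z p u = of_int (-1)" using xy by (auto simp: d_def algebra_simps)
      ultimately show ?thesis using eq[of q u "-1"] xy by (auto simp: I_def)
    next
      fix q u assume "x = Inr q" "y = Inl u"
      moreover from this have "W z p u - W z p q = of_int (-1)" using xy by (auto simp: d_def algebra_simps)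
      ultimately show ?thesis using eq[of u q "-1"] xy by (auto simp: I_def)
    qed (use xy eq[of _ _ 0] in \<open>auto simp: d_def I_def\<close>)
  qed
  show "finite I" "I \<noteq> {}" "finite J" "card I = 2 * p" "card J = 2 * p + card X"
    using assms(1,3) by (auto simp: I_def J_def card_Plus)
qed

abbreviation psum where "psum k z r \<equiv> \<Sum>q=1..r. W z r q ^ k"

lemma lie_ef_same:
  assumes "1 \<le> p" "p < n"
  shows "lie (eop n e p) (fop n e p) = hop n e p - hop n e (p + 1)"
proof -
  note R = weighted_ef_residues[OF assms, where X = "{} :: unit set"]
  \<comment> \<open>The weight 1 is written as an empty product in order to match the residue lemma.
    Numerator and node set then both have 2 p elements.\<close>
  have A: "eop n e p = shop p 1 (\<lambda>q z. (\<Prod>x\<in>({} :: unit set). W z p q - 0) * cup n e p q z)"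
    by (simp add: eop_def)
  have "lie (eop n e p) (fop n e p) = diag_op (\<lambda>z. 2 * psum 1 z p - psum 1 z (p + 1) - psum 1 z (p - 1) - 1)"
    unfolding A weighted_ef[OF assms, of "\<lambda>t. \<Prod>x\<in>({} :: unit set). t - 0"] R(1)[OF finite.emptyI, where \<nu> = "\<lambda>_. 0"]
  proof (intro arg_cong[where f = diag_op] ext)
    fix z
    note R' = R(2-7)[OF finite.emptyI]
    show "(\<Sum>i\<in>{1..p} <+> {1..p}. (\<Prod>j\<in>{1..p+1} <+> ({1..p-1} <+> {}). case_sum (W z p) (\<lambda>q. W z p q - 1) i -
        case_sum (W z (p + 1)) (case_sum (\<lambda>u. W z (p - 1) u - 1) (\<lambda>_::unit. 0)) j) /
        (\<Prod>j\<in>({1..p} <+> {1..p}) - {i}. case_sum (W z p) (\<lambda>q. W z p q - 1) i - case_sum (W z p) (\<lambda>q. W z p q - 1) j)) =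
      2 * psum 1 z p - psum 1 z (p + 1) - psum 1 z (p - 1) - 1"
      using R'(5,6) assms by (subst residue_sum1[OF R'(2,1,4)]) (simp_all add: sum.Plus sum_subtractf of_nat_diff)
  qed
  moreover have "wt n e p z - wt n e (p + 1) z = 2 * psum 1 z p - psum 1 z (p + 1) - psum 1 z (p - 1) - 1" for z
  proof -
    have "(\<Sum>q=1..p. of_nat q :: 'k) = of_nat p + (\<Sum>q=1..p-1. of_nat q)"
      using assms(1) by (cases p) simp_all
    then show ?thesis using assms
      by (simp add: wt_def sum.distrib sum_subtractf of_nat_diff field_simps)
  qed
  ultimately show ?thesis by (simp add: hop_def diag_op_simps)
qed

lemma lie_hop_shop:
  assumes "p \<in> {1..n}" "1 \<le> q" "q < n"
  shows "lie (hop n e p) (shop q d c) = (if p = q then shop q d (\<lambda>s z. of_int d * c s z) else 0) -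
    (if p = q + 1 then shop q d (\<lambda>s z. of_int d * c s z) else 0)"
proof -
  have "lie (hop n e p) (shop q d c) = shop q d (\<lambda>s z. ((if p = q then of_int d else 0) - (if p = q + 1 then of_int d else 0)) * c s z)"
    unfolding hop_def lie_diag_shop using assms by (intro shop_cong) (simp add: wt_shift)
  then show ?thesis by (auto simp: shop_linear)
qed

lemma lie_ef_different:
  assumes "1 \<le> p" "p < n" "1 \<le> q" "q < n" "p \<noteq> q"
  shows "lie (eop n e p) (fop n e q) = 0"
  unfolding eop_def fop_def
proof (rule lie_shop_zero)
  fix z i j assume ij: "i \<in> {1..p}" "j \<in> {1..q}"
  show "cdn n e q j z * cup n e p i (shift z (q,j) (- 1)) = cup n e p i z * cdn n e q j (shift z (p,i) 1)"
  \<comment> \<open>Only in this case does either coefficient see the row moved by the other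
    operator: both contain the difference of the two moved entries, with opposite signs.\<close>
  proof (cases "q = p + 1")
    case True
    have m: "j \<in> {1..p+1}" "i \<in> {1..p}" "p \<noteq> p + 1" "p + 1 \<noteq> n" "p + 1 \<noteq> p" "p \<noteq> n" using ij True assms by auto
    have "cdn n e (p + 1) j z = (W z (p + 1) j - W z p i) * cg n e 1 (p + 1) p p i j z"
      "cdn n e (p + 1) j (shift z (p,i) 1) = (W z (p + 1) j - W z p i - 1) * cg n e 1 (p + 1) p p i j z"
      "cup n e p i z = (W z p i - W z (p + 1) j) * cg n e (-1) p (p + 1) (p + 1) j i z"
      "cup n e p i (shift z (p + 1,j) (- 1)) = (W z p i - W z (p + 1) j + 1) * cg n e (-1) p (p + 1) (p + 1) j i z"
      using cf_shift_target(1)[OF m(3,4,1), of e "-1" i z] cf_shift_target(2)[OF m(3,4,1), of e "-1" i z "-1"]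
        cf_shift_target(1)[OF m(5,6,2), of e 1 j z] cf_shift_target(2)[OF m(5,6,2), of e 1 j z 1] by simp_all
    note E = this
    show ?thesis unfolding True E by (simp add: algebra_simps)
  next
    case False
    then show ?thesis using assms by simp
  qed
qed

lemma chevalley_generic: "chevalley lie n (eop n e) (fop n e) (hop n e)"
proof (unfold_locales, goal_cases)
  case (4 x)
  then show ?case by (rule lop_double_zero)
next
  case (5 p q)
  then show ?case by (simp add: lie_def hop_def diag_op_simps mult.commute)
next
  case (6 p q)
  then show ?case by (simp add: eop_def lie_hop_shop)
next
  case (7 p q)
  then show ?case by (simp add: fop_def lie_hop_shop shop_linear(3)[symmetric])
next
  case (8 p q)
  then show ?case using lie_ef_same[of p] lie_ef_different[of p q] by auto
next
  case (9 p q)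
  then show ?case unfolding eop_def by (intro lie_shop_zero) simp
next
  case (10 p q)
  then show ?case unfolding fop_def by (intro lie_shop_zero) simp
next
  case (11 p)
  then show ?case unfolding eop_def by (intro serre_A) simp_all
next
  case (12 p)
  then show ?case using serre_B[of "p + 1" p "p + 2" "cup n e p" "-1" 1 "-1" "p + 2"] unfolding eop_def by simp
next
  case (13 p)
  then show ?case using serre_B[of p "p + 1" "p - 1" "cdn n e (p + 1)" 1 "-1" 1 "p - 1"] unfolding fop_def by simp
next
  case (14 p)
  then show ?case using serre_A[of "p + 1" p "cdn n e p" "-1" 1] unfolding fop_def by simp
qed (simp_all add: lie_def algebra_simps)

sublocale chevalley lie n "eop n e" "fop n e" "hop n e"
  by (rule chevalley_generic)

end

section \<open>Gelfand invariants and Casimir elements\<close>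

primrec mpow :: "(nat \<Rightarrow> nat \<Rightarrow> 'a::ring_1) \<Rightarrow> nat \<Rightarrow> nat \<Rightarrow> nat \<Rightarrow> nat \<Rightarrow> 'a" where
  "mpow E r 0 i j = (if i = j then 1 else 0)"
| "mpow E r (Suc s) i j = (\<Sum>l=1..r. mpow E r s i l * E l j)"

text \<open>The trace of a matrix power with non-commuting entries. For s at least 1 it is the image
  of \<open>c_free r s\<close>, see \<open>rep_c_free\<close>.\<close>

definition gelfand :: "(nat \<Rightarrow> nat \<Rightarrow> 'a::ring_1) \<Rightarrow> nat \<Rightarrow> nat \<Rightarrow> 'a" where
  "gelfand E r s = (\<Sum>i=1..r. mpow E r s i i)"

lemma lie_simps:
  "lie (x + y) z = lie x z + lie y z" "lie z (x + y) = lie z x + lie z y"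
  "lie (x - y) z = lie x z - lie y z" "lie z (x - y) = lie z x - lie z y"
  "lie (x * y) z = lie x z * y + x * lie y z" "lie z (x * y) = lie z x * y + x * lie z y"
  "lie 0 z = 0" "lie z 0 = 0"
  by (simp_all add: lie_def algebra_simps)

lemma lie_sum: "lie (sum f A) z = (\<Sum>x\<in>A. lie (f x) z)" "lie z (sum f A) = (\<Sum>x\<in>A. lie z (f x))"
  by (induction A rule: infinite_finite_induct) (simp_all add: lie_simps)

locale gl_rep =
  fixes n :: nat and E :: "nat \<Rightarrow> nat \<Rightarrow> 'a::ring_1"
  assumes gl: "\<lbrakk>a \<in> {1..n}; b \<in> {1..n}; r \<in> {1..n}; s \<in> {1..n}\<rbrakk> \<Longrightarrow>
    lie (E a b) (E r s) = (if b = r then E a s else 0) - (if s = a then E r b else 0)"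
begin

text \<open>The entries of a power of the generator matrix transform like the matrix units
  themselves: the Leibniz rule gives four families of terms, two of which cancel. Taking the trace
  then gives centrality.\<close>

lemma lie_mpow:
  assumes "r \<le> n" "i \<in> {1..r}" "j \<in> {1..r}" "k \<in> {1..r}" "l \<in> {1..r}"
  shows "lie (mpow E r s i j) (E k l) =
    (if j = k then mpow E r s i l else 0) - (if l = i then mpow E r s k j else 0)"
  using assms(3)
proof (induction s arbitrary: j)
  case 0
  then show ?case by (auto simp: lie_def)
next
  case (Suc s)
  have "lie (mpow E r (Suc s) i j) (E k l) =
    (\<Sum>m=1..r. lie (mpow E r s i m) (E k l) * E m j + mpow E r s i m * lie (E m j) (E k l))"
    by (simp add: lie_sum lie_simps)
  also have "\<dots> = (\<Sum>m=1..r. (if m = k then mpow E r s i l * E k j else 0)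
      - (if l = i then mpow E r s k m * E m j else 0)
      + ((if j = k then mpow E r s i m * E m l else 0) - (if m = l then mpow E r s i l * E k j else 0)))"
  proof (intro sum.cong refl)
    fix m assume m: "m \<in> {1..r}"
    have "lie (E m j) (E k l) = (if j = k then E m l else 0) - (if l = m then E k j else 0)"
      by (rule gl) (use m assms Suc in auto)
    note L = this
    show "lie (mpow E r s i m) (E k l) * E m j + mpow E r s i m * lie (E m j) (E k l) =
      (if m = k then mpow E r s i l * E k j else 0)
      - (if l = i then mpow E r s k m * E m j else 0)
      + ((if j = k then mpow E r s i m * E m l else 0) - (if m = l then mpow E r s i l * E k j else 0))"
      unfolding Suc.IH[OF m] L by (auto simp: algebra_simps)
  qed
  also have "\<dots> = mpow E r s i l * E k j - (if l = i then mpow E r (Suc s) k j else 0)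
      + ((if j = k then mpow E r (Suc s) i l else 0) - mpow E r s i l * E k j)"
    using assms(4,5) by (simp add: sum.distrib sum_subtractf if_distrib[where f = "\<lambda>x. sum x _"] if_distribR)
  finally show ?case by simp
qed

lemma gelfand_central:
  assumes "r \<le> n" "k \<in> {1..r}" "l \<in> {1..r}"
  shows "lie (gelfand E r s) (E k l) = 0"
proof -
  have "lie (gelfand E r s) (E k l) = (\<Sum>i=1..r. (if i = k then mpow E r s k l else 0) - (if i = l then mpow E r s k l else 0))"
    unfolding gelfand_def lie_sum using assms by (intro sum.cong) (auto simp: lie_mpow)
  then show ?thesis using assms by (simp add: sum_subtractf)
qed

section \<open>Quadratic Casimir elements: recursion in the rank\<close>

definition cas :: "nat \<Rightarrow> 'a" where
  "cas r = (\<Sum>i=1..r. \<Sum>j=1..r. E i j * E j i)"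

definition casX :: "nat \<Rightarrow> 'a" where
  "casX r = (\<Sum>j=1..r-1. E r j * E j r)"

text \<open>By \<open>lie_cas\<close> this is determined by [\<open>cas r\<close>, E_(r, r+1)]; its
  bracket with E_(r+1, r) gives \<open>casX (Suc r)\<close>, which in turn gives
  \<open>cas (Suc r)\<close>. So it carries the recursion from gl(r) to gl(r+1).\<close>

definition casY :: "nat \<Rightarrow> 'a" where
  "casY r = (\<Sum>j=1..r. E r j * E j (Suc r))"

lemma cas_eq_gelfand: "cas r = gelfand E r 2"
  by (simp add: cas_def gelfand_def numeral_2_eq_2 if_distrib[where f = "\<lambda>x. x * _"] cong: if_cong)

lemma cas_Suc:
  assumes "Suc r \<le> n"
  shows "cas (Suc r) = cas r + E (Suc r) (Suc r) * E (Suc r) (Suc r) + (casX (Suc r) + casX (Suc r))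
    + (\<Sum>i=1..r. E i i) - of_nat r * E (Suc r) (Suc r)"
proof -
  have "(\<Sum>i=1..r. E i (Suc r) * E (Suc r) i) = (\<Sum>i=1..r. E (Suc r) i * E i (Suc r) + (E i i - E (Suc r) (Suc r)))"
  proof (intro sum.cong refl)
    fix i assume "i \<in> {1..r}"
    then have "lie (E i (Suc r)) (E (Suc r) i) = E i i - E (Suc r) (Suc r)"
      using gl[of i "Suc r" "Suc r" i] assms by simp
    then show "E i (Suc r) * E (Suc r) i = E (Suc r) i * E i (Suc r) + (E i i - E (Suc r) (Suc r))"
      by (simp add: lie_def algebra_simps)
  qed
  also have "\<dots> = casX (Suc r) + (\<Sum>i=1..r. E i i) - of_nat r * E (Suc r) (Suc r)"
    by (simp add: casX_def sum.distrib sum_subtractf)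
  finally have *: "(\<Sum>i=1..r. E i (Suc r) * E (Suc r) i) = \<dots>" .
  have "cas (Suc r) = cas r + (\<Sum>i=1..r. E i (Suc r) * E (Suc r) i) + casX (Suc r) + E (Suc r) (Suc r) * E (Suc r) (Suc r)"
    by (simp add: cas_def casX_def sum.distrib)
  then show ?thesis unfolding * by (simp add: algebra_simps)
qed

lemma casX_Suc:
  assumes "1 \<le> r" "Suc r \<le> n"
  shows "casX (Suc r) = casX r + E r r * E r r - E r r * E (Suc r) (Suc r) - lie (casY r) (E (Suc r) r)"
proof -
  have "lie (casY r) (E (Suc r) r) = (\<Sum>j=1..r. E r j * E j r - (if j = r then E r r * E (Suc r) (Suc r) else 0) - E (Suc r) j * E j (Suc r))"
    unfolding casY_def lie_sum
  proof (intro sum.cong refl)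
    fix j assume j: "j \<in> {1..r}"
    then have "lie (E r j) (E (Suc r) r) = - E (Suc r) j"
      "lie (E j (Suc r)) (E (Suc r) r) = E j r - (if j = r then E (Suc r) (Suc r) else 0)"
      using gl[of r j "Suc r" r] gl[of j "Suc r" "Suc r" r] assms by auto
    note L = this
    show "lie (E r j * E j (Suc r)) (E (Suc r) r) =
      E r j * E j r - (if j = r then E r r * E (Suc r) (Suc r) else 0) - E (Suc r) j * E j (Suc r)"
      unfolding lie_simps(5) L by (auto simp: algebra_simps)
  qed
  also have "\<dots> = (\<Sum>j=1..r. E r j * E j r) - E r r * E (Suc r) (Suc r) - casX (Suc r)"
    using assms by (simp add: sum_subtractf casX_def)
  also have "(\<Sum>j=1..r. E r j * E j r) = casX r + E r r * E r r"
    using assms by (cases r) (simp_all add: casX_def)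
  finally show ?thesis by simp
qed

lemma lie_cas:
  assumes "1 \<le> r" "Suc r \<le> n"
  shows "lie (cas r) (E r (Suc r)) = casY r + casY r - of_nat r * E r (Suc r)"
proof -
  have "lie (cas r) (E r (Suc r)) = (\<Sum>i=1..r. \<Sum>j=1..r. (if i = r then E r j * E j (Suc r) else 0) +
      (if j = r then E r i * E i (Suc r) - E r (Suc r) else 0))"
    unfolding cas_def lie_sum
  proof (intro sum.cong refl)
    fix i j assume ij: "i \<in> {1..r}" "j \<in> {1..r}"
    have 1: "lie (E i j) (E r (Suc r)) = (if j = r then E i (Suc r) else 0)" if "i \<in> {1..r}" "j \<in> {1..r}" for i j
      using gl[of i j r "Suc r"] assms that by auto
    have "lie (E i (Suc r)) (E r i) = - E r (Suc r)"
      using gl[of i "Suc r" r i] assms ij by simp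
    then have "E i (Suc r) * E r i = E r i * E i (Suc r) - E r (Suc r)"
      by (simp add: lie_def algebra_simps)
    then show "lie (E i j * E j i) (E r (Suc r)) = (if i = r then E r j * E j (Suc r) else 0) +
      (if j = r then E r i * E i (Suc r) - E r (Suc r) else 0)"
      using ij by (auto simp: lie_simps 1)
  qed
  also have "\<dots> = casY r + (casY r - of_nat r * E r (Suc r))"
  proof -
    have "(\<Sum>i=1..r. \<Sum>j=1..r. (if i = r then E r j * E j (Suc r) else 0)) = casY r"
      using assms by (subst sum.swap) (simp add: casY_def)
    moreover have "(\<Sum>i=1..r. \<Sum>j=1..r. (if j = r then E r i * E i (Suc r) - E r (Suc r) else 0)) = casY r - of_nat r * E r (Suc r)"
      using assms by (simp add: casY_def sum_subtractf)
    ultimately show ?thesis by (simp add: sum.distrib)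
  qed
  finally show ?thesis by simp
qed

end

sublocale generic_tableau \<subseteq> gl_rep n "mat_unit lie (eop n e) (fop n e) (hop n e)"
  by unfold_locales (rule gl_relations)

definition gE :: "nat \<Rightarrow> (idx \<Rightarrow> 'k) \<Rightarrow> nat \<Rightarrow> nat \<Rightarrow> (zvec, 'k::field_char_0) lop" where
  "gE n e = mat_unit lie (eop n e) (fop n e) (hop n e)"

section \<open>Eigenvalues of the quadratic Casimir elements\<close>

context generic_tableau
begin

text \<open>The binomial coefficient r over 3: it vanishes for r = 1, and the step from r to r + 1
  adds r (r - 1) / 2.\<close>

definition casc :: "nat \<Rightarrow> 'k" where
  "casc r = of_nat r * (of_nat r - 1) * (of_nat r - 2) / 6"

definition kap :: "nat \<Rightarrow> zvec \<Rightarrow> 'k" where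
  "kap r z = psum 2 z r + (of_nat r - 1) * psum 1 z r + casc r"

text \<open>The eigenvalue of E_11 + ... + E_rr, see \<open>sum_wt\<close>.\<close>

definition tot :: "nat \<Rightarrow> zvec \<Rightarrow> 'k" where
  "tot r z = psum 1 z r + of_nat r * (of_nat r - 1) / 2"

text \<open>The eigenvalue of \<open>casX r\<close>, obtained by solving the identity
  \<open>cas_Suc\<close> for it.\<close>

definition xi :: "nat \<Rightarrow> zvec \<Rightarrow> 'k" where
  "xi r z = (kap r z - kap (r - 1) z - (tot r z - tot (r - 1) z)\<^sup>2 - tot (r - 1) z
     + (of_nat r - 1) * (tot r z - tot (r - 1) z)) / 2"

lemma wt_tot: "1 \<le> r \<Longrightarrow> wt n e r z = tot r z - tot (r - 1) z"
proof -
  have "(\<Sum>q=1..r. of_nat q :: 'k) = of_nat r * (of_nat r + 1) / 2" for r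
    by (induction r) (auto simp: field_simps)
  then show "1 \<le> r \<Longrightarrow> ?thesis"
    by (cases r) (simp_all add: wt_def tot_def sum.distrib sum_subtractf of_nat_diff field_simps)
qed

lemma sum_wt: "(\<Sum>i=1..r. wt n e i z) = tot r z"
proof (induction r)
  case (Suc r)
  then show ?case using wt_tot[of "Suc r" z] by simp
qed (simp add: tot_def)

lemma psum_shift:
  assumes "q \<in> {1..r}" "r < n"
  shows "psum k (shift z (r,q) d) r = psum k z r - W z r q ^ k + (W z r q + of_int d) ^ k"
proof -
  have "psum k (shift z (r,q) d) r = (W z r q + of_int d) ^ k + (\<Sum>u\<in>{1..r} - {q}. W z r u ^ k)"
    using assms by (subst sum.remove[of "{1..r}" q]) (auto intro!: sum.cong)
  moreover have "psum k z r = W z r q ^ k + (\<Sum>u\<in>{1..r} - {q}. W z r u ^ k)"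
    using assms by (subst sum.remove[of "{1..r}" q]) auto
  ultimately show ?thesis by simp
qed

lemma kap_shift:
  assumes "q \<in> {1..r}" "r < n"
  shows "kap r (shift z (r,q) d) = kap r z + of_int d * (2 * W z r q + of_int d + of_nat r - 1)"
  using assms unfolding kap_def psum_shift[OF assms] by (simp add: power2_eq_square algebra_simps)

text \<open>The weight t + p adds one zero, at -p, to the numerator of the residue sum. So there are
  2 p + 1 factors against 2 p nodes, and the second residue formula, with its quadratic power sums,
  applies.\<close>

lemma lie_weighted_same:
  assumes "1 \<le> p" "p < n"
  shows "lie (shop p 1 (\<lambda>q z. (W z p q + of_nat p) * cup n e p q z)) (fop n e p) =
    diag_op (\<lambda>z. xi p z + wt n e p z * wt n e p z - wt n e p z * wt n e (p + 1) z - xi (p + 1) z)"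
proof -
  note R = weighted_ef_residues[OF assms, where X = "{()}"]
  have A: "(\<lambda>q z. (W z p q + of_nat p) * cup n e p q z) = (\<lambda>q z. (\<Prod>x\<in>{()}. W z p q - (- of_nat p)) * cup n e p q z)"
    by simp
  show ?thesis
    unfolding A weighted_ef[OF assms, of "\<lambda>t. \<Prod>x\<in>{()}. t - (- of_nat p)"] R(1)[OF finite.insertI[OF finite.emptyI], where \<nu> = "\<lambda>_. - of_nat p"]
  proof (intro arg_cong[where f = diag_op] ext)
    fix z
    note R' = R(2-7)[OF finite.insertI[OF finite.emptyI]]
    have c: "casc (Suc p) = casc p + of_nat p * (of_nat p - 1) / 2"
      "casc p = casc (p - 1) + (of_nat p - 1) * (of_nat p - 2) / 2"
      using assms by (simp_all add: casc_def of_nat_diff field_simps)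
    show "(\<Sum>i\<in>{1..p} <+> {1..p}. (\<Prod>j\<in>{1..p+1} <+> ({1..p-1} <+> {()}). case_sum (W z p) (\<lambda>q. W z p q - 1) i -
        case_sum (W z (p + 1)) (case_sum (\<lambda>u. W z (p - 1) u - 1) (\<lambda>_. - of_nat p)) j) /
        (\<Prod>j\<in>({1..p} <+> {1..p}) - {i}. case_sum (W z p) (\<lambda>q. W z p q - 1) i - case_sum (W z p) (\<lambda>q. W z p q - 1) j)) =
      xi p z + wt n e p z * wt n e p z - wt n e p z * wt n e (p + 1) z - xi (p + 1) z"
    proof (subst residue_sum2[OF R'(2,1,3,4)])
      have S: "(\<Sum>j\<in>{1..p+1} <+> ({1..p-1} <+> {()}). (case_sum (W z (p + 1)) (case_sum (\<lambda>u. W z (p - 1) u - 1) (\<lambda>_. - of_nat p)) j) ^ k) =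
          psum k z (p + 1) + (\<Sum>u=1..p-1. (W z (p - 1) u - 1) ^ k) + (- of_nat p) ^ k" for k
        by (simp add: sum.Plus)
      have S': "(\<Sum>i\<in>{1..p} <+> {1..p}. (case_sum (W z p) (\<lambda>q. W z p q - 1) i) ^ k) = psum k z p + (\<Sum>q=1..p. (W z p q - 1) ^ k)" for k
        by (simp add: sum.Plus)
      have 1: "(\<Sum>u=1..r. (W z r u - 1) ^ 1) = psum 1 z r - of_nat r"
        "(\<Sum>u=1..r. (W z r u - 1) ^ 2) = psum 2 z r - 2 * psum 1 z r + of_nat r" for r
        by (simp_all add: sum_subtractf sum.distrib power2_diff sum_distrib_left algebra_simps)
      show "(((\<Sum>j\<in>{1..p+1} <+> ({1..p-1} <+> {()}). case_sum (W z (p + 1)) (case_sum (\<lambda>u. W z (p - 1) u - 1) (\<lambda>_. - of_nat p)) j)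
          - (\<Sum>i\<in>{1..p} <+> {1..p}. case_sum (W z p) (\<lambda>q. W z p q - 1) i))\<^sup>2
          + (\<Sum>i\<in>{1..p} <+> {1..p}. (case_sum (W z p) (\<lambda>q. W z p q - 1) i)\<^sup>2)
          - (\<Sum>j\<in>{1..p+1} <+> ({1..p-1} <+> {()}). (case_sum (W z (p + 1)) (case_sum (\<lambda>u. W z (p - 1) u - 1) (\<lambda>_. - of_nat p)) j)\<^sup>2)) / 2 =
        xi p z + wt n e p z * wt n e p z - wt n e p z * wt n e (p + 1) z - xi (p + 1) z"
      proof -
        define a1 a2 b1 b2 c1 c2 where "a1 = (\<Sum>q=1..p. W z p q)" "a2 = psum 2 z p"
          "b1 = (\<Sum>q=1..p+1. W z (p + 1) q)" "b2 = psum 2 z (p + 1)" "c1 = (\<Sum>q=1..p-1. W z (p - 1) q)" "c2 = psum 2 z (p - 1)"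
        note d = this
        have cc: "casc (p + 1) = casc p + of_nat p * (of_nat p - 1) / 2"
           "casc (p - 1) = casc p - (of_nat p - 1) * (of_nat p - 2) / 2" using c by simp_all
        have P: "(of_nat (p - 1) :: 'k) = of_nat p - 1" using assms by (simp add: of_nat_diff)
        have w: "wt n e p z = tot p z - tot (p - 1) z" "wt n e (p + 1) z = tot (p + 1) z - tot p z"
          using wt_tot[of p z] wt_tot[of "p + 1" z] assms by simp_all
        show ?thesis
          unfolding S[of 1, unfolded power_one_right] S'[of 1, unfolded power_one_right] S S' 1[unfolded power_one_right] w xi_def kap_def tot_def cc P add_diff_cancel_right'
            power_one_right d[symmetric] of_nat_add of_nat_1
          by (simp add: field_simps power2_eq_square)
      qed
    qed (use R'(5,6) in simp_all)
  qed
qed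

lemma E_eops: "E p (Suc p) = eop n e p" "E (Suc p) p = fop n e p" "E p p = hop n e p"
  by (simp_all add: E_simps)

lemma diag_op_sum: "(\<Sum>i\<in>A. diag_op (\<mu> i)) = diag_op (\<lambda>z. \<Sum>i\<in>A. \<mu> i z)"
  by (rule lop_eqI) (simp add: app_sum_left single_sum)

lemma diag_op_of_nat: "of_nat m * diag_op \<mu> = diag_op (\<lambda>z. of_nat m * \<mu> z :: 'k)"
  by (induction m) (auto intro!: lop_eqI simp: algebra_simps single_add)

lemma of_nat_shop: "of_nat m * shop p d c = shop p d (\<lambda>q z. of_nat m * c q z)"
  by (induction m) (auto intro!: lop_eqI simp: algebra_simps single_add sum.distrib)

text \<open>Both claims are carried through one induction: a diagonal \<open>cas r\<close> makes
  \<open>casY r\<close> a weighted shift operator, whose bracket with f_r is the diagonal operator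
  that \<open>casX (Suc r)\<close> and then \<open>cas (Suc r)\<close> require.\<close>

lemma casimir_diag:
  assumes "1 \<le> r" "r \<le> n"
  shows "casX r = diag_op (xi r) \<and> cas r = diag_op (kap r)"
  using assms
proof (induction r rule: dec_induct)
  case base
  have "xi 1 = (\<lambda>z. 0)" by (auto simp: xi_def kap_def tot_def casc_def)
  moreover have "wt n e 1 z * wt n e 1 z = kap 1 z" for z
    by (simp add: wt_def kap_def casc_def power2_eq_square)
  moreover have "diag_op (\<lambda>_. 0) = (0 :: (zvec, 'k) lop)" by (auto intro!: lop_eqI)
  moreover have "cas 1 = hop n e 1 * hop n e 1" "casX 1 = 0" by (simp_all add: casX_def cas_def E_simps)
  moreover have "hop n e 1 * hop n e 1 = diag_op (\<lambda>z. wt n e 1 z * wt n e 1 z)" by (simp add: hop_def diag_op_simps)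
  ultimately show ?case by simp
next
  case (step r)
  have X: "casX r = diag_op (xi r)" and K: "cas r = diag_op (kap r)" using step by auto
  have "casY r + casY r = lie (cas r) (eop n e r) + of_nat r * eop n e r"
    using lie_cas[of r] step by (simp add: E_eops)
  \<comment> \<open>A unit shift changes \<open>kap r\<close> by 2 W + r; the additional r makes
    this twice the weight W + r.\<close>
  also have "\<dots> = shop r 1 (\<lambda>q z. (W z r q + of_nat r) * cup n e r q z) + shop r 1 (\<lambda>q z. (W z r q + of_nat r) * cup n e r q z)"
    unfolding K eop_def lie_diag_shop of_nat_shop shop_linear
    using step by (intro shop_cong) (auto simp: kap_shift algebra_simps)
  finally have "(casY r - shop r 1 (\<lambda>q z. (W z r q + of_nat r) * cup n e r q z)) +
      (casY r - shop r 1 (\<lambda>q z. (W z r q + of_nat r) * cup n e r q z)) = 0"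
    by (simp add: algebra_simps)
  then have Y: "casY r = shop r 1 (\<lambda>q z. (W z r q + of_nat r) * cup n e r q z)"
    using lop_double_zero by fastforce
  have X': "casX (Suc r) = diag_op (xi (Suc r))"
    using casX_Suc[of r] step lie_weighted_same[of r]
    by (simp add: X Y E_eops hop_def diag_op_simps)
  have "cas (Suc r) = diag_op (kap (Suc r))"
    using cas_Suc[of r] step
    by (simp add: X' K E_eops hop_def diag_op_simps diag_op_sum sum_wt[simplified] diag_op_of_nat)
      (auto intro!: arg_cong[where f = diag_op] simp: xi_def wt_tot power2_eq_square field_simps)
  then show ?case using X' by simp
qed

end

section \<open>Homomorphisms out of monoid algebras and fraction fields\<close>

text \<open>The same formula yields substitution into polynomials, when the words are monomials, and
  representations of the free algebra, so the homomorphism laws are proved once for both.\<close>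

definition alg_ext :: "('c \<Rightarrow> 'a) \<Rightarrow> ('w \<Rightarrow> 'a) \<Rightarrow> ('w \<Rightarrow>\<^sub>0 'c::zero) \<Rightarrow> 'a::ring_1" where
  "alg_ext \<iota> \<psi> f = (\<Sum>w\<in>Poly_Mapping.keys f. \<iota> (Poly_Mapping.lookup f w) * \<psi> w)"

locale alg_hom =
  fixes \<iota> :: "'c::comm_ring_1 \<Rightarrow> 'a::ring_1" and \<psi> :: "'w::monoid_add \<Rightarrow> 'a"
  assumes iota_add: "\<iota> (c + d) = \<iota> c + \<iota> d" and iota_mult: "\<iota> (c * d) = \<iota> c * \<iota> d" and iota_1: "\<iota> 1 = 1"
    and central: "\<iota> c * \<psi> w = \<psi> w * \<iota> c" and psi_0: "\<psi> 0 = 1" and psi_add: "\<psi> (u + w) = \<psi> u * \<psi> w"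
begin

abbreviation "\<Phi> \<equiv> alg_ext \<iota> \<psi>"

lemma iota_0: "\<iota> 0 = 0"
  using iota_add[of 0 0] by simp

lemma superset:
  assumes "finite A" "Poly_Mapping.keys f \<subseteq> A"
  shows "\<Phi> f = (\<Sum>w\<in>A. \<iota> (Poly_Mapping.lookup f w) * \<psi> w)"
  unfolding alg_ext_def using assms
  by (intro sum.mono_neutral_left) (auto simp: in_keys_iff iota_0)

lemma ext_single: "\<Phi> (Poly_Mapping.single w c) = \<iota> c * \<psi> w"
  by (subst superset[of "{w}"]) auto

lemma ext_add: "\<Phi> (f + g) = \<Phi> f + \<Phi> g"
proof -
  let ?A = "Poly_Mapping.keys f \<union> Poly_Mapping.keys g"
  have "finite ?A" "Poly_Mapping.keys (f + g) \<subseteq> ?A" using keys_add[of f g] by auto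
  then show ?thesis by (simp add: superset[of ?A] lookup_add iota_add algebra_simps sum.distrib)
qed

lemma ext_0: "\<Phi> 0 = 0"
  by (simp add: alg_ext_def)

lemma ext_sum: "\<Phi> (sum f A) = (\<Sum>x\<in>A. \<Phi> (f x))"
  by (induction A rule: infinite_finite_induct) (simp_all add: ext_0 ext_add)

lemma ext_uminus: "\<Phi> (- f) = - \<Phi> f"
  using ext_add[of f "- f"] by (simp add: ext_0 eq_neg_iff_add_eq_0 add.commute)

lemma ext_diff: "\<Phi> (f - g) = \<Phi> f - \<Phi> g"
  using ext_add[of f "- g"] by (simp add: ext_uminus)

lemma ext_mult: "\<Phi> (f * g) = \<Phi> f * \<Phi> g"
proof -
  let ?l = Poly_Mapping.lookup
  have "f * g = (\<Sum>w\<in>Poly_Mapping.keys f. Poly_Mapping.single w (?l f w)) * (\<Sum>u\<in>Poly_Mapping.keys g. Poly_Mapping.single u (?l g u))"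
    by (simp flip: poly_mapping_sum_singles)
  also have "\<dots> = (\<Sum>w\<in>Poly_Mapping.keys f. \<Sum>u\<in>Poly_Mapping.keys g. Poly_Mapping.single (w + u) (?l f w * ?l g u))"
    by (simp add: sum_product mult_single)
  finally have "\<Phi> (f * g) = (\<Sum>w\<in>Poly_Mapping.keys f. \<Sum>u\<in>Poly_Mapping.keys g. \<iota> (?l f w) * (\<iota> (?l g u) * \<psi> w) * \<psi> u)"
    by (simp add: ext_sum ext_single iota_mult psi_add mult.assoc)
  also have "\<dots> = \<Phi> f * \<Phi> g"
    unfolding central by (simp add: alg_ext_def sum_product mult.assoc)
  finally show ?thesis .
qed

lemma ext_1: "\<Phi> 1 = 1"
  using ext_single[of 0 1] by (simp add: iota_1 psi_0)

end

section \<open>Specialization of fractions as a partial homomorphism of fields\<close>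

definition frac_rel :: "('a::idom \<Rightarrow> 'l::field) \<Rightarrow> 'a fract \<Rightarrow> 'l \<Rightarrow> bool" where
  "frac_rel \<phi> f b \<longleftrightarrow> (\<exists>p q. f = Fract p q \<and> \<phi> q \<noteq> 0 \<and> b = \<phi> p / \<phi> q)"

text \<open>A specialization is a relation because it is undefined at elements with poles. The
  axioms cover substitution into fractions, the constant term of a power series and the automorphism
  t to -t alike. The last axiom makes 0 related to nothing but 0.\<close>

locale specialization =
  fixes R :: "'k::field_char_0 \<Rightarrow> 'l::field_char_0 \<Rightarrow> bool"
  assumes R_0: "R 0 0" and R_1: "R 1 1"
    and R_add: "R a b \<Longrightarrow> R c d \<Longrightarrow> R (a + c) (b + d)"
    and R_mult: "R a b \<Longrightarrow> R c d \<Longrightarrow> R (a * c) (b * d)"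
    and R_uminus: "R a b \<Longrightarrow> R (- a) (- b)"
    and R_inverse: "R a b \<Longrightarrow> b \<noteq> 0 \<Longrightarrow> a \<noteq> 0 \<and> R (inverse a) (inverse b)"
begin

lemma R_diff: "R a b \<Longrightarrow> R c d \<Longrightarrow> R (a - c) (b - d)"
  using R_add[of a b "- c" "- d"] R_uminus by simp

lemma R_divide: "R a b \<Longrightarrow> R c d \<Longrightarrow> d \<noteq> 0 \<Longrightarrow> R (a / c) (b / d)"
  unfolding divide_inverse using R_inverse R_mult by blast

lemma R_0_left: "R 0 b \<Longrightarrow> b = 0"
  using R_inverse by blast

lemma R_of_nat: "R (of_nat m) (of_nat m)"
  by (induction m) (auto intro: R_0 R_1 R_add)

lemma R_of_int: "R (of_int m) (of_int m)"
  by (cases m rule: int_cases2) (auto intro: R_of_nat R_uminus)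

lemma R_sum: "(\<And>x. x \<in> A \<Longrightarrow> R (f x) (g x)) \<Longrightarrow> R (sum f A) (sum g A)"
  by (induction A rule: infinite_finite_induct) (auto intro: R_0 R_add)

lemma R_prod: "(\<And>x. x \<in> A \<Longrightarrow> R (f x) (g x)) \<Longrightarrow> R (prod f A) (prod g A)"
  by (induction A rule: infinite_finite_induct) (auto intro: R_1 R_mult)

end

instance fract :: ("{idom, ring_char_0}") field_char_0
proof
  have "(of_nat n :: 'a fract) = Fract (of_nat n) 1" for n
    by (induction n) (simp_all add: Zero_fract_def One_fract_def)
  then show "inj (of_nat :: nat \<Rightarrow> 'a fract)"
    by (auto simp: inj_def eq_fract)
qed

locale idom_hom =
  fixes \<phi> :: "'a::{idom,ring_char_0} \<Rightarrow> 'l::field_char_0"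
  assumes hom_add: "\<phi> (x + y) = \<phi> x + \<phi> y" and hom_mult: "\<phi> (x * y) = \<phi> x * \<phi> y" and hom_1: "\<phi> 1 = 1"
begin

lemma hom_0: "\<phi> 0 = 0"
  using hom_add[of 0 0] by simp

lemma hom_uminus: "\<phi> (- x) = - \<phi> x"
  using hom_add[of x "- x"] by (simp add: hom_0 eq_neg_iff_add_eq_0 add.commute)

lemma frac_rel_unique:
  assumes "frac_rel \<phi> f b" "frac_rel \<phi> f c" shows "b = c"
proof -
  obtain p q p' q' where *: "f = Fract p q" "\<phi> q \<noteq> 0" "b = \<phi> p / \<phi> q" "f = Fract p' q'" "\<phi> q' \<noteq> 0" "c = \<phi> p' / \<phi> q'"
    using assms unfolding frac_rel_def by blast
  then have "q \<noteq> 0" "q' \<noteq> 0" using hom_0 by auto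
  with * have "p * q' = p' * q" by (simp add: eq_fract)
  then have "\<phi> p * \<phi> q' = \<phi> p' * \<phi> q" by (simp flip: hom_mult)
  with * show ?thesis by (simp add: frac_eq_eq)
qed

lemma frac_rel_Fract: "\<phi> q \<noteq> 0 \<Longrightarrow> frac_rel \<phi> (Fract p q) (\<phi> p / \<phi> q)"
  unfolding frac_rel_def by blast

lemma frac_rel_Fract1: "frac_rel \<phi> (Fract p 1) (\<phi> p)"
  using frac_rel_Fract[of 1 p] by (simp add: hom_1)

lemma specialization: "specialization (frac_rel \<phi>)"
proof
  show "frac_rel \<phi> 0 0" "frac_rel \<phi> 1 1"
    using frac_rel_Fract1[of 0] frac_rel_Fract1[of 1] by (simp_all add: Zero_fract_def One_fract_def hom_0 hom_1)
next
  fix a b c d assume ab: "frac_rel \<phi> a b" and "frac_rel \<phi> c d"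
  then obtain p q p' q' where *: "a = Fract p q" "\<phi> q \<noteq> 0" "b = \<phi> p / \<phi> q" "c = Fract p' q'" "\<phi> q' \<noteq> 0" "d = \<phi> p' / \<phi> q'"
    unfolding frac_rel_def by blast
  then have nz: "q \<noteq> 0" "q' \<noteq> 0" "\<phi> (q * q') \<noteq> 0" using hom_0 by (auto simp: hom_mult)
  show "frac_rel \<phi> (a + c) (b + d)"
    using frac_rel_Fract[OF nz(3), of "p * q' + p' * q"] * nz by (simp add: hom_mult hom_add add_frac_eq)
  show "frac_rel \<phi> (a * c) (b * d)"
    using frac_rel_Fract[OF nz(3), of "p * p'"] * nz by (simp add: hom_mult)
next
  fix a b assume "frac_rel \<phi> a b"
  then obtain p q where *: "a = Fract p q" "\<phi> q \<noteq> 0" "b = \<phi> p / \<phi> q"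
    unfolding frac_rel_def by blast
  then show "frac_rel \<phi> (- a) (- b)"
    using frac_rel_Fract[of q "- p"] by (simp add: hom_uminus)
  assume "b \<noteq> 0"
  then have "\<phi> p \<noteq> 0" "p \<noteq> 0" "q \<noteq> 0" using * hom_0 by auto
  then show "a \<noteq> 0 \<and> frac_rel \<phi> (inverse a) (inverse b)"
    using frac_rel_Fract[of p q] * by (simp add: Zero_fract_def eq_fract)
qed

end

section \<open>Transfer of matrix coefficients\<close>

lemma lookup_app:
  assumes "finite A" "Poly_Mapping.keys f \<subseteq> A"
  shows "Poly_Mapping.lookup (app X f) z = (\<Sum>y\<in>A. Poly_Mapping.lookup f y * Poly_Mapping.lookup (app X (T y)) z)"
  by (subst app_eq_lin_extend) (rule lookup_lin_extend[OF assms])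

text \<open>
  The index map and the column permutations allow a specialization to be combined with a
  translation of the tableaux or with the exchange of two columns.
\<close>

locale tableau_transfer = specialization R + target: generic_tableau n e'
  for R :: "'k::field_char_0 \<Rightarrow> 'l::field_char_0 \<Rightarrow> bool" and n and e :: "idx \<Rightarrow> 'k" and e' :: "idx \<Rightarrow> 'l" +
  fixes \<pi> :: "zvec \<Rightarrow> zvec" and \<sigma> :: "nat \<Rightarrow> nat \<Rightarrow> nat"
  assumes bij: "bij \<pi>" and perm: "bij_betw (\<sigma> r) {1..r} {1..r}"
    and pi_shift: "q \<in> {1..p} \<Longrightarrow> p < n \<Longrightarrow> \<pi> (shift z (p,q) d) = shift (\<pi> z) (p, \<sigma> p q) d"
    and R_ent: "q \<in> {1..p} \<Longrightarrow> p \<le> n \<Longrightarrow> R (ent n e z p q) (ent n e' (\<pi> z) p (\<sigma> p q))"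
begin

definition RO :: "(zvec, 'k) lop \<Rightarrow> (zvec, 'l) lop \<Rightarrow> bool" where
  "RO X Y \<longleftrightarrow> (\<forall>z z'. R (Poly_Mapping.lookup (app X (T z)) z') (Poly_Mapping.lookup (app Y (T (\<pi> z))) (\<pi> z')))"

lemma pi_eq [simp]: "\<pi> x = \<pi> y \<longleftrightarrow> x = y"
  using bij by (simp add: bij_def inj_eq)

lemma sigma_image: "\<sigma> p ` {1..p} = {1..p}" "q \<in> {1..p} \<Longrightarrow> \<sigma> p q \<in> {1..p}"
  using perm[of p] by (auto simp: bij_betw_def)

lemma sigma_inj: "A \<subseteq> {1..p} \<Longrightarrow> inj_on (\<sigma> p) A"
  using perm[of p] inj_on_subset by (auto simp: bij_betw_def)

lemma sigma_eq: "q \<in> {1..p} \<Longrightarrow> u \<in> {1..p} \<Longrightarrow> \<sigma> p q = \<sigma> p u \<longleftrightarrow> q = u"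
  by (rule inj_on_eq_iff[OF sigma_inj[OF subset_refl]])

lemma RO_add: "RO X Y \<Longrightarrow> RO X' Y' \<Longrightarrow> RO (X + X') (Y + Y')"
  by (simp add: RO_def lookup_add R_add)

lemma RO_diff: "RO X Y \<Longrightarrow> RO X' Y' \<Longrightarrow> RO (X - X') (Y - Y')"
  by (simp add: RO_def lookup_minus R_diff)

lemma RO_1: "RO 1 1"
  by (auto simp: RO_def lookup_single when_def intro: R_0 R_1)

lemma RO_0: "RO 0 0"
  by (simp add: RO_def R_0)

lemma RO_mult:
  assumes "RO X Y" "RO X' Y'" shows "RO (X * X') (Y * Y')"
  unfolding RO_def
proof (intro allI)
  fix z z'
  define A where "A = Poly_Mapping.keys (app X' (T z)) \<union> \<pi> -` Poly_Mapping.keys (app Y' (T (\<pi> z)))"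
  have fin: "finite A" unfolding A_def
    using bij by (auto intro!: finite_vimageI simp: bij_def)
  have "Poly_Mapping.keys (app Y' (T (\<pi> z))) \<subseteq> \<pi> ` A"
  proof
    fix y assume "y \<in> Poly_Mapping.keys (app Y' (T (\<pi> z)))"
    moreover obtain x where "y = \<pi> x" using bij by (metis bij_pointE)
    ultimately show "y \<in> \<pi> ` A" by (auto simp: A_def)
  qed
  then have "Poly_Mapping.lookup (app (Y * Y') (T (\<pi> z))) (\<pi> z') =
      (\<Sum>y\<in>\<pi> ` A. Poly_Mapping.lookup (app Y' (T (\<pi> z))) y * Poly_Mapping.lookup (app Y (T y)) (\<pi> z'))"
    using fin by (simp add: lookup_app[of "\<pi> ` A"])
  also have "\<dots> = (\<Sum>y\<in>A. Poly_Mapping.lookup (app Y' (T (\<pi> z))) (\<pi> y) * Poly_Mapping.lookup (app Y (T (\<pi> y))) (\<pi> z'))"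
    by (subst sum.reindex) (auto simp: inj_on_def)
  finally have Y: "Poly_Mapping.lookup (app (Y * Y') (T (\<pi> z))) (\<pi> z') = \<dots>" .
  have "Poly_Mapping.lookup (app (X * X') (T z)) z' =
      (\<Sum>y\<in>A. Poly_Mapping.lookup (app X' (T z)) y * Poly_Mapping.lookup (app X (T y)) z')"
    using fin by (simp add: lookup_app[of A] A_def)
  then show "R (Poly_Mapping.lookup (app (X * X') (T z)) z') (Poly_Mapping.lookup (app (Y * Y') (T (\<pi> z))) (\<pi> z'))"
    unfolding Y using assms by (auto simp: RO_def intro!: R_sum R_mult)
qed

lemma RO_lie: "RO X Y \<Longrightarrow> RO X' Y' \<Longrightarrow> RO (lie X X') (lie Y Y')"
  by (simp add: lie_def RO_diff RO_mult)

lemma RO_sum: "(\<And>x. x \<in> A \<Longrightarrow> RO (f x) (g x)) \<Longrightarrow> RO (sum f A) (sum g A)"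
  by (induction A rule: infinite_finite_induct) (auto intro: RO_0 RO_add)

lemma RO_diag: "(\<And>z. R (\<mu> z) (\<nu> (\<pi> z))) \<Longrightarrow> RO (diag_op \<mu>) (diag_op \<nu>)"
  by (auto simp: RO_def lookup_single when_def intro: R_0)

lemma RO_shop:
  assumes "p < n" "\<And>q z. q \<in> {1..p} \<Longrightarrow> R (c q z) (c' (\<sigma> p q) (\<pi> z))"
  shows "RO (shop p d c) (shop p d c')"
  unfolding RO_def
proof (intro allI)
  fix z z'
  have "Poly_Mapping.lookup (app (shop p d c') (T (\<pi> z))) (\<pi> z') =
    (\<Sum>q\<in>\<sigma> p ` {1..p}. if shift (\<pi> z) (p,q) d = \<pi> z' then c' q (\<pi> z) else 0)"
    unfolding sigma_image by (simp add: lookup_sum lookup_single when_def)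
  also have "\<dots> = (\<Sum>q=1..p. if shift z (p,q) d = z' then c' (\<sigma> p q) (\<pi> z) else 0)"
    by (subst sum.reindex[OF sigma_inj[OF subset_refl]]) (use assms(1) in \<open>auto intro!: sum.cong simp: pi_shift[symmetric]\<close>)
  finally show "R (Poly_Mapping.lookup (app (shop p d c) (T z)) z') (Poly_Mapping.lookup (app (shop p d c') (T (\<pi> z))) (\<pi> z'))"
    using assms(2) by (auto simp: lookup_sum lookup_single when_def intro!: R_sum R_0)
qed

text \<open>Products over a row do not change when its columns are permuted, so the permuted
  coefficient can be compared factor by factor; genericity of the target keeps its denominator away
  from zero.\<close>

lemma R_cf:
  assumes "R \<kappa> \<kappa>'" "p < n" "p' \<le> n" "m = p'" "q \<in> {1..p}"
  shows "R (cf n e \<kappa> p p' m q z) (cf n e' \<kappa>' p p' m (\<sigma> p q) (\<pi> z))"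
proof -
  have num: "(\<Prod>u=1..m. ent n e' (\<pi> z) p (\<sigma> p q) - ent n e' (\<pi> z) p' u) =
      (\<Prod>u=1..m. ent n e' (\<pi> z) p (\<sigma> p q) - ent n e' (\<pi> z) p' (\<sigma> p' u))"
    unfolding assms(4) by (subst sigma_image(1)[of p', symmetric], subst prod.reindex[OF sigma_inj[OF subset_refl]]) simp
  have "{1..p} - {\<sigma> p q} = \<sigma> p ` ({1..p} - {q})"
    using inj_on_image_set_diff[OF sigma_inj[OF subset_refl, of p], of "{1..p}" "{q}"] assms(5) sigma_image(1)[of p] by auto
  then have den: "(\<Prod>u\<in>{1..p} - {\<sigma> p q}. ent n e' (\<pi> z) p (\<sigma> p q) - ent n e' (\<pi> z) p u) =
      (\<Prod>u\<in>{1..p} - {q}. ent n e' (\<pi> z) p (\<sigma> p q) - ent n e' (\<pi> z) p (\<sigma> p u))"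
    by (simp only: prod.reindex[OF sigma_inj[OF Diff_subset]] o_def)
  have nz: "ent n e' (\<pi> z) p (\<sigma> p q) - ent n e' (\<pi> z) p (\<sigma> p u) \<noteq> 0" if "u \<in> {1..p} - {q}" for u
    using target.ent_generic0[of "\<sigma> p q" p "\<sigma> p u" "\<pi> z"] sigma_image(2) that assms sigma_eq[of q p u] by auto
  show ?thesis
    unfolding cf_def num den
    using assms nz by (intro R_divide R_mult R_prod R_diff R_ent) auto
qed

lemma RO_eop: "p < n \<Longrightarrow> RO (eop n e p) (eop n e' p)"
  unfolding eop_def by (intro RO_shop R_cf) (auto intro: R_uminus R_1)

lemma RO_fop: "p < n \<Longrightarrow> RO (fop n e p) (fop n e' p)"
  unfolding fop_def by (intro RO_shop R_cf) (auto intro: R_1)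

lemma RO_hop:
  assumes "p \<le> n" shows "RO (hop n e p) (hop n e' p)"
  unfolding hop_def
proof (rule RO_diag)
  fix z
  have "R (\<Sum>q=1..p. ent n e z p q + of_nat q - 1) (\<Sum>q=1..p. ent n e' (\<pi> z) p q + of_nat q - 1)" if "p \<le> n" for p
  proof -
    have "(\<Sum>q=1..p. ent n e' (\<pi> z) p q) = (\<Sum>q=1..p. ent n e' (\<pi> z) p (\<sigma> p q))"
      by (subst sigma_image(1)[of p, symmetric], subst sum.reindex[OF sigma_inj[OF subset_refl]]) simp
    then have "(\<Sum>q=1..p. ent n e' (\<pi> z) p q + of_nat q - 1) = (\<Sum>q=1..p. ent n e' (\<pi> z) p (\<sigma> p q) + of_nat q - 1)"
      by (simp add: sum.distrib sum_subtractf)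
    then show ?thesis using that by (auto intro!: R_sum R_diff R_add R_ent R_of_nat R_1)
  qed
  then show "R (wt n e p z) (wt n e' p (\<pi> z))"
    using assms unfolding wt_def by (intro R_diff) auto
qed

lemma RO_gE:
  assumes "r \<in> {1..n}" "s \<in> {1..n}"
  shows "RO (gE n e r s) (gE n e' r s)"
proof -
  have "RO (up_far lie (eop n e) r d) (up_far lie (eop n e') r d)" if "r + d < n" for r d
    using that by (induction d) (auto intro: RO_eop RO_lie)
  moreover have "RO (down_far lie (fop n e) r d) (down_far lie (fop n e') r d)" if "r + d < n" for r d
    using that by (induction d) (auto intro: RO_fop RO_lie)
  ultimately show ?thesis using assms by (auto simp: gE_def mat_unit_def RO_hop)
qed

lemma RO_gelfand:
  assumes "r \<le> n"
  shows "RO (gelfand (gE n e) r s) (gelfand (gE n e') r s)"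
proof -
  have "RO (mpow (gE n e) r s i j) (mpow (gE n e') r s i j)" if "i \<in> {1..r}" "j \<in> {1..r}" for i j
    using that(2)
  proof (induction s arbitrary: j)
    case (Suc s)
    have "RO (gE n e l j) (gE n e' l j)" if "l \<in> {1..r}" for l
      using assms Suc.prems that by (intro RO_gE) auto
    then show ?case using Suc unfolding mpow.simps by (intro RO_sum RO_mult) auto
  qed (auto intro: RO_1 RO_0)
  then show ?thesis unfolding gelfand_def by (intro RO_sum) auto
qed

text \<open>Zero specializes only to zero, and \<open>\<pi>\<close> is a bijection, so vanishing
  off-diagonal coefficients remain zero in the target.\<close>

lemma RO_eigen:
  assumes "RO X Y" "app X (T z) = Poly_Mapping.single z \<mu>"
  obtains \<nu> where "R \<mu> \<nu>" "app Y (T (\<pi> z)) = Poly_Mapping.single (\<pi> z) \<nu>"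
proof
  let ?\<nu> = "Poly_Mapping.lookup (app Y (T (\<pi> z))) (\<pi> z)"
  have *: "R (Poly_Mapping.lookup (Poly_Mapping.single z \<mu>) z') (Poly_Mapping.lookup (app Y (T (\<pi> z))) (\<pi> z'))" for z'
    using assms unfolding RO_def by metis
  from *[of z] show "R \<mu> ?\<nu>" by simp
  show "app Y (T (\<pi> z)) = Poly_Mapping.single (\<pi> z) ?\<nu>"
  proof (rule poly_mapping_eqI)
    fix y
    obtain z' where y: "y = \<pi> z'" using bij by (metis bij_pointE)
    show "Poly_Mapping.lookup (app Y (T (\<pi> z))) y = Poly_Mapping.lookup (Poly_Mapping.single (\<pi> z) ?\<nu>) y"
      using *[of z'] R_0_left by (auto simp: y lookup_single when_def)
  qed
qed

end

lemma (in generic_tableau) tableau_transferI: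
  assumes "specialization R"
    and "\<And>p q z. q \<in> {1..p} \<Longrightarrow> p \<le> n \<Longrightarrow> R (ent n e0 z p q) (ent n e (\<lambda>u. z u + a u) p q)"
  shows "tableau_transfer R n e0 e (\<lambda>z u. z u + a u) (\<lambda>_. id)"
proof -
  have "bij (\<lambda>z u. z u + a u)"
    by (rule o_bij[of "\<lambda>z u. z u - a u"]) (auto simp: fun_eq_iff)
  then show ?thesis
    by (intro tableau_transfer.intro assms(1) tableau_transfer_axioms.intro generic_tableau_axioms)
      (auto simp: assms(2) bij_betw_def shift_def fun_eq_iff)
qed

section \<open>Gelfand invariants act diagonally\<close>

text \<open>The entries of each row p < n together with 1 are linearly independent over the
  rationals. This is stronger than genericity; it makes the quadratic Casimir eigenvalue alone
  distinguish any two integral translates of a row.\<close>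

definition row_indep :: "nat \<Rightarrow> (idx \<Rightarrow> 'k::field_char_0) \<Rightarrow> bool" where
  "row_indep n e \<longleftrightarrow> (\<forall>p<n. \<forall>c :: nat \<Rightarrow> int. \<forall>m.
     (\<Sum>q=1..p. of_int (c q) * e (p,q)) = of_int m \<longrightarrow> (\<forall>q\<in>{1..p}. c q = 0))"

lemma row_indepD:
  assumes "row_indep n e" "p < n" "(\<Sum>q=1..p. of_int (c q) * e (p,q)) = of_int m" "q \<in> {1..p}"
  shows "c q = 0"
  using assms unfolding row_indep_def by blast

lemma row_indep_generic:
  assumes "row_indep n e" shows "generic_tableau n e"
proof
  fix s u r m assume *: "1 \<le> s" "s < u" "u \<le> r" "r < n"
  define c :: "nat \<Rightarrow> int" where "c q = (if q = s then 1 else 0) - (if q = u then 1 else 0)" for q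
  have "(\<Sum>q=1..r. of_int (c q) * e (r,q)) = e (r,s) - e (r,u)"
  proof -
    have "(\<Sum>q=1..r. of_int (c q) * e (r,q)) = (\<Sum>q=1..r. (if q = s then e (r,s) else 0) - (if q = u then e (r,u) else 0))"
      by (intro sum.cong) (auto simp: c_def)
    then show ?thesis using * by (simp add: sum_subtractf)
  qed
  moreover have "c s = 1" using * by (simp add: c_def)
  ultimately show "e (r,s) - e (r,u) \<noteq> of_int m"
    using row_indepD[OF assms *(4), of c m s] * by auto
qed

section \<open>Operators that move only rows of index less than r\<close>

definition same_outside :: "nat \<Rightarrow> zvec \<Rightarrow> zvec \<Rightarrow> bool" where
  "same_outside r z z' \<longleftrightarrow> (\<forall>p q. p \<notin> {1..<r} \<or> q \<notin> {1..p} \<longrightarrow> z' (p,q) = z (p,q))"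

definition low :: "nat \<Rightarrow> (zvec, 'k::field_char_0) lop \<Rightarrow> bool" where
  "low r X \<longleftrightarrow> (\<forall>z z'. z' \<in> Poly_Mapping.keys (app X (T z)) \<longrightarrow> same_outside r z z')"

lemma low_add:
  assumes "low r X" "low r Y" shows "low r (X + Y)"
  unfolding low_def app_ops
proof (intro allI impI)
  fix z z' assume "z' \<in> Poly_Mapping.keys (app X (T z) + app Y (T z))"
  then have "z' \<in> Poly_Mapping.keys (app X (T z)) \<union> Poly_Mapping.keys (app Y (T z))" by (rule subsetD[OF keys_add])
  then show "same_outside r z z'" using assms by (auto simp: low_def)
qed

lemma keys_minus': "Poly_Mapping.keys (f - g) \<subseteq> Poly_Mapping.keys f \<union> Poly_Mapping.keys (g :: _ \<Rightarrow>\<^sub>0 'c::ab_group_add)"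
  by (auto simp: in_keys_iff lookup_minus)

lemma low_diff:
  assumes "low r X" "low r Y" shows "low r (X - Y)"
  unfolding low_def app_ops
proof (intro allI impI)
  fix z z' assume "z' \<in> Poly_Mapping.keys (app X (T z) - app Y (T z))"
  then have "z' \<in> Poly_Mapping.keys (app X (T z)) \<union> Poly_Mapping.keys (app Y (T z))" by (rule subsetD[OF keys_minus'])
  then show "same_outside r z z'" using assms by (auto simp: low_def)
qed

lemma keys_app:
  assumes "z' \<in> Poly_Mapping.keys (app X f)"
  obtains y where "y \<in> Poly_Mapping.keys f" "z' \<in> Poly_Mapping.keys (app X (T y))"
proof -
  have "(\<Sum>y\<in>Poly_Mapping.keys f. Poly_Mapping.lookup f y * Poly_Mapping.lookup (app X (T y)) z') \<noteq> 0"
    using assms by (simp add: in_keys_iff lookup_app[of "Poly_Mapping.keys f"])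
  then obtain y where "y \<in> Poly_Mapping.keys f" "Poly_Mapping.lookup f y * Poly_Mapping.lookup (app X (T y)) z' \<noteq> 0"
    by (metis (no_types, lifting) sum.neutral)
  then show thesis by (intro that[of y]) (auto simp: in_keys_iff)
qed

lemma low_mult:
  assumes "low r X" "low r Y" shows "low r (X * Y)"
  unfolding low_def app_ops
proof (intro allI impI)
  fix z z' assume "z' \<in> Poly_Mapping.keys (app X (app Y (T z)))"
  then obtain y where "y \<in> Poly_Mapping.keys (app Y (T z))" "z' \<in> Poly_Mapping.keys (app X (T y))" by (rule keys_app)
  then have "same_outside r z y" "same_outside r y z'" using assms by (auto simp: low_def)
  then show "same_outside r z z'" by (simp add: same_outside_def)
qed

lemma low_lie: "low r X \<Longrightarrow> low r Y \<Longrightarrow> low r (lie X Y)"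
  by (simp add: lie_def low_diff low_mult)

lemma low_0: "low r 0" and low_1: "low r 1" and low_diag: "low r (diag_op \<mu>)"
  by (auto simp: low_def same_outside_def split: if_splits)

lemma low_sum: "(\<And>x. x \<in> A \<Longrightarrow> low r (f x)) \<Longrightarrow> low r (sum f A)"
  by (induction A rule: infinite_finite_induct) (auto intro: low_add low_0)

lemma low_shop:
  assumes "p \<in> {1..<r}" shows "low r (shop p d c)"
  unfolding low_def same_outside_def
proof (intro allI impI)
  fix z z' p' q' assume z': "z' \<in> Poly_Mapping.keys (app (shop p d c) (T z))" and pq: "p' \<notin> {1..<r} \<or> q' \<notin> {1..p'}"
  have "(\<Sum>q=1..p. Poly_Mapping.lookup (Poly_Mapping.single (shift z (p,q) d) (c q z)) z') \<noteq> 0"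
    using z' by (simp add: in_keys_iff lookup_sum)
  then obtain q where "q \<in> {1..p}" "Poly_Mapping.lookup (Poly_Mapping.single (shift z (p,q) d) (c q z)) z' \<noteq> 0"
    by (metis (no_types, lifting) sum.neutral)
  then show "z' (p',q') = z (p',q')"
    using pq assms by (auto simp: lookup_single when_def shift_def split: if_splits)
qed

lemma low_gE:
  assumes "a \<in> {1..r}" "b \<in> {1..r}"
  shows "low r (gE n e a b)"
proof -
  have "low r (up_far lie (eop n e) a d)" if "1 \<le> a" "a + d < r" for a d
    using that by (induction d) (auto simp: eop_def intro!: low_lie low_shop)
  moreover have "low r (down_far lie (fop n e) a d)" if "1 \<le> a" "a + d < r" for a d
    using that by (induction d) (auto simp: fop_def intro!: low_lie low_shop)
  ultimately show ?thesis using assms by (auto simp: gE_def mat_unit_def hop_def low_diag)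
qed

lemma low_gelfand: "low r (gelfand (gE n e) r s)"
proof -
  have "low r (mpow (gE n e) r s i j)" if "i \<in> {1..r}" "j \<in> {1..r}" for i j
    using that(2)
  proof (induction s arbitrary: j)
    case (Suc s)
    then show ?case by (auto intro!: low_sum low_mult low_gE)
  qed (auto intro: low_1 low_0)
  then show ?thesis unfolding gelfand_def by (intro low_sum) auto
qed

lemma lookup_diag_op: "Poly_Mapping.lookup (app (diag_op \<mu>) f) z = \<mu> z * Poly_Mapping.lookup f z"
proof -
  have "Poly_Mapping.lookup (app (diag_op \<mu>) f) z = (\<Sum>y\<in>Poly_Mapping.keys f. if y = z then \<mu> z * Poly_Mapping.lookup f z else 0)"
    by (subst lookup_app[OF finite_keys subset_refl], rule sum.cong) (auto simp: lookup_single when_def)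
  then show ?thesis by (auto simp: in_keys_iff)
qed

text \<open>The invariant commutes with the Casimir element of gl(p) for p < r, so it only connects
  tableaux with equal \<open>kap p\<close>. Two translates of a row differ in \<open>kap p\<close>
  by an integer plus the sum of twice the differences times the entries, so independence forces
  equal rows. Rows from r on are not moved at all.\<close>

lemma gelfand_diag:
  assumes "row_indep n e" "r \<le> n"
  obtains \<mu> where "gelfand (gE n e) r s = diag_op \<mu>"
proof
  interpret generic_tableau n e using assms(1) by (rule row_indep_generic)
  let ?G = "gelfand (gE n e) r s"
  have key: "z' = z" if z': "z' \<in> Poly_Mapping.keys (app ?G (T z))" for z z'
  proof -
    have "z' (p,q) = z (p,q)" if pq: "p \<in> {1..<r}" "q \<in> {1..p}" for p q
    proof -
      have pn: "p < n" "1 \<le> p" using pq assms by auto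
      have "lie ?G (cas p) = 0"
      proof -
        have 0: "lie ?G (mat_unit lie (eop n e) (fop n e) (hop n e) a b) = 0" if "a \<in> {1..p}" "b \<in> {1..p}" for a b
          unfolding gE_def using that pq assms(2) by (intro gelfand_central) auto
        show ?thesis unfolding cas_def lie_sum lie_simps(6) using 0 by (simp add: sum.neutral)
      qed
      then have "app (?G * diag_op (kap p)) (T z) = app (diag_op (kap p) * ?G) (T z)"
        using casimir_diag[of p] pn by (simp add: lie_def)
      then have "scale (kap p z) (app ?G (T z)) = app (diag_op (kap p)) (app ?G (T z))"
      proof -
        assume "app (?G * diag_op (kap p)) (T z) = app (diag_op (kap p) * ?G) (T z)"
        then have "app ?G (app (diag_op (kap p)) (T z)) = app (diag_op (kap p)) (app ?G (T z))"
          by (simp only: app_ops)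
        moreover have "app (diag_op (kap p)) (T z) = scale (kap p z) (T z)" by simp
        ultimately show ?thesis by (simp only: app_scale)
      qed
      from arg_cong[OF this, of "\<lambda>f. Poly_Mapping.lookup f z'"] have "kap p z * Poly_Mapping.lookup (app ?G (T z)) z' = kap p z' * Poly_Mapping.lookup (app ?G (T z)) z'"
        by (simp only: lookup_scale lookup_diag_op)
      then have k: "kap p z' = kap p z" using z' by (simp add: in_keys_iff)
      define d where "d q = z' (p,q) - z (p,q)" for q
      have "(\<Sum>q=1..p. of_int (2 * d q) * e (p,q)) = kap p z' - kap p z
          - of_int (\<Sum>q=1..p. 2 * d q * z (p,q) + d q * d q + (int p - 1) * d q)"
      proof -
        have "kap p z' - kap p z = (\<Sum>q=1..p. W z' p q ^ 2 - W z p q ^ 2 + (of_nat p - 1) * (W z' p q - W z p q))"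
          by (simp add: kap_def sum.distrib sum_subtractf sum_distrib_left algebra_simps)
        also have "\<dots> = (\<Sum>q=1..p. of_int (2 * d q) * e (p,q) + of_int (2 * d q * z (p,q) + d q * d q + (int p - 1) * d q))"
          using pn by (intro sum.cong) (auto simp: ent_def d_def power2_eq_square algebra_simps)
        finally show ?thesis by (simp add: sum.distrib)
      qed
      then have "(\<Sum>q=1..p. of_int (2 * d q) * e (p,q)) = of_int (- (\<Sum>q=1..p. 2 * d q * z (p,q) + d q * d q + (int p - 1) * d q))"
        unfolding k by simp
      from row_indepD[OF assms(1) pn(1) this pq(2)] show ?thesis by (simp add: d_def)
    qed
    moreover have "same_outside r z z'" using low_gelfand[of r n e s] z' by (simp add: low_def)
    ultimately have "z' (p,q) = z (p,q)" for p q unfolding same_outside_def by blast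
    then show "z' = z" by (simp add: fun_eq_iff)
  qed
  show "?G = diag_op (\<lambda>z. Poly_Mapping.lookup (app ?G (T z)) z)"
  proof (rule lop_eqI, rule poly_mapping_eqI)
    fix z z'
    show "Poly_Mapping.lookup (app ?G (T z)) z' = Poly_Mapping.lookup (app (diag_op (\<lambda>z. Poly_Mapping.lookup (app ?G (T z)) z)) (T z)) z'"
      using key[of z' z] by (auto simp: in_keys_iff lookup_single when_def)
  qed
qed

lemma shift_0 [simp]: "shift z u 0 = z"
  by (simp add: shift_def)

lemma shift_shift: "shift (shift z u d) u d' = shift z u (d + d')"
  by (auto simp: shift_def)

text \<open>In the commutator with e_p, which vanishes, each matrix coefficient of e_p appears
  multiplied by a difference of two eigenvalues; where the coefficient is non-zero the eigenvalues
  agree.\<close>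

lemma gelfand_shift_invariant:
  assumes "row_indep n e" "r \<le> n" "gelfand (gE n e) r s = diag_op \<mu>" "p \<in> {1..<r}" "q \<in> {1..p}"
    and nz: "\<And>z. cup n e p q z \<noteq> 0"
  shows "\<mu> (shift z (p,q) m) = \<mu> z"
proof -
  interpret generic_tableau n e using assms(1) by (rule row_indep_generic)
  have step: "\<mu> (shift z (p,q) 1) = \<mu> z" for z
  proof -
    have "lie (gelfand (gE n e) r s) (eop n e p) = 0"
      using gelfand_central[of r p "Suc p" s] assms(2,4) by (simp add: gE_def E_eops)
    then have "shop p 1 (\<lambda>q z. (\<mu> (shift z (p,q) 1) - \<mu> z) * cup n e p q z) = 0"
      unfolding assms(3) eop_def lie_diag_shop .
    then have "Poly_Mapping.lookup (app (shop p 1 (\<lambda>q z. (\<mu> (shift z (p,q) 1) - \<mu> z) * cup n e p q z)) (T z)) (shift z (p,q) 1) = 0"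
      by simp
    moreover have "shift z (p,u) 1 = shift z (p,q) 1 \<longleftrightarrow> u = q" for u
      by (auto simp: shift_def fun_eq_iff)
    ultimately have "(\<mu> (shift z (p,q) 1) - \<mu> z) * cup n e p q z = 0"
      using assms(5) by (simp add: lookup_sum lookup_single when_def)
    then show ?thesis using nz by simp
  qed
  show ?thesis
  proof (induction m rule: int_induct[of _ 0])
    case (step1 i)
    then show ?case using step[of "shift z (p,q) i"] by (simp add: shift_shift)
  next
    case (step2 i)
    then show ?case using step[of "shift z (p,q) (i - 1)"] by (simp add: shift_shift)
  qed simp
qed

section \<open>The eigenvalue does not depend on the lower rows\<close>

definition fconst :: "'k::field_char_0 \<Rightarrow> 'k poly fract" where
  "fconst x = Fract [:x:] 1"

lemma fconst_simps: "fconst (x + y) = fconst x + fconst y" "fconst (x * y) = fconst x * fconst y"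
  "fconst 0 = 0" "fconst (- x) = - fconst x" "fconst (x - y) = fconst x - fconst y"
  by (simp_all add: fconst_def Zero_fract_def mult.commute)

lemma fconst_1: "fconst 1 = 1"
  by (simp add: fconst_def One_fract_def one_pCons)

lemma fconst_of_int: "fconst (of_int m) = of_int m"
proof -
  have "fconst (of_nat k) = of_nat k" for k
    by (induction k) (simp_all add: fconst_simps fconst_1)
  then show ?thesis by (cases m rule: int_cases2) (simp_all add: fconst_simps)
qed

lemma fconst_sum: "fconst (sum f A) = (\<Sum>x\<in>A. fconst (f x))"
  by (induction A rule: infinite_finite_induct) (simp_all add: fconst_simps)

lemma fconst_eq: "fconst x = fconst y \<longleftrightarrow> x = y"
  by (simp add: fconst_def eq_fract)

lemma fconst_t_linear:
  assumes "fconst x + fconst c * Fract [:0, 1:] 1 = 0" shows "x = 0" "c = 0"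
proof -
  have "fconst x + fconst c * Fract [:0, 1:] 1 = Fract [:x, c:] 1"
    by (simp add: fconst_def)
  then have "[:x, c:] = 0" using assms by (simp add: Zero_fract_def eq_fract)
  then show "x = 0" "c = 0" by simp_all
qed

lemma idom_hom_poly: "idom_hom (\<lambda>f. poly f (c::'k::field_char_0))"
  by unfold_locales simp_all

definition gelfand_val :: "nat \<Rightarrow> (idx \<Rightarrow> 'k) \<Rightarrow> nat \<Rightarrow> nat \<Rightarrow> zvec \<Rightarrow> 'k::field_char_0" where
  "gelfand_val n e r s z = Poly_Mapping.lookup (app (gelfand (gE n e) r s) (T z)) z"

lemma gelfand_diag_val:
  assumes "row_indep n e" "r \<le> n"
  shows "gelfand (gE n e) r s = diag_op (gelfand_val n e r s)"
proof -
  obtain \<mu> where "gelfand (gE n e) r s = diag_op \<mu>" using assms by (rule gelfand_diag)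
  moreover from this have "gelfand_val n e r s = \<mu>" by (simp add: gelfand_val_def fun_eq_iff)
  ultimately show ?thesis by simp
qed

lemma (in tableau_transfer) R_gelfand_val:
  assumes "r \<le> n"
  shows "R (gelfand_val n e r s z) (gelfand_val n e' r s (\<pi> z))"
  using RO_gelfand[OF assms, of s] by (simp add: RO_def gelfand_val_def)

text \<open>Make the entry an indeterminate t. The eigenvalue is then a rational function that, by
  shift invariance, takes the same value at e (p,q) + m for all integers m, so it is constant; t may
  be specialized to the old and to the new entry.\<close>

lemma gelfand_val_entry:
  fixes e :: "idx \<Rightarrow> 'k::field_char_0"
  assumes ri: "row_indep n e" and ri2: "row_indep n (e((p,q) := c))"
    and r: "r \<le> n" "p \<in> {1..<r}" "q \<in> {1..p}"
  shows "gelfand_val n (e((p,q) := c)) r s z = gelfand_val n e r s z"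
proof -
  let ?t = "Fract [:0, 1:] 1 :: 'k poly fract"
  define e' where "e' u = (if u = (p,q) then ?t else fconst (e u))" for u
  have pn: "p < n" using r by auto
  have ri': "row_indep n e'"
    unfolding row_indep_def
  proof (intro allI impI)
    fix p' and c :: "nat \<Rightarrow> int" and m
    assume p': "p' < n" and eq: "(\<Sum>u=1..p'. of_int (c u) * e' (p',u)) = of_int m"
    show "\<forall>u\<in>{1..p'}. c u = 0"
    proof (cases "p' = p")
      case False
      then have "(\<Sum>u=1..p'. of_int (c u) * e' (p',u)) = fconst (\<Sum>u=1..p'. of_int (c u) * e (p',u))"
        by (simp add: e'_def fconst_sum fconst_simps fconst_of_int)
      then have "(\<Sum>u=1..p'. of_int (c u) * e (p',u)) = of_int m"
        using eq by (metis fconst_eq fconst_of_int)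
      then show ?thesis using row_indepD[OF ri p'] by blast
    next
      case True
      have "(\<Sum>u=1..p. of_int (c u) * e' (p,u)) = of_int (c q) * ?t + (\<Sum>u\<in>{1..p} - {q}. of_int (c u) * fconst (e (p,u)))"
        using r by (subst sum.remove[of _ q]) (auto intro!: sum.cong simp: e'_def)
      also have "\<dots> = fconst (of_int (c q)) * ?t + fconst (\<Sum>u\<in>{1..p} - {q}. of_int (c u) * e (p,u))"
        by (simp add: fconst_sum fconst_simps fconst_of_int)
      finally have eq2: "fconst (of_int (c q)) * ?t + fconst (\<Sum>u\<in>{1..p} - {q}. of_int (c u) * e (p,u)) = fconst (of_int m)"
        using eq True by (simp add: fconst_of_int)
      have "fconst ((\<Sum>u\<in>{1..p} - {q}. of_int (c u) * e (p,u)) - of_int m) =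
          fconst (\<Sum>u\<in>{1..p} - {q}. of_int (c u) * e (p,u)) - fconst (of_int m)"
        by (rule fconst_simps(5))
      then have "fconst ((\<Sum>u\<in>{1..p} - {q}. of_int (c u) * e (p,u)) - of_int m) + fconst (of_int (c q)) * ?t = 0"
        unfolding eq2[symmetric] by simp
      from fconst_t_linear[OF this] have 0: "(\<Sum>u\<in>{1..p} - {q}. of_int (c u) * e (p,u)) = of_int m" "c q = 0" by simp_all
      then have "(\<Sum>u=1..p. of_int (c u) * e (p,u)) = of_int m"
        using r by (subst sum.remove[of _ q]) auto
      then show ?thesis using row_indepD[OF ri pn] True by blast
    qed
  qed
  interpret K': generic_tableau n e' using ri' by (rule row_indep_generic)
  have ent': "ent n e' y p' q' = (if (p',q') = (p,q) then ?t + of_int (y (p,q)) else fconst (ent n e y p' q'))" for y p' q'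
    using pn by (auto simp: ent_def e'_def fconst_simps fconst_of_int)
  \<comment> \<open>The indeterminate occurs in entry (p,q) and nowhere in row p + 1, so no factor
    of the numerator can vanish.\<close>
  have "cup n e' p q y \<noteq> 0" for y
  proof -
    have "W' \<noteq> 0" if "W' = ent n e' y p q - ent n e' y (p + 1) u" for W' u
    proof
      assume "W' = 0"
      then have 1: "?t + of_int (y (p,q)) = fconst (ent n e y (p + 1) u)" using that by (simp add: ent')
      have "fconst (of_int (y (p,q)) - ent n e y (p + 1) u) + fconst 1 * ?t = 0"
        unfolding fconst_simps(5) 1[symmetric] by (simp add: fconst_of_int fconst_1 Zero_fract_def)
      from fconst_t_linear(2)[OF this] show False by simp
    qed
    then show ?thesis using K'.ent_generic0[of q p _ y] r pn by (auto simp: cf_def)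
  qed
  then have inv: "gelfand_val n e' r s (shift y (p,q) m) = gelfand_val n e' r s y" for y m
    using gelfand_shift_invariant[OF ri' r(1) gelfand_diag_val[OF ri' r(1)] r(2,3)] by blast
  have rel: "frac_rel (\<lambda>f. poly f (c + of_int m)) (gelfand_val n e' r s y) (gelfand_val n (e((p,q) := c)) r s (shift y (p,q) m))"
    if "row_indep n (e((p,q) := c))" for c m y
  proof -
    interpret idom_hom "\<lambda>f. poly f (c + of_int m)" by (rule idom_hom_poly)
    interpret S: specialization "frac_rel (\<lambda>f. poly f (c + of_int m))" by (rule specialization)
    interpret L: generic_tableau n "e((p,q) := c)" using that by (rule row_indep_generic)
    have const: "frac_rel (\<lambda>f. poly f (c + of_int m)) (fconst x) x" for x
      using frac_rel_Fract1[of "[:x:]"] by (simp add: fconst_def)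
    have t: "frac_rel (\<lambda>f. poly f (c + of_int m)) ?t (c + of_int m)"
      using frac_rel_Fract1[of "[:0, 1:]"] by simp
    \<comment> \<open>Specializing t to c + m corresponds to t = c together with a translation of
      the tableau by m in this entry.\<close>
    define a :: zvec where "a u = (if u = (p,q) then m else 0)" for u
    interpret tableau_transfer "frac_rel (\<lambda>f. poly f (c + of_int m))" n e' "e((p,q) := c)" "\<lambda>z u. z u + a u" "\<lambda>_. id"
    proof (rule L.tableau_transferI[OF specialization])
      fix p' q' y
      show "frac_rel (\<lambda>f. poly f (c + of_int m)) (ent n e' y p' q') (ent n (e((p,q) := c)) (\<lambda>u. y u + a u) p' q')"
      proof (cases "(p',q') = (p,q)")
        case True
        then show ?thesis using S.R_add[OF t S.R_of_int[of "y (p,q)"]] pn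
          by (simp add: e'_def ent_def a_def algebra_simps)
      next
        case False
        then have "ent n (e((p,q) := c)) (\<lambda>u. y u + a u) p' q' = ent n e y p' q'"
          by (auto simp: ent_def a_def)
        then show ?thesis using False const by (auto simp: ent')
      qed
    qed
    have "(\<lambda>u. y u + a u) = shift y (p,q) m" by (auto simp: a_def shift_def)
    then show ?thesis using R_gelfand_val[OF r(1), of s y] by simp
  qed
  obtain P Q where PQ: "gelfand_val n e' r s z = Fract P Q" "Q \<noteq> 0" by (cases "gelfand_val n e' r s z")
  define b where "b = gelfand_val n e r s z"
  have ri1: "row_indep n (e((p,q) := e (p,q)))" using ri by simp
  \<comment> \<open>The denominator Q may vanish at this point. Cross-multiplying with a
    representative whose denominator does not vanish there avoids the division.\<close>
  have zero: "poly (P - smult b Q) (e (p,q) + of_int m) = 0" for m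
  proof -
    have "frac_rel (\<lambda>f. poly f (e (p,q) + of_int m)) (Fract P Q) b"
      using rel[OF ri1, of m "shift z (p,q) (- m)"] inv PQ(1) by (simp add: shift_shift b_def)
    then obtain p' q' where *: "Fract P Q = Fract p' q'" "poly q' (e (p,q) + of_int m) \<noteq> 0"
      "b = poly p' (e (p,q) + of_int m) / poly q' (e (p,q) + of_int m)"
      unfolding frac_rel_def by blast
    then have "q' \<noteq> 0" by (metis poly_0)
    with *(1) PQ(2) have "P * q' = p' * Q" by (simp add: eq_fract)
    then have "poly P (e (p,q) + of_int m) * poly q' (e (p,q) + of_int m) = poly p' (e (p,q) + of_int m) * poly Q (e (p,q) + of_int m)"
      by (simp flip: poly_mult)
    also have "poly p' (e (p,q) + of_int m) = b * poly q' (e (p,q) + of_int m)" using *(2,3) by simp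
    finally have "poly P (e (p,q) + of_int m) * poly q' (e (p,q) + of_int m) =
        (b * poly Q (e (p,q) + of_int m)) * poly q' (e (p,q) + of_int m)" by (simp only: mult_ac)
    then have "poly P (e (p,q) + of_int m) = b * poly Q (e (p,q) + of_int m)"
      using *(2) by simp
    then show ?thesis by simp
  qed
  have "P - smult b Q = 0"
  proof (rule ccontr)
    assume "P - smult b Q \<noteq> 0"
    then have "finite {x. poly (P - smult b Q) x = 0}" by (rule poly_roots_finite)
    moreover have "range (\<lambda>m. e (p,q) + of_int m) \<subseteq> {x. poly (P - smult b Q) x = 0}" using zero by auto
    ultimately have "finite (range (\<lambda>m::int. e (p,q) + of_int m))" using finite_subset by blast
    moreover have "inj (\<lambda>m::int. e (p,q) + of_int m)" by (auto simp: inj_def)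
    ultimately show False using finite_imageD infinite_UNIV_int by blast
  qed
  then have "gelfand_val n e' r s z = fconst b"
    using PQ by (simp add: fconst_def eq_fract)
  moreover have "frac_rel (\<lambda>f. poly f c) (fconst b) b"
    using idom_hom.frac_rel_Fract1[OF idom_hom_poly, of c "[:b:]"] by (simp add: fconst_def)
  ultimately show ?thesis
    using rel[OF ri2, of 0 z] idom_hom.frac_rel_unique[OF idom_hom_poly[of c]] by (simp add: b_def)
qed

section \<open>The eigenvalue on a highest weight vector\<close>

text \<open>The eigenvalue of the i-th diagonal entry of the s-th power of the generator matrix on a
  highest weight vector of weight l, see \<open>mpow_highest_weight\<close>.\<close>

primrec hwc :: "nat \<Rightarrow> (nat \<Rightarrow> 'k::field_char_0) \<Rightarrow> nat \<Rightarrow> nat \<Rightarrow> 'k" where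
  "hwc r l 0 i = 1"
| "hwc r l (Suc s) i = l i * hwc r l s i + (\<Sum>j=Suc i..r. hwc r l s i - hwc r l s j)"

definition pp :: "(nat \<Rightarrow> 'k::field_char_0) \<Rightarrow> nat \<Rightarrow> nat \<Rightarrow> nat \<Rightarrow> 'k" where
  "pp m r i p = (\<Prod>q\<in>{i..r} - {p}. 1 - 1 / (m p - m q))"

text \<open>Each product is, up to sign, a quotient whose numerator has the nodes shifted by one,
  the factor q = p being -1; the first residue formula then counts the nodes.\<close>

lemma sum_pp:
  fixes m :: "nat \<Rightarrow> 'k::field_char_0"
  assumes "inj_on m {i..r}"
  shows "(\<Sum>p=i..r. pp m r i p) = of_nat (Suc r - i)"
proof -
  have "pp m r i p = - ((\<Prod>q\<in>{i..r}. m p - (m q + 1)) / (\<Prod>q\<in>{i..r} - {p}. m p - m q))" if p: "p \<in> {i..r}" for p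
  proof -
    have "1 - 1 / (m p - m q) = (m p - (m q + 1)) / (m p - m q)" if "q \<in> {i..r} - {p}" for q
    proof -
      have "m p - m q \<noteq> 0" using assms p that by (auto simp: inj_on_def)
      then show ?thesis by (simp add: divide_simps)
    qed
    then have "pp m r i p = (\<Prod>q\<in>{i..r} - {p}. m p - (m q + 1)) / (\<Prod>q\<in>{i..r} - {p}. m p - m q)"
      by (simp add: pp_def prod_dividef)
    then show ?thesis using p by (simp add: prod.remove[of "{i..r}" p])
  qed
  then have "(\<Sum>p=i..r. pp m r i p) = - (\<Sum>p=i..r. (\<Prod>q\<in>{i..r}. m p - (m q + 1)) / (\<Prod>q\<in>{i..r} - {p}. m p - m q))"
    by (simp add: sum_negf)
  then show ?thesis using residue_sum1[of "{i..r}" m "{i..r}" "\<lambda>q. m q + 1"] assms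
    by (simp add: sum.distrib)
qed

text \<open>The claim is made for all tails i..r because the recursion of \<open>hwc\<close> refers
  to later indices. Both sides then satisfy the same recursion in s and, downwards, in i. The nodes
  are l p + r - p, the shifted weights that occur in \<open>gamma\<close>.\<close>

lemma hwc_sum:
  fixes l :: "nat \<Rightarrow> 'k::field_char_0" and r
  defines "m \<equiv> \<lambda>p. l p + of_nat r - of_nat p"
  assumes inj: "inj_on m {1..r}" and "1 \<le> i" "i \<le> Suc r"
  shows "(\<Sum>j=i..r. hwc r l s j) = (\<Sum>p=i..r. m p ^ s * pp m r i p)"
  using assms(3,4)
proof (induction s arbitrary: i)
  case 0
  have "inj_on m {i..r}" using inj 0 by (auto intro: inj_on_subset)
  then show ?case by (simp add: sum_pp)
next
  case (Suc s)
  define A where "A s i = (\<Sum>j=i..r. hwc r l s j)" for s i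
  define G where "G s i = (\<Sum>p=i..r. m p ^ s * pp m r i p)" for s i
  have IH: "A s i = G s i" if "1 \<le> i" "i \<le> Suc r" for i using Suc.IH that by (simp add: A_def G_def)
  have "A (Suc s) i = G (Suc s) i"
    using Suc.prems(2,1)
  proof (induction i rule: inc_induct)
    case base
    then show ?case by (simp add: A_def G_def)
  next
    case (step i)
    have i: "i \<le> r" "1 \<le> i" using step by auto
    have Ai: "A s' i = hwc r l s' i + A s' (Suc i)" for s'
      using i by (simp add: A_def sum.atLeast_Suc_atMost)
    have "(\<Sum>j=Suc i..r. hwc r l s i - hwc r l s j) = (of_nat r - of_nat i) * hwc r l s i - A s (Suc i)"
      using i by (simp add: A_def sum_subtractf of_nat_diff)
    then have "hwc r l (Suc s) i = m i * hwc r l s i - A s (Suc i)"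
      by (simp add: m_def algebra_simps)
    moreover have "hwc r l s i = G s i - G s (Suc i)" "A s (Suc i) = G s (Suc i)" "A (Suc s) (Suc i) = G (Suc s) (Suc i)"
      using step.IH IH[of i] IH[of "Suc i"] i Ai[of s] by (simp_all add: eq_diff_eq)
    ultimately have EA: "A (Suc s) i = G (Suc s) (Suc i) + m i * (G s i - G s (Suc i)) - G s (Suc i)"
      using Ai[of "Suc s"] by (simp del: hwc.simps)
    have "G (Suc s) i - m i * G s i = G (Suc s) (Suc i) - (m i + 1) * G s (Suc i)"
    proof -
      have "G (Suc s) i - m i * G s i = (\<Sum>p=i..r. m p ^ s * (m p - m i) * pp m r i p)"
        by (simp add: G_def sum_distrib_left sum_subtractf algebra_simps)
      also have "\<dots> = (\<Sum>p=Suc i..r. m p ^ s * (m p - m i) * pp m r i p)"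
        using i by (simp add: sum.atLeast_Suc_atMost)
      also have "\<dots> = (\<Sum>p=Suc i..r. m p ^ s * (m p - m i - 1) * pp m r (Suc i) p)"
      proof (intro sum.cong refl)
        fix p assume p: "p \<in> {Suc i..r}"
        then have "m p - m i \<noteq> 0" using inj_onD[OF inj, of p i] i by auto
        moreover have "{i..r} - {p} = insert i ({Suc i..r} - {p})" using p i by auto
        ultimately show "m p ^ s * (m p - m i) * pp m r i p = m p ^ s * (m p - m i - 1) * pp m r (Suc i) p"
          by (simp add: pp_def field_simps)
      qed
      also have "\<dots> = G (Suc s) (Suc i) - (m i + 1) * G s (Suc i)"
        by (simp add: G_def sum_distrib_left sum_subtractf algebra_simps)
      finally show ?thesis .
    qed
    then have EG: "G (Suc s) i = G (Suc s) (Suc i) - (m i + 1) * G s (Suc i) + m i * G s i"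
      by (simp only: diff_eq_eq)
    show ?case unfolding EA EG by (simp add: algebra_simps)
  qed
  then show ?case by (simp add: A_def G_def)
qed

text \<open>The last factor E_(l', j) acts first. It kills u for l' < j and is a scalar for l' = j;
  for l' > j it is commuted to the left past the power, whose entry above the diagonal kills u by
  induction.\<close>

lemma mpow_highest_weight:
  fixes E :: "nat \<Rightarrow> nat \<Rightarrow> ('b, 'k::field_char_0) lop"
  assumes "gl_rep n E" "r \<le> n"
    and up: "\<And>i j. \<lbrakk>i \<in> {1..r}; j \<in> {1..r}; i < j\<rbrakk> \<Longrightarrow> app (E i j) u = 0"
    and diag: "\<And>i. i \<in> {1..r} \<Longrightarrow> app (E i i) u = scale (l i) u"
    and "i \<in> {1..r}" "j \<in> {1..r}"
  shows "(i < j \<longrightarrow> app (mpow E r s i j) u = 0) \<and> app (mpow E r s i i) u = scale (hwc r l s i) u"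
  using assms(5,6)
proof (induction s arbitrary: i j)
  case 0
  then show ?case by simp
next
  case (Suc s)
  interpret gl_rep n E by fact
  have swap: "app (mpow E r s i' l') (app (E l' j') u) = app (E l' j') (app (mpow E r s i' l') u)
      + (app (mpow E r s i' j') u - (if j' = i' then app (mpow E r s l' l') u else 0))"
    if "i' \<in> {1..r}" "l' \<in> {1..r}" "j' \<in> {1..r}" for i' l' j'
  proof -
    have "mpow E r s i' l' * E l' j' = E l' j' * mpow E r s i' l' + (mpow E r s i' j' - (if j' = i' then mpow E r s l' l' else 0))"
      using lie_mpow[OF assms(2) that(1,2,2,3), of s] by (simp add: lie_def algebra_simps)
    from arg_cong[OF this, of "\<lambda>X. app X u"] show ?thesis by auto
  qed
  show ?case
  proof (intro conjI impI)
    assume ij: "i < j"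
    have "app (mpow E r s i l') (app (E l' j) u) = 0" if l': "l' \<in> {1..r}" for l'
    proof (cases l' j rule: linorder_cases)
      case less
      then show ?thesis using up[of l' j] l' Suc.prems by simp
    next
      case equal
      then show ?thesis using diag[of j] Suc ij by (simp add: app_scale)
    next
      case greater
      then have "app (mpow E r s i l') u = 0" "app (mpow E r s i j) u = 0" using Suc.IH[of i] l' Suc.prems ij by auto
      then show ?thesis using swap[of i l' j] l' Suc.prems ij by simp
    qed
    then show "app (mpow E r (Suc s) i j) u = 0" by (simp add: app_sum_left)
  next
    have 1: "app (mpow E r s i l') (app (E l' i) u) =
        scale (if l' = i then l i * hwc r l s i else if i < l' then hwc r l s i - hwc r l s l' else 0) u"
      if l': "l' \<in> {1..r}" for l'
    proof (cases l' i rule: linorder_cases)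
      case less
      then show ?thesis using up[of l' i] l' Suc.prems by simp
    next
      case equal
      then show ?thesis using diag[of i] Suc by (simp add: app_scale scale_scale)
    next
      case greater
      then have "app (mpow E r s i l') u = 0" using Suc.IH[of i l'] l' Suc.prems by simp
      then show ?thesis using swap[of i l' i] l' Suc greater by (simp add: scale_left_diff)
    qed
    have "(\<Sum>l'=1..r. if l' = i then l i * hwc r l s i else if i < l' then hwc r l s i - hwc r l s l' else 0) =
        (\<Sum>l'=1..r. (if l' = i then l i * hwc r l s i else 0) + (if l' \<in> {Suc i..r} then hwc r l s i - hwc r l s l' else 0))"
      by (intro sum.cong) auto
    also have "\<dots> = hwc r l (Suc s) i"
    proof -
      have "(\<Sum>l'=1..r. if l' \<in> {Suc i..r} then hwc r l s i - hwc r l s l' else 0) = (\<Sum>l'=Suc i..r. hwc r l s i - hwc r l s l')"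
        by (rule sum.mono_neutral_cong_right) auto
      then show ?thesis using Suc.prems by (simp add: sum.distrib)
    qed
    finally have "hwc r l (Suc s) i = (\<Sum>l'=1..r. if l' = i then l i * hwc r l s i else if i < l' then hwc r l s i - hwc r l s l' else 0)"
      by simp
    moreover have "scale (sum g A) u = (\<Sum>x\<in>A. scale (g x) u)" for g :: "nat \<Rightarrow> 'k" and A
      by (induction A rule: infinite_finite_induct) (simp_all add: scale_left_add)
    ultimately have "scale (hwc r l (Suc s) i) u = (\<Sum>l'=1..r. app (mpow E r s i l') (app (E l' i) u))"
      by (simp only: 1 cong: sum.cong)
    then show "app (mpow E r (Suc s) i i) u = scale (hwc r l (Suc s) i) u"
      by (simp add: app_sum_left)
  qed
qed

section \<open>The eigenvalues are polynomials\<close>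

definition emb :: "'a::idom \<Rightarrow> 'a fract" where "emb x = Fract x 1"

lemma emb_simps: "emb (x + y) = emb x + emb y" "emb (x * y) = emb x * emb y" "emb 0 = 0" "emb 1 = 1"
  "emb (- x) = - emb x" "emb (x - y) = emb x - emb y"
  by (simp_all add: emb_def Zero_fract_def One_fract_def)

lemma emb_sum: "emb (sum f A) = (\<Sum>x\<in>A. emb (f x))"
  by (induction A rule: infinite_finite_induct) (simp_all add: emb_simps)

lemma emb_of_nat: "emb (of_nat m) = of_nat m"
  by (induction m) (simp_all add: emb_simps)

lemma emb_of_int: "emb (of_int m) = of_int m"
  by (cases m rule: int_cases2) (simp_all add: emb_simps emb_of_nat)

lemma emb_eq: "emb x = emb y \<longleftrightarrow> x = y"
  by (simp add: emb_def eq_fract)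

text \<open>
  A divided difference of a polynomial with coefficients in a subring, at nodes in the subring,
  lies in the subring: reduce the polynomial modulo the monic product of the linear factors.
\<close>

lemma divided_difference_emb:
  fixes d :: "'i \<Rightarrow> 'a::{idom,ring_char_0} fract"
  assumes I: "finite I" "inj_on d I" "I \<noteq> {}" and d: "\<And>i. i \<in> I \<Longrightarrow> d i \<in> range emb"
    and R: "\<And>k. coeff R k \<in> range emb"
  shows "(\<Sum>i\<in>I. poly R (d i) / (\<Prod>j\<in>I - {i}. d i - d j)) \<in> range emb"
  using R
proof (induction "degree R" arbitrary: R rule: less_induct)
  case less
  have closed: "x - y \<in> range emb" "x * y \<in> range emb" if "x \<in> range emb" "y \<in> range emb" for x y :: "'a fract"
    using that by (auto simp flip: emb_simps)
  have closed3: "- x \<in> range emb" if "x \<in> range emb" for x :: "'a fract"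
    using that by (auto simp flip: emb_simps)
  have closed0: "(0 :: 'a fract) \<in> range emb" "(1 :: 'a fract) \<in> range emb"
    by (metis emb_simps(3) rangeI, metis emb_simps(4) rangeI)
  show ?case
  proof (cases "degree R < card I")
    case True
    then show ?thesis using lagrange_leading_coeff[OF I] less.prems by simp
  next
    case False
    define k where "k = degree R - card I"
    define D where "D = monom (lead_coeff R) k * linprod d I"
    have D: "coeff D (degree R) = lead_coeff R" "degree D \<le> degree R"
    proof -
      show "coeff D (degree R) = lead_coeff R"
        using False linprod_degree(2)[of I d] I by (simp add: D_def coeff_monom_mult k_def)
      show "degree D \<le> degree R"
        using False linprod_degree(1)[of I d] I degree_mult_le[of "monom (lead_coeff R) k" "linprod d I"]
          degree_monom_le[of "lead_coeff R" k] unfolding D_def k_def by linarith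
    qed
    have lin: "coeff (linprod d J) l \<in> range emb" if "finite J" "J \<subseteq> I" for J l
      using that
    proof (induction J arbitrary: l)
      case (insert x J)
      have "d x \<in> range emb" using insert d by auto
      have eq: "linprod d (insert x J) = [:- d x, 1:] * linprod d J" using insert by (simp add: linprod_def)
      have "coeff (linprod d (insert x J)) l = (case l of 0 \<Rightarrow> 0 | Suc l' \<Rightarrow> coeff (linprod d J) l') - d x * coeff (linprod d J) l"
        unfolding eq by (cases l) simp_all
      then show ?case using insert closed(1)[OF _ closed(2)[OF \<open>d x \<in> range emb\<close>]]
          closed3[OF closed(2)[OF \<open>d x \<in> range emb\<close>]] by (cases l) auto
    qed (auto simp: linprod_def coeff_1 closed0)
    have cD: "coeff D l \<in> range emb" for l
      using closed closed0 lin[OF I(1) subset_refl] less.prems by (simp add: D_def coeff_monom_mult)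
    have "poly (R - D) (d i) = poly R (d i)" if "i \<in> I" for i
    proof -
      have "(\<Prod>j\<in>I. d i - d j) = 0" using I that by auto
      then show ?thesis by (simp add: D_def poly_linprod)
    qed
    then have eq: "(\<Sum>i\<in>I. poly (R - D) (d i) / (\<Prod>j\<in>I - {i}. d i - d j)) = (\<Sum>i\<in>I. poly R (d i) / (\<Prod>j\<in>I - {i}. d i - d j))"
      by simp
    show ?thesis
    proof (cases "degree R = 0")
      case True
      then have "card I = 0" using False by simp
      then show ?thesis using I by simp
    next
      case False
      then have "degree (R - D) < degree R"
        using D by (intro degree_lessI) (auto simp: coeff_eq_0 le_less)
      then show ?thesis using less.hyps[of "R - D"] closed cD less.prems eq by auto
    qed
  qed
qed

lemma app_lie: "app (lie f g) x = app f (app g x) - app g (app f x)"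
  by (simp add: lie_def)

lemma rvar_emb: "rvar u = emb (Poly_Mapping.single (Poly_Mapping.single u 1) 1)"
  by (simp add: rvar_def emb_def)

lemma single_1_eq [simp]: "Poly_Mapping.single u (Suc 0) = Poly_Mapping.single w (Suc 0) \<longleftrightarrow> u = w"
  by (metis lookup_single_eq lookup_single_not_eq nat.distinct(1))

lemma rvar_eq [simp]: "rvar u = rvar w \<longleftrightarrow> u = w"
proof
  assume "rvar u = rvar w"
  then have "Poly_Mapping.single (Poly_Mapping.single u (1::nat)) (1::complex) = Poly_Mapping.single (Poly_Mapping.single w 1) 1"
    by (simp add: rvar_emb emb_eq)
  then have "Poly_Mapping.single u (1::nat) = Poly_Mapping.single w 1"
    by (metis lookup_single_eq lookup_single_not_eq zero_neq_one)
  then show "u = w" by simp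
qed simp

text \<open>\<open>gamma\<close> is minus a divided difference of the polynomial (t + r - 1)^s times
  the product of the t - (x_q + 1), at the nodes x_p: the factor q = p equals -1 at the
  node.\<close>

lemma gamma_emb: "gamma r s \<in> range emb"
proof (cases "r = 0")
  case True
  then have "gamma r s = 0" by (simp add: gamma_def)
  then show ?thesis by (metis emb_simps(3) rangeI)
next
  case False
  define d where "d p = rvar (r,p)" for p
  define R where "R = [:of_nat r - 1, 1:] ^ s * linprod (\<lambda>q. d q + 1) {1..r}"
  have dr: "d p \<in> range emb" for p by (simp add: d_def rvar_emb)
  have inj: "inj_on d {1..r}" by (rule inj_onI) (simp add: d_def)
  have tm: "(rvar (r,p) + of_nat r - 1) ^ s * (\<Prod>q\<in>{1..r} - {p}. 1 - 1 / (rvar (r,p) - rvar (r,q))) =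
      - (poly R (d p) / (\<Prod>q\<in>{1..r} - {p}. d p - d q))" if p: "p \<in> {1..r}" for p
  proof -
    have "1 - 1 / (d p - d q) = (d p - (d q + 1)) / (d p - d q)" if "q \<in> {1..r} - {p}" for q
    proof -
      have "d p - d q \<noteq> 0" using inj_onD[OF inj, of p q] that p by auto
      then show ?thesis by (simp add: divide_simps)
    qed
    then have 1: "(\<Prod>q\<in>{1..r} - {p}. 1 - 1 / (d p - d q)) = (\<Prod>q\<in>{1..r} - {p}. d p - (d q + 1)) / (\<Prod>q\<in>{1..r} - {p}. d p - d q)"
      by (simp add: prod_dividef)
    have 2: "(\<Prod>q=1..r. d p - (d q + 1)) = - (\<Prod>q\<in>{1..r} - {p}. d p - (d q + 1))"
      using prod_remove1[OF p, of "\<lambda>q. d p - (d q + 1)"] by simp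
    have 3: "poly R (d p) = (d p + of_nat r - 1) ^ s * - (\<Prod>q\<in>{1..r} - {p}. d p - (d q + 1))"
      unfolding R_def poly_mult poly_linprod 2 by (simp add: algebra_simps)
    show ?thesis unfolding d_def[symmetric] 1 3 by simp
  qed
  have "gamma r s = (\<Sum>p=1..r. - (poly R (d p) / (\<Prod>q\<in>{1..r} - {p}. d p - d q)))"
    unfolding gamma_def by (rule sum.cong[OF refl]) (rule tm)
  also have "\<dots> = - (\<Sum>p=1..r. poly R (d p) / (\<Prod>q\<in>{1..r} - {p}. d p - d q))"
    by (rule sum_negf)
  finally have "gamma r s = \<dots>" .
  moreover have "(\<Sum>p=1..r. poly R (d p) / (\<Prod>q\<in>{1..r} - {p}. d p - d q)) \<in> range emb"
  proof (rule divided_difference_emb)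
    have "R = map_poly emb ([:of_nat r - 1, 1:] ^ s * linprod (\<lambda>q. Poly_Mapping.single (Poly_Mapping.single (r,q) 1) 1 + 1) {1..r})"
    proof -
      have mult: "map_poly emb (f * g) = map_poly emb f * map_poly emb g" for f g :: "mpoly poly"
        by (rule poly_eqI) (simp add: coeff_map_poly coeff_mult emb_sum emb_simps)
      have one: "map_poly emb 1 = (1 :: ratfun poly)"
        by (rule poly_eqI) (simp add: coeff_map_poly emb_simps coeff_1)
      have lin: "map_poly emb [:x, 1:] = [:emb x, 1:]" for x :: mpoly
        by (simp add: map_poly_pCons emb_simps one_pCons[symmetric])
      have pow: "map_poly emb (f ^ k) = map_poly emb f ^ k" for f :: "mpoly poly" and k
        by (induction k) (simp_all add: mult one)
      have prod: "map_poly emb (\<Prod>x\<in>A. f x) = (\<Prod>x\<in>A. map_poly emb (f x))" for f :: "nat \<Rightarrow> mpoly poly" and A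
        by (induction A rule: infinite_finite_induct) (simp_all add: mult one)
      show ?thesis
        by (simp add: R_def linprod_def mult pow prod lin d_def rvar_emb emb_simps emb_of_nat)
    qed
    then show "coeff R k \<in> range emb" for k by (simp add: coeff_map_poly emb_simps)
  qed (use inj False dr in auto)
  ultimately show ?thesis by (auto simp flip: emb_simps)
qed

section \<open>The eigenvalues of the Gelfand invariants\<close>

text \<open>Variables may be renamed across rows as long as columns are kept: the variables within
  one row then remain distinct, which is all that the independence of a row uses.\<close>

lemma row_indep_rvar: "row_indep n (\<lambda>u. rvar (\<psi> u, snd u))"
  unfolding row_indep_def
proof (intro allI impI ballI)
  fix p c m q assume eq: "(\<Sum>q=1..p. of_int (c q) * rvar (\<psi> (p,q), snd (p,q))) = of_int m" and q: "q \<in> {1..p}"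
  let ?x = "\<lambda>q. Poly_Mapping.single (\<psi> (p,q), q) (1::nat)"
  have "emb (\<Sum>q=1..p. of_int (c q) * Poly_Mapping.single (?x q) (1::complex)) = emb (of_int m)"
    using eq by (simp add: emb_sum emb_simps emb_of_int rvar_emb)
  then have "Poly_Mapping.lookup (\<Sum>q=1..p. of_int (c q) * Poly_Mapping.single (?x q) (1::complex)) (?x q) =
      Poly_Mapping.lookup (of_int m) (?x q)"
    by (simp add: emb_eq)
  moreover have of_int: "(of_int l :: mpoly) = Poly_Mapping.single 0 (of_int l)" for l
    by (simp add: single_of_int)
  moreover have "of_int l * Poly_Mapping.single x (1::complex) = Poly_Mapping.single x (of_int l)" for l and x :: "idx \<Rightarrow>\<^sub>0 nat"
    by (simp only: of_int mult_single add_0 mult_1_right)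
  moreover have x0: "?x q \<noteq> 0" by (metis lookup_single_eq lookup_zero zero_neq_one)
  ultimately have "(\<Sum>u=1..p. Poly_Mapping.lookup (Poly_Mapping.single (?x u) (of_int (c u) :: complex)) (?x q)) =
      Poly_Mapping.lookup (Poly_Mapping.single 0 (of_int m)) (?x q)"
    by (simp only: lookup_sum)
  also have "\<dots> = 0" using x0 by (metis lookup_single_not_eq)
  also have "(\<Sum>u=1..p. Poly_Mapping.lookup (Poly_Mapping.single (?x u) (of_int (c u) :: complex)) (?x q)) =
      (\<Sum>u=1..p. if u = q then of_int (c q) else 0)"
  proof (intro sum.cong refl)
    fix u
    show "Poly_Mapping.lookup (Poly_Mapping.single (?x u) (of_int (c u) :: complex)) (?x q) = (if u = q then of_int (c q) else 0)"
      by (cases "u = q") (simp_all add: lookup_single when_def)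
  qed
  finally have "(\<Sum>u=1..p. if u = q then of_int (c q) else 0) = (0::complex)" .
  then show "c q = 0" using q by simp
qed

text \<open>The lower entries do not matter, so they are replaced one by one by the variables of row
  r in the same column. In the resulting tableau every raising numerator of rows below r has a zero
  factor, so it is a highest weight vector for gl(r), of weight x_(r,i) + i - 1.\<close>

lemma gelfand_val_universal:
  assumes "r \<le> n"
  shows "gelfand_val n rvar r s (\<lambda>_. 0) = gamma r s"
proof -
  define A where "A = (SIGMA p:{1..<r}. {1..p})"
  define eS where "eS S u = rvar (if u \<in> S then r else fst u, snd u)" for S u
  have ri: "row_indep n (eS S)" for S
    unfolding eS_def by (rule row_indep_rvar[of n "\<lambda>u. if u \<in> S then r else fst u"])
  have fin: "finite A" by (simp add: A_def)
  have "gelfand_val n (eS S) r s (\<lambda>_. 0) = gelfand_val n rvar r s (\<lambda>_. 0)" if "finite S" "S \<subseteq> A" for S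
    using that
  proof (induction S)
    case empty
    have "eS {} = rvar" by (simp add: eS_def fun_eq_iff)
    then show ?case by simp
  next
    case (insert u S)
    obtain p q where u: "u = (p,q)" "p \<in> {1..<r}" "q \<in> {1..p}" using insert by (auto simp: A_def)
    have eq: "eS (insert u S) = (eS S)((p,q) := rvar (r,q))" by (auto simp: eS_def u fun_eq_iff)
    have "gelfand_val n (eS (insert u S)) r s (\<lambda>_. 0) = gelfand_val n (eS S) r s (\<lambda>_. 0)"
      unfolding eq by (rule gelfand_val_entry[OF ri ri[of "insert u S", unfolded eq] assms u(2,3)])
    then show ?case using insert by simp
  qed
  from this[OF fin subset_refl] have "gelfand_val n rvar r s (\<lambda>_. 0) = gelfand_val n (eS A) r s (\<lambda>_. 0)" by simp
  also have "\<dots> = gamma r s"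
  proof -
    interpret generic_tableau n "eS A" by (rule row_indep_generic[OF ri])
    define z :: zvec where "z = (\<lambda>_. 0)"
    have W: "W z p q = rvar (r,q)" if "p \<in> {1..r}" "q \<in> {1..p}" for p q
      using that by (auto simp: ent_def eS_def A_def z_def)
    have e0: "app (eop n (eS A) p) (T z) = 0" if p: "1 \<le> p" "p < r" for p
    proof -
      have "cup n (eS A) p q z = 0" if q: "q \<in> {1..p}" for q
      proof -
        \<comment> \<open>Rows p and p + 1 hold the same variable in column q.\<close>
        have "W z p q - W z (p + 1) q = 0" using p q by (simp add: W)
        then have "(\<Prod>u=1..p+1. W z p q - W z (p + 1) u) = 0" using q by (intro prod_zero) auto
        then show ?thesis by (simp add: cf_def)
      qed
      then show ?thesis by (simp add: eop_def)
    qed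
    have up: "app (E i j) (T z) = 0" if "i \<in> {1..r}" "j \<in> {1..r}" "i < j" for i j
      using that(3,2)
    proof (induction j rule: less_induct_step)
      case base
      then show ?case using that by (simp add: E_simps e0)
    next
      case (step j)
      then show ?case using that by (simp add: E_simps app_lie e0)
    qed
    define l where "l i = rvar (r,i) + of_nat i - 1" for i
    have diag: "app (E i i) (T z) = scale (l i) (T z)" if i: "i \<in> {1..r}" for i
    proof -
      have "wt n (eS A) i z = (\<Sum>q=1..i. rvar (r,q) + of_nat q - 1) - (\<Sum>q=1..i-1. rvar (r,q) + of_nat q - 1)"
        unfolding wt_def using i by (intro arg_cong2[where f = "(-)"] sum.cong) (auto simp: W)
      also have "\<dots> = l i" using i by (cases i) (simp_all add: l_def)
      finally show ?thesis by (simp add: E_simps hop_def)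
    qed
    have "app (gelfand (gE n (eS A)) r s) (T z) = scale (\<Sum>i=1..r. hwc r l s i) (T z)"
    proof -
      have "app (mpow (gE n (eS A)) r s i i) (T z) = scale (hwc r l s i) (T z)" if "i \<in> {1..r}" for i
        using mpow_highest_weight[OF gl_rep_axioms assms up diag that that] by (simp add: gE_def)
      then show ?thesis by (simp add: gelfand_def app_sum_left single_sum)
    qed
    then have "gelfand_val n (eS A) r s z = (\<Sum>i=1..r. hwc r l s i)"
      by (simp add: gelfand_val_def)
    also have "\<dots> = (\<Sum>p=1..r. (l p + of_nat r - of_nat p) ^ s * pp (\<lambda>p. l p + of_nat r - of_nat p) r 1 p)"
      by (rule hwc_sum) (auto simp: inj_on_def l_def)
    also have "\<dots> = gamma r s"
      unfolding gamma_def by (intro sum.cong refl) (simp add: l_def pp_def add_diff_eq)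
    finally show ?thesis by (simp add: z_def)
  qed
  finally show ?thesis .
qed

section \<open>Substitution into polynomials with complex coefficients\<close>

definition monom_val :: "(idx \<Rightarrow> 'a::comm_ring_1) \<Rightarrow> (idx \<Rightarrow>\<^sub>0 nat) \<Rightarrow> 'a" where
  "monom_val g m = (\<Prod>u\<in>Poly_Mapping.keys m. g u ^ Poly_Mapping.lookup m u)"

lemma monom_val_superset:
  assumes "finite A" "Poly_Mapping.keys m \<subseteq> A"
  shows "monom_val g m = (\<Prod>u\<in>A. g u ^ Poly_Mapping.lookup m u)"
  unfolding monom_val_def using assms by (intro prod.mono_neutral_left) (auto simp: in_keys_iff)

lemma monom_val_add: "monom_val g (m + m') = monom_val g m * monom_val g m'"
proof -
  let ?A = "Poly_Mapping.keys m \<union> Poly_Mapping.keys m'"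
  have "finite ?A" "Poly_Mapping.keys (m + m') \<subseteq> ?A" using keys_add[of m m'] by auto
  then show ?thesis by (simp add: monom_val_superset[of ?A] lookup_add power_add prod.distrib)
qed

lemma monom_val_single: "monom_val g (Poly_Mapping.single u 1) = g u"
  by (simp add: monom_val_def del: One_nat_def)

locale complex_embedding =
  fixes \<iota> :: "complex \<Rightarrow> 'l::field_char_0"
  assumes iota_hom: "\<iota> (c + d) = \<iota> c + \<iota> d" "\<iota> (c * d) = \<iota> c * \<iota> d" "\<iota> 1 = 1"
begin

lemma alg_hom_monom_val: "alg_hom \<iota> (monom_val g)"
  by unfold_locales (simp_all add: iota_hom monom_val_add mult.commute, simp add: monom_val_def)

abbreviation subst :: "(idx \<Rightarrow> 'l) \<Rightarrow> mpoly \<Rightarrow> 'l" where "subst g \<equiv> alg_ext \<iota> (monom_val g)"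

lemma idom_hom_subst: "idom_hom (subst g)"
  by (intro idom_hom.intro alg_hom.ext_add alg_hom.ext_mult alg_hom.ext_1 alg_hom_monom_val)

lemma subst_var: "subst g (Poly_Mapping.single (Poly_Mapping.single u 1) 1) = g u"
  unfolding alg_hom.ext_single[OF alg_hom_monom_val] monom_val_single by (simp add: iota_hom)

lemma subst_const: "subst g (Poly_Mapping.single 0 c) = \<iota> c"
  by (simp add: alg_hom.ext_single[OF alg_hom_monom_val] monom_val_def)

text \<open>The universal tableau, with all entries variables and shift 0, specializes to the
  tableau z when its variables are replaced by the actual entries; the translation by z matches the
  shifts. A polynomial eigenvalue specializes without any restriction.\<close>

lemma gelfand_eigenvalue:
  assumes "generic_tableau n e" "r \<le> n" "gamma r s = emb P"
  shows "app (gelfand (gE n e) r s) (T z) = Poly_Mapping.single z (subst (\<lambda>u. ent n e z (fst u) (snd u)) P)"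
proof -
  interpret generic_tableau n e by fact
  let ?g = "\<lambda>u. ent n e z (fst u) (snd u)"
  interpret H: idom_hom "subst ?g" by (rule idom_hom_subst)
  interpret S: specialization "frac_rel (subst ?g)" by (rule H.specialization)
  interpret tableau_transfer "frac_rel (subst ?g)" n rvar e "\<lambda>y u. y u + z u" "\<lambda>_. id"
  proof (rule tableau_transferI[OF H.specialization])
    fix p q y
    have v: "frac_rel (subst ?g) (rvar (p,q)) (ent n e z p q)"
      using H.frac_rel_Fract1[of "Poly_Mapping.single (Poly_Mapping.single (p,q) 1) 1"] unfolding rvar_def subst_var by simp
    show "frac_rel (subst ?g) (ent n rvar y p q) (ent n e (\<lambda>u. y u + z u) p q)"
      using v S.R_add[OF v S.R_of_int[of "y (p,q)"]] by (auto simp: ent_def algebra_simps)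
  qed
  have ri: "row_indep n rvar" using row_indep_rvar[of n fst] by simp
  let ?z = "\<lambda>_. 0 :: int"
  have "app (gelfand (gE n rvar) r s) (T ?z) = Poly_Mapping.single ?z (emb P)"
    using gelfand_diag_val[OF ri assms(2), of s] gelfand_val_universal[OF assms(2), of s] assms(3) by simp
  from RO_eigen[OF RO_gelfand[OF assms(2)] this] obtain \<nu> where
    "frac_rel (subst ?g) (emb P) \<nu>" "app (gelfand (gE n e) r s) (T z) = Poly_Mapping.single z \<nu>"
    by auto
  moreover have "frac_rel (subst ?g) (emb P) (subst ?g P)"
    unfolding emb_def by (rule H.frac_rel_Fract1)
  ultimately show ?thesis using H.frac_rel_unique by blast
qed

end

section \<open>Representations of the free algebra\<close>

definition scal :: "'c \<Rightarrow> ('b, 'c::comm_ring_1) lop" where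
  "scal c = diag_op (\<lambda>_. c)"

lemma app_scal [simp]: "app (scal c) x = scale c x"
proof -
  have "app (scal c) x = lin_extend (\<lambda>z. Poly_Mapping.single z c) x"
    by (simp add: scal_def diag_op_def app_lop_of)
  also have "\<dots> = scale c x"
    by (rule lin_extend_unique[symmetric]) (simp_all add: scale_add mult.commute)
  finally show ?thesis .
qed

lemma lop_eqI': "(\<And>x. app f x = app g x) \<Longrightarrow> f = g"
  by (rule lop_eqI) simp

definition wordop :: "(nat \<Rightarrow> nat \<Rightarrow> 'a::monoid_mult) \<Rightarrow> gl_word \<Rightarrow> 'a" where
  "wordop E w = prod_list (map (\<lambda>(r,s). E r s) (letters w))"

lemma app_wordop: "app (wordop E w) x = foldr (\<lambda>(r,s). app (E r s)) (letters w) x"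
proof -
  have "app (prod_list (map (\<lambda>(r,s). E r s) l)) x = foldr (\<lambda>(r,s). app (E r s)) l x" for l
    by (induction l) auto
  then show ?thesis by (simp add: wordop_def)
qed

definition rep :: "(complex \<Rightarrow> 'k) \<Rightarrow> (nat \<Rightarrow> nat \<Rightarrow> ('b, 'k) lop) \<Rightarrow> gl_free \<Rightarrow> ('b, 'k::comm_ring_1) lop" where
  "rep \<kappa> E = alg_ext (\<lambda>c. scal (\<kappa> c)) (wordop E)"

lemma app_rep: "app (rep \<kappa> E f) x = free_act (\<lambda>c. scale (\<kappa> c)) (\<lambda>r s. app (E r s)) f x"
  by (simp add: rep_def alg_ext_def free_act_def app_sum_left app_wordop)

context complex_embedding
begin

lemma alg_hom_wordop: "alg_hom (\<lambda>c. scal (\<iota> c)) (wordop (E :: nat \<Rightarrow> nat \<Rightarrow> ('b, 'l) lop))"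
  by unfold_locales
    (auto intro!: lop_eqI' simp: iota_hom scale_left_add scale_scale app_scale mult.commute wordop_def zero_gl_word_def plus_gl_word_def)

lemmas rep_hom = alg_hom.ext_add[OF alg_hom_wordop, folded rep_def] alg_hom.ext_mult[OF alg_hom_wordop, folded rep_def]
  alg_hom.ext_0[OF alg_hom_wordop, folded rep_def] alg_hom.ext_1[OF alg_hom_wordop, folded rep_def]
  alg_hom.ext_diff[OF alg_hom_wordop, folded rep_def] alg_hom.ext_uminus[OF alg_hom_wordop, folded rep_def]
  alg_hom.ext_sum[OF alg_hom_wordop, folded rep_def]

lemma rep_single: "rep \<iota> E (Poly_Mapping.single w c) = scal (\<iota> c) * wordop E w"
  unfolding rep_def by (rule alg_hom.ext_single[OF alg_hom_wordop])

lemma iota_0: "\<iota> 0 = 0"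
  using iota_hom(1)[of 0 0] by simp

lemma scal_1: "scal (1::'l) = (1 :: ('b, 'l) lop)"
  by (rule lop_eqI') simp

lemma rep_Efree: "rep \<iota> E (Efree r s) = (E r s :: ('b, 'l) lop)"
  by (simp add: Efree_def rep_single iota_hom scal_1 wordop_def)

lemma rep_scalar: "rep \<iota> E (Poly_Mapping.single 0 c) = (scal (\<iota> c) :: ('b, 'l) lop)"
  by (simp add: rep_single wordop_def zero_gl_word_def)

lemma rep_relator:
  fixes E :: "nat \<Rightarrow> nat \<Rightarrow> ('b, 'l) lop"
  assumes "gl_rep n E" "f \<in> gl_relators n"
  shows "rep \<iota> E f = 0"
proof -
  obtain r s p q where f: "f = Efree r s * Efree p q - Efree p q * Efree r s
       - ((if s = p then Efree r q else 0) - (if q = r then Efree p s else 0))" and "{r, s, p, q} \<subseteq> {1..n}"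
    using assms(2) unfolding gl_relators_def by blast
  then have "lie (E r s) (E p q) = (if s = p then E r q else 0) - (if q = r then E p s else 0)"
    using gl_rep.gl[OF assms(1)] by auto
  then show ?thesis by (simp add: f rep_hom rep_Efree lie_def)
qed

text \<open>c_rs is a sum over closed paths of length s, and entries of matrix powers are sums over
  open paths, from which the last step is split off. For s = 0 the single empty list would give 1
  instead of the trace r.\<close>

lemma rep_c_free:
  fixes E :: "nat \<Rightarrow> nat \<Rightarrow> ('b, 'l) lop"
  assumes "1 \<le> s"
  shows "rep \<iota> E (c_free r s) = gelfand E r s"
proof -
  define L where "L s = {xs. length xs = s \<and> set xs \<subseteq> {1..r}}" for s
  have fin: "finite (L s)" for s
    unfolding L_def using finite_lists_length_eq[of "{1..r}" s] by (simp add: conj_commute)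
  have path: "(\<Sum>xs\<in>L s. wordop E (GW (zip (i # xs) (xs @ [j])))) = mpow E r (Suc s) i j"
    if "i \<in> {1..r}" for i j s
  proof (induction s arbitrary: j)
    case 0
    have "L 0 = {[]}" by (auto simp: L_def)
    then show ?case using that by (simp add: wordop_def if_distrib[where f = "\<lambda>x. x * _"] cong: if_cong)
  next
    case (Suc s)
    have LS: "L (Suc s) = (\<lambda>(xs, l). xs @ [l]) ` (L s \<times> {1..r})"
    proof (rule equalityI; rule subsetI)
      fix ys assume ys: "ys \<in> L (Suc s)"
      then obtain xs l where "ys = xs @ [l]" by (cases ys rule: rev_cases) (auto simp: L_def)
      then show "ys \<in> (\<lambda>(xs, l). xs @ [l]) ` (L s \<times> {1..r})" using ys by (auto simp: L_def)
    qed (auto simp: L_def)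
    have inj: "inj_on (\<lambda>(xs, l). xs @ [l]) (L s \<times> {1..r})" by (auto simp: inj_on_def)
    have "(\<Sum>ys\<in>L (Suc s). wordop E (GW (zip (i # ys) (ys @ [j])))) =
      (\<Sum>(xs, l)\<in>L s \<times> {1..r}. wordop E (GW (zip (i # xs) (xs @ [l]))) * E l j)"
      unfolding LS by (subst sum.reindex[OF inj]) (auto intro!: sum.cong simp: wordop_def zip_append[of "i # _" "_ @ [_]", simplified])
    also have "\<dots> = (\<Sum>l=1..r. (\<Sum>xs\<in>L s. wordop E (GW (zip (i # xs) (xs @ [l])))) * E l j)"
      by (simp only: sum.cartesian_product[symmetric] sum_distrib_right) (rule sum.swap)
    also have "\<dots> = mpow E r (Suc (Suc s)) i j" unfolding Suc.IH by simp
    finally show ?case .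
  qed
  obtain s' where s: "s = Suc s'" using assms by (cases s) auto
  have LS: "L s = (\<lambda>(i, xs). i # xs) ` ({1..r} \<times> L s')"
    unfolding s by (auto simp: L_def length_Suc_conv image_iff)
  have inj: "inj_on (\<lambda>(i, xs). i # xs) ({1..r} \<times> L s')" by (auto simp: inj_on_def)
  have "rep \<iota> E (c_free r s) = (\<Sum>is\<in>L s. wordop E (GW (zip is (rotate1 is))))"
    unfolding c_free_def rep_hom L_def[symmetric] by (simp add: rep_single iota_hom scal_1)
  also have "\<dots> = (\<Sum>(i, xs)\<in>{1..r} \<times> L s'. wordop E (GW (zip (i # xs) (xs @ [i]))))"
    unfolding LS by (subst sum.reindex[OF inj]) (auto intro!: sum.cong)
  also have "\<dots> = (\<Sum>i=1..r. \<Sum>xs\<in>L s'. wordop E (GW (zip (i # xs) (xs @ [i]))))"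
    by (simp add: sum.cartesian_product)
  also have "\<dots> = gelfand E r s"
    unfolding gelfand_def s by (intro sum.cong refl path)
  finally show ?thesis .
qed

end

lemma (in tableau_transfer) RO_rep:
  assumes "\<And>c. R (\<kappa> c) (\<kappa>' c)" "\<forall>w\<in>Poly_Mapping.keys f. set (letters w) \<subseteq> {1..n} \<times> {1..n}"
  shows "RO (rep \<kappa> (gE n e) f) (rep \<kappa>' (gE n e') f)"
proof -
  have "RO (prod_list (map (\<lambda>(r,s). gE n e r s) l)) (prod_list (map (\<lambda>(r,s). gE n e' r s) l))"
    if "set l \<subseteq> {1..n} \<times> {1..n}" for l
    using that by (induction l) (auto intro!: RO_1 RO_mult RO_gE)
  moreover have "RO (scal (\<kappa> c)) (scal (\<kappa>' c))" for c
    unfolding scal_def by (rule RO_diag) (rule assms(1))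
  ultimately show ?thesis
    unfolding rep_def alg_ext_def wordop_def using assms(2) by (intro RO_sum RO_mult) auto
qed

section \<open>The operators of the definitions\<close>

definition ea :: "nat \<Rightarrow> (nat \<Rightarrow> complex) \<Rightarrow> idx \<Rightarrow> ratfun" where
  "ea n a u = (if fst u = n then rconst (a (snd u)) else rvar u)"

lemma entry_ent: "entry n a z r s = ent n (ea n a) z r s"
  by (simp add: entry_def ent_def ea_def)

lemma E_ops_app: "E_up n a p = app (eop n (ea n a) p)" "E_down n a p = app (fop n (ea n a) p)" "E_diag n a p = app (hop n (ea n a) p)"
  unfolding E_up_def E_down_def E_diag_def eop_def fop_def hop_def shop_def diag_op_def app_lop_of entry_ent cf_def wt_def
  by (simp_all add: sum_negf[symmetric] single_uminus[symmetric])

lemma E_gen_app: "E_gen n a r s = app (gE n (ea n a) r s)"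
proof -
  have "E_up_far n a r d = app (up_far lie (eop n (ea n a)) r d)" for r d
    by (induction d) (auto simp: E_ops_app commutator_def app_lie fun_eq_iff)
  moreover have "E_down_far n a s d = app (down_far lie (fop n (ea n a)) s d)" for s d
    by (induction d) (auto simp: E_ops_app commutator_def app_lie fun_eq_iff)
  ultimately show ?thesis by (simp add: E_gen_def gE_def mat_unit_def E_ops_app)
qed

lemma gen_act_app: "gen_act n a f x = app (rep rconst (gE n (ea n a)) f) x"
proof -
  have "E_gen n a = (\<lambda>r s. app (gE n (ea n a) r s))" by (simp add: fun_eq_iff E_gen_app)
  then show ?thesis by (simp add: gen_act_def app_rep)
qed

lemma rconst_emb: "rconst c = emb (Poly_Mapping.single 0 c)"
  by (simp add: rconst_def emb_def)

lemma complex_embedding_rconst: "complex_embedding rconst"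
  by unfold_locales (simp_all add: rconst_emb single_add mult_single emb_simps flip: emb_simps)

lemma complex_embedding_id: "complex_embedding (\<lambda>c. c)"
  by unfold_locales simp_all

section \<open>Evaluation of polynomials and rational functions at a complex point\<close>

lemma mpoly_eval_alg_ext: "mpoly_eval p v = alg_ext (\<lambda>c. c) (monom_val v) p"
  by (simp add: mpoly_eval_def alg_ext_def monom_val_def)

lemma idom_hom_eval: "idom_hom (\<lambda>p. mpoly_eval p v)"
  unfolding mpoly_eval_alg_ext by (rule complex_embedding.idom_hom_subst[OF complex_embedding_id])

lemma mpoly_eval_simps: "mpoly_eval (p + q) v = mpoly_eval p v + mpoly_eval q v"
  "mpoly_eval (p * q) v = mpoly_eval p v * mpoly_eval q v" "mpoly_eval 1 v = 1"
  using idom_hom_eval[of v] by (auto simp: idom_hom_def)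

lemma mpoly_eval_var: "mpoly_eval (Poly_Mapping.single (Poly_Mapping.single u 1) 1) v = v u"
  unfolding mpoly_eval_alg_ext by (rule complex_embedding.subst_var[OF complex_embedding_id])

lemma mpoly_eval_const: "mpoly_eval (Poly_Mapping.single 0 c) v = c"
  unfolding mpoly_eval_alg_ext by (rule complex_embedding.subst_const[OF complex_embedding_id])

abbreviation rv :: "(idx \<Rightarrow> complex) \<Rightarrow> ratfun \<Rightarrow> complex \<Rightarrow> bool" where
  "rv v \<equiv> frac_rel (\<lambda>p. mpoly_eval p v)"

lemma regular_at_rv: "regular_at f v \<longleftrightarrow> (\<exists>b. rv v f b)"
  by (auto simp: regular_at_def frac_rel_def)

lemma rf_eval_rv:
  assumes "rv v f b" shows "rf_eval f v = b"
  unfolding rf_eval_def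
proof (rule the_equality)
  show "\<exists>p q. f = Fract p q \<and> mpoly_eval q v \<noteq> 0 \<and> b = mpoly_eval p v / mpoly_eval q v"
    using assms unfolding frac_rel_def .
  fix c assume "\<exists>p q. f = Fract p q \<and> mpoly_eval q v \<noteq> 0 \<and> c = mpoly_eval p v / mpoly_eval q v"
  then have "rv v f c" unfolding frac_rel_def .
  then show "c = b" using assms by (rule idom_hom.frac_rel_unique[OF idom_hom_eval])
qed

section \<open>Restriction to a line through the singular point\<close>

text \<open>A power series modulo t^2. Along the line used below, the two numbers are the value and
  the derivation D of a regular function.\<close>

definition jet :: "complex fls \<Rightarrow> complex \<Rightarrow> complex \<Rightarrow> bool" where
  "jet g c d \<longleftrightarrow> (\<exists>G. g = fps_to_fls G \<and> fps_nth G 0 = c \<and> fps_nth G 1 = d)"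

lemma jet_add: "jet g c d \<Longrightarrow> jet h c' d' \<Longrightarrow> jet (g + h) (c + c') (d + d')"
  unfolding jet_def by (metis fps_to_fls_plus fps_add_nth)

lemma jet_mult: "jet g c d \<Longrightarrow> jet h c' d' \<Longrightarrow> jet (g * h) (c * c') (c * d' + d * c')"
  unfolding jet_def by (metis fls_times_fps_to_fls fps_mult_nth_0 fps_mult_nth_1)

lemma jet_const: "jet (fls_const c) c 0"
  unfolding jet_def by (intro exI[of _ "fps_const c"]) simp

lemma jet_X: "jet fls_X 0 1"
  unfolding jet_def by (intro exI[of _ fps_X]) simp

lemma jet_inverse:
  assumes "jet h c d" "c \<noteq> 0" shows "jet (inverse h) (inverse c) (- d / c\<^sup>2)"
proof -
  obtain H where H: "h = fps_to_fls H" "fps_nth H 0 = c" "fps_nth H 1 = d" using assms by (auto simp: jet_def)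
  have "subdegree H = 0" using H assms(2) by (simp add: subdegree_eq_0)
  then have "inverse h = fps_to_fls (inverse H)" using H by (simp add: fls_inverse_fps_to_fls)
  moreover have 0: "fps_nth (inverse H) 0 = inverse c" using H by simp
  moreover have "fps_nth (inverse H) 1 = - d / c\<^sup>2"
  proof -
    have "fps_nth (H * inverse H) 1 = 0" using H assms(2) by (simp add: inverse_mult_eq_1')
    then have "c * fps_nth (inverse H) 1 + d * inverse c = 0" using 0 H by (simp add: fps_mult_nth_1)
    then show ?thesis using assms(2) by (simp add: field_simps power2_eq_square eq_neg_iff_add_eq_0)
  qed
  ultimately show ?thesis unfolding jet_def by blast
qed

lemma jet_nth:
  assumes "jet g c d" shows "fls_nth g 0 = c" "fls_nth g 1 = d" "m < 0 \<Longrightarrow> fls_nth g m = 0"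
proof -
  obtain G where G: "g = fps_to_fls G" "fps_nth G 0 = c" "fps_nth G 1 = d" using assms by (auto simp: jet_def)
  show "fls_nth g 0 = c" "fls_nth g 1 = d" "m < 0 \<Longrightarrow> fls_nth g m = 0" using G by (simp_all add: fps_to_fls_nth)
qed

definition holo :: "complex fls \<Rightarrow> bool" where "holo g \<longleftrightarrow> (\<exists>c d. jet g c d)"

lemma holo_fps: "holo g \<longleftrightarrow> (\<exists>G. g = fps_to_fls G)"
  by (auto simp: holo_def jet_def)

lemma holo_add: "holo g \<Longrightarrow> holo h \<Longrightarrow> holo (g + h)"
  and holo_mult: "holo g \<Longrightarrow> holo h \<Longrightarrow> holo (g * h)"
  and holo_0: "holo 0"
  using jet_add jet_mult jet_const[of 0] unfolding holo_def by (blast, blast, force)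

lemma holo_sum: "(\<And>x. x \<in> A \<Longrightarrow> holo (f x)) \<Longrightarrow> holo (sum f A)"
  by (induction A rule: infinite_finite_induct) (auto intro: holo_0 holo_add)

lemma mpoly_induct:
  assumes const: "\<And>c. P (Poly_Mapping.single 0 c)"
    and var: "\<And>u. P (Poly_Mapping.single (Poly_Mapping.single u 1) 1)"
    and add: "\<And>p q. P p \<Longrightarrow> P q \<Longrightarrow> P (p + q)" and mult: "\<And>p q. P p \<Longrightarrow> P q \<Longrightarrow> P (p * q)"
  shows "P (p :: mpoly)"
proof -
  have pow: "P (Poly_Mapping.single (Poly_Mapping.single u k) 1)" for u k
  proof (induction k)
    case 0
    then show ?case using const[of 1] by simp
  next
    case (Suc k)
    have "Poly_Mapping.single (Poly_Mapping.single u (Suc k)) (1::complex) =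
      Poly_Mapping.single (Poly_Mapping.single u k) 1 * Poly_Mapping.single (Poly_Mapping.single u 1) 1"
      by (simp add: mult_single single_add[symmetric])
    then show ?case using mult[OF Suc var] by simp
  qed
  have "P (Poly_Mapping.single (\<Sum>u\<in>A. Poly_Mapping.single u (k u)) 1)" for A k
  proof (induction A rule: infinite_finite_induct)
    case (insert x F)
    have "Poly_Mapping.single (\<Sum>u\<in>insert x F. Poly_Mapping.single u (k u)) (1::complex) =
      Poly_Mapping.single (Poly_Mapping.single x (k x)) 1 * Poly_Mapping.single (\<Sum>u\<in>F. Poly_Mapping.single u (k u)) 1"
      using insert by (simp add: mult_single)
    then show ?case using mult[OF pow insert(3)] by simp
  qed (use const[of 1] in auto)
  then have mono: "P (Poly_Mapping.single m 1)" for m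
    by (metis poly_mapping_sum_singles)
  have tm: "P (Poly_Mapping.single m c)" for m c
    using mult[OF const[of c] mono[of m]] by (simp add: mult_single)
  have "P (\<Sum>m\<in>A. Poly_Mapping.single m (c m))" for A c
    by (induction A rule: infinite_finite_induct) (use tm const[of 0] in \<open>auto intro: add\<close>)
  then show ?thesis by (metis poly_mapping_sum_singles)
qed

definition line :: "nat \<Rightarrow> nat \<Rightarrow> nat \<Rightarrow> (idx \<Rightarrow> complex) \<Rightarrow> idx \<Rightarrow> complex fls" where
  "line k i j v u = fls_const (v u) + (if u = (k,i) then fls_const (1/2) * fls_X else if u = (k,j) then - fls_const (1/2) * fls_X else 0)"

lemma complex_embedding_fls: "complex_embedding fls_const"
  by unfold_locales (simp_all add: fls_plus_const)

abbreviation lsub :: "nat \<Rightarrow> nat \<Rightarrow> nat \<Rightarrow> (idx \<Rightarrow> complex) \<Rightarrow> mpoly \<Rightarrow> complex fls" where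
  "lsub k i j v \<equiv> alg_ext fls_const (monom_val (line k i j v))"

lemma idom_hom_lsub: "idom_hom (lsub k i j v)"
  by (rule complex_embedding.idom_hom_subst[OF complex_embedding_fls])

text \<open>The sum and product rules for derivatives and for jets are the same, so the claim passes
  from constants and variables to all polynomials. Differentiability is carried along because
  \<open>deriv\<close> is meaningful only where the derivative exists.\<close>

lemma lsub_jet:
  assumes "i \<noteq> j"
  shows "\<exists>d1 d2. ((\<lambda>t. mpoly_eval p (v((k,i) := t))) has_field_derivative d1) (at (v (k,i))) \<and>
    ((\<lambda>t. mpoly_eval p (v((k,j) := t))) has_field_derivative d2) (at (v (k,j))) \<and>
    jet (lsub k i j v p) (mpoly_eval p v) ((d1 - d2) / 2)"
proof (induction p rule: mpoly_induct)
  case (1 c)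
  have "lsub k i j v (Poly_Mapping.single 0 c) = fls_const c"
    by (rule complex_embedding.subst_const[OF complex_embedding_fls])
  then show ?case using jet_const[of c] by (intro exI[of _ 0]) (simp add: mpoly_eval_const)
next
  case (2 u)
  have l: "lsub k i j v (Poly_Mapping.single (Poly_Mapping.single u 1) 1) = line k i j v u"
    by (rule complex_embedding.subst_var[OF complex_embedding_fls])
  have "jet (line k i j v u) (v u) (((if u = (k,i) then 1 else 0) - (if u = (k,j) then 1 else 0)) / 2)"
    using assms jet_add[OF jet_const[of "v u"] jet_mult[OF jet_const jet_X]] jet_const[of "v u"] jet_const[of 0]
      jet_add[OF jet_const[of "v u"] jet_mult[OF jet_const[of "- (1/2)"] jet_X]]
    by (auto simp: line_def)
  then show ?case unfolding l mpoly_eval_var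
    by - (rule exI[of _ "if u = (k,i) then 1 else 0"], rule exI[of _ "if u = (k,j) then 1 else 0"], auto intro!: derivative_eq_intros)
next
  case (3 p q)
  then obtain a b c d where *: "((\<lambda>t. mpoly_eval p (v((k,i) := t))) has_field_derivative a) (at (v (k,i)))"
    "((\<lambda>t. mpoly_eval p (v((k,j) := t))) has_field_derivative b) (at (v (k,j)))"
    "jet (lsub k i j v p) (mpoly_eval p v) ((a - b) / 2)"
    "((\<lambda>t. mpoly_eval q (v((k,i) := t))) has_field_derivative c) (at (v (k,i)))"
    "((\<lambda>t. mpoly_eval q (v((k,j) := t))) has_field_derivative d) (at (v (k,j)))"
    "jet (lsub k i j v q) (mpoly_eval q v) ((c - d) / 2)" by blast
  have e: "(a - b) / 2 + (c - d) / 2 = (a + c - (b + d)) / 2" by (simp add: field_simps)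
  show ?case
    using jet_add[OF *(3,6), unfolded e] idom_hom.hom_add[OF idom_hom_lsub, of k i j v p q] DERIV_add[OF *(1,4)] DERIV_add[OF *(2,5)]
    by - (rule exI[of _ "a + c"], rule exI[of _ "b + d"], simp add: mpoly_eval_simps del: fun_upd_apply)
next
  case (4 p q)
  then obtain a b c d where *: "((\<lambda>t. mpoly_eval p (v((k,i) := t))) has_field_derivative a) (at (v (k,i)))"
    "((\<lambda>t. mpoly_eval p (v((k,j) := t))) has_field_derivative b) (at (v (k,j)))"
    "jet (lsub k i j v p) (mpoly_eval p v) ((a - b) / 2)"
    "((\<lambda>t. mpoly_eval q (v((k,i) := t))) has_field_derivative c) (at (v (k,i)))"
    "((\<lambda>t. mpoly_eval q (v((k,j) := t))) has_field_derivative d) (at (v (k,j)))"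
    "jet (lsub k i j v q) (mpoly_eval q v) ((c - d) / 2)" by blast
  have "jet (lsub k i j v (p * q)) (mpoly_eval p v * mpoly_eval q v)
      ((a * mpoly_eval q v + c * mpoly_eval p v - (b * mpoly_eval q v + d * mpoly_eval p v)) / 2)"
  proof -
    have e: "mpoly_eval p v * ((c - d) / 2) + (a - b) / 2 * mpoly_eval q v =
        (a * mpoly_eval q v + c * mpoly_eval p v - (b * mpoly_eval q v + d * mpoly_eval p v)) / 2"
      by (simp add: field_simps)
    show ?thesis
      using jet_mult[OF *(3,6), unfolded e] idom_hom.hom_mult[OF idom_hom_lsub, of k i j v p q] by simp
  qed
  then show ?case using DERIV_mult[OF *(1,4)] DERIV_mult[OF *(2,5)]
    by - (rule exI[of _ "a * mpoly_eval q v + c * mpoly_eval p v"], rule exI[of _ "b * mpoly_eval q v + d * mpoly_eval p v"], simp add: mpoly_eval_simps del: fun_upd_apply)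
qed

lemma partial_deriv_Fract:
  assumes "((\<lambda>t. mpoly_eval p (v(u := t))) has_field_derivative a) (at (v u))"
    "((\<lambda>t. mpoly_eval q (v(u := t))) has_field_derivative b) (at (v u))" and q: "mpoly_eval q v \<noteq> 0"
  shows "partial_deriv (Fract p q) u v = (a * mpoly_eval q v - mpoly_eval p v * b) / (mpoly_eval q v)\<^sup>2"
proof -
  have "((\<lambda>t. mpoly_eval p (v(u := t)) / mpoly_eval q (v(u := t))) has_field_derivative
      (a * mpoly_eval q v - mpoly_eval p v * b) / (mpoly_eval q v)\<^sup>2) (at (v u))"
    using DERIV_divide[OF assms(1,2)] q by (simp add: power2_eq_square)
  \<comment> \<open>\<open>rf_eval\<close> is the quotient only where the denominator does not
    vanish; by continuity this holds near the point, which suffices for the derivative.\<close>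
  moreover have "eventually (\<lambda>t. mpoly_eval q (v(u := t)) \<noteq> 0) (nhds (v u))"
    using DERIV_isCont[OF assms(2)] q tendsto_at_iff_tendsto_nhds[of "\<lambda>t. mpoly_eval q (v(u := t))" "v u"]
    by (intro tendsto_imp_eventually_ne[of _ "mpoly_eval q v"]) (simp_all add: isCont_def del: fun_upd_apply)
  then have "eventually (\<lambda>t. rf_eval (Fract p q) (v(u := t)) = mpoly_eval p (v(u := t)) / mpoly_eval q (v(u := t))) (nhds (v u))"
    by eventually_elim (intro rf_eval_rv idom_hom.frac_rel_Fract[OF idom_hom_eval])
  ultimately have "((\<lambda>t. rf_eval (Fract p q) (v(u := t))) has_field_derivative
      (a * mpoly_eval q v - mpoly_eval p v * b) / (mpoly_eval q v)\<^sup>2) (at (v u))"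
    by (subst DERIV_cong_ev[OF refl _ refl]) auto
  then show ?thesis unfolding partial_deriv_def by (rule DERIV_imp_deriv)
qed

text \<open>The quotient rule for partial derivatives and the inverse of a jet agree. This is what
  allows all values of D to be read off from Laurent series.\<close>

lemma regular_jet:
  assumes "i \<noteq> j" "regular_at f v" "frac_rel (lsub k i j v) f g"
  shows "jet g (rf_eval f v) (D_rf k i j v f)"
proof -
  obtain p q where f: "f = Fract p q" "mpoly_eval q v \<noteq> 0" using assms(2) by (auto simp: regular_at_def)
  obtain a b where p: "((\<lambda>t. mpoly_eval p (v((k,i) := t))) has_field_derivative a) (at (v (k,i)))"
    "((\<lambda>t. mpoly_eval p (v((k,j) := t))) has_field_derivative b) (at (v (k,j)))"
    "jet (lsub k i j v p) (mpoly_eval p v) ((a - b) / 2)" using lsub_jet[OF assms(1)] by blast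
  obtain c d where q: "((\<lambda>t. mpoly_eval q (v((k,i) := t))) has_field_derivative c) (at (v (k,i)))"
    "((\<lambda>t. mpoly_eval q (v((k,j) := t))) has_field_derivative d) (at (v (k,j)))"
    "jet (lsub k i j v q) (mpoly_eval q v) ((c - d) / 2)" using lsub_jet[OF assms(1)] by blast
  have "lsub k i j v q \<noteq> 0" using jet_nth(1)[OF q(3)] f by auto
  then have "g = lsub k i j v p * inverse (lsub k i j v q)"
    using assms(3) idom_hom.frac_rel_Fract[OF idom_hom_lsub] idom_hom.frac_rel_unique[OF idom_hom_lsub] f
    by (metis divide_inverse)
  moreover have "rf_eval f v = mpoly_eval p v * inverse (mpoly_eval q v)"
    unfolding f(1) using rf_eval_rv[OF idom_hom.frac_rel_Fract[OF idom_hom_eval f(2), of p]] by (simp add: divide_inverse)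
  moreover have "D_rf k i j v f = mpoly_eval p v * (- ((c - d) / 2) / (mpoly_eval q v)\<^sup>2) + (a - b) / 2 * inverse (mpoly_eval q v)"
    unfolding D_rf_def f(1) partial_deriv_Fract[OF p(1) q(1) f(2)] partial_deriv_Fract[OF p(2) q(2) f(2)]
    using f(2) by (simp add: field_simps power2_eq_square)
  ultimately show ?thesis using jet_mult[OF p(3) jet_inverse[OF q(3) f(2)]] by simp
qed

section \<open>Regularity of the matrix coefficients\<close>

lemma swap_swap [simp]: "swap k i j (swap k i j z) = z"
  by (auto simp: swap_def fun_eq_iff)

lemma swap_fixed_iff: "swap k i j z = z \<longleftrightarrow> z (k,i) = z (k,j)"
  by (auto simp: swap_def fun_eq_iff)

lemma swap_eq_iff [simp]: "swap k i j z = swap k i j z' \<longleftrightarrow> z = z'"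
  by (metis swap_swap)

locale singular_point =
  fixes n k i j :: nat and a :: "nat \<Rightarrow> complex" and v :: "idx \<Rightarrow> complex"
  assumes ij: "1 \<le> i" "i < j" "j \<le> k" "k \<le> n - 1" and v_eq: "v (k,i) = v (k,j)"
    and v_generic: "\<lbrakk>1 \<le> s; s < u; u \<le> r; r \<le> n - 1; (r, s, u) \<noteq> (k, i, j)\<rbrakk> \<Longrightarrow> v (r,s) - v (r,u) \<notin> \<int>"
begin

lemma kn: "k < n" "1 \<le> k" "i \<in> {1..k}" "j \<in> {1..k}" "i \<noteq> j"
  using ij by auto

abbreviation "A \<equiv> gE n (ea n a)"
abbreviation "\<tau> \<equiv> swap k i j"

definition val :: "zvec \<Rightarrow> nat \<Rightarrow> nat \<Rightarrow> complex" where
  "val z r s = (if r = n then a s else v (r,s) + of_int (z (r,s)))"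

interpretation Rv: specialization "rv v"
  by (rule idom_hom.specialization[OF idom_hom_eval])

lemma v_diff:
  assumes "s \<in> {1..r}" "u \<in> {1..r}" "s \<noteq> u" "r < n" "r = k \<Longrightarrow> {s,u} \<noteq> {i,j}"
  shows "v (r,s) - v (r,u) \<notin> \<int>"
proof (cases "s < u")
  case True
  then show ?thesis using assms by (intro v_generic) auto
next
  case False
  then have "v (r,u) - v (r,s) \<notin> \<int>" using assms by (intro v_generic) auto
  then show ?thesis by (metis Ints_minus minus_diff_eq)
qed

lemma val_ne:
  assumes "s \<in> {1..r}" "u \<in> {1..r}" "s \<noteq> u" "r < n" "r = k \<Longrightarrow> {s,u} \<noteq> {i,j}"
  shows "val z r s - val z r u \<noteq> 0"
proof
  assume "val z r s - val z r u = 0"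
  then have "v (r,s) - v (r,u) = of_int (z (r,u) - z (r,s))" using assms(4) by (simp add: val_def algebra_simps)
  then show False using v_diff[OF assms] by (metis Ints_of_int)
qed

lemma rv_ent: "rv v (ent n (ea n a) z r s) (val z r s)"
proof -
  have "rv v (rconst c) c" for c
    using idom_hom.frac_rel_Fract1[OF idom_hom_eval, of v "Poly_Mapping.single 0 c"] by (simp add: rconst_def mpoly_eval_const)
  moreover have "rv v (rvar u) (v u)" for u
    using idom_hom.frac_rel_Fract1[OF idom_hom_eval, of v "Poly_Mapping.single (Poly_Mapping.single u 1) 1"]
    unfolding rvar_def mpoly_eval_var .
  ultimately show ?thesis by (auto simp: ent_def ea_def val_def intro!: Rv.R_add Rv.R_of_int)
qed

definition reg :: "ratfun \<Rightarrow> bool" where "reg f \<longleftrightarrow> (\<exists>b. rv v f b)"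

lemma reg_regular: "regular_at f v \<longleftrightarrow> reg f"
  by (simp add: reg_def regular_at_rv)

lemma reg_intros: "reg f \<Longrightarrow> reg g \<Longrightarrow> reg (f + g)" "reg f \<Longrightarrow> reg g \<Longrightarrow> reg (f - g)"
  "reg f \<Longrightarrow> reg g \<Longrightarrow> reg (f * g)" "reg 0" "reg 1" "reg f \<Longrightarrow> reg (- f)"
  unfolding reg_def by (metis Rv.R_add, metis Rv.R_diff, metis Rv.R_mult, metis Rv.R_0, metis Rv.R_1, metis Rv.R_uminus)

lemma reg_divide: "reg f \<Longrightarrow> rv v g b \<Longrightarrow> b \<noteq> 0 \<Longrightarrow> reg (f / g)"
  unfolding reg_def by (metis Rv.R_divide)

lemma reg_sum: "(\<And>x. x \<in> S \<Longrightarrow> reg (f x)) \<Longrightarrow> reg (sum f S)"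
  by (induction S rule: infinite_finite_induct) (auto intro: reg_intros)

lemma reg_prod: "(\<And>x. x \<in> S \<Longrightarrow> reg (f x)) \<Longrightarrow> reg (prod f S)"
  by (induction S rule: infinite_finite_induct) (auto intro: reg_intros)

lemma reg_ent: "reg (ent n (ea n a) z r s)"
  using rv_ent by (auto simp: reg_def)

definition dlt :: "zvec \<Rightarrow> ratfun" where
  "dlt z = ent n (ea n a) z k i - ent n (ea n a) z k j"

text \<open>The only factor of a denominator that can vanish at v is the difference of the two
  singular entries, and \<open>dlt z\<close> cancels it up to sign.\<close>

lemma cf_regular:
  assumes "reg \<kappa>" "p < n" "q \<in> {1..p}"
  shows "(p = k \<Longrightarrow> q \<noteq> i \<and> q \<noteq> j) \<Longrightarrow> reg (cf n (ea n a) \<kappa> p p' m q z)"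
    and "p = k \<Longrightarrow> reg (dlt z * cf n (ea n a) \<kappa> p p' m q z)"
proof -
  let ?W = "ent n (ea n a) z"
  have num: "reg (\<kappa> * (\<Prod>u=1..m. ?W p q - ?W p' u))"
    by (intro reg_intros reg_prod reg_ent assms(1))
  have den: "rv v (\<Prod>u\<in>S. ?W p q - ?W p u) (\<Prod>u\<in>S. val z p q - val z p u)" for S
    by (intro Rv.R_prod Rv.R_diff rv_ent)
  show 1: "reg (cf n (ea n a) \<kappa> p p' m q z)" if *: "p = k \<Longrightarrow> q \<noteq> i \<and> q \<noteq> j"
  proof -
    have "(\<Prod>u\<in>{1..p} - {q}. val z p q - val z p u) \<noteq> 0"
      using val_ne[of q p _ z] assms(2,3) * by (auto simp: doubleton_eq_iff)
    then show ?thesis unfolding cf_def by (rule reg_divide[OF num den])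
  qed
  assume p: "p = k"
  show "reg (dlt z * cf n (ea n a) \<kappa> p p' m q z)"
  proof (cases "q \<noteq> i \<and> q \<noteq> j")
    case True
    then show ?thesis using 1 by (auto simp: dlt_def intro!: reg_intros reg_ent)
  next
    case False
    define q' where "q' = (if q = i then j else i)"
    have q': "q' \<in> {1..p} - {q}" "{q,q'} = {i,j}" using False kn p by (auto simp: q'_def)
    define \<epsilon> :: ratfun where "\<epsilon> = (if q = i then 1 else - 1)"
    have d: "dlt z = \<epsilon> * (?W p q - ?W p q')" using False p by (auto simp: dlt_def q'_def \<epsilon>_def)
    show ?thesis
    proof (cases "?W p q - ?W p q' = 0")
      case True
      then show ?thesis using d by (simp add: reg_intros)
    next
      case nz: False
      have "(\<Prod>u\<in>{1..p} - {q}. ?W p q - ?W p u) = (?W p q - ?W p q') * (\<Prod>u\<in>{1..p} - {q} - {q'}. ?W p q - ?W p u)"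
        using q' by (intro prod.remove) auto
      then have "dlt z * cf n (ea n a) \<kappa> p p' m q z =
          \<epsilon> * (\<kappa> * (\<Prod>u=1..m. ?W p q - ?W p' u) / (\<Prod>u\<in>{1..p} - {q} - {q'}. ?W p q - ?W p u))"
        using nz by (simp add: d cf_def)
      moreover have "(\<Prod>u\<in>{1..p} - {q} - {q'}. val z p q - val z p u) \<noteq> 0"
      proof -
        have "val z p q - val z p u \<noteq> 0" if "u \<in> {1..p} - {q} - {q'}" for u
          using that q' assms(2,3) by (intro val_ne) (auto simp: doubleton_eq_iff)
        then show ?thesis by (simp add: prod_zero_iff)
      qed
      then have "reg (\<kappa> * (\<Prod>u=1..m. ?W p q - ?W p' u) / (\<Prod>u\<in>{1..p} - {q} - {q'}. ?W p q - ?W p u))"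
        by (rule reg_divide[OF num den])
      moreover have "reg \<epsilon>" by (auto simp: \<epsilon>_def intro: reg_intros)
      ultimately show ?thesis by (simp only: reg_intros(3))
    qed
  qed
qed

section \<open>Pole orders of the matrix units along x = y\<close>

definition RegOp :: "(zvec, ratfun) lop \<Rightarrow> bool" where
  "RegOp X \<longleftrightarrow> (\<forall>z z'. reg (Poly_Mapping.lookup (app X (T z)) z'))"

lemma RegOp_mult: "RegOp X \<Longrightarrow> RegOp Y \<Longrightarrow> RegOp (X * Y)"
  unfolding RegOp_def app_ops
  by (subst lookup_app[OF finite_keys subset_refl]) (auto intro!: reg_sum reg_intros)

lemma RegOp_diff: "RegOp X \<Longrightarrow> RegOp Y \<Longrightarrow> RegOp (X - Y)"
  by (simp add: RegOp_def lookup_minus reg_intros)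

lemma RegOp_shop: "(\<And>q z. q \<in> {1..p} \<Longrightarrow> reg (c q z)) \<Longrightarrow> RegOp (shop p d c)"
  by (auto simp: RegOp_def lookup_sum lookup_single when_def intro!: reg_sum reg_intros)

definition Dop :: "(zvec, ratfun) lop" where "Dop = diag_op dlt"

lemma RegOp_Dop: "RegOp Dop"
  by (auto simp: RegOp_def Dop_def dlt_def lookup_single when_def intro!: reg_intros reg_ent)

text \<open>\<open>G1\<close> holds for operators that do not move row k, \<open>G2\<close> allows a
  simple pole. A bracket of two operators with poles might have a double pole, but a matrix unit is
  an iterated bracket over distinct rows, of which at most one is k; so only brackets with a factor
  in \<open>G1\<close> occur.\<close>

definition G1 where "G1 X \<longleftrightarrow> RegOp X \<and> X * Dop = Dop * X"
definition G2 where "G2 X \<longleftrightarrow> RegOp (X * Dop)"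

lemma G1_G2: "G1 X \<Longrightarrow> G2 X"
  by (simp add: G1_def G2_def RegOp_mult RegOp_Dop)

lemma G1_lie: "G1 X \<Longrightarrow> G1 Y \<Longrightarrow> G1 (lie X Y)"
proof -
  assume G: "G1 X" "G1 Y"
  then have "X * Y * Dop = Dop * (X * Y)" "Y * X * Dop = Dop * (Y * X)"
    by (metis (no_types, lifting) G1_def mult.assoc)+
  then show ?thesis using G by (auto simp: G1_def lie_def RegOp_mult RegOp_diff algebra_simps)
qed

lemma G12_lie:
  assumes "G1 X" "G2 Y" shows "G2 (lie X Y)" "G2 (lie Y X)"
proof -
  have "X * Y * Dop = X * (Y * Dop)" "Y * X * Dop = (Y * Dop) * X"
    using assms(1) by (simp_all add: G1_def mult.assoc)
  moreover have "RegOp X" "RegOp (Y * Dop)" using assms by (auto simp: G1_def G2_def)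
  ultimately show "G2 (lie X Y)" "G2 (lie Y X)"
    by (auto simp: G2_def lie_def left_diff_distrib RegOp_mult RegOp_diff)
qed

lemma shop_commute_Dop: "p \<noteq> k \<Longrightarrow> shop p d c * Dop = Dop * shop p d c"
  using lie_diag_shop[of dlt p d c] by (simp add: dlt_def Dop_def shop_linear lie_def)

lemma G_simple:
  assumes "1 \<le> p" "p < n" "reg \<kappa>"
  shows "p \<noteq> k \<Longrightarrow> G1 (shop p d (cf n (ea n a) \<kappa> p p' m))" "G2 (shop p d (cf n (ea n a) \<kappa> p p' m))"
proof -
  show 1: "G1 (shop p d (cf n (ea n a) \<kappa> p p' m))" if "p \<noteq> k"
    using that assms by (auto simp: G1_def shop_commute_Dop intro!: RegOp_shop cf_regular(1))
  have "shop k d c * Dop = shop k d (\<lambda>q z. dlt z * c q z)" for c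
    by (rule lop_eqI) (simp add: Dop_def)
  then have "G2 (shop p d (cf n (ea n a) \<kappa> p p' m))" if "p = k"
    using that assms cf_regular(2)[of \<kappa> k] by (auto simp: G2_def intro!: RegOp_shop)
  then show "G2 (shop p d (cf n (ea n a) \<kappa> p p' m))" using 1 G1_G2 by blast
qed

lemma G_hop: "G1 (hop n (ea n a) p)"
  by (auto simp: G1_def RegOp_def hop_def wt_def Dop_def diag_op_simps mult.commute lookup_single when_def
      intro!: reg_intros reg_sum reg_ent)
    (auto simp: reg_def intro: Rv.R_of_nat)

lemma G_step:
  assumes "P \<longrightarrow> G1 X" "G2 X" "Q \<longrightarrow> G1 Y" "G2 Y" "P \<or> Q"
  shows "(P \<and> Q \<longrightarrow> G1 (lie X Y) \<and> G1 (lie Y X)) \<and> G2 (lie X Y) \<and> G2 (lie Y X)"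
  using assms by (cases P; cases Q) (simp_all add: G1_lie G12_lie)

lemma G2_A:
  assumes "r \<in> {1..n}" "s \<in> {1..n}" shows "G2 (A r s)"
proof -
  have u: "(k \<notin> {r..r+d} \<longrightarrow> G1 (up_far lie (eop n (ea n a)) r d)) \<and> G2 (up_far lie (eop n (ea n a)) r d)" if "1 \<le> r" "r + d < n" for r d
    using that
  proof (induction d)
    case 0
    then show ?case using G_simple[of r "- 1" 1] by (auto simp: eop_def reg_intros)
  next
    case (Suc d)
    define p where "p = r + d + 1"
    have "k \<noteq> p \<longrightarrow> G1 (eop n (ea n a) p)" "G2 (eop n (ea n a) p)"
      using Suc.prems G_simple[of p "- 1" "1"] by (auto simp: p_def eop_def reg_intros)
    moreover have "k \<notin> {r..r+d} \<longrightarrow> G1 (up_far lie (eop n (ea n a)) r d)" "G2 (up_far lie (eop n (ea n a)) r d)"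
      using Suc by simp_all
    moreover have "k \<notin> {r..r+d} \<or> k \<noteq> p" by (auto simp: p_def)
    ultimately have "(k \<notin> {r..r+d} \<and> k \<noteq> p \<longrightarrow> G1 (lie (up_far lie (eop n (ea n a)) r d) (eop n (ea n a) p)) \<and> G1 (lie (eop n (ea n a) p) (up_far lie (eop n (ea n a)) r d))) \<and>
        G2 (lie (up_far lie (eop n (ea n a)) r d) (eop n (ea n a) p)) \<and> G2 (lie (eop n (ea n a) p) (up_far lie (eop n (ea n a)) r d))"
      by (intro G_step)
    moreover have "k \<notin> {r..r + Suc d} \<longleftrightarrow> k \<notin> {r..r+d} \<and> k \<noteq> p" by (auto simp: p_def)
    ultimately show ?case by (simp add: p_def)
  qed
  have d: "(k \<notin> {r..r+d} \<longrightarrow> G1 (down_far lie (fop n (ea n a)) r d)) \<and> G2 (down_far lie (fop n (ea n a)) r d)" if "1 \<le> r" "r + d < n" for r d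
    using that
  proof (induction d)
    case 0
    then show ?case using G_simple[of r 1 "- 1"] by (auto simp: fop_def reg_intros)
  next
    case (Suc d)
    define p where "p = r + d + 1"
    have "k \<noteq> p \<longrightarrow> G1 (fop n (ea n a) p)" "G2 (fop n (ea n a) p)"
      using Suc.prems G_simple[of p "1" "- 1"] by (auto simp: p_def fop_def reg_intros)
    moreover have "k \<notin> {r..r+d} \<longrightarrow> G1 (down_far lie (fop n (ea n a)) r d)" "G2 (down_far lie (fop n (ea n a)) r d)"
      using Suc by simp_all
    moreover have "k \<notin> {r..r+d} \<or> k \<noteq> p" by (auto simp: p_def)
    ultimately have "(k \<notin> {r..r+d} \<and> k \<noteq> p \<longrightarrow> G1 (lie (down_far lie (fop n (ea n a)) r d) (fop n (ea n a) p)) \<and> G1 (lie (fop n (ea n a) p) (down_far lie (fop n (ea n a)) r d))) \<and>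
        G2 (lie (down_far lie (fop n (ea n a)) r d) (fop n (ea n a) p)) \<and> G2 (lie (fop n (ea n a) p) (down_far lie (fop n (ea n a)) r d))"
      by (intro G_step)
    moreover have "k \<notin> {r..r + Suc d} \<longleftrightarrow> k \<notin> {r..r+d} \<and> k \<noteq> p" by (auto simp: p_def)
    ultimately show ?case by (simp add: p_def)
  qed
  show ?thesis using assms u[of r "s - r - 1"] d[of s "r - s - 1"] G1_G2[OF G_hop]
    by (auto simp: gE_def mat_unit_def)
qed

lemma x_minus_y_ent: "x_minus_y k i j = ent n (ea n a) (\<lambda>_. 0) k i - ent n (ea n a) (\<lambda>_. 0) k j"
  using kn by (simp add: x_minus_y_def ent_def ea_def)

lemma reg_x_minus_y: "reg (x_minus_y k i j)"
  unfolding x_minus_y_ent by (intro reg_intros reg_ent)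

text \<open>If z is not fixed by the swap, \<open>dlt z\<close> is a non-zero integer at v and may
  be divided out; if it is fixed, \<open>dlt z\<close> is x - y itself.\<close>

lemma A_coeff_regular:
  assumes "r \<in> {1..n}" "s \<in> {1..n}"
  shows "reg (x_minus_y k i j * Poly_Mapping.lookup (app (A r s) (T z)) z')"
    and "\<tau> z \<noteq> z \<Longrightarrow> reg (Poly_Mapping.lookup (app (A r s) (T z)) z')"
proof -
  have "reg (Poly_Mapping.lookup (app (A r s * Dop) (T z)) z')"
    using G2_A[OF assms] by (simp add: G2_def RegOp_def)
  moreover have "app (A r s * Dop) (T z) = scale (dlt z) (app (A r s) (T z))"
    by (simp add: Dop_def app_single[of "A r s" z "dlt z"])
  ultimately have d: "reg (dlt z * Poly_Mapping.lookup (app (A r s) (T z)) z')" by simp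
  show 2: "reg (Poly_Mapping.lookup (app (A r s) (T z)) z')" if "\<tau> z \<noteq> z"
  proof -
    have rvd: "rv v (dlt z) (val z k i - val z k j)" unfolding dlt_def by (intro Rv.R_diff rv_ent)
    have nz: "val z k i - val z k j \<noteq> 0"
      using that kn v_eq by (simp add: val_def swap_fixed_iff)
    show ?thesis using reg_divide[OF d rvd nz] Rv.R_inverse[OF rvd nz] by simp
  qed
  show "reg (x_minus_y k i j * Poly_Mapping.lookup (app (A r s) (T z)) z')"
  proof (cases "\<tau> z = z")
    case True
    then have "dlt z = x_minus_y k i j"
      using kn by (simp add: dlt_def x_minus_y_def ent_def ea_def swap_fixed_iff)
    then show ?thesis using d by simp
  next
    case False
    then show ?thesis using 2 reg_x_minus_y reg_intros(3) by blast
  qed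
qed

section \<open>The tableau module over Laurent series\<close>

definition eL :: "idx \<Rightarrow> complex fls" where
  "eL u = (if fst u = n then fls_const (a (snd u)) else line k i j v u)"

abbreviation "B \<equiv> gE n eL"

text \<open>The difference of the singular entries has the coefficient 1 at t, so it is not an
  integer; every other difference within a row is already non-integral in its constant term.\<close>

lemma line_generic: "generic_tableau n eL"
proof
  fix s u r m assume *: "1 \<le> s" "s < u" "u \<le> r" "r < n"
  show "eL (r,s) - eL (r,u) \<noteq> of_int m"
  proof
    assume eq: "eL (r,s) - eL (r,u) = of_int m"
    show False
    proof (cases "(r,s,u) = (k,i,j)")
      case True
      then have "fls_nth (eL (r,s) - eL (r,u)) 1 = 1"
        using * kn by (simp add: eL_def line_def)
      then show False unfolding eq by (simp add: fls_of_int_nth)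
    next
      case False
      have "fls_nth (eL (r,s) - eL (r,u)) 0 = v (r,s) - v (r,u)"
        using * by (simp add: eL_def line_def)
      then have "v (r,s) - v (r,u) = of_int m" unfolding eq by (simp add: fls_of_int_nth)
      then show False using v_generic[of s u r] * False by force
    qed
  qed
qed

interpretation gB: generic_tableau n eL by (rule line_generic)

abbreviation "Rl \<equiv> frac_rel (lsub k i j v)"

interpretation Rl: specialization Rl by (rule idom_hom.specialization[OF idom_hom_lsub])

lemma Rl_const: "Rl (rconst c) (fls_const c)"
  using idom_hom.frac_rel_Fract1[OF idom_hom_lsub, of k i j v "Poly_Mapping.single 0 c"]
  by (simp add: rconst_def complex_embedding.subst_const[OF complex_embedding_fls])

lemma Rl_var: "Rl (rvar u) (line k i j v u)"
  using idom_hom.frac_rel_Fract1[OF idom_hom_lsub, of k i j v "Poly_Mapping.single (Poly_Mapping.single u 1) 1"]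
  unfolding rvar_def complex_embedding.subst_var[OF complex_embedding_fls] .

lemma Rl_x_minus_y: "Rl (x_minus_y k i j) fls_X"
proof -
  have "line k i j v (k,i) - line k i j v (k,j) = (fls_X :: complex fls)"
    using v_eq kn by (intro fls_eqI) (simp add: line_def)
  then show ?thesis using Rl.R_diff[OF Rl_var Rl_var, of "(k,i)" "(k,j)"] by (simp add: x_minus_y_def)
qed

lemma transfer_line: "tableau_transfer Rl n (ea n a) eL (\<lambda>z. z) (\<lambda>_. id)"
proof -
  have "tableau_transfer Rl n (ea n a) eL (\<lambda>z u. z u + 0) (\<lambda>_. id)"
    using Rl_const Rl_var Rl.R_add[OF Rl_var Rl.R_of_int]
    by (intro gB.tableau_transferI Rl.specialization_axioms) (auto simp: ent_def ea_def eL_def)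
  then show ?thesis by simp
qed

interpretation tl: tableau_transfer Rl n "ea n a" eL "\<lambda>z. z" "\<lambda>_. id" by (rule transfer_line)

lemma Rl_coeff:
  assumes "\<forall>w\<in>Poly_Mapping.keys f. set (letters w) \<subseteq> {1..n} \<times> {1..n}"
  shows "Rl (Poly_Mapping.lookup (app (rep rconst A f) (T z)) z') (Poly_Mapping.lookup (app (rep fls_const B f) (T z)) z')"
  using tl.RO_rep[of rconst fls_const, OF Rl_const assms] unfolding tl.RO_def by simp

lemma Rl_B:
  assumes "r \<in> {1..n}" "s \<in> {1..n}"
  shows "Rl (Poly_Mapping.lookup (app (A r s) (T z)) z') (Poly_Mapping.lookup (app (B r s) (T z)) z')"
  using tl.RO_gE[OF assms] unfolding tl.RO_def by blast

lemma B_coeff_holo: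
  assumes "r \<in> {1..n}" "s \<in> {1..n}"
  shows "holo (fls_X * Poly_Mapping.lookup (app (B r s) (T z)) z')"
    and "\<tau> z \<noteq> z \<Longrightarrow> holo (Poly_Mapping.lookup (app (B r s) (T z)) z')"
proof -
  note J = regular_jet[OF kn(5), of _ v]
  show "holo (fls_X * Poly_Mapping.lookup (app (B r s) (T z)) z')"
    using J[OF A_coeff_regular(1)[OF assms, folded reg_regular] Rl.R_mult[OF Rl_x_minus_y Rl_B[OF assms]]]
    unfolding holo_def by (intro exI)
  show "holo (Poly_Mapping.lookup (app (B r s) (T z)) z')" if "\<tau> z \<noteq> z"
    using J[OF A_coeff_regular(2)[OF assms that, folded reg_regular] Rl_B[OF assms]]
    unfolding holo_def by (intro exI)
qed

section \<open>The symmetry exchanging the two singular entries\<close>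

definition \<theta> :: "complex fls \<Rightarrow> complex fls" where "\<theta> f = fls_compose_fps f (- fps_X)"

lemma \<theta>_hom: "\<theta> (f + g) = \<theta> f + \<theta> g" "\<theta> (f * g) = \<theta> f * \<theta> g" "\<theta> 0 = 0" "\<theta> 1 = 1" "\<theta> (- f) = - \<theta> f"
  "\<theta> (inverse f) = inverse (\<theta> f)" "\<theta> f = 0 \<longleftrightarrow> f = 0" "\<theta> (fls_const c) = fls_const c" "\<theta> fls_X = - fls_X" "\<theta> (f - g) = \<theta> f - \<theta> g"
  by (simp_all add: \<theta>_def fls_compose_fps_add fls_compose_fps_mult fls_compose_fps_inverse fls_compose_fps_eq_0_iff fls_compose_fps_diff)

lemma \<theta>_sum: "\<theta> (sum f S) = (\<Sum>x\<in>S. \<theta> (f x))"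
  by (induction S rule: infinite_finite_induct) (simp_all add: \<theta>_hom)

lemma \<theta>_of_int: "\<theta> (of_int m) = of_int m"
  by (simp add: \<theta>_def)

lemma \<theta>_jet: "jet g c d \<Longrightarrow> jet (\<theta> g) c (- d)"
proof -
  assume "jet g c d"
  then obtain G where G: "g = fps_to_fls G" "fps_nth G 0 = c" "fps_nth G 1 = d" by (auto simp: jet_def)
  have "\<theta> g = fps_to_fls (G oo (- fps_X))" by (simp add: \<theta>_def G)
  moreover have "fps_nth (G oo (- fps_X)) 1 = - d"
    using G by (simp add: fps_compose_nth)
  moreover have "fps_nth (G oo (- fps_X)) 0 = c" using G by simp
  ultimately show ?thesis unfolding jet_def by blast
qed

interpretation Rt: specialization "\<lambda>f g. g = \<theta> f"
  by unfold_locales (auto simp: \<theta>_hom)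

definition sg :: "nat \<Rightarrow> nat \<Rightarrow> nat" where
  "sg r s = (if r = k then (if s = i then j else if s = j then i else s) else s)"

text \<open>As the singular entries agree at v, replacing t by -t exchanges them along the line.
  Together with the swap of z and of columns i and j this preserves all entries, so the action is
  equivariant.\<close>

lemma transfer_tau: "tableau_transfer (\<lambda>f g. g = \<theta> f) n eL eL \<tau> sg"
proof (intro tableau_transfer.intro Rt.specialization_axioms tableau_transfer_axioms.intro line_generic)
  show "bij \<tau>" by (rule o_bij[of \<tau>]) (auto simp: fun_eq_iff)
  show "bij_betw (sg r) {1..r} {1..r}" for r
  proof (rule bij_betw_byWitness[of _ "sg r"])
    have m: "sg r s \<in> {1..r}" if "s \<in> {1..r}" for s
    proof -
      consider "r = k" "s = i" | "r = k" "s = j" | "r \<noteq> k \<or> (s \<noteq> i \<and> s \<noteq> j)" by blast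
      then show ?thesis
      proof cases
        case 1
        then have "sg r s = j" by (simp add: sg_def)
        then show ?thesis using kn(4) 1 by simp
      next
        case 2
        then have "sg r s = i" by (simp add: sg_def)
        then show ?thesis using kn(3) 2 by simp
      next
        case 3
        then have "sg r s = s" by (auto simp: sg_def)
        then show ?thesis using that by simp
      qed
    qed
    show "sg r ` {1..r} \<subseteq> {1..r}" "sg r ` {1..r} \<subseteq> {1..r}" using m by blast+
    show "\<forall>s\<in>{1..r}. sg r (sg r s) = s" "\<forall>s\<in>{1..r}. sg r (sg r s) = s" by (simp_all add: sg_def)
  qed
  show "\<tau> (shift z (p,q) d) = shift (\<tau> z) (p, sg p q) d" for z p q d
  proof (rule ext)
    fix u
    have ne: "i \<noteq> j" "j \<noteq> i" using kn(5) by auto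
    consider "p = k" "q = i" | "p = k" "q = j" | "(p,q) \<noteq> (k,i)" "(p,q) \<noteq> (k,j)" by blast
    then show "\<tau> (shift z (p,q) d) u = shift (\<tau> z) (p, sg p q) d u"
    proof cases
      case 1
      then have "sg p q = j" by (simp add: sg_def)
      then show ?thesis using 1 ne by (simp add: swap_def shift_def)
    next
      case 2
      then have "sg p q = i" using ne by (simp add: sg_def)
      then show ?thesis using 2 ne by (simp add: swap_def shift_def)
    next
      case 3
      then have "sg p q = q" by (auto simp: sg_def)
      then show ?thesis using 3 by (cases "u = (p,q)"; cases "p = k") (auto simp: swap_def shift_def)
    qed
  qed
  show "ent n eL (\<tau> z) p (sg p q) = \<theta> (ent n eL z p q)" for z p q
  proof -
    have ne: "i \<noteq> j" "j \<noteq> i" "k \<noteq> n" using kn by auto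
    consider "p = k" "q = i" | "p = k" "q = j" | "(p,q) \<noteq> (k,i)" "(p,q) \<noteq> (k,j)" by blast
    then show ?thesis
    proof cases
      case 1
      then have "sg p q = j" by (simp add: sg_def)
      then show ?thesis using 1 ne v_eq by (simp add: ent_def eL_def line_def swap_def \<theta>_hom \<theta>_of_int)
    next
      case 2
      then have "sg p q = i" using ne by (simp add: sg_def)
      then show ?thesis using 2 ne v_eq by (simp add: ent_def eL_def line_def swap_def \<theta>_hom \<theta>_of_int)
    next
      case 3
      then have "sg p q = q" by (auto simp: sg_def)
      then show ?thesis using 3 by (auto simp: ent_def eL_def line_def swap_def \<theta>_hom \<theta>_of_int)
    qed
  qed
qed

interpretation tt: tableau_transfer "\<lambda>f g. g = \<theta> f" n eL eL \<tau> sg by (rule transfer_tau)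

lemma B_tau:
  assumes "\<forall>w\<in>Poly_Mapping.keys f. set (letters w) \<subseteq> {1..n} \<times> {1..n}"
  shows "Poly_Mapping.lookup (app (rep fls_const B f) (T (\<tau> z))) (\<tau> z') = \<theta> (Poly_Mapping.lookup (app (rep fls_const B f) (T z)) z')"
proof -
  have "tt.RO (rep fls_const B f) (rep fls_const B f)"
    using assms by (intro tt.RO_rep) (auto simp: \<theta>_hom)
  then show ?thesis unfolding tt.RO_def by blast
qed

end

section \<open>Symmetric lattices of Laurent series tableaux\<close>

lemma holo_iff: "holo g \<longleftrightarrow> (\<forall>m<0. fls_nth g m = 0)"
proof
  assume "holo g"
  then show "\<forall>m<0. fls_nth g m = 0" using jet_nth(3) by (auto simp: holo_def)
next
  assume *: "\<forall>m<0. fls_nth g m = 0"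
  have "g = fps_to_fls (fls_regpart g)"
    using * by (intro fls_eqI) (simp add: fps_to_fls_nth)
  then show "holo g" unfolding holo_fps by blast
qed

lemma X_nth [simp]: "fls_nth (fls_X * g) m = fls_nth g (m - 1)" "fls_nth (fls_X_inv * g) m = fls_nth g (m + 1)"
  for g :: "complex fls"
  by (simp_all add: fls_X_times_conv_shift fls_X_inv_times_conv_shift)

lemma holo_X_iff: "holo (fls_X * g) \<longleftrightarrow> (\<forall>m < - 1. fls_nth g m = 0)"
proof -
  have "(\<forall>m<0. fls_nth g (m - 1) = 0) \<longleftrightarrow> (\<forall>m < - 1. fls_nth g m = 0)"
  proof (intro iffI allI impI)
    fix m :: int assume "\<forall>m<0. fls_nth g (m - 1) = 0" "m < -1"
    then show "fls_nth g m = 0" by (elim allE[of _ "m + 1"]) simp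
  qed simp
  then show ?thesis by (simp add: holo_iff)
qed

lemma X_mult_inv [simp]: "fls_X * (fls_X_inv * g) = g" "fls_X_inv * (fls_X * g) = g" for g :: "complex fls"
  by (intro fls_eqI; simp)+

lemma holo_const: "holo (fls_const c)"
  using jet_const by (auto simp: holo_def)

definition free_letters :: "nat \<Rightarrow> gl_free set" where
  "free_letters n = {f. \<forall>w\<in>Poly_Mapping.keys f. set (letters w) \<subseteq> {1..n} \<times> {1..n}}"

text \<open>On the lattice of symmetric vectors with simple poles this is congruence modulo t^2
  times the lattice.\<close>

definition eqv :: "(zvec \<Rightarrow>\<^sub>0 complex fls) \<Rightarrow> (zvec \<Rightarrow>\<^sub>0 complex fls) \<Rightarrow> bool" (infix "\<asymp>" 50) where
  "G \<asymp> H \<longleftrightarrow> (\<forall>z. fls_nth (Poly_Mapping.lookup G z) 0 = fls_nth (Poly_Mapping.lookup H z) 0 \<and>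
     fls_nth (Poly_Mapping.lookup G z) (-1) = fls_nth (Poly_Mapping.lookup H z) (-1))"

lemma eqv_refl [simp]: "G \<asymp> G" by (simp add: eqv_def)
lemma eqv_sym: "G \<asymp> H \<Longrightarrow> H \<asymp> G" by (simp add: eqv_def)
lemma eqv_trans: "G \<asymp> H \<Longrightarrow> H \<asymp> K \<Longrightarrow> G \<asymp> K" by (simp add: eqv_def)
lemma eqv_add: "G \<asymp> H \<Longrightarrow> G' \<asymp> H' \<Longrightarrow> G + G' \<asymp> H + H'" by (simp add: eqv_def lookup_add)
lemma eqv_scale: "G \<asymp> H \<Longrightarrow> scale (fls_const c) G \<asymp> scale (fls_const c) H" by (simp add: eqv_def)
lemma eqv_sum: "(\<And>x. x \<in> A \<Longrightarrow> G x \<asymp> H x) \<Longrightarrow> sum G A \<asymp> sum H A"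
  by (induction A rule: infinite_finite_induct) (auto intro: eqv_add)

definition Delta :: "(zvec \<Rightarrow>\<^sub>0 complex fls) \<Rightarrow> tab_free" where
  "Delta H = Abs_poly_mapping (\<lambda>b. case b of Tsym z \<Rightarrow> fls_nth (Poly_Mapping.lookup H z) 0
     | DTsym z \<Rightarrow> fls_nth (Poly_Mapping.lookup H z) (-1))"

lemma lookup_Delta [simp]: "Poly_Mapping.lookup (Delta H) (Tsym z) = fls_nth (Poly_Mapping.lookup H z) 0"
  "Poly_Mapping.lookup (Delta H) (DTsym z) = fls_nth (Poly_Mapping.lookup H z) (-1)"
proof -
  have "finite {b. (case b of Tsym z \<Rightarrow> fls_nth (Poly_Mapping.lookup H z) 0
     | DTsym z \<Rightarrow> fls_nth (Poly_Mapping.lookup H z) (-1)) \<noteq> 0}"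
  proof (rule finite_subset[of _ "Tsym ` Poly_Mapping.keys H \<union> DTsym ` Poly_Mapping.keys H"], rule subsetI)
    fix b assume "b \<in> {b. (case b of Tsym z \<Rightarrow> fls_nth (Poly_Mapping.lookup H z) 0
     | DTsym z \<Rightarrow> fls_nth (Poly_Mapping.lookup H z) (-1)) \<noteq> 0}"
    then show "b \<in> Tsym ` Poly_Mapping.keys H \<union> DTsym ` Poly_Mapping.keys H"
    proof (cases b)
      case (Tsym z)
      then have "z \<in> Poly_Mapping.keys H" using \<open>b \<in> _\<close> by (auto simp: in_keys_iff)
      then show ?thesis using Tsym by blast
    next
      case (DTsym z)
      then have "z \<in> Poly_Mapping.keys H" using \<open>b \<in> _\<close> by (auto simp: in_keys_iff)
      then show ?thesis using DTsym by blast
    qed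
  qed simp
  then show "Poly_Mapping.lookup (Delta H) (Tsym z) = fls_nth (Poly_Mapping.lookup H z) 0"
    "Poly_Mapping.lookup (Delta H) (DTsym z) = fls_nth (Poly_Mapping.lookup H z) (-1)"
    by (simp_all add: Delta_def)
qed

lemma tab_free_eqI:
  assumes "\<And>z. Poly_Mapping.lookup f (Tsym z) = Poly_Mapping.lookup g (Tsym z)"
    "\<And>z. Poly_Mapping.lookup f (DTsym z) = Poly_Mapping.lookup g (DTsym z)"
  shows "f = g"
proof (rule poly_mapping_eqI)
  fix b show "Poly_Mapping.lookup f b = Poly_Mapping.lookup g b" using assms by (cases b) auto
qed

lemma Delta_cong: "G \<asymp> H \<Longrightarrow> Delta G = Delta H"
  by (intro tab_free_eqI) (auto simp: eqv_def)

section \<open>The symmetric lattice and its stability\<close>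

context singular_point
begin

interpretation gB: generic_tableau n eL by (rule line_generic)
interpretation Rl: specialization Rl by (rule idom_hom.specialization[OF idom_hom_lsub])
interpretation ce: complex_embedding "fls_const :: complex \<Rightarrow> complex fls" by (rule complex_embedding_fls)

abbreviation "\<rho> \<equiv> rep fls_const B"

lemma theta_pole:
  assumes "holo (fls_X * f)"
  shows "holo (fls_X * \<theta> f)" "fls_nth (\<theta> f) 0 = fls_nth f 0" "fls_nth (\<theta> f) (-1) = - fls_nth f (-1)" "\<theta> (\<theta> f) = f"
proof -
  obtain G where G: "fls_X * f = fps_to_fls G" using assms by (auto simp: holo_fps)
  have t: "fls_X * \<theta> f = - \<theta> (fls_X * f)" by (simp add: \<theta>_hom)
  have "jet (fls_X * f) (fps_nth G 0) (fps_nth G 1)" using G by (auto simp: jet_def)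
  note jet_nth[OF this] jet_nth[OF \<theta>_jet[OF this]]
  note J = this
  have "fls_nth (\<theta> f) m = - fls_nth (\<theta> (fls_X * f)) (m + 1)" for m
    using arg_cong[OF t, of "\<lambda>h. fls_nth h (m + 1)"] by simp
  then show "fls_nth (\<theta> f) 0 = fls_nth f 0" "fls_nth (\<theta> f) (-1) = - fls_nth f (-1)"
    using J by simp_all
  show "holo (fls_X * \<theta> f)" unfolding t using J by (simp add: holo_iff)
  have "\<theta> (\<theta> (fls_X * f)) = fps_to_fls ((G oo (- fps_X)) oo (- fps_X))" by (simp add: G \<theta>_def)
  also have "(G oo (- fps_X)) oo (- fps_X) = G"
  proof -
    have m: "- fps_X = fps_const (-1 :: complex) * fps_X" by simp
    show ?thesis unfolding m fps_compose_linear
      by (rule fps_ext) (simp add: mult.assoc[symmetric] power_mult_distrib[symmetric])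
  qed
  finally have "fls_X * \<theta> (\<theta> f) = fls_X * f" by (simp add: G[symmetric] \<theta>_hom)
  then show "\<theta> (\<theta> f) = f" by simp
qed

lemma swap_Zvecs [simp]: "\<tau> z \<in> Zvecs n \<longleftrightarrow> z \<in> Zvecs n"
proof -
  have "\<tau> z \<in> Zvecs n" if "z \<in> Zvecs n" for z using that ij by (auto simp: Zvecs_def swap_def)
  from this[of z] this[of "\<tau> z"] show ?thesis by auto
qed

definition flip :: "(zvec \<Rightarrow>\<^sub>0 complex fls) \<Rightarrow> (zvec \<Rightarrow>\<^sub>0 complex fls)" where
  "flip H = Abs_poly_mapping (\<lambda>z. \<theta> (Poly_Mapping.lookup H (\<tau> z)))"

lemma lookup_flip [simp]: "Poly_Mapping.lookup (flip H) z = \<theta> (Poly_Mapping.lookup H (\<tau> z))"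
proof -
  have "finite {z. \<theta> (Poly_Mapping.lookup H (\<tau> z)) \<noteq> 0}"
  proof (rule finite_subset[of _ "\<tau> ` Poly_Mapping.keys H"])
    show "{z. \<theta> (Poly_Mapping.lookup H (\<tau> z)) \<noteq> 0} \<subseteq> \<tau> ` Poly_Mapping.keys H"
    proof
      fix z assume "z \<in> {z. \<theta> (Poly_Mapping.lookup H (\<tau> z)) \<noteq> 0}"
      then have "\<tau> z \<in> Poly_Mapping.keys H" by (auto simp: \<theta>_hom in_keys_iff)
      then show "z \<in> \<tau> ` Poly_Mapping.keys H" by (metis image_eqI swap_swap)
    qed
  qed simp
  then show ?thesis by (simp add: flip_def)
qed

lemma flip_add: "flip (G + H) = flip G + flip H"
  and flip_diff: "flip (G - H) = flip G - flip H"
  and flip_scale: "flip (scale c G) = scale (\<theta> c) (flip G)"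
  and flip_0 [simp]: "flip 0 = 0"
  by (intro poly_mapping_eqI; simp add: lookup_add lookup_minus \<theta>_hom)+

definition pol :: "(zvec \<Rightarrow>\<^sub>0 complex fls) \<Rightarrow> bool" where
  "pol H \<longleftrightarrow> Poly_Mapping.keys H \<subseteq> Zvecs n \<and> (\<forall>z. holo (fls_X * Poly_Mapping.lookup H z))"

definition lat :: "(zvec \<Rightarrow>\<^sub>0 complex fls) \<Rightarrow> bool" where
  "lat H \<longleftrightarrow> pol H \<and> flip H = H"

lemma pol_keys: "Poly_Mapping.keys H \<subseteq> Zvecs n \<longleftrightarrow> (\<forall>z. z \<notin> Zvecs n \<longrightarrow> Poly_Mapping.lookup H z = 0)"
  by (auto simp: in_keys_iff)

lemma pol_0: "pol 0" by (simp add: pol_def holo_0)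

lemma pol_add: "pol G \<Longrightarrow> pol H \<Longrightarrow> pol (G + H)"
  unfolding pol_def pol_keys by (auto simp: lookup_add holo_add distrib_left)

lemma pol_scale: "holo c \<Longrightarrow> pol G \<Longrightarrow> pol (scale c G)"
  unfolding pol_def pol_keys by (auto simp: mult.left_commute[of fls_X] holo_mult)

lemma pol_diff: "pol G \<Longrightarrow> pol H \<Longrightarrow> pol (G - H)"
  unfolding pol_def pol_keys holo_X_iff by (auto simp: lookup_minus)

lemma pol_single: "z \<in> Zvecs n \<Longrightarrow> holo (fls_X * g) \<Longrightarrow> pol (Poly_Mapping.single z g)"
  unfolding pol_def pol_keys by (auto simp: lookup_single when_def holo_0)

lemma pol_flip: "pol H \<Longrightarrow> pol (flip H)"
  unfolding pol_def pol_keys by (auto simp: \<theta>_hom theta_pole(1))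

lemma flip_flip: "pol H \<Longrightarrow> flip (flip H) = H"
  by (intro poly_mapping_eqI) (simp add: pol_def theta_pole(4))

lemma lat_sym: "pol H \<Longrightarrow> lat (H + flip H)"
  by (simp add: lat_def pol_add pol_flip flip_add flip_flip add.commute)

lemma lat_0: "lat 0" by (simp add: lat_def pol_0)
lemma lat_add: "lat G \<Longrightarrow> lat H \<Longrightarrow> lat (G + H)" by (simp add: lat_def pol_add flip_add)
lemma lat_diff: "lat G \<Longrightarrow> lat H \<Longrightarrow> lat (G - H)" by (simp add: lat_def pol_diff flip_diff)
lemma lat_scale: "lat G \<Longrightarrow> lat (scale (fls_const c) G)" by (simp add: lat_def pol_scale flip_scale holo_const \<theta>_hom)
lemma lat_sum: "(\<And>x. x \<in> S \<Longrightarrow> lat (G x)) \<Longrightarrow> lat (sum G S)"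
  by (induction S rule: infinite_finite_induct) (auto intro: lat_add lat_0)

lemma lat_lookup: "lat G \<Longrightarrow> \<theta> (Poly_Mapping.lookup G (\<tau> z)) = Poly_Mapping.lookup G z"
  using lookup_flip[of G z] by (simp add: lat_def)

lemma lat_nth:
  assumes "lat G"
  shows "fls_nth (Poly_Mapping.lookup G (\<tau> z)) 0 = fls_nth (Poly_Mapping.lookup G z) 0"
    "fls_nth (Poly_Mapping.lookup G (\<tau> z)) (-1) = - fls_nth (Poly_Mapping.lookup G z) (-1)"
  using assms theta_pole(2,3)[of "Poly_Mapping.lookup G (\<tau> z)"] lat_lookup[OF assms, of z] by (auto simp: lat_def pol_def)

lemma flip_rho:
  assumes "y \<in> free_letters n" shows "flip (app (\<rho> y) H) = app (\<rho> y) (flip H)"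
proof (rule poly_mapping_eqI)
  fix z
  let ?l = "Poly_Mapping.lookup"
  have k: "Poly_Mapping.keys (flip H) \<subseteq> \<tau> ` Poly_Mapping.keys H"
  proof
    fix z assume "z \<in> Poly_Mapping.keys (flip H)"
    then have "\<tau> z \<in> Poly_Mapping.keys H" by (auto simp: \<theta>_hom in_keys_iff)
    then show "z \<in> \<tau> ` Poly_Mapping.keys H" by (metis image_eqI swap_swap)
  qed
  have inj: "inj_on \<tau> (Poly_Mapping.keys H)" by (auto simp: inj_on_def)
  have b: "?l (app (\<rho> y) (T (\<tau> w))) z = \<theta> (?l (app (\<rho> y) (T w)) (\<tau> z))" for w
    using B_tau[of y w "\<tau> z"] assms by (simp add: free_letters_def)
  have "?l (app (\<rho> y) (flip H)) z = (\<Sum>w\<in>\<tau> ` Poly_Mapping.keys H. ?l (flip H) w * ?l (app (\<rho> y) (T w)) z)"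
    using k by (intro lookup_app) auto
  also have "\<dots> = (\<Sum>w\<in>Poly_Mapping.keys H. \<theta> (?l H w) * \<theta> (?l (app (\<rho> y) (T w)) (\<tau> z)))"
    by (subst sum.reindex[OF inj]) (simp add: b)
  also have "\<dots> = \<theta> (?l (app (\<rho> y) H) (\<tau> z))"
    by (subst lookup_app[OF finite_keys subset_refl]) (simp add: \<theta>_sum \<theta>_hom)
  finally show "?l (flip (app (\<rho> y) H)) z = ?l (app (\<rho> y) (flip H)) z" by simp
qed

lemma Efree_letters: "r \<in> {1..n} \<Longrightarrow> s \<in> {1..n} \<Longrightarrow> Efree r s \<in> free_letters n"
  by (auto simp: free_letters_def Efree_def)

lemma flip_B: "r \<in> {1..n} \<Longrightarrow> s \<in> {1..n} \<Longrightarrow> flip (app (B r s) H) = app (B r s) (flip H)"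
  using flip_rho[OF Efree_letters] by (simp add: ce.rep_Efree)

lemma B_Zvecs:
  assumes "r \<in> {1..n}" "s \<in> {1..n}" "z \<in> Zvecs n" "z' \<notin> Zvecs n"
  shows "Poly_Mapping.lookup (app (B r s) (T z)) z' = 0"
proof (rule ccontr)
  assume "Poly_Mapping.lookup (app (B r s) (T z)) z' \<noteq> 0"
  then have "same_outside n z z'"
    using low_gE[OF assms(1,2), of n eL] by (auto simp: low_def in_keys_iff)
  note so = this
  obtain p q where pq: "\<not> (1 \<le> q \<and> q \<le> p \<and> p \<le> n - 1)" "z' (p,q) \<noteq> 0" using assms(4) unfolding Zvecs_def by blast
  then have "p \<notin> {1..<n} \<or> q \<notin> {1..p}" by auto
  then have "z' (p,q) = z (p,q)" using so unfolding same_outside_def by blast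
  moreover have "z (p,q) = 0" using assms(3) pq(1) unfolding Zvecs_def by blast
  ultimately show False using pq(2) by simp
qed

text \<open>A pole of the coefficient of G and a pole of the operator never meet: the operator has
  one only at z fixed by the swap, and there the odd part of a symmetric coefficient, in particular
  its residue, vanishes.\<close>

lemma lat_B:
  assumes "r \<in> {1..n}" "s \<in> {1..n}" "lat G"
  shows "lat (app (B r s) G)"
proof -
  let ?l = "Poly_Mapping.lookup"
  have G: "pol G" "flip G = G" using assms by (auto simp: lat_def)
  have e: "?l (app (B r s) G) z' = (\<Sum>z\<in>Poly_Mapping.keys G. ?l G z * ?l (app (B r s) (T z)) z')" for z'
    by (rule lookup_app) auto
  have "holo (fls_X * (?l G z * ?l (app (B r s) (T z)) z'))" for z z'
  proof (cases "\<tau> z = z")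
    case False
    have "holo (fls_X * ?l G z)" using G by (simp add: pol_def)
    then show ?thesis using holo_mult B_coeff_holo(2)[OF assms(1,2) False] by (simp add: mult.assoc[symmetric])
  next
    case True
    have "fls_nth (?l G z) (-1) = 0" using lat_nth(2)[OF assms(3), of z] True by simp
    moreover have "\<forall>m < - 1. fls_nth (?l G z) m = 0" using G by (auto simp: pol_def holo_X_iff)
    ultimately have "holo (?l G z)" unfolding holo_iff by (metis less_linear less_minus_one_simps(1) zless_add1_eq add.left_neutral neg_equal_iff_equal ab_left_minus)
    then show ?thesis using holo_mult B_coeff_holo(1)[OF assms(1,2)] by (simp add: mult.left_commute[of fls_X])
  qed
  then have h: "holo (fls_X * ?l (app (B r s) G) z')" for z'
    unfolding e sum_distrib_left by (intro holo_sum)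
  have "?l (app (B r s) G) z' = 0" if "z' \<notin> Zvecs n" for z'
    unfolding e
  proof (intro sum.neutral ballI)
    fix z assume "z \<in> Poly_Mapping.keys G"
    then have "z \<in> Zvecs n" using G by (auto simp: pol_def)
    then show "?l G z * ?l (app (B r s) (T z)) z' = 0" using B_Zvecs[OF assms(1,2)] that by simp
  qed
  then show ?thesis using h G(2) flip_B[OF assms(1,2), of G] by (simp only: lat_def pol_def pol_keys) auto
qed

lemma lat_word:
  assumes "set l \<subseteq> {1..n} \<times> {1..n}" "lat G" shows "lat (foldr (\<lambda>(r,s). app (B r s)) l G)"
  using assms(1)
proof (induction l)
  case (Cons x l)
  obtain r s where x: "x = (r, s)" by (cases x)
  have "lat (app (B r s) (foldr (\<lambda>(r,s). app (B r s)) l G))"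
    using Cons x by (intro lat_B) auto
  then show ?case by (simp add: x)
qed (simp add: assms(2))

lemma lat_rho: "y \<in> free_letters n \<Longrightarrow> lat G \<Longrightarrow> lat (app (\<rho> y) G)"
  unfolding app_rep free_act_def free_letters_def by (intro lat_sum lat_scale lat_word) auto

text \<open>The difference is t^2 times a lattice vector, the lattice is stable, and the operator is
  linear over Laurent series.\<close>

lemma eqv_rho:
  assumes "y \<in> free_letters n" "lat G" "lat H" "G \<asymp> H"
  shows "app (\<rho> y) G \<asymp> app (\<rho> y) H"
proof -
  let ?l = "Poly_Mapping.lookup"
  \<comment> \<open>Since t^2 is even, dividing by it preserves symmetry; a difference without terms
    up to t^0 keeps at most a simple pole.\<close>
  define D where "D = scale fls_X_inv (scale fls_X_inv (G - H))"
  have GH: "lat (G - H)" using assms by (simp add: lat_diff)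
  have z: "fls_nth (?l (G - H) z) m = 0" if "m \<le> 0" for z m
  proof -
    have "m < -1 \<or> m = -1 \<or> m = 0" using that by auto
    then show ?thesis using GH assms(4) by (auto simp: lat_def pol_def holo_X_iff eqv_def lookup_minus)
  qed
  have ti: "\<theta> fls_X_inv = - fls_X_inv"
    using \<theta>_hom(6)[of fls_X] by (simp add: \<theta>_hom(9) fls_inverse_X)
  have "pol D" using GH z by (auto simp: D_def lat_def pol_def pol_keys holo_iff)
  moreover have "flip D = D" using GH by (simp add: D_def flip_scale \<theta>_hom(2) ti lat_def scale_scale)
  ultimately have "lat (app (\<rho> y) D)" using assms(1) by (intro lat_rho) (simp_all add: lat_def)
  then have h: "fls_nth (?l (app (\<rho> y) D) z) m = 0" if "m < - 1" for z m
    using that by (simp add: lat_def pol_def holo_X_iff)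
  have "G - H = scale fls_X (scale fls_X D)" by (rule poly_mapping_eqI) (simp add: D_def)
  then have "app (\<rho> y) (G - H) = scale fls_X (scale fls_X (app (\<rho> y) D))" by (simp add: app_scale)
  then have "app (\<rho> y) G = app (\<rho> y) H + scale fls_X (scale fls_X (app (\<rho> y) D))" by (simp add: app_diff algebra_simps)
  then show ?thesis by (simp add: eqv_def lookup_add h)
qed

section \<open>Comparison with the free space on the tableau symbols\<close>

definition F0 :: "tab_free set" where
  "F0 = {f. Poly_Mapping.keys f \<subseteq> Tsym ` Zvecs n \<union> DTsym ` Zvecs n}"

lemma F0_iff: "f \<in> F0 \<longleftrightarrow> (\<forall>z. z \<notin> Zvecs n \<longrightarrow> Poly_Mapping.lookup f (Tsym z) = 0 \<and> Poly_Mapping.lookup f (DTsym z) = 0)"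
proof -
  have "Poly_Mapping.lookup f b = 0" if "\<forall>z. z \<notin> Zvecs n \<longrightarrow> Poly_Mapping.lookup f (Tsym z) = 0 \<and> Poly_Mapping.lookup f (DTsym z) = 0"
    "b \<notin> Tsym ` Zvecs n \<union> DTsym ` Zvecs n" for b using that by (cases b) auto
  note * = this
  show ?thesis
  proof (intro iffI allI impI)
    fix z assume "f \<in> F0" "z \<notin> Zvecs n"
    then have "Tsym z \<notin> Poly_Mapping.keys f" "DTsym z \<notin> Poly_Mapping.keys f" unfolding F0_def by blast+
    then show "Poly_Mapping.lookup f (Tsym z) = 0 \<and> Poly_Mapping.lookup f (DTsym z) = 0" by (simp add: in_keys_iff)
  next
    assume h: "\<forall>z. z \<notin> Zvecs n \<longrightarrow> Poly_Mapping.lookup f (Tsym z) = 0 \<and> Poly_Mapping.lookup f (DTsym z) = 0"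
    have "b \<in> Tsym ` Zvecs n \<union> DTsym ` Zvecs n" if "b \<in> Poly_Mapping.keys f" for b
      using *[OF h, of b] that by (metis in_keys_iff)
    then show "f \<in> F0" unfolding F0_def by blast
  qed
qed

lemma F0_ops: "0 \<in> F0" "f \<in> F0 \<Longrightarrow> g \<in> F0 \<Longrightarrow> f + g \<in> F0" "f \<in> F0 \<Longrightarrow> scale c f \<in> F0"
  by (auto simp: F0_iff lookup_add)

lemma F0_sum: "(\<And>x. x \<in> S \<Longrightarrow> f x \<in> F0) \<Longrightarrow> sum f S \<in> F0"
  by (induction S rule: infinite_finite_induct) (auto intro: F0_ops)

lemma Delta_F0: "Poly_Mapping.keys H \<subseteq> Zvecs n \<Longrightarrow> Delta H \<in> F0"
  by (auto simp: F0_iff pol_keys)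

text \<open>The lift of the free space into the lattice. The minus sign in the polar part comes from
  t to -t and matches the antisymmetry of the symbols DT.\<close>

definition Psi :: "tab_free \<Rightarrow> (zvec \<Rightarrow>\<^sub>0 complex fls)" where
  "Psi f = Abs_poly_mapping (\<lambda>z. fls_const (Poly_Mapping.lookup f (Tsym z) + Poly_Mapping.lookup f (Tsym (\<tau> z))) +
     fls_X_inv * fls_const (Poly_Mapping.lookup f (DTsym z) - Poly_Mapping.lookup f (DTsym (\<tau> z))))"

lemma lookup_Psi: "Poly_Mapping.lookup (Psi f) z = fls_const (Poly_Mapping.lookup f (Tsym z) + Poly_Mapping.lookup f (Tsym (\<tau> z))) +
     fls_X_inv * fls_const (Poly_Mapping.lookup f (DTsym z) - Poly_Mapping.lookup f (DTsym (\<tau> z)))" (is "_ = ?g z")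
proof -
  let ?K = "Tsym -` Poly_Mapping.keys f \<union> DTsym -` Poly_Mapping.keys f"
  have K: "finite ?K" by (auto intro!: finite_vimageI simp: inj_def)
  have "{z. ?g z \<noteq> 0} \<subseteq> ?K \<union> \<tau> ` ?K"
  proof
    fix z assume "z \<in> {z. ?g z \<noteq> 0}"
    then have "z \<in> ?K \<or> \<tau> z \<in> ?K" by (auto simp: in_keys_iff)
    then show "z \<in> ?K \<union> \<tau> ` ?K" by (metis UnI1 UnI2 image_eqI swap_swap)
  qed
  then have "finite {z. ?g z \<noteq> 0}" using K by (metis (no_types, lifting) finite_UnI finite_imageI finite_subset)
  then show ?thesis by (simp add: Psi_def)
qed

lemma Psi_nth [simp]:
  "fls_nth (Poly_Mapping.lookup (Psi f) z) 0 = Poly_Mapping.lookup f (Tsym z) + Poly_Mapping.lookup f (Tsym (\<tau> z))"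
  "fls_nth (Poly_Mapping.lookup (Psi f) z) (-1) = Poly_Mapping.lookup f (DTsym z) - Poly_Mapping.lookup f (DTsym (\<tau> z))"
  by (simp_all add: lookup_Psi)

lemma Psi_0 [simp]: "Psi 0 = 0" by (rule poly_mapping_eqI) (simp add: lookup_Psi)

lemma Psi_add: "Psi (f + g) = Psi f + Psi g"
  by (rule poly_mapping_eqI) (simp add: lookup_Psi lookup_add fls_plus_const[symmetric] fls_minus_const[symmetric] algebra_simps)

lemma Psi_scale: "Psi (scale c f) = scale (fls_const c) (Psi f)"
proof (rule poly_mapping_eqI)
  fix z
  have "fls_const (c * x + c * y) = fls_const c * fls_const (x + y)" "fls_const (c * x - c * y) = fls_const c * fls_const (x - y)" for x y
    by (simp_all add: fls_const_mult_const distrib_left right_diff_distrib)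
  then show "Poly_Mapping.lookup (Psi (scale c f)) z = Poly_Mapping.lookup (scale (fls_const c) (Psi f)) z"
    by (simp only: lookup_Psi lookup_scale) (simp only: distrib_left mult.left_commute)
qed

lemma Psi_sum: "Psi (sum f S) = (\<Sum>x\<in>S. Psi (f x))"
  by (induction S rule: infinite_finite_induct) (auto simp: Psi_add)

lemma theta_X_inv: "\<theta> fls_X_inv = - fls_X_inv"
  using \<theta>_hom(6)[of fls_X] by (simp add: \<theta>_hom(9) fls_inverse_X)

lemma tau_eq_iff: "\<tau> w = z \<longleftrightarrow> w = \<tau> z"
  by (metis swap_swap)

lemma Psi_T: "Psi (T (Tsym z)) = T z + flip (T z)"
  by (rule poly_mapping_eqI) (auto simp: lookup_Psi lookup_add lookup_single when_def tau_eq_iff \<theta>_hom)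

lemma Psi_DT: "Psi (T (DTsym z)) = Poly_Mapping.single z fls_X_inv + flip (Poly_Mapping.single z fls_X_inv)"
  by (rule poly_mapping_eqI) (auto simp: lookup_Psi lookup_add lookup_single when_def tau_eq_iff \<theta>_hom theta_X_inv)

lemma pol_T: "z \<in> Zvecs n \<Longrightarrow> pol (T z)" "z \<in> Zvecs n \<Longrightarrow> pol (Poly_Mapping.single z fls_X_inv)"
  by (auto intro!: pol_single simp: holo_iff)

lemma Psi_symbols: "Psi f = (\<Sum>b\<in>Poly_Mapping.keys f. scale (fls_const (Poly_Mapping.lookup f b)) (Psi (T b)))"
proof -
  have "f = (\<Sum>b\<in>Poly_Mapping.keys f. scale (Poly_Mapping.lookup f b) (T b))"
    by (subst poly_mapping_sum_singles[of f]) simp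
  then show ?thesis by (metis (no_types, lifting) Psi_sum Psi_scale sum.cong)
qed

lemma lat_Psi: "f \<in> F0 \<Longrightarrow> lat (Psi f)"
  by (subst Psi_symbols) (auto intro!: lat_sum lat_scale lat_sym pol_T simp: F0_def Psi_T Psi_DT dest!: subsetD)

lemma Psi_Delta: "pol H \<Longrightarrow> Psi (Delta H) \<asymp> H + flip H"
  by (auto simp: eqv_def lookup_add theta_pole(2,3) pol_def)

text \<open>The value and the derivation are the coefficients of t^0 and t^1. Division by t moves
  them to the positions of DT and T, which are exactly the symbols that they accompany in
  \<open>Dtab_free\<close>.\<close>

lemma Dtab_Delta:
  assumes "\<And>z. Rl (Poly_Mapping.lookup F z) (Poly_Mapping.lookup G z)" "regular_tab F v"
  shows "Dtab_free k i j v F = Delta (scale fls_X_inv G)"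
proof -
  let ?l = "Poly_Mapping.lookup"
  have l: "?l (Dtab_free k i j v F) (Tsym z) = (if z \<in> Poly_Mapping.keys F then D_rf k i j v (?l F z) else 0)"
    "?l (Dtab_free k i j v F) (DTsym z) = (if z \<in> Poly_Mapping.keys F then rf_eval (?l F z) v else 0)" for z
    by (simp_all add: Dtab_free_def lookup_sum lookup_add lookup_single when_def sum.delta)
  have J: "jet (?l G z) (rf_eval (?l F z) v) (D_rf k i j v (?l F z))" for z
    using regular_jet[OF kn(5) _ assms(1)] assms(2) by (simp add: regular_tab_def)
  have "?l G z = 0" if "z \<notin> Poly_Mapping.keys F" for z
    using Rl.R_0_left[of "?l G z"] assms(1)[of z] that by (simp add: in_keys_iff)
  then have 0: "fls_nth (?l G z) m = (if z \<in> Poly_Mapping.keys F then fls_nth (?l G z) m else 0)" for z m by simp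
  have 1: "fls_nth (?l G z) 0 = (if z \<in> Poly_Mapping.keys F then rf_eval (?l F z) v else 0)"
    "fls_nth (?l G z) 1 = (if z \<in> Poly_Mapping.keys F then D_rf k i j v (?l F z) else 0)" for z
    using 0[of z 0] 0[of z 1] unfolding jet_nth(1,2)[OF J] .
  show ?thesis
  proof (rule tab_free_eqI)
    fix z
    show "?l (Dtab_free k i j v F) (Tsym z) = ?l (Delta (scale fls_X_inv G)) (Tsym z)" by (simp add: l 1)
    show "?l (Dtab_free k i j v F) (DTsym z) = ?l (Delta (scale fls_X_inv G)) (DTsym z)" by (simp add: l 1)
  qed
qed

text \<open>The factor x - y in the action on T becomes t and cancels the division by t in
  \<open>Dtab_Delta\<close>. In the action on DT that division remains and turns T z into its
  multiple by 1/t, the lift of DT.\<close>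

lemma E_sym_Psi:
  assumes "r \<in> {1..n}" "s \<in> {1..n}" "b \<in> Tsym ` Zvecs n \<union> DTsym ` Zvecs n"
  shows "E_sym n k i j a v r s b \<in> F0 \<and> Psi (E_sym n k i j a v r s b) \<asymp> app (B r s) (Psi (T b))"
proof -
  have u: "Poly_Mapping.keys (app (B r s) (T z)) \<subseteq> Zvecs n" if "z \<in> Zvecs n" for z
    unfolding pol_keys using B_Zvecs[OF assms(1,2) that] by blast
  have *: "Delta H \<in> F0 \<and> Psi (Delta H) \<asymp> app (B r s) (h + flip h)" if "pol H" "H = app (B r s) h" for H h
    using Delta_F0[of H] Psi_Delta[OF that(1)] that flip_B[OF assms(1,2)] by (simp add: app_add pol_def)
  consider z where "b = Tsym z" "z \<in> Zvecs n" | z where "b = DTsym z" "z \<in> Zvecs n" "\<tau> z = z"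
    | z where "b = DTsym z" "z \<in> Zvecs n" "\<tau> z \<noteq> z" using assms(3) by blast
  then show ?thesis
  proof cases
    case 1
    have p: "pol (app (B r s) (T z))" using u[OF 1(2)] B_coeff_holo(1)[OF assms(1,2)] by (simp add: pol_def)
    have "E_sym n k i j a v r s b = Delta (scale fls_X_inv (scale fls_X (app (B r s) (T z))))"
      unfolding 1 E_sym.simps gen_tab_def E_gen_app
      using A_coeff_regular(1)[OF assms(1,2)] Rl.R_mult[OF Rl_x_minus_y Rl_B[OF assms(1,2)]]
      by (intro Dtab_Delta) (auto simp: regular_tab_def reg_regular)
    also have "scale fls_X_inv (scale fls_X (app (B r s) (T z))) = app (B r s) (T z)"
      by (rule poly_mapping_eqI) simp
    finally show ?thesis using *[OF p refl] 1 by (simp add: Psi_T)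
  next
    case 2
    \<comment> \<open>For fixed z the lift of DT vanishes, in agreement with the value 0 in
      \<open>E_sym\<close>.\<close>
    have "z = \<tau> w \<longleftrightarrow> z = w" for w using 2(3) by (metis swap_swap)
    then have "Psi (T b) = 0" unfolding 2 by (intro poly_mapping_eqI) (auto simp: lookup_Psi lookup_single when_def)
    then show ?thesis using 2 by (simp add: F0_ops)
  next
    case 3
    have e: "scale fls_X_inv (app (B r s) (T z)) = app (B r s) (Poly_Mapping.single z fls_X_inv)"
      by (simp add: app_single[of _ _ fls_X_inv])
    have p: "pol (scale fls_X_inv (app (B r s) (T z)))"
      using u[OF 3(2)] B_coeff_holo(2)[OF assms(1,2) 3(3)] by (auto simp: pol_def pol_keys)
    have "E_sym n k i j a v r s b = Delta (scale fls_X_inv (app (B r s) (T z)))"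
      using 3 A_coeff_regular(2)[OF assms(1,2) 3(3)] Rl_B[OF assms(1,2)]
      by (simp add: gen_tab_def E_gen_app) (intro Dtab_Delta, auto simp: regular_tab_def reg_regular)
    then show ?thesis using *[OF p e] 3 by (simp add: Psi_DT)
  qed
qed

lemma E_free_Psi:
  assumes "r \<in> {1..n}" "s \<in> {1..n}" "f \<in> F0"
  shows "E_free n k i j a v r s f \<in> F0 \<and> Psi (E_free n k i j a v r s f) \<asymp> app (B r s) (Psi f)"
proof
  have b: "b \<in> Tsym ` Zvecs n \<union> DTsym ` Zvecs n" if "b \<in> Poly_Mapping.keys f" for b using assms(3) that by (auto simp: F0_def)
  note e = E_sym_Psi[OF assms(1,2) b]
  show "E_free n k i j a v r s f \<in> F0"
    unfolding E_free_def lin_extend_def using e by (intro F0_sum F0_ops) auto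
  have 1: "Psi (E_free n k i j a v r s f) = (\<Sum>b\<in>Poly_Mapping.keys f. scale (fls_const (Poly_Mapping.lookup f b)) (Psi (E_sym n k i j a v r s b)))"
    by (simp add: E_free_def lin_extend_def Psi_sum Psi_scale)
  have 2: "app (B r s) (Psi f) = (\<Sum>b\<in>Poly_Mapping.keys f. scale (fls_const (Poly_Mapping.lookup f b)) (app (B r s) (Psi (T b))))"
    by (subst Psi_symbols) (simp add: app_sum app_scale)
  show "Psi (E_free n k i j a v r s f) \<asymp> app (B r s) (Psi f)"
    unfolding 1 2 using e by (intro eqv_sum eqv_scale) blast
qed

text \<open>A single letter is compatible with the lift only up to \<open>eqv\<close>. This suffices
  for words because the iterates stay in the lattice, where the next letter preserves
  \<open>eqv\<close>.\<close>

lemma free_act_Psi: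
  assumes "y \<in> free_letters n" "f \<in> F0"
  shows "free_act scale (E_free n k i j a v) y f \<in> F0" "Psi (free_act scale (E_free n k i j a v) y f) \<asymp> app (\<rho> y) (Psi f)"
proof -
  let ?w = "\<lambda>l. foldr (\<lambda>(r,s). E_free n k i j a v r s) l f"
  have w: "?w l \<in> F0 \<and> Psi (?w l) \<asymp> foldr (\<lambda>(r,s). app (B r s)) l (Psi f)" if "set l \<subseteq> {1..n} \<times> {1..n}" for l
    using that
  proof (induction l)
    case (Cons x l)
    obtain r s where x: "x = (r, s)" by (cases x)
    have rs: "r \<in> {1..n}" "s \<in> {1..n}" using Cons x by auto
    have IH: "?w l \<in> F0" "Psi (?w l) \<asymp> foldr (\<lambda>(r,s). app (B r s)) l (Psi f)" using Cons by auto
    have "app (B r s) (Psi (?w l)) \<asymp> app (B r s) (foldr (\<lambda>(r,s). app (B r s)) l (Psi f))"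
      using eqv_rho[OF Efree_letters[OF rs] lat_Psi[OF IH(1)] lat_word IH(2)] Cons.prems lat_Psi[OF assms(2)]
      by (simp add: ce.rep_Efree)
    then show ?case using E_free_Psi[OF rs IH(1)] eqv_trans by (simp add: x) blast
  qed (simp add: assms(2))
  show "free_act scale (E_free n k i j a v) y f \<in> F0"
    unfolding free_act_def using assms(1) w by (intro F0_sum F0_ops) (auto simp: free_letters_def)
  show "Psi (free_act scale (E_free n k i j a v) y f) \<asymp> app (\<rho> y) (Psi f)"
    unfolding free_act_def app_rep Psi_sum Psi_scale using assms(1) w
    by (intro eqv_sum eqv_scale) (auto simp: free_letters_def)
qed

section \<open>The relations between the tableau symbols\<close>

abbreviation "Rel \<equiv> tab_relations n k i j"

lemma Rel_subspace: "module.subspace scale Rel"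
  unfolding tab_relations_def by (rule module.subspace_span[OF module_scale])

lemma Rel_ops: "0 \<in> Rel" "f \<in> Rel \<Longrightarrow> g \<in> Rel \<Longrightarrow> f + g \<in> Rel" "f \<in> Rel \<Longrightarrow> scale c f \<in> Rel"
  "f \<in> Rel \<Longrightarrow> g \<in> Rel \<Longrightarrow> f - g \<in> Rel"
  using Rel_subspace module.subspace_0[OF module_scale] module.subspace_add[OF module_scale] module.subspace_scale[OF module_scale]
    module.subspace_diff[OF module_scale] by blast+

lemma Rel_sum: "(\<And>x. x \<in> S \<Longrightarrow> f x \<in> Rel) \<Longrightarrow> sum f S \<in> Rel"
  by (induction S rule: infinite_finite_induct) (auto intro: Rel_ops)

lemma Rel_gens: "z \<in> Zvecs n \<Longrightarrow> T (Tsym z) - T (Tsym (\<tau> z)) \<in> Rel" "z \<in> Zvecs n \<Longrightarrow> T (DTsym z) + T (DTsym (\<tau> z)) \<in> Rel"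
  unfolding tab_relations_def by (rule module.span_base[OF module_scale]; blast)+

lemma Rel_Psi: assumes "f \<in> Rel" shows "f \<in> F0 \<and> Psi f = 0"
proof -
  have "Rel \<subseteq> {f. f \<in> F0 \<and> Psi f = 0}"
    unfolding tab_relations_def
  proof (rule module.span_minimal[OF module_scale])
    show "module.subspace scale {f. f \<in> F0 \<and> Psi f = 0}"
      by (auto simp: module.subspace_def[OF module_scale] F0_ops Psi_add Psi_scale)
    have 1: "T (Tsym z) - T (Tsym (\<tau> z)) \<in> F0 \<and> Psi (T (Tsym z) - T (Tsym (\<tau> z))) = 0"
      "T (DTsym z) + T (DTsym (\<tau> z)) \<in> F0 \<and> Psi (T (DTsym z) + T (DTsym (\<tau> z))) = 0" if "z \<in> Zvecs n" for z
      using that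
      by (auto simp: F0_iff lookup_add lookup_minus lookup_single when_def lookup_Psi tau_eq_iff intro!: poly_mapping_eqI)
    then show "{T (Tsym z) - T (Tsym (\<tau> z)) |z. z \<in> Zvecs n} \<union> {T (DTsym z) + T (DTsym (\<tau> z)) |z. z \<in> Zvecs n} \<subseteq> {f. f \<in> F0 \<and> Psi f = 0}"
      by blast
  qed
  then show ?thesis using assms by blast
qed

text \<open>Lifting symmetrizes without dividing by two, so reading the coefficients back gives f
  plus or minus its swapped copy, which is 2 f modulo the relations. On each symbol the error is a
  multiple of one relation.\<close>

lemma half_Delta_Psi:
  assumes "f \<in> F0" shows "f - scale (1/2) (Delta (Psi f)) \<in> Rel"
proof -
  define N where "N f = f - scale (1/2) (Delta (Psi f))" for f
  have N_add: "N (f + g) = N f + N g" for f g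
    by (intro tab_free_eqI) (simp_all add: N_def lookup_minus lookup_add algebra_simps add_divide_distrib diff_divide_distrib)
  have N_sum: "N (sum f S) = (\<Sum>x\<in>S. N (f x))" for f :: "tab_sym \<Rightarrow> _" and S
  proof (induction S rule: infinite_finite_induct)
    case empty
    have "N 0 = 0" by (intro tab_free_eqI) (simp_all add: N_def)
    then show ?case by simp
  next
    case (infinite S)
    have "N 0 = 0" by (intro tab_free_eqI) (simp_all add: N_def)
    then show ?case using infinite by simp
  qed (simp add: N_add)
  have 1: "N (Poly_Mapping.single (Tsym z) c) = scale (c/2) (T (Tsym z) - T (Tsym (\<tau> z)))" for z c
    by (intro tab_free_eqI) (auto simp: N_def lookup_minus lookup_single when_def tau_eq_iff)
  have 2: "N (Poly_Mapping.single (DTsym z) c) = scale (c/2) (T (DTsym z) + T (DTsym (\<tau> z)))" for z c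
    by (intro tab_free_eqI) (auto simp: N_def lookup_minus lookup_add lookup_single when_def tau_eq_iff)
  have "N f = (\<Sum>b\<in>Poly_Mapping.keys f. N (Poly_Mapping.single b (Poly_Mapping.lookup f b)))"
    by (subst poly_mapping_sum_singles[of f]) (rule N_sum)
  also have "\<dots> \<in> Rel"
  proof (rule Rel_sum)
    fix b assume "b \<in> Poly_Mapping.keys f"
    then have "b \<in> Tsym ` Zvecs n \<union> DTsym ` Zvecs n" using assms by (auto simp: F0_def)
    then show "N (Poly_Mapping.single b (Poly_Mapping.lookup f b)) \<in> Rel"
      using Rel_gens Rel_ops(3) by (auto simp: 1 2)
  qed
  finally show ?thesis by (simp add: N_def)
qed

abbreviation "cls \<equiv> tab_cls n k i j"

lemma cls_eq_diff: "cls f = cls g \<longleftrightarrow> f - g \<in> Rel"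
proof
  assume "cls f = cls g"
  moreover have "f \<in> cls f" using Rel_ops(1) by (force simp: tab_cls_def)
  ultimately show "f - g \<in> Rel" by (auto simp: tab_cls_def)
next
  assume *: "f - g \<in> Rel"
  have "f + h \<in> cls g" if "h \<in> Rel" for h
    using Rel_ops(2)[OF * that] unfolding tab_cls_def by (intro CollectI exI[of _ "f - g + h"]) simp
  moreover have "g + h \<in> cls f" if "h \<in> Rel" for h
    using Rel_ops(4)[OF that *] unfolding tab_cls_def by (intro CollectI exI[of _ "h - (f - g)"]) simp
  ultimately show "cls f = cls g" unfolding tab_cls_def by auto
qed

lemma cls_eq:
  assumes "f \<in> F0" "g \<in> F0" shows "cls f = cls g \<longleftrightarrow> Psi f \<asymp> Psi g"
proof
  assume "cls f = cls g"
  then have "Psi (f - g) = 0" using Rel_Psi by (simp add: cls_eq_diff)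
  then have "Psi f = Psi g" using Psi_add[of "f - g" g] by simp
  then show "Psi f \<asymp> Psi g" by simp
next
  assume "Psi f \<asymp> Psi g"
  then have "Delta (Psi f) = Delta (Psi g)" by (rule Delta_cong)
  then have "f - g = (f - scale (1/2) (Delta (Psi f))) - (g - scale (1/2) (Delta (Psi g)))" by simp
  then show "cls f = cls g"
    unfolding cls_eq_diff using Rel_ops(4)[OF half_Delta_Psi half_Delta_Psi] assms by metis
qed

section \<open>The module structure\<close>

text \<open>The factor 1/2 makes \<open>cl (Psi f)\<close> the class of f. Every element of V has
  this form with G in the lattice, so the module laws are checked on lattice vectors.\<close>

definition cl :: "(zvec \<Rightarrow>\<^sub>0 complex fls) \<Rightarrow> tab_vec" where
  "cl G = cls (scale (1/2) (Delta G))"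

lemma half_Delta: 
  assumes "lat G" shows "scale (1/2) (Delta G) \<in> F0" "Psi (scale (1/2) (Delta G)) \<asymp> G"
proof -
  show "scale (1/2) (Delta G) \<in> F0" using assms by (intro F0_ops Delta_F0) (simp add: lat_def pol_def)
  show "Psi (scale (1/2) (Delta G)) \<asymp> G"
    using lat_nth[OF assms] by (auto simp: eqv_def)
qed

lemma cl_eq: "lat G \<Longrightarrow> lat H \<Longrightarrow> cl G = cl H \<longleftrightarrow> G \<asymp> H"
  unfolding cl_def using half_Delta[of G] half_Delta[of H] by (simp add: cls_eq) (meson eqv_sym eqv_trans)

lemma cls_cl: "f \<in> F0 \<Longrightarrow> cls f = cl (Psi f)"
  unfolding cl_def using half_Delta[OF lat_Psi] by (simp add: cls_eq eqv_sym)

abbreviation "V \<equiv> V_sing n k i j a v"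

lemma V_carrier: "carrier V = cl ` {G. lat G}"
proof -
  have "carrier V = cls ` F0" by (simp add: V_sing_def F0_def)
  also have "\<dots> = cl ` {G. lat G}"
    using cls_cl lat_Psi half_Delta(1) by (auto simp: cl_def image_iff)
  finally show ?thesis .
qed

lemma cl_V [simp]: "lat G \<Longrightarrow> cl G \<in> carrier V" by (auto simp: V_carrier)

lemma V_cases: "u \<in> carrier V \<Longrightarrow> (\<And>G. lat G \<Longrightarrow> u = cl G \<Longrightarrow> P) \<Longrightarrow> P"
  by (auto simp: V_carrier)

lemma V_zero: "\<zero>\<^bsub>V\<^esub> = cl 0"
proof -
  have "Delta 0 = 0" by (intro tab_free_eqI) auto
  then show ?thesis by (simp add: V_sing_def cl_def)
qed

lemma V_add: "cl G \<oplus>\<^bsub>V\<^esub> cl H = cl (G + H)"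
proof -
  have "{f + g | f g. f \<in> cls F \<and> g \<in> cls F'} = cls (F + F')" for F F'
  proof (intro equalityI subsetI)
    fix x assume "x \<in> {f + g | f g. f \<in> cls F \<and> g \<in> cls F'}"
    then obtain h h' where "x = (F + h) + (F' + h')" "h \<in> Rel" "h' \<in> Rel" by (auto simp: tab_cls_def)
    then show "x \<in> cls (F + F')" using Rel_ops(2)[of h h'] unfolding tab_cls_def
      by (intro CollectI exI[of _ "h + h'"]) (simp add: algebra_simps)
  next
    fix x assume "x \<in> cls (F + F')"
    then obtain h where h: "x = F + F' + h" "h \<in> Rel" by (auto simp: tab_cls_def)
    have "F \<in> cls F" using Rel_ops(1) by (force simp: tab_cls_def)
    moreover have "F' + h \<in> cls F'" using h by (auto simp: tab_cls_def)
    ultimately show "x \<in> {f + g | f g. f \<in> cls F \<and> g \<in> cls F'}" using h by (auto simp: add.assoc)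
  qed
  moreover have "scale (1/2) (Delta G) + scale (1/2) (Delta H) = scale (1/2) (Delta (G + H))"
    by (intro tab_free_eqI) (simp_all add: lookup_add add_divide_distrib)
  ultimately show ?thesis by (simp add: V_sing_def cl_def)
qed

lemma V_abelian_group: "abelian_group V"
proof (rule abelian_groupI)
  fix x assume "x \<in> carrier V"
  then obtain G where G: "lat G" "x = cl G" by (rule V_cases)
  show "\<exists>y\<in>carrier V. y \<oplus>\<^bsub>V\<^esub> x = \<zero>\<^bsub>V\<^esub>"
    using lat_diff[OF lat_0 G(1)] by (intro bexI[of _ "cl (0 - G)"]) (simp_all add: G V_add V_zero)
qed (auto elim!: V_cases simp: V_add V_zero lat_add lat_0 ac_simps)

end

section \<open>The enveloping algebra\<close>

lemma free_letters_iff: "f \<in> free_letters n \<longleftrightarrow> (\<forall>w. \<not> set (letters w) \<subseteq> {1..n} \<times> {1..n} \<longrightarrow> Poly_Mapping.lookup f w = 0)"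
  unfolding free_letters_def mem_Collect_eq by (metis in_keys_iff)

lemma free_letters_ops: "0 \<in> free_letters n" "1 \<in> free_letters n" "Poly_Mapping.single 0 c \<in> free_letters n"
  "f \<in> free_letters n \<Longrightarrow> - f \<in> free_letters n"
  "f \<in> free_letters n \<Longrightarrow> g \<in> free_letters n \<Longrightarrow> f + g \<in> free_letters n"
  "f \<in> free_letters n \<Longrightarrow> g \<in> free_letters n \<Longrightarrow> f - g \<in> free_letters n"
  "f \<in> free_letters n \<Longrightarrow> g \<in> free_letters n \<Longrightarrow> f * g \<in> free_letters n"
proof -
  show 0: "Poly_Mapping.single 0 c \<in> free_letters n" for c
    by (simp add: free_letters_def zero_gl_word_def)
  show "0 \<in> free_letters n" by (simp add: free_letters_def)
  show "1 \<in> free_letters n" using 0[of 1] by simp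
  show "f \<in> free_letters n \<Longrightarrow> - f \<in> free_letters n"
    "f \<in> free_letters n \<Longrightarrow> g \<in> free_letters n \<Longrightarrow> f + g \<in> free_letters n"
    "f \<in> free_letters n \<Longrightarrow> g \<in> free_letters n \<Longrightarrow> f - g \<in> free_letters n"
    by (simp_all add: free_letters_iff lookup_add lookup_minus)
  assume fg: "f \<in> free_letters n" "g \<in> free_letters n"
  show "f * g \<in> free_letters n"
    unfolding free_letters_def mem_Collect_eq
  proof
    fix w assume "w \<in> Poly_Mapping.keys (f * g)"
    then obtain u u' where "w = u + u'" "u \<in> Poly_Mapping.keys f" "u' \<in> Poly_Mapping.keys g" using keys_mult[of f g] by blast
    moreover from this have "set (letters u) \<subseteq> {1..n} \<times> {1..n}" "set (letters u') \<subseteq> {1..n} \<times> {1..n}"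
      using fg unfolding free_letters_def by blast+
    ultimately show "set (letters w) \<subseteq> {1..n} \<times> {1..n}" by (simp add: plus_gl_word_def)
  qed
qed

lemma free_alg_simps [simp]: "carrier (free_alg n) = free_letters n" "\<zero>\<^bsub>free_alg n\<^esub> = 0" "\<one>\<^bsub>free_alg n\<^esub> = 1"
  "f \<oplus>\<^bsub>free_alg n\<^esub> g = f + g" "f \<otimes>\<^bsub>free_alg n\<^esub> g = f * g"
  by (simp_all add: free_alg_def free_letters_def)

lemma ring_free_alg: "ring (free_alg n)"
proof (rule ringI)
  show "abelian_group (free_alg n)"
  proof (rule abelian_groupI)
    fix x assume "x \<in> carrier (free_alg n)"
    then show "\<exists>y\<in>carrier (free_alg n). y \<oplus>\<^bsub>free_alg n\<^esub> x = \<zero>\<^bsub>free_alg n\<^esub>"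
      by (intro bexI[of _ "- x"]) (simp_all add: free_letters_ops)
  qed (simp_all add: free_letters_ops ac_simps)
  show "monoid (free_alg n)"
    by (rule monoidI) (simp_all add: free_letters_ops mult.assoc)
qed (simp_all add: distrib_left distrib_right)

lemma gl_relators_free: "gl_relators n \<subseteq> free_letters n"
proof
  fix f assume "f \<in> gl_relators n"
  then obtain r s p q where f: "f = Efree r s * Efree p q - Efree p q * Efree r s
       - ((if s = p then Efree r q else 0) - (if q = r then Efree p s else 0))" and 1: "{r, s, p, q} \<subseteq> {1..n}"
    unfolding gl_relators_def by blast
  have E: "Efree r s \<in> free_letters n" if "r \<in> {1..n}" "s \<in> {1..n}" for r s
    using that by (simp add: free_letters_def Efree_def)
  show "f \<in> free_letters n"
    unfolding f using 1 by (intro free_letters_ops(6) free_letters_ops(7)) (simp_all add: E free_letters_ops)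
qed

lemma c_free_letters: "r \<le> n \<Longrightarrow> c_free r s \<in> free_letters n"
proof -
  assume r: "r \<le> n"
  have sum: "(\<And>x. x \<in> S \<Longrightarrow> f x \<in> free_letters n) \<Longrightarrow> sum f S \<in> free_letters n" for f :: "nat list \<Rightarrow> gl_free" and S
    by (induction S rule: infinite_finite_induct) (simp_all add: free_letters_ops)
  show ?thesis unfolding c_free_def
  proof (rule sum)
    fix l assume "l \<in> {is. length is = s \<and> set is \<subseteq> {1..r}}"
    then have "set l \<subseteq> {1..n}" using r by auto
    moreover have "set (zip l (rotate1 l)) \<subseteq> set l \<times> set (rotate1 l)" using set_zip_leftD set_zip_rightD by fast
    ultimately have "set (zip l (rotate1 l)) \<subseteq> {1..n} \<times> {1..n}" unfolding set_rotate1 by blast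
    then show "Poly_Mapping.single (GW (zip l (rotate1 l))) 1 \<in> free_letters n" by (simp add: free_letters_def)
  qed
qed

lemma ideal_gl_ideal: "ideal (gl_ideal n) (free_alg n)"
  unfolding gl_ideal_def using gl_relators_free by (intro ring.genideal_ideal[OF ring_free_alg]) simp

lemma carrier_Ugl: "carrier (Ugl n) = Ucls n ` free_letters n"
  by (auto simp: Ugl_def FactRing_def A_RCOSETS_def' Ucls_def)

lemma ring_Ugl: "ring (Ugl n)"
  unfolding Ugl_def by (rule ideal.quotient_is_ring[OF ideal_gl_ideal])

lemma Ugl_ops:
  assumes "x \<in> free_letters n" "y \<in> free_letters n"
  shows "Ucls n x \<oplus>\<^bsub>Ugl n\<^esub> Ucls n y = Ucls n (x + y)" "Ucls n x \<otimes>\<^bsub>Ugl n\<^esub> Ucls n y = Ucls n (x * y)"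
  using ring_hom_add[OF ideal.rcos_ring_hom[OF ideal_gl_ideal], of x n y] ring_hom_mult[OF ideal.rcos_ring_hom[OF ideal_gl_ideal], of x n y] assms
  by (simp_all add: Ugl_def Ucls_def)

lemma Ugl_one: "\<one>\<^bsub>Ugl n\<^esub> = Ucls n 1"
  using ring_hom_one[OF ideal.rcos_ring_hom[OF ideal_gl_ideal], of n] by (simp add: Ugl_def Ucls_def)

lemma Ugl_zero: "\<zero>\<^bsub>Ugl n\<^esub> = Ucls n 0"
proof -
  interpret ring "Ugl n" by (rule ring_Ugl)
  have "Ucls n 0 \<in> carrier (Ugl n)" by (simp add: carrier_Ugl free_letters_ops)
  moreover have "Ucls n 0 \<oplus>\<^bsub>Ugl n\<^esub> Ucls n 0 = Ucls n 0" by (simp add: Ugl_ops free_letters_ops)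
  ultimately show ?thesis by (metis add.r_cancel_one)
qed

lemma Ugl_inv: "y \<in> free_letters n \<Longrightarrow> \<ominus>\<^bsub>Ugl n\<^esub> Ucls n y = Ucls n (- y)"
proof -
  assume y: "y \<in> free_letters n"
  interpret ring "Ugl n" by (rule ring_Ugl)
  show ?thesis
    by (rule minus_equality) (use y in \<open>simp_all add: Ugl_ops free_letters_ops Ugl_zero carrier_Ugl\<close>)
qed

lemma Ucls_closed [simp]: "y \<in> free_letters n \<Longrightarrow> Ucls n y \<in> carrier (Ugl n)"
  by (simp add: carrier_Ugl)

context singular_point
begin

interpretation gB: generic_tableau n eL by (rule line_generic)
interpretation Rl: specialization Rl by (rule idom_hom.specialization[OF idom_hom_lsub])
interpretation ce: complex_embedding "fls_const :: complex \<Rightarrow> complex fls" by (rule complex_embedding_fls)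

lemma gl_rep_B: "gl_rep n B"
  using gB.gl_rep_axioms unfolding gE_def .

text \<open>The elements of the free algebra that act as zero form an ideal, and it contains the
  relators because the Laurent tableaux form a gl(n)-module.\<close>

lemma rho_gl_ideal: assumes "f \<in> gl_ideal n" shows "f \<in> free_letters n \<and> \<rho> f = 0"
proof -
  interpret F: ring "free_alg n" by (rule ring_free_alg)
  let ?I = "{f \<in> free_letters n. \<rho> f = 0}"
  have inv: "\<ominus>\<^bsub>free_alg n\<^esub> f = - f" if "f \<in> free_letters n" for f
    by (rule F.minus_equality) (use that in \<open>simp_all add: free_letters_ops\<close>)
  have "ideal ?I (free_alg n)"
  proof (rule idealI[OF ring_free_alg])
    show "subgroup ?I (add_monoid (free_alg n))"
    proof (rule F.add.subgroupI)
      show "?I \<noteq> {}" using free_letters_ops(1)[of n] ce.rep_hom(3) by blast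
    qed (auto simp: inv free_letters_ops ce.rep_hom)
  qed (auto simp: free_letters_ops ce.rep_hom)
  moreover have "gl_relators n \<subseteq> ?I" using gl_relators_free ce.rep_relator[OF gl_rep_B] by blast
  ultimately have "gl_ideal n \<subseteq> ?I" unfolding gl_ideal_def genideal_def by blast
  then show ?thesis using assms by blast
qed

lemma Ucls_mem:
  assumes "y' \<in> Ucls n y" "y \<in> free_letters n" shows "y' \<in> free_letters n \<and> \<rho> y' = \<rho> y"
proof -
  obtain h where "h \<in> gl_ideal n" "y' = h + y" using assms(1) by (auto simp: Ucls_def a_r_coset_def')
  then show ?thesis using rho_gl_ideal assms(2) by (simp add: free_letters_ops ce.rep_hom)
qed

lemma Ucls_self: "y \<in> Ucls n y"
proof -
  have "0 \<in> gl_ideal n" using additive_subgroup.zero_closed[OF ideal.axioms(1)[OF ideal_gl_ideal]] by simp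
  then show ?thesis by (force simp: Ucls_def a_r_coset_def')
qed

text \<open>The scalar multiplication of \<open>V_sing\<close> is a union over all representatives.
  Each of them contributes the same coset, since congruent words act equally and \<open>eqv\<close>
  is respected, and there is at least one.\<close>

lemma smult_cl:
  assumes "y \<in> free_letters n" "lat G"
  shows "Ucls n y \<odot>\<^bsub>V\<^esub> cl G = cl (app (\<rho> y) G)"
proof -
  have c: "cls (free_act scale (E_free n k i j a v) y' f) = cl (app (\<rho> y) G)"
    if yf: "y' \<in> Ucls n y" "f \<in> cl G" for y' f
  proof -
    have y': "y' \<in> free_letters n" "\<rho> y' = \<rho> y" using Ucls_mem[OF yf(1) assms(1)] by auto
    obtain h where h: "f = scale (1/2) (Delta G) + h" "h \<in> Rel" using yf(2) by (auto simp: cl_def tab_cls_def)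
    have f: "f \<in> F0" "Psi f \<asymp> G"
      using half_Delta[OF assms(2)] Rel_Psi[OF h(2)] by (simp_all add: h(1) F0_ops Psi_add)
    have "Psi (free_act scale (E_free n k i j a v) y' f) \<asymp> app (\<rho> y) (Psi f)"
      using free_act_Psi(2)[OF y'(1) f(1)] by (simp add: y'(2))
    moreover have "app (\<rho> y) (Psi f) \<asymp> app (\<rho> y) G"
      by (rule eqv_rho[OF assms(1) lat_Psi[OF f(1)] assms(2) f(2)])
    ultimately have "Psi (free_act scale (E_free n k i j a v) y' f) \<asymp> app (\<rho> y) G" by (rule eqv_trans)
    then show ?thesis
      unfolding cls_cl[OF free_act_Psi(1)[OF y'(1) f(1)]]
      by (subst cl_eq[OF lat_Psi[OF free_act_Psi(1)[OF y'(1) f(1)]] lat_rho[OF assms]])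
  qed
  have ne: "scale (1/2) (Delta G) \<in> cl G" using Rel_ops(1) by (force simp: cl_def tab_cls_def)
  have "Ucls n y \<odot>\<^bsub>V\<^esub> cl G = (\<Union>y'\<in>Ucls n y. \<Union>f\<in>cl G. cls (free_act scale (E_free n k i j a v) y' f))"
    by (simp add: V_sing_def)
  also have "\<dots> = (\<Union>y'\<in>Ucls n y. \<Union>f\<in>cl G. cl (app (\<rho> y) G))"
    by (intro SUP_cong refl c)
  also have "\<dots> = cl (app (\<rho> y) G)" using ne Ucls_self[of y] by blast
  finally show ?thesis .
qed

lemma Ugl_cases: "x \<in> carrier (Ugl n) \<Longrightarrow> (\<And>y. y \<in> free_letters n \<Longrightarrow> x = Ucls n y \<Longrightarrow> P) \<Longrightarrow> P"
  by (auto simp: carrier_Ugl)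

lemma left_module_V: "left_module (Ugl n) V"
proof (rule left_module.intro[OF ring_Ugl V_abelian_group], unfold_locales)
  fix x u assume "x \<in> carrier (Ugl n)" "u \<in> carrier V"
  then show "x \<odot>\<^bsub>V\<^esub> u \<in> carrier V"
    by (elim Ugl_cases V_cases) (simp add: smult_cl lat_rho)
next
  fix x y u assume "x \<in> carrier (Ugl n)" "y \<in> carrier (Ugl n)" "u \<in> carrier V"
  then show "(x \<oplus>\<^bsub>Ugl n\<^esub> y) \<odot>\<^bsub>V\<^esub> u = x \<odot>\<^bsub>V\<^esub> u \<oplus>\<^bsub>V\<^esub> y \<odot>\<^bsub>V\<^esub> u"
    by (elim Ugl_cases V_cases) (simp add: smult_cl lat_rho Ugl_ops free_letters_ops V_add ce.rep_hom)
next
  fix x u w assume "x \<in> carrier (Ugl n)" "u \<in> carrier V" "w \<in> carrier V"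
  then show "x \<odot>\<^bsub>V\<^esub> (u \<oplus>\<^bsub>V\<^esub> w) = x \<odot>\<^bsub>V\<^esub> u \<oplus>\<^bsub>V\<^esub> x \<odot>\<^bsub>V\<^esub> w"
    by (elim Ugl_cases V_cases) (simp add: smult_cl lat_rho V_add lat_add app_add)
next
  fix x y u assume "x \<in> carrier (Ugl n)" "y \<in> carrier (Ugl n)" "u \<in> carrier V"
  then show "(x \<otimes>\<^bsub>Ugl n\<^esub> y) \<odot>\<^bsub>V\<^esub> u = x \<odot>\<^bsub>V\<^esub> (y \<odot>\<^bsub>V\<^esub> u)"
    by (elim Ugl_cases V_cases) (simp add: smult_cl lat_rho Ugl_ops free_letters_ops ce.rep_hom)
next
  fix u assume "u \<in> carrier V"
  then show "\<one>\<^bsub>Ugl n\<^esub> \<odot>\<^bsub>V\<^esub> u = u"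
    by (elim V_cases) (simp add: smult_cl Ugl_one free_letters_ops ce.rep_hom)
qed

section \<open>The action of the Gelfand-Tsetlin generators\<close>

lemma T_sing_cl: "z \<in> Zvecs n \<Longrightarrow> T_sing n k i j z = cl (T z + flip (T z))"
  unfolding T_sing_def Psi_T[symmetric] by (rule cls_cl) (simp add: F0_def)

lemma DT_sing_cl: "z \<in> Zvecs n \<Longrightarrow> DT_sing n k i j z = cl (Poly_Mapping.single z fls_X_inv + flip (Poly_Mapping.single z fls_X_inv))"
  unfolding DT_sing_def Psi_DT[symmetric] by (rule cls_cl) (simp add: F0_def)

lemma generic_A: "generic_tableau n (ea n a)"
proof
  fix s u r m assume *: "1 \<le> s" "s < u" "u \<le> r" "r < n"
  show "ea n a (r,s) - ea n a (r,u) \<noteq> of_int m"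
  proof
    assume eq: "ea n a (r,s) - ea n a (r,u) = of_int m"
    have R: "Rl (ea n a w) (eL w)" for w by (simp add: ea_def eL_def Rl_const Rl_var)
    have "Rl (ea n a (r,s) - ea n a (r,u) - of_int m) (eL (r,s) - eL (r,u) - of_int m)"
      by (intro Rl.R_diff R Rl.R_of_int)
    then have "eL (r,s) - eL (r,u) - of_int m = 0" unfolding eq by (intro Rl.R_0_left) simp
    then show False using gB.generic[OF *, of m] by simp
  qed
qed

definition mu :: "nat \<Rightarrow> nat \<Rightarrow> zvec \<Rightarrow> complex fls" where
  "mu r s z = Poly_Mapping.lookup (app (\<rho> (c_free r s)) (T z)) z"

lemma ent_jet: "jet (ent n eL z r s) (val z r s) (if (r,s) = (k,i) then 1/2 else if (r,s) = (k,j) then -1/2 else 0)"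
proof -
  have l: "jet (line k i j v (r,s)) (v (r,s)) (if (r,s) = (k,i) then 1/2 else if (r,s) = (k,j) then -1/2 else 0)"
    using jet_add[OF jet_const[of "v (r,s)"] jet_mult[OF jet_const[of "1/2"] jet_X]] jet_const[of "v (r,s)"]
      jet_add[OF jet_const[of "v (r,s)"] jet_mult[OF jet_const[of "- (1/2)"] jet_X]]
    by (auto simp: line_def)
  have o: "jet (of_int (z (r,s))) (of_int (z (r,s))) 0" using jet_const[of "of_int (z (r,s))"] by (simp add: fls_of_int)
  show ?thesis
  proof (cases "r = n")
    case True
    then have "r \<noteq> k" using kn by simp
    then show ?thesis using True jet_const[of "a s"] by (simp add: ent_def val_def eL_def)
  next
    case False
    then show ?thesis using jet_add[OF l o] by (simp add: ent_def val_def eL_def)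
  qed
qed

text \<open>Unlike the coefficients of matrix units, the eigenvalue is a polynomial in the entries;
  by induction on that polynomial it is regular at v, and on the line its constant term is
  \<open>gamma\<close> at the entries of the singular tableau.\<close>

lemma c_eigen:
  assumes "1 \<le> s" "r \<le> n"
  obtains m where "app (rep rconst A (c_free r s)) (T z) = Poly_Mapping.single z m"
    "app (\<rho> (c_free r s)) (T z) = Poly_Mapping.single z (mu r s z)"
    "reg m" "Rl m (mu r s z)" "holo (mu r s z)"
    "fls_nth (mu r s z) 0 = rf_eval (gamma r s) (\<lambda>u. val z (fst u) (snd u))"
proof -
  interpret cr: complex_embedding rconst by (rule complex_embedding_rconst)
  obtain P where P: "gamma r s = emb P" using gamma_emb[of r s] by auto
  let ?g = "\<lambda>u. ent n (ea n a) z (fst u) (snd u)" and ?h = "\<lambda>u. ent n eL z (fst u) (snd u)"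
  let ?v = "\<lambda>u. val z (fst u) (snd u)"
  let ?m = "alg_ext rconst (monom_val ?g) P" and ?mu = "alg_ext fls_const (monom_val ?h) P"
  have 1: "app (rep rconst A (c_free r s)) (T z) = Poly_Mapping.single z ?m"
    using cr.gelfand_eigenvalue[OF generic_A assms(2) P, of z] by (simp only: cr.rep_c_free[OF assms(1)])
  have 2: "app (\<rho> (c_free r s)) (T z) = Poly_Mapping.single z ?mu"
    using ce.gelfand_eigenvalue[OF line_generic assms(2) P, of z] by (simp only: ce.rep_c_free[OF assms(1)])
  have mu: "mu r s z = ?mu" by (simp add: mu_def 2)
  have "rv v (rconst c) c" for c
    using idom_hom.frac_rel_Fract1[OF idom_hom_eval, of v "Poly_Mapping.single 0 c"] by (simp add: rconst_def mpoly_eval_const)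
  then have rc: "reg (rconst c)" for c unfolding reg_def by blast
  have 3: "reg ?m"
  proof (induction P rule: mpoly_induct)
    case (1 c) then show ?case using rc by (simp only: cr.subst_const)
  next
    case (2 u) then show ?case using reg_ent by (simp only: cr.subst_var)
  next
    case (3 p q) then show ?case unfolding idom_hom.hom_add[OF cr.idom_hom_subst] by (rule reg_intros)
  next
    case (4 p q) then show ?case unfolding idom_hom.hom_mult[OF cr.idom_hom_subst] by (rule reg_intros)
  qed
  have 4: "Rl ?m ?mu"
    using Rl_coeff[of "c_free r s" z z] c_free_letters[OF assms(2), of s] 1 2 by (simp add: free_letters_def)
  have jh: "\<exists>d. jet (?h u) (?v u) d" for u using ent_jet by blast
  have 5: "\<exists>d. jet ?mu (mpoly_eval P ?v) d"
  proof (induction P rule: mpoly_induct)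
    case (1 c) then show ?case using jet_const by (simp only: ce.subst_const mpoly_eval_const) blast
  next
    case (2 u) then show ?case using jh by (simp only: ce.subst_var mpoly_eval_var)
  next
    case (3 p q) then show ?case unfolding idom_hom.hom_add[OF ce.idom_hom_subst] mpoly_eval_simps using jet_add by blast
  next
    case (4 p q) then show ?case unfolding idom_hom.hom_mult[OF ce.idom_hom_subst] mpoly_eval_simps using jet_mult by blast
  qed
  then have 6: "holo ?mu" unfolding holo_def by blast
  have "rf_eval (gamma r s) ?v = mpoly_eval P ?v"
    unfolding P emb_def by (rule rf_eval_rv[OF idom_hom.frac_rel_Fract1[OF idom_hom_eval]])
  then show thesis using that[OF 1 2[folded mu] 3 4[folded mu] 6[folded mu]] 5 jet_nth(1) mu by metis
qed

text \<open>Handles both kinds of symbols: g = 1 is the lift of T, and g = 1/t the lift of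
  DT.\<close>

lemma cl_flip_c:
  assumes "1 \<le> s" "r \<le> n" "z \<in> Zvecs n" "holo (fls_X * g)"
  shows "c_env n r s \<odot>\<^bsub>V\<^esub> cl (Poly_Mapping.single z g + flip (Poly_Mapping.single z g)) = cls (Delta (Poly_Mapping.single z (g * mu r s z)))"
proof -
  have m: "app (\<rho> (c_free r s)) (T z) = Poly_Mapping.single z (mu r s z)" "holo (mu r s z)"
    by (rule c_eigen[OF assms(1,2), of z]; assumption)+
  have L: "lat (Poly_Mapping.single z g + flip (Poly_Mapping.single z g))" using assms by (intro lat_sym pol_single)
  have p: "pol (Poly_Mapping.single z (g * mu r s z))"
    using holo_mult[OF assms(4) m(2)] assms(3) by (intro pol_single) (simp_all add: mult.assoc)
  have "app (\<rho> (c_free r s)) (Poly_Mapping.single z g) = Poly_Mapping.single z (g * mu r s z)"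
    by (simp add: app_single[of _ z g] m)
  then have e: "app (\<rho> (c_free r s)) (Poly_Mapping.single z g + flip (Poly_Mapping.single z g)) =
      Poly_Mapping.single z (g * mu r s z) + flip (Poly_Mapping.single z (g * mu r s z))"
    by (simp add: app_add flip_rho[OF c_free_letters[OF assms(2)], symmetric])
  have "c_env n r s \<odot>\<^bsub>V\<^esub> cl (Poly_Mapping.single z g + flip (Poly_Mapping.single z g)) = cl (Poly_Mapping.single z (g * mu r s z) + flip (Poly_Mapping.single z (g * mu r s z)))"
    unfolding c_env_def smult_cl[OF c_free_letters[OF assms(2)] L] e ..
  also have "\<dots> = cl (Psi (Delta (Poly_Mapping.single z (g * mu r s z))))"
    using Psi_Delta[OF p] Delta_F0 p by (subst cl_eq) (auto intro!: lat_sym lat_Psi eqv_sym simp: pol_def)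
  also have "\<dots> = cls (Delta (Poly_Mapping.single z (g * mu r s z)))"
    using Delta_F0 p by (intro cls_cl[symmetric]) (simp add: pol_def)
  finally show ?thesis .
qed

lemma c_action:
  assumes "1 \<le> s" "s \<le> r" "r \<le> n" "z \<in> Zvecs n"
  shows "regular_tab (scale (x_minus_y k i j) (gen_act n a (c_free r s) (gen_tab z))) v"
    "c_env n r s \<odot>\<^bsub>V\<^esub> T_sing n k i j z = Dtab n k i j v (scale (x_minus_y k i j) (gen_act n a (c_free r s) (gen_tab z)))"
    "regular_tab (gen_act n a (c_free r s) (gen_tab z)) v"
    "c_env n r s \<odot>\<^bsub>V\<^esub> DT_sing n k i j z = Dtab n k i j v (gen_act n a (c_free r s) (gen_tab z))"
proof -
  obtain m where m: "app (rep rconst A (c_free r s)) (T z) = Poly_Mapping.single z m"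
    "reg m" "Rl m (mu r s z)" "holo (mu r s z)" by (rule c_eigen[OF assms(1,3), of z]) (rule that)
  have g: "gen_act n a (c_free r s) (gen_tab z) = Poly_Mapping.single z m" by (simp add: gen_act_app gen_tab_def m)
  show r1: "regular_tab (scale (x_minus_y k i j) (gen_act n a (c_free r s) (gen_tab z))) v"
    and r2: "regular_tab (gen_act n a (c_free r s) (gen_tab z)) v"
    unfolding g using m(2) reg_x_minus_y reg_intros(3,4) by (auto simp: regular_tab_def reg_regular lookup_single when_def)
  have "Dtab_free k i j v (scale (x_minus_y k i j) (gen_act n a (c_free r s) (gen_tab z))) =
      Delta (scale fls_X_inv (Poly_Mapping.single z (fls_X * mu r s z)))"
    using r1 Rl.R_mult[OF Rl_x_minus_y m(3)] Rl.R_0 unfolding g by (intro Dtab_Delta) (auto simp: lookup_single when_def)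
  then show "c_env n r s \<odot>\<^bsub>V\<^esub> T_sing n k i j z = Dtab n k i j v (scale (x_minus_y k i j) (gen_act n a (c_free r s) (gen_tab z)))"
    using cl_flip_c[OF assms(1,3,4), of 1] by (simp add: T_sing_cl[OF assms(4)] Dtab_def holo_iff)
  have "Dtab_free k i j v (gen_act n a (c_free r s) (gen_tab z)) = Delta (scale fls_X_inv (Poly_Mapping.single z (mu r s z)))"
    using r2 m(3) Rl.R_0 unfolding g by (intro Dtab_Delta) (auto simp: lookup_single when_def)
  then show "c_env n r s \<odot>\<^bsub>V\<^esub> DT_sing n k i j z = Dtab n k i j v (gen_act n a (c_free r s) (gen_tab z))"
    using cl_flip_c[OF assms(1,3,4), of fls_X_inv] by (simp add: DT_sing_cl[OF assms(4)] Dtab_def holo_iff)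
qed

end

section \<open>Finite generation\<close>

lemma jet_sum: "(\<And>x. x \<in> S \<Longrightarrow> jet (g x) (c x) (d x)) \<Longrightarrow> jet (sum g S) (sum c S) (sum d S)"
  using jet_const[of 0] by (induction S rule: infinite_finite_induct) (simp_all add: jet_add)

lemma fls_const_inverse: "c \<noteq> 0 \<Longrightarrow> fls_const (inverse c) * fls_const c = (1 :: complex fls)"
  by (subst fls_const_mult_const) simp

lemma fls_const_plus_minus: "fls_const c + fls_const (- c) = (0 :: complex fls)"
  by (rule fls_eqI) (simp add: fls_plus_nth)

lemma jet_specialization: "specialization (\<lambda>g c. \<exists>d. jet g c d)"
proof (unfold_locales, goal_cases)
  case 1
  then show ?case using jet_const[of 0] by auto
next
  case 2
  then show ?case using jet_const[of 1] by auto
next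
  case (3 g c h e)
  then show ?case using jet_add by blast
next
  case (4 g c h e)
  then show ?case using jet_mult by blast
next
  case (5 g c)
  then obtain d where d: "jet g c d" by blast
  have "fls_const (- 1) * g = - g" by (rule fls_eqI) simp
  then show ?case using jet_mult[OF jet_const[of "- 1"] d] by auto
next
  case (6 g c)
  then obtain d where d: "jet g c d" by blast
  then show ?case using jet_inverse[OF d 6(2)] jet_nth(1)[OF d] 6(2) by auto
qed

context singular_point
begin

interpretation gB: generic_tableau n eL by (rule line_generic)
interpretation ce: complex_embedding "fls_const :: complex \<Rightarrow> complex fls" by (rule complex_embedding_fls)
interpretation Hv: specialization "\<lambda>g c. \<exists>d. jet g c d" by (rule jet_specialization)

section \<open>The submodule generated by one tableau vector\<close>

definition symm :: "(zvec \<Rightarrow>\<^sub>0 complex fls) \<Rightarrow> (zvec \<Rightarrow>\<^sub>0 complex fls)" where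
  "symm H = H + flip H"

lemma symm_add: "symm (G + H) = symm G + symm H"
  and symm_scale: "symm (scale (fls_const c) G) = scale (fls_const c) (symm G)"
  by (simp_all add: symm_def flip_add flip_scale scale_add \<theta>_hom ac_simps)

lemma symm_rho: "y \<in> free_letters n \<Longrightarrow> app (\<rho> y) (symm H) = symm (app (\<rho> y) H)"
  by (simp add: symm_def app_add flip_rho)

lemma symm_single_eqv:
  assumes "holo (fls_X * f)" "holo (fls_X * g)" "fls_nth f 0 = fls_nth g 0" "fls_nth f (-1) = fls_nth g (-1)"
  shows "symm (Poly_Mapping.single z f) \<asymp> symm (Poly_Mapping.single z g)"
  using assms theta_pole(2,3)[OF assms(1)] theta_pole(2,3)[OF assms(2)]
  by (simp add: eqv_def symm_def lookup_add lookup_single when_def \<theta>_hom)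

text \<open>The generating vector is the lift of DT: a Casimir element minus its constant term turns
  1/t into a constant, whereas applied to the lift of T it gives a multiple of t, which vanishes in
  V.\<close>

definition gen :: "zvec \<Rightarrow> (zvec \<Rightarrow>\<^sub>0 complex fls) \<Rightarrow> bool" where
  "gen z0 G \<longleftrightarrow> lat G \<and> (\<exists>y\<in>free_letters n. G \<asymp> app (\<rho> y) (symm (Poly_Mapping.single z0 fls_X_inv)))"

lemma lat_symm_single: "z \<in> Zvecs n \<Longrightarrow> holo (fls_X * g) \<Longrightarrow> lat (symm (Poly_Mapping.single z g))"
  unfolding symm_def by (intro lat_sym pol_single)

lemma holo_X_X_inv: "holo (fls_X * fls_X_inv)" by (simp add: holo_iff)

lemma casimir_act:
  assumes "p \<le> n"
  shows "app (\<rho> (c_free p 2 - Poly_Mapping.single 0 c)) (Poly_Mapping.single w g) = Poly_Mapping.single w ((mu p 2 w - fls_const c) * g)"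
    "c_free p 2 - Poly_Mapping.single 0 c \<in> free_letters n" "holo (mu p 2 w)"
proof -
  have e: "app (\<rho> (c_free p 2)) (T w) = Poly_Mapping.single w (mu p 2 w)"
    by (rule c_eigen[OF _ assms, of 2 w]) (simp, assumption)
  show "holo (mu p 2 w)" by (rule c_eigen[OF _ assms, of 2 w]) (simp, assumption)
  have "app (\<rho> (c_free p 2 - Poly_Mapping.single 0 c)) (T w) = Poly_Mapping.single w (mu p 2 w - fls_const c)"
    by (simp add: ce.rep_hom ce.rep_scalar e single_diff)
  then show "app (\<rho> (c_free p 2 - Poly_Mapping.single 0 c)) (Poly_Mapping.single w g) = Poly_Mapping.single w ((mu p 2 w - fls_const c) * g)"
    by (simp add: app_single[of _ w g] mult.commute)
  show "c_free p 2 - Poly_Mapping.single 0 c \<in> free_letters n"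
    by (intro free_letters_ops c_free_letters assms)
qed

lemma mu_kap: assumes "1 \<le> p" "p \<le> n" shows "mu p 2 w = gB.kap p w"
proof -
  have "app (\<rho> (c_free p 2)) (T w) = Poly_Mapping.single w (gB.kap p w)"
    using gB.casimir_diag[OF assms] gB.cas_eq_gelfand[of p] ce.rep_c_free[of 2 B p] by (simp add: gE_def)
  then show ?thesis by (simp add: mu_def)
qed

lemma val_distinct:
  assumes "s \<in> {1..r}" "u \<in> {1..r}" "s \<noteq> u" "r < n" "r = k \<Longrightarrow> \<tau> z \<noteq> z"
  shows "val z r s \<noteq> val z r u"
proof (cases "r = k \<and> {s,u} = {i,j}")
  case True
  then have "z (k,i) \<noteq> z (k,j)" using assms(5) by (simp add: swap_fixed_iff)
  then show ?thesis using True v_eq kn(1) by (auto simp: val_def doubleton_eq_iff)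
next
  case False
  then show ?thesis using val_ne[OF assms(1,2,3,4), of z] by auto
qed

lemma shift_Zvecs: "z \<in> Zvecs n \<Longrightarrow> q \<in> {1..p} \<Longrightarrow> p < n \<Longrightarrow> shift z (p,q) d \<in> Zvecs n"
  by (auto simp: Zvecs_def shift_def)

context
  fixes z0 assumes z0: "z0 \<in> Zvecs n"
begin

lemma lat_start: "lat (symm (Poly_Mapping.single z0 fls_X_inv))"
  by (rule lat_symm_single[OF z0 holo_X_X_inv])

lemma gen_start: "gen z0 (symm (Poly_Mapping.single z0 fls_X_inv))"
  unfolding gen_def using lat_start by (intro conjI bexI[of _ 1]) (simp_all add: free_letters_ops ce.rep_hom)

lemma gen_eqv: "gen z0 G \<Longrightarrow> G \<asymp> H \<Longrightarrow> lat H \<Longrightarrow> gen z0 H"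
  unfolding gen_def using eqv_sym eqv_trans by blast

lemma gen_rho: assumes "gen z0 G" "y \<in> free_letters n" shows "gen z0 (app (\<rho> y) G)"
proof -
  obtain y0 where y0: "lat G" "y0 \<in> free_letters n" "G \<asymp> app (\<rho> y0) (symm (Poly_Mapping.single z0 fls_X_inv))"
    using assms(1) unfolding gen_def by blast
  have "app (\<rho> y) G \<asymp> app (\<rho> y) (app (\<rho> y0) (symm (Poly_Mapping.single z0 fls_X_inv)))"
    by (rule eqv_rho[OF assms(2) y0(1) lat_rho[OF y0(2) lat_start] y0(3)])
  then have "app (\<rho> y) G \<asymp> app (\<rho> (y * y0)) (symm (Poly_Mapping.single z0 fls_X_inv))" by (simp add: ce.rep_hom)
  then show ?thesis unfolding gen_def using lat_rho[OF assms(2) y0(1)] free_letters_ops(7)[OF assms(2) y0(2)] by blast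
qed

lemma gen_add: assumes "gen z0 G" "gen z0 H" shows "gen z0 (G + H)"
proof -
  obtain y y' where y: "lat G" "y \<in> free_letters n" "G \<asymp> app (\<rho> y) (symm (Poly_Mapping.single z0 fls_X_inv))"
    "lat H" "y' \<in> free_letters n" "H \<asymp> app (\<rho> y') (symm (Poly_Mapping.single z0 fls_X_inv))"
    using assms unfolding gen_def by blast
  have "G + H \<asymp> app (\<rho> (y + y')) (symm (Poly_Mapping.single z0 fls_X_inv))"
    using eqv_add[OF y(3,6)] by (simp add: ce.rep_hom)
  then show ?thesis unfolding gen_def using lat_add[OF y(1,4)] free_letters_ops(5)[OF y(2,5)] by blast
qed

lemma gen_scale: "gen z0 G \<Longrightarrow> gen z0 (scale (fls_const c) G)"
  using gen_rho[of G "Poly_Mapping.single 0 c"] by (simp add: free_letters_ops ce.rep_scalar)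

lemma gen_0: "gen z0 0"
  using gen_scale[OF gen_start, of 0] by simp

lemma gen_sum: "(\<And>x. x \<in> S \<Longrightarrow> gen z0 (f x)) \<Longrightarrow> gen z0 (sum f S)"
  by (induction S rule: infinite_finite_induct) (simp_all add: gen_0 gen_add)

text \<open>Squares of shifted Casimir operators kill a Jordan block of size two, so that the summands
  with distinct Casimir eigenvalues can be isolated.\<close>

lemma separate:
  assumes "finite S" "q \<notin> S" "p \<le> n"
    "\<And>q'. q' \<in> insert q S \<Longrightarrow> zz q' \<in> Zvecs n \<and> (\<exists>d. jet (mu p 2 (zz q')) (lam q') d)"
    "\<And>q'. q' \<in> S \<Longrightarrow> lam q' \<noteq> lam q"
    "\<And>q'. q' \<in> insert q S \<Longrightarrow> holo (fls_X * g q')"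
    "gen z0 (symm (Poly_Mapping.single (zz q) (g q) + (\<Sum>q'\<in>S. Poly_Mapping.single (zz q') (g q'))))"
  shows "\<exists>u c d. c \<noteq> 0 \<and> jet u c d \<and> gen z0 (symm (Poly_Mapping.single (zz q) (u * g q)))"
  using assms
proof (induction S arbitrary: g rule: finite_induct)
  case empty
  then show ?case using jet_const[of 1] by (intro exI[of _ 1] exI[of _ "1::complex"] exI[of _ "0::complex"]) simp
next
  case (insert q1 S)
  define e where "e q' = (mu p 2 (zz q') - fls_const (lam q1)) ^ 2" for q'
  define y where "y = c_free p 2 - Poly_Mapping.single 0 (lam q1)"
  have y: "y \<in> free_letters n" unfolding y_def by (rule casimir_act(2)[OF insert.prems(2)])
  have act: "app (\<rho> y) (app (\<rho> y) (Poly_Mapping.single (zz q') f)) = Poly_Mapping.single (zz q') (e q' * f)" for q' f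
    unfolding y_def casimir_act(1)[OF insert.prems(2)] by (simp add: e_def power2_eq_square mult.assoc)
  have je: "\<exists>d. jet (e q') ((lam q' - lam q1) ^ 2) d" if q': "q' \<in> insert q (insert q1 S)" for q'
  proof -
    have "\<exists>d. jet (mu p 2 (zz q')) (lam q') d" using insert.prems(3)[OF q'] by blast
    moreover have "\<exists>d. jet (fls_const (lam q1)) (lam q1) d" using jet_const by blast
    ultimately have "\<exists>d. jet (mu p 2 (zz q') - fls_const (lam q1)) (lam q' - lam q1) d" by (rule Hv.R_diff)
    from Hv.R_mult[OF this this] show ?thesis by (simp add: e_def power2_eq_square)
  qed
  have he: "holo (fls_X * (e q' * g q'))" if q': "q' \<in> insert q (insert q1 S)" for q'
    using holo_mult[of "e q'" "fls_X * g q'"] je[OF q'] insert.prems(5)[OF q'] by (auto simp: holo_def mult.left_commute)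
  define R where "R = symm (Poly_Mapping.single (zz q) (e q * g q) + (\<Sum>q'\<in>S. Poly_Mapping.single (zz q') (e q' * g q')))"
  have "gen z0 (app (\<rho> y) (app (\<rho> y) (symm (Poly_Mapping.single (zz q) (g q) + (\<Sum>q'\<in>insert q1 S. Poly_Mapping.single (zz q') (g q'))))))"
    by (intro gen_rho y insert.prems(6))
  then have "gen z0 (symm (Poly_Mapping.single (zz q) (e q * g q) + (\<Sum>q'\<in>insert q1 S. Poly_Mapping.single (zz q') (e q' * g q'))))"
    by (simp only: symm_rho[OF y] app_add app_sum act)
  then have 1: "gen z0 (symm (Poly_Mapping.single (zz q1) (e q1 * g q1)) + R)"
    unfolding R_def using insert.hyps by (simp add: symm_add ac_simps)
  have "symm (Poly_Mapping.single (zz q1) (e q1 * g q1)) \<asymp> symm (Poly_Mapping.single (zz q1) 0)"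
  proof (rule symm_single_eqv)
    obtain d where d: "jet (mu p 2 (zz q1)) (lam q1) d" using insert.prems(3)[of q1] by blast
    define f where "f = fls_X_inv * (mu p 2 (zz q1) - fls_const (lam q1))"
    have "fls_nth (mu p 2 (zz q1) - fls_const (lam q1)) m = 0" if "m \<le> 0" for m
      using jet_nth[OF d] that by (cases "m = 0") auto
    then have f: "holo f" "mu p 2 (zz q1) - fls_const (lam q1) = fls_X * f" by (simp_all add: f_def holo_iff)
    have h: "holo (f * f * (fls_X * g q1))" using holo_mult[OF holo_mult[OF f(1) f(1)]] insert.prems(5)[of q1] by simp
    have e: "e q1 * g q1 = fls_X * (f * f * (fls_X * g q1))" unfolding e_def f(2) by (simp add: power2_eq_square ac_simps)
    show "fls_nth (e q1 * g q1) 0 = fls_nth 0 0" "fls_nth (e q1 * g q1) (-1) = fls_nth 0 (-1)"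
      unfolding e using h by (simp_all add: holo_iff)
    show "holo (fls_X * (e q1 * g q1))" by (rule he) simp
  qed (simp add: holo_0)
  then have 2: "symm (Poly_Mapping.single (zz q1) (e q1 * g q1)) + R \<asymp> R"
    using eqv_add[of _ 0 R R] by (simp add: symm_def)
  have R: "lat R" unfolding R_def symm_def
  proof (rule lat_sym)
    have "pol (\<Sum>q'\<in>S'. Poly_Mapping.single (zz q') (e q' * g q'))" if "S' \<subseteq> S" for S'
      using finite_subset[OF that insert.hyps(1)] that
    proof (induction S' rule: finite_induct)
      case (insert q' S')
      then show ?case using he[of q'] \<open>\<And>q'. q' \<in> insert q (insert q1 S) \<Longrightarrow> zz q' \<in> Zvecs n \<and> _\<close>[of q'] by (auto intro!: pol_add pol_single)
    qed (simp add: pol_0)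
    then show "pol (Poly_Mapping.single (zz q) (e q * g q) + (\<Sum>q'\<in>S. Poly_Mapping.single (zz q') (e q' * g q')))"
      using he[of q] insert.prems(3)[of q] by (intro pol_add pol_single) auto
  qed
  have IH: "\<exists>u c d. c \<noteq> 0 \<and> jet u c d \<and> gen z0 (symm (Poly_Mapping.single (zz q) (u * (e q * g q))))"
  proof (rule insert.IH)
    show "gen z0 (symm (Poly_Mapping.single (zz q) (e q * g q) + (\<Sum>q'\<in>S. Poly_Mapping.single (zz q') (e q' * g q'))))"
      using gen_eqv[OF 1 2 R] by (simp add: R_def)
  qed (use insert.prems he in auto)
  then obtain u c d where u: "c \<noteq> 0" "jet u c d" "gen z0 (symm (Poly_Mapping.single (zz q) (u * (e q * g q))))" by blast
  obtain d' where d': "jet (e q) ((lam q - lam q1) ^ 2) d'" using je[of q] by blast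
  have "c * (lam q - lam q1) ^ 2 \<noteq> 0" using u(1) insert.prems(4)[of q1] by simp
  then show ?case using jet_mult[OF u(2) d'] u(3) by (metis mult.assoc)
qed

definition reach :: "zvec \<Rightarrow> bool" where
  "reach z \<longleftrightarrow> z \<in> Zvecs n \<and> gen z0 (symm (T z)) \<and> gen z0 (symm (Poly_Mapping.single z fls_X_inv))"

text \<open>One generator moves all entries of row p; the summands are separated by the Casimir
  element of gl(p). The coefficient of the wanted summand is a unit of the power series ring, by the
  conditions on numerator and denominator. T and DT are treated together, because moving DT produces
  an additional multiple of T.\<close>

lemma move:
  assumes z: "reach z" and q: "q \<in> {1..p}" "1 \<le> p" "p < n" and sing: "p = k \<Longrightarrow> \<tau> z \<noteq> z"
    and rs: "r \<in> {1..n}" "s \<in> {1..n}" "B r s = shop p d (cf n eL (of_int \<kappa>) p p' m)"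
    and dk: "d = 1 \<or> d = -1" "\<kappa> \<noteq> 0"
    and num: "\<And>u. u \<in> {1..m} \<Longrightarrow> val z p q \<noteq> val z p' u"
  shows "reach (shift z (p,q) d)"
proof -
  define c where "c q' = cf n eL (of_int \<kappa>) p p' m q' z" for q'
  have zZ: "z \<in> Zvecs n" using z by (simp add: reach_def)
  have jc: "\<exists>d. jet (c q') (of_int \<kappa> * (\<Prod>u=1..m. val z p q' - val z p' u) / (\<Prod>u\<in>{1..p} - {q'}. val z p q' - val z p u)) d"
    if q': "q' \<in> {1..p}" for q'
  proof -
    have e: "\<exists>d. jet (ent n eL z r s) (val z r s) d" for r s using ent_jet by blast
    have "(\<Prod>u\<in>{1..p} - {q'}. val z p q' - val z p u) \<noteq> 0"
      using val_distinct[OF q' _ _ q(3) sing] by (simp add: prod_zero_iff)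
    then show ?thesis unfolding c_def cf_def by (intro Hv.R_divide Hv.R_mult Hv.R_prod Hv.R_diff Hv.R_of_int e)
  qed
  obtain dc where dc: "jet (c q) (of_int \<kappa> * (\<Prod>u=1..m. val z p q - val z p' u) / (\<Prod>u\<in>{1..p} - {q}. val z p q - val z p u)) dc"
    using jc[OF q(1)] by blast
  define c0 where "c0 = of_int \<kappa> * (\<Prod>u=1..m. val z p q - val z p' u) / (\<Prod>u\<in>{1..p} - {q}. val z p q - val z p u)"
  have c0: "c0 \<noteq> 0"
  proof -
    have "(\<Prod>u\<in>{1..p} - {q}. val z p q - val z p u) \<noteq> 0"
      using val_distinct[OF q(1) _ _ q(3) sing] by (simp add: prod_zero_iff)
    moreover have "(\<Prod>u=1..m. val z p q - val z p' u) \<noteq> 0" using num by (simp add: prod_zero_iff)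
    ultimately show ?thesis using dk by (simp add: c0_def)
  qed
  obtain l0 l1 where l: "jet (mu p 2 z) l0 l1" using casimir_act(3)[of p z] q by (auto simp: holo_def)
  \<comment> \<open>The constant term of the Casimir eigenvalue after entry q' has moved, by
    \<open>kap_shift\<close>. It depends on q' only through the entry, and the entries of the row
    are distinct.\<close>
  define lam where "lam q' = l0 + of_int d * (2 * val z p q' + of_int d + of_nat p - 1)" for q'
  have jl: "\<exists>e. jet (mu p 2 (shift z (p,q') d)) (lam q') e" if q': "q' \<in> {1..p}" for q'
  proof -
    have "mu p 2 (shift z (p,q') d) = mu p 2 z + of_int d * ((1 + 1) * ent n eL z p q' + of_int d + of_nat p - 1)"
      using gB.kap_shift[OF q' q(3), of z d] q by (simp add: mu_kap)
    moreover have "\<exists>e. jet (mu p 2 z + of_int d * ((1 + 1) * ent n eL z p q' + of_int d + of_nat p - 1))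
       (l0 + of_int d * ((1 + 1) * val z p q' + of_int d + of_nat p - 1)) e"
      using l ent_jet by (intro Hv.R_add Hv.R_mult Hv.R_of_int Hv.R_diff Hv.R_of_nat Hv.R_1) blast+
    ultimately show ?thesis by (simp add: lam_def)
  qed
  have key: "\<exists>u b d'. b \<noteq> 0 \<and> jet u b d' \<and> gen z0 (symm (Poly_Mapping.single (shift z (p,q) d) (u * (g * c q))))"
    if g: "gen z0 (symm (Poly_Mapping.single z g))" "holo (fls_X * g)" for g
  proof -
    have "gen z0 (app (B r s) (symm (Poly_Mapping.single z g)))"
      using gen_rho[OF g(1) Efree_letters[OF rs(1,2)]] by (simp add: ce.rep_Efree)
    then have "gen z0 (symm (\<Sum>q'=1..p. Poly_Mapping.single (shift z (p,q') d) (g * c q')))"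
      using symm_rho[OF Efree_letters[OF rs(1,2)], of "Poly_Mapping.single z g"] by (simp add: ce.rep_Efree rs(3) c_def)
    then have G: "gen z0 (symm (Poly_Mapping.single (shift z (p,q) d) (g * c q) + (\<Sum>q'\<in>{1..p} - {q}. Poly_Mapping.single (shift z (p,q') d) (g * c q'))))"
      using sum.remove[of "{1..p}" q "\<lambda>q'. Poly_Mapping.single (shift z (p,q') d) (g * c q')"] q(1) by simp
    have "\<exists>u c' d'. c' \<noteq> 0 \<and> jet u c' d' \<and> gen z0 (symm (Poly_Mapping.single (shift z (p,q) d) (u * (g * c q))))"
    proof (rule separate[where S = "{1..p} - {q}" and p = p and q = q and zz = "\<lambda>q'. shift z (p,q') d" and lam = lam and g = "\<lambda>q'. g * c q'"])
      fix q' assume "q' \<in> insert q ({1..p} - {q})"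
      then have q': "q' \<in> {1..p}" using q(1) by blast
      show "shift z (p,q') d \<in> Zvecs n \<and> (\<exists>d'. jet (mu p 2 (shift z (p,q') d)) (lam q') d')"
        using shift_Zvecs[OF zZ q' q(3)] jl[OF q'] by blast
      have "holo (c q')" using jc[OF q'] unfolding holo_def by blast
      then show "holo (fls_X * (g * c q'))" using holo_mult[OF g(2)] by (simp add: mult.assoc)
    next
      fix q' assume "q' \<in> {1..p} - {q}"
      then have "val z p q' \<noteq> val z p q" using val_distinct[of q' p q z] q sing by blast
      then show "lam q' \<noteq> lam q" using dk(1) by (auto simp: lam_def)
    qed (use q G in auto)
    then show ?thesis by blast
  qed
  let ?w = "shift z (p,q) d"
  have w: "?w \<in> Zvecs n" by (rule shift_Zvecs[OF zZ q(1,3)])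
  have T: "gen z0 (symm (T ?w))"
  proof -
    obtain u b d' where u: "b \<noteq> 0" "jet u b d'" "gen z0 (symm (Poly_Mapping.single ?w (u * (1 * c q))))"
      using key[of 1] z by (auto simp: reach_def holo_iff)
    have J: "jet (u * c q) (b * c0) (b * dc + d' * c0)" using jet_mult[OF u(2) dc] by (simp add: c0_def)
    have "symm (Poly_Mapping.single ?w (u * (1 * c q))) \<asymp> symm (Poly_Mapping.single ?w (fls_const (b * c0)))"
      using jet_nth[OF J] by (intro symm_single_eqv) (auto simp: holo_X_iff)
    from gen_eqv[OF u(3) this] have "gen z0 (symm (Poly_Mapping.single ?w (fls_const (b * c0))))"
      using lat_symm_single[OF w, of "fls_const (b * c0)"] by (simp add: holo_X_iff)
    from gen_scale[OF this, of "inverse (b * c0)"] show ?thesis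
      using fls_const_inverse[of "b * c0"] u(1) c0 by (simp only: symm_scale[symmetric] scale_simps(1)) simp
  qed
  moreover have "gen z0 (symm (Poly_Mapping.single ?w fls_X_inv))"
  proof -
    obtain u b d' where u: "b \<noteq> 0" "jet u b d'" "gen z0 (symm (Poly_Mapping.single ?w (u * (fls_X_inv * c q))))"
      using key[of fls_X_inv] z holo_X_X_inv by (auto simp: reach_def)
    have J: "jet (u * c q) (b * c0) (b * dc + d' * c0)" using jet_mult[OF u(2) dc] by (simp add: c0_def)
    \<comment> \<open>The linear term of the unit; multiplied by 1/t it contributes e times T, which
      is removed with the T already generated.\<close>
    define e where "e = b * dc + d' * c0"
    have s: "u * (fls_X_inv * c q) = fls_X_inv * (u * c q)" by (simp add: ac_simps)
    have "symm (Poly_Mapping.single ?w (u * (fls_X_inv * c q))) \<asymp> symm (Poly_Mapping.single ?w (fls_X_inv * fls_const (b * c0) + fls_const e))"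
      unfolding s using jet_nth[OF J] by (intro symm_single_eqv) (auto simp: holo_X_iff holo_iff e_def)
    from gen_eqv[OF u(3) this] have 1: "gen z0 (symm (Poly_Mapping.single ?w (fls_X_inv * fls_const (b * c0) + fls_const e)))"
      using lat_symm_single[OF w, of "fls_X_inv * fls_const (b * c0) + fls_const e"] by (simp add: holo_X_iff)
    have 2: "scale (fls_const (inverse (b * c0))) (symm (Poly_Mapping.single ?w (fls_X_inv * fls_const (b * c0) + fls_const e))
        + scale (fls_const (- e)) (symm (T ?w))) = symm (Poly_Mapping.single ?w fls_X_inv)"
    proof -
      have f: "fls_const (inverse (b * c0)) * (fls_X_inv * fls_const (b * c0) + fls_const e + fls_const (- e)) = fls_X_inv"
        using fls_const_inverse[of "b * c0"] u(1) c0 fls_const_plus_minus[of e]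
        by (simp only: add.assoc add_0_right mult.left_commute[of "fls_const (inverse (b * c0))" fls_X_inv]) simp
      have a1: "symm (Poly_Mapping.single ?w x) + symm (Poly_Mapping.single ?w y) = symm (Poly_Mapping.single ?w (x + y))" for x y
        by (simp only: single_add symm_add)
      have a2: "scale (fls_const c) (symm (Poly_Mapping.single ?w x)) = symm (Poly_Mapping.single ?w (fls_const c * x))" for c x
        using symm_scale[of c "Poly_Mapping.single ?w x"] by simp
      show ?thesis unfolding a2[of "- e" 1] a1 a2 mult_1_right f ..
    qed
    show ?thesis using gen_scale[OF gen_add[OF 1 gen_scale[OF T]]] 2 by metis
  qed
  ultimately show ?thesis using w by (simp add: reach_def)
qed

lemma move_up:
  assumes "reach z" "q \<in> {1..p}" "p < n" "p = k \<Longrightarrow> \<tau> z \<noteq> z"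
    "\<And>u. u \<in> {1..p+1} \<Longrightarrow> Re (val z (p+1) u) < Re (val z p q)"
  shows "reach (shift z (p,q) 1)"
proof (rule move[where r = p and s = "Suc p" and \<kappa> = "-1" and p' = "p + 1" and m = "p + 1"])
  show "B p (Suc p) = shop p 1 (cf n eL (of_int (- 1)) p (p + 1) (p + 1))"
    using gB.E_eops(1) by (simp add: gE_def eop_def)
  show "val z p q \<noteq> val z (p + 1) u" if "u \<in> {1..p+1}" for u using assms(5)[OF that] by auto
qed (use assms in auto)

lemma move_down:
  assumes "reach z" "q \<in> {1..p}" "p < n" "p = k \<Longrightarrow> \<tau> z \<noteq> z"
    "\<And>u. u \<in> {1..p-1} \<Longrightarrow> Re (val z p q) < Re (val z (p-1) u)"
  shows "reach (shift z (p,q) (-1))"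
proof (rule move[where r = "Suc p" and s = p and \<kappa> = 1 and p' = "p - 1" and m = "p - 1"])
  show "B (Suc p) p = shop p (- 1) (cf n eL (of_int 1) p (p - 1) (p - 1))"
    using gB.E_eops(2) by (simp add: gE_def fop_def)
  show "val z p q \<noteq> val z (p - 1) u" if "u \<in> {1..p-1}" for u using assms(5)[OF that] by auto
qed (use assms in auto)

end

end

section \<open>Gelfand-Tsetlin characters\<close>

lemma holo_nth_mult: "holo f \<Longrightarrow> holo g \<Longrightarrow> fls_nth (f * g) 0 = fls_nth f 0 * fls_nth g 0"
  unfolding holo_def using jet_mult jet_nth(1) by metis

lemma fls_nth_sum: "fls_nth (sum f S) m = (\<Sum>x\<in>S. fls_nth (f x) m)"
  by (induction S rule: infinite_finite_induct) simp_all

lemma ring_complex_ring: "ring complex_ring"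
proof (rule ringI)
  show "abelian_group complex_ring"
  proof (rule abelian_groupI)
    fix x :: complex
    show "\<exists>y\<in>carrier complex_ring. y \<oplus>\<^bsub>complex_ring\<^esub> x = \<zero>\<^bsub>complex_ring\<^esub>"
      by (intro bexI[of _ "- x"]) (simp_all add: complex_ring_def)
  qed (simp_all add: complex_ring_def)
  show "monoid complex_ring" by (rule monoidI) (simp_all add: complex_ring_def)
qed (simp_all add: complex_ring_def algebra_simps)

definition ord_ge :: "complex fls \<Rightarrow> nat \<Rightarrow> bool" where
  "ord_ge f N \<longleftrightarrow> (\<exists>g. holo g \<and> f = fls_X ^ N * g)"

lemma ord_ge_add: "ord_ge f N \<Longrightarrow> ord_ge g N \<Longrightarrow> ord_ge (f + g) N"
  unfolding ord_ge_def using holo_add distrib_left by metis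

lemma ord_ge_mult: assumes "ord_ge f M" "ord_ge g N" shows "ord_ge (f * g) (M + N)"
proof -
  obtain f' g' where "holo f'" "f = fls_X ^ M * f'" "holo g'" "g = fls_X ^ N * g'" using assms unfolding ord_ge_def by blast
  then have "holo (f' * g')" "f * g = fls_X ^ (M + N) * (f' * g')" by (simp_all add: holo_mult power_add)
  then show ?thesis unfolding ord_ge_def by blast
qed

lemma ord_ge_0: "holo f \<Longrightarrow> ord_ge f 0" by (simp add: ord_ge_def)

lemma ord_ge_1: assumes "holo f" "fls_nth f 0 = 0" shows "ord_ge f 1"
proof -
  have "holo (fls_X_inv * f)" unfolding holo_iff
  proof (intro allI impI)
    fix m :: int assume "m < 0"
    then have "m + 1 < 0 \<or> m + 1 = 0" by auto
    then show "fls_nth (fls_X_inv * f) m = 0" using assms by (auto simp: holo_iff)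
  qed
  then show ?thesis unfolding ord_ge_def by (intro exI[of _ "fls_X_inv * f"]) simp
qed

text \<open>Multiplication by a unit power series is injective on series with simple poles modulo
  t.\<close>

lemma unit_cancel:
  assumes "holo h" "fls_nth h 0 \<noteq> 0" "holo (fls_X * g)" "fls_nth (h * g) 0 = 0" "fls_nth (h * g) (-1) = 0"
  shows "fls_nth g 0 = 0" "fls_nth g (-1) = 0"
proof -
  obtain b b' where h: "jet h b b'" using assms(1) by (auto simp: holo_def)
  obtain c c' where g: "jet (fls_X * g) c c'" using assms(3) by (auto simp: holo_def)
  have J: "jet (fls_X * (h * g)) (b * c) (b * c' + b' * c)" using jet_mult[OF h g] by (simp add: mult.left_commute)
  have "b \<noteq> 0" using jet_nth(1)[OF h] assms(2) by simp
  moreover have "b * c = 0" "b * c' + b' * c = 0" using jet_nth(1,2)[OF J] assms(4,5) by simp_all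
  ultimately have "c = 0" "c' = 0" by auto
  then show "fls_nth g 0 = 0" "fls_nth g (-1) = 0" using jet_nth(1,2)[OF g] by simp_all
qed

lemma Gamma_carrier_subset: "range (scalar_env n) \<union> {c_env n r s | r s. 1 \<le> s \<and> s \<le> r \<and> r \<le> n} \<subseteq> carrier (Ugl n)"
  by (auto simp: scalar_env_def c_env_def free_letters_ops c_free_letters)

lemma ring_GTalg: "ring (GTalg n)"
  unfolding GTalg_def by (rule ring.generate_ring_is_ring[OF ring_Ugl Gamma_carrier_subset])

lemma GTalg_simps: "carrier (GTalg n) = generate_ring (Ugl n) (range (scalar_env n) \<union> {c_env n r s | r s. 1 \<le> s \<and> s \<le> r \<and> r \<le> n})"
  "x \<oplus>\<^bsub>GTalg n\<^esub> y = x \<oplus>\<^bsub>Ugl n\<^esub> y" "x \<otimes>\<^bsub>GTalg n\<^esub> y = x \<otimes>\<^bsub>Ugl n\<^esub> y" "\<one>\<^bsub>GTalg n\<^esub> = \<one>\<^bsub>Ugl n\<^esub>" "\<zero>\<^bsub>GTalg n\<^esub> = \<zero>\<^bsub>Ugl n\<^esub>"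
  by (simp_all add: GTalg_def)

context singular_point
begin

interpretation ce: complex_embedding "fls_const :: complex \<Rightarrow> complex fls" by (rule complex_embedding_fls)
interpretation VA: abelian_group V by (rule V_abelian_group)
interpretation \<Gamma>: ring "GTalg n" by (rule ring_GTalg)

abbreviation "\<Gamma> \<equiv> GTalg n"

section \<open>Eigenvalues and characters of the Gelfand-Tsetlin subalgebra\<close>

definition evU :: "gl_env \<Rightarrow> zvec \<Rightarrow> complex fls" where
  "evU x z = Poly_Mapping.lookup (app (\<rho> (SOME y. y \<in> x)) (T z)) z"

lemma evU_Ucls: assumes "y \<in> free_letters n" shows "evU (Ucls n y) z = Poly_Mapping.lookup (app (\<rho> y) (T z)) z"
proof -
  have "(SOME y'. y' \<in> Ucls n y) \<in> Ucls n y" by (rule someI[of _ y]) (rule Ucls_self)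
  then show ?thesis using Ucls_mem[OF _ assms] by (simp add: evU_def)
qed

text \<open>Membership in the Gelfand-Tsetlin subalgebra is a statement about cosets; this records a
  representative whose action on every Laurent tableau is by a power series, a property that passes
  through generation of the subring.\<close>

definition diagonal :: "gl_free \<Rightarrow> bool" where
  "diagonal y \<longleftrightarrow> y \<in> free_letters n \<and> (\<forall>z. app (\<rho> y) (T z) = Poly_Mapping.single z (evU (Ucls n y) z) \<and> holo (evU (Ucls n y) z))"

lemma diagonalI:
  assumes "y \<in> free_letters n" "\<And>z. app (\<rho> y) (T z) = Poly_Mapping.single z (m z)" "\<And>z. holo (m z)"
  shows "diagonal y" "evU (Ucls n y) z = m z"
  using assms by (simp_all add: diagonal_def evU_Ucls)

lemma diagonal_act: "diagonal y \<Longrightarrow> app (\<rho> y) (Poly_Mapping.single z g) = Poly_Mapping.single z (g * evU (Ucls n y) z)"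
  by (simp add: app_single[of _ z g] diagonal_def)

lemma diagonal_ops:
  assumes "diagonal x" "diagonal y"
  shows "diagonal (x + y)" "evU (Ucls n (x + y)) z = evU (Ucls n x) z + evU (Ucls n y) z"
    "diagonal (x * y)" "evU (Ucls n (x * y)) z = evU (Ucls n x) z * evU (Ucls n y) z"
    "diagonal (- x)" "evU (Ucls n (- x)) z = - evU (Ucls n x) z"
    "diagonal 1" "evU (Ucls n 1) z = 1" "diagonal (Poly_Mapping.single 0 c)" "evU (Ucls n (Poly_Mapping.single 0 c)) z = fls_const c"
proof -
  have x: "x \<in> free_letters n" "app (\<rho> x) (T z) = Poly_Mapping.single z (evU (Ucls n x) z)" "holo (evU (Ucls n x) z)"
    and y: "y \<in> free_letters n" "app (\<rho> y) (T z) = Poly_Mapping.single z (evU (Ucls n y) z)" "holo (evU (Ucls n y) z)" for z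
    using assms by (auto simp: diagonal_def)
  have "app (\<rho> (x + y)) (T z) = Poly_Mapping.single z (evU (Ucls n x) z + evU (Ucls n y) z)" for z
    by (simp add: ce.rep_hom x y single_add)
  from diagonalI[OF free_letters_ops(5)[OF x(1) y(1)] this holo_add[OF x(3) y(3)]]
  show "diagonal (x + y)" "evU (Ucls n (x + y)) z = evU (Ucls n x) z + evU (Ucls n y) z" by auto
  have "app (\<rho> (x * y)) (T z) = Poly_Mapping.single z (evU (Ucls n x) z * evU (Ucls n y) z)" for z
    by (simp add: ce.rep_hom y diagonal_act[OF assms(1)] mult.commute)
  from diagonalI[OF free_letters_ops(7)[OF x(1) y(1)] this holo_mult[OF x(3) y(3)]]
  show "diagonal (x * y)" "evU (Ucls n (x * y)) z = evU (Ucls n x) z * evU (Ucls n y) z" by auto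
  have 1: "app (\<rho> (- x)) (T z) = Poly_Mapping.single z (- evU (Ucls n x) z)" for z
    by (simp add: ce.rep_hom x single_uminus)
  have "holo (- evU (Ucls n x) z)" for z using x(3)[of z] by (simp add: holo_iff)
  from diagonalI[OF free_letters_ops(4)[OF x(1)] 1 this]
  show "diagonal (- x)" "evU (Ucls n (- x)) z = - evU (Ucls n x) z" by auto
  have "app (\<rho> (Poly_Mapping.single 0 c)) (T z) = Poly_Mapping.single z (fls_const c)" for c z
    by (simp add: ce.rep_scalar)
  note s = diagonalI[OF free_letters_ops(3) this holo_const]
  from s show "diagonal (Poly_Mapping.single 0 c)" "evU (Ucls n (Poly_Mapping.single 0 c)) z = fls_const c" by auto
  from s[of 1] show "diagonal 1" "evU (Ucls n 1) z = 1" by auto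
qed

lemma diagonal_c: assumes "1 \<le> s" "r \<le> n" shows "diagonal (c_free r s)" "evU (c_env n r s) z = mu r s z"
proof -
  have "app (\<rho> (c_free r s)) (T z) = Poly_Mapping.single z (mu r s z)" "holo (mu r s z)" for z
    by (rule c_eigen[OF assms, of z]; assumption)+
  from diagonalI[OF c_free_letters[OF assms(2)] this] show "diagonal (c_free r s)" "evU (c_env n r s) z = mu r s z"
    by (auto simp: c_env_def)
qed

lemma Gamma_diagonal: "x \<in> carrier \<Gamma> \<Longrightarrow> \<exists>y. diagonal y \<and> x = Ucls n y"
  unfolding GTalg_simps
proof (induction rule: generate_ring.induct)
  case one
  show ?case by (intro exI[of _ 1]) (simp add: Ugl_one diagonalI(1)[OF free_letters_ops(2), of "\<lambda>_. 1"] ce.rep_hom holo_const[of 1, simplified])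
next
  case (incl h)
  then show ?case
  proof
    assume "h \<in> range (scalar_env n)"
    then obtain c where h: "h = Ucls n (Poly_Mapping.single 0 c)" by (auto simp: scalar_env_def)
    have "diagonal (Poly_Mapping.single 0 c)"
      by (rule diagonalI(1)[OF free_letters_ops(3) _ holo_const[of c]]) (simp add: ce.rep_scalar)
    then show ?thesis using h by blast
  next
    assume "h \<in> {c_env n r s | r s. 1 \<le> s \<and> s \<le> r \<and> r \<le> n}"
    then show ?thesis using diagonal_c(1) unfolding c_env_def by blast
  qed
next
  case (a_inv h)
  then obtain y where y: "diagonal y" "h = Ucls n y" by blast
  then have "\<ominus>\<^bsub>Ugl n\<^esub> h = Ucls n (- y)" using Ugl_inv by (simp add: diagonal_def)
  then show ?case using diagonal_ops(5)[OF y(1) y(1)] by blast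
next
  case (eng_add h1 h2)
  then obtain y1 y2 where y: "diagonal y1" "h1 = Ucls n y1" "diagonal y2" "h2 = Ucls n y2" by blast
  then have "h1 \<oplus>\<^bsub>Ugl n\<^esub> h2 = Ucls n (y1 + y2)" by (simp add: Ugl_ops diagonal_def)
  then show ?case using diagonal_ops(1)[OF y(1,3)] by blast
next
  case (eng_mult h1 h2)
  then obtain y1 y2 where y: "diagonal y1" "h1 = Ucls n y1" "diagonal y2" "h2 = Ucls n y2" by blast
  then have "h1 \<otimes>\<^bsub>Ugl n\<^esub> h2 = Ucls n (y1 * y2)" by (simp add: Ugl_ops diagonal_def)
  then show ?case using diagonal_ops(3)[OF y(1,3)] by blast
qed

lemma evU_ops:
  assumes "x \<in> carrier \<Gamma>" "y \<in> carrier \<Gamma>"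
  shows "evU (x \<oplus>\<^bsub>\<Gamma>\<^esub> y) z = evU x z + evU y z" "evU (x \<otimes>\<^bsub>\<Gamma>\<^esub> y) z = evU x z * evU y z" "holo (evU x z)"
proof -
  obtain x' y' where x: "diagonal x'" "x = Ucls n x'" and y: "diagonal y'" "y = Ucls n y'"
    using Gamma_diagonal[OF assms(1)] Gamma_diagonal[OF assms(2)] by blast
  have f: "x' \<in> free_letters n" "y' \<in> free_letters n" using x y by (auto simp: diagonal_def)
  show "evU (x \<oplus>\<^bsub>\<Gamma>\<^esub> y) z = evU x z + evU y z"
    unfolding x y GTalg_simps Ugl_ops[OF f] by (rule diagonal_ops(2)[OF x(1) y(1)])
  show "evU (x \<otimes>\<^bsub>\<Gamma>\<^esub> y) z = evU x z * evU y z"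
    unfolding x y GTalg_simps Ugl_ops[OF f] by (rule diagonal_ops(4)[OF x(1) y(1)])
  show "holo (evU x z)" using x by (simp add: diagonal_def)
qed

lemma scalar_Gamma: "scalar_env n c \<in> carrier \<Gamma>"
  unfolding GTalg_simps by (rule generate_ring.incl) blast

lemma evU_scalar: "evU (scalar_env n c) z = fls_const c"
  by (simp add: scalar_env_def evU_Ucls free_letters_ops ce.rep_scalar)

lemma evU_one: "evU \<one>\<^bsub>\<Gamma>\<^esub> z = 1"
  by (simp add: GTalg_simps Ugl_one evU_Ucls free_letters_ops ce.rep_hom)

definition ch :: "zvec \<Rightarrow> gl_env \<Rightarrow> complex" where
  "ch z x = fls_nth (evU x z) 0"

lemma ch_hom: "ch z \<in> ring_hom \<Gamma> complex_ring"
  by (rule ring_hom_memI) (simp_all add: ch_def evU_ops evU_one complex_ring_def holo_nth_mult)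

lemma GT_character_ch: "GT_character n (ch z)"
  unfolding GT_character_def using ch_hom by (simp add: ch_def evU_scalar)

definition Ker :: "zvec \<Rightarrow> gl_env set" where
  "Ker z = a_kernel \<Gamma> complex_ring (ch z)"

lemma Ker_iff: "x \<in> Ker z \<longleftrightarrow> x \<in> carrier \<Gamma> \<and> ch z x = 0"
  by (simp add: Ker_def a_kernel_def' complex_ring_def)

lemma ideal_Ker: "ideal (Ker z) \<Gamma>"
  unfolding Ker_def by (rule ring_hom_ring.kernel_is_ideal[OF ring_hom_ringI2[OF ring_GTalg ring_complex_ring ch_hom]])

text \<open>An element outside the kernel can be scaled by a constant so that its character value is
  1; it then differs from the unit by an element of the kernel, so an ideal containing both is
  everything.\<close>

lemma maximal_Ker: "maximalideal (Ker z) \<Gamma>"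
proof (rule maximalidealI[OF ideal_Ker])
  have "\<one>\<^bsub>\<Gamma>\<^esub> \<notin> Ker z" by (simp add: Ker_iff ch_def evU_one)
  then show "carrier \<Gamma> \<noteq> Ker z" using \<Gamma>.one_closed by blast
  fix J assume J: "ideal J \<Gamma>" "Ker z \<subseteq> J" "J \<subseteq> carrier \<Gamma>"
  show "J = Ker z \<or> J = carrier \<Gamma>"
  proof (rule disjCI)
    assume "J \<noteq> carrier \<Gamma>"
    show "J = Ker z"
    proof (rule ccontr)
      assume "J \<noteq> Ker z"
      then obtain x where x: "x \<in> J" "x \<notin> Ker z" using J(2) by blast
      have xc: "x \<in> carrier \<Gamma>" using x J(3) by blast
      define c where "c = ch z x"
      have c: "c \<noteq> 0" using x xc by (simp add: c_def Ker_iff)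
      define w where "w = scalar_env n (1/c) \<otimes>\<^bsub>\<Gamma>\<^esub> x"
      have wJ: "w \<in> J" unfolding w_def by (rule ideal.I_l_closed[OF J(1) x(1) scalar_Gamma])
      have wc: "w \<in> carrier \<Gamma>" using wJ J(3) by blast
      have "ch z w = fls_nth (fls_const (1/c) * evU x z) 0" unfolding ch_def w_def by (simp only: evU_ops(2)[OF scalar_Gamma xc] evU_scalar)
      then have cw: "ch z w = 1" using c by (simp add: c_def ch_def)
      obtain y where y: "diagonal y" "w = Ucls n y" using Gamma_diagonal[OF wc] by blast
      have yf: "y \<in> free_letters n" using y(1) by (simp add: diagonal_def)
      have nw: "Ucls n (- y) \<in> carrier \<Gamma>"
        using generate_ring.a_inv[OF wc[unfolded GTalg_simps]] unfolding GTalg_simps y(2) Ugl_inv[OF yf] .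
      have e: "\<one>\<^bsub>\<Gamma>\<^esub> \<oplus>\<^bsub>\<Gamma>\<^esub> Ucls n (- y) \<in> Ker z"
        using nw cw diagonal_ops(6)[OF y(1) y(1), of z] evU_ops(1)[OF \<Gamma>.one_closed nw, of z]
        by (simp add: Ker_iff ch_def evU_one y(2))
      have "(\<one>\<^bsub>\<Gamma>\<^esub> \<oplus>\<^bsub>\<Gamma>\<^esub> Ucls n (- y)) \<oplus>\<^bsub>\<Gamma>\<^esub> w = \<one>\<^bsub>\<Gamma>\<^esub>"
        using yf by (simp add: GTalg_simps y(2) Ugl_one Ugl_ops free_letters_ops)
      moreover have "(\<one>\<^bsub>\<Gamma>\<^esub> \<oplus>\<^bsub>\<Gamma>\<^esub> Ucls n (- y)) \<oplus>\<^bsub>\<Gamma>\<^esub> w \<in> J"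
        using additive_subgroup.a_closed[OF ideal.axioms(1)[OF J(1)]] e wJ J(2) by blast
      ultimately have "J = carrier \<Gamma>" using ideal.one_imp_carrier[OF J(1)] by simp
      then show False using \<open>J \<noteq> carrier \<Gamma>\<close> by blast
    qed
  qed
qed

lemma evU_tau: assumes "x \<in> carrier \<Gamma>" shows "evU x (\<tau> z) = \<theta> (evU x z)"
proof -
  obtain y where y: "diagonal y" "x = Ucls n y" using Gamma_diagonal[OF assms] by blast
  then have "y \<in> free_letters n" by (simp add: diagonal_def)
  then show ?thesis using B_tau[of y z z] by (simp add: y evU_Ucls free_letters_def)
qed

text \<open>The eigenvalues at z and at its swap differ by t to -t, which does not affect the
  constant term. So a symmetrized tableau lies in a single generalized weight space.\<close>

lemma Ker_tau: "Ker (\<tau> z) = Ker z"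
proof -
  have "ch (\<tau> z) x = ch z x" if x: "x \<in> carrier \<Gamma>" for x
  proof -
    obtain c d where J: "jet (evU x z) c d" using evU_ops(3)[OF x x, of z] unfolding holo_def by blast
    show ?thesis using jet_nth(1)[OF J] jet_nth(1)[OF \<theta>_jet[OF J]] by (simp add: ch_def evU_tau[OF x])
  qed
  then show ?thesis by (auto simp: Ker_iff)
qed

lemma ideal_pow_ord: "x \<in> ideal_pow \<Gamma> (Ker z) N \<Longrightarrow> x \<in> carrier \<Gamma> \<and> ord_ge (evU x z) N"
proof (induction N arbitrary: x)
  case 0
  then show ?case using evU_ops(3) ord_ge_0 by simp
next
  case (Suc N)
  then have "x \<in> ideal_prod \<Gamma> (Ker z) (ideal_pow \<Gamma> (Ker z) N)" by simp
  then show ?case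
  proof (induction rule: ideal_prod.induct)
    case (prod x y)
    have x1: "x \<in> carrier \<Gamma>" "fls_nth (evU x z) 0 = 0" using prod(1) by (simp_all add: Ker_iff ch_def)
    have x: "x \<in> carrier \<Gamma>" "ord_ge (evU x z) 1" using x1(1) ord_ge_1[OF evU_ops(3)[OF x1(1,1)] x1(2)] by auto
    have y: "y \<in> carrier \<Gamma>" "ord_ge (evU y z) N" using Suc.IH[OF prod(2)] by auto
    show ?case using ord_ge_mult[OF x(2) y(2)] evU_ops(2)[OF x(1) y(1), of z] \<Gamma>.m_closed[OF x(1) y(1)] by simp
  next
    case (sum x y)
    then show ?case using ord_ge_add evU_ops(1)[of x y z] \<Gamma>.a_closed[of x y] by simp
  qed
qed

lemma lookup_diagonal: assumes "diagonal y" shows "Poly_Mapping.lookup (app (\<rho> y) G) z = evU (Ucls n y) z * Poly_Mapping.lookup G z"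
proof -
  have "Poly_Mapping.lookup (app (\<rho> y) G) z = (\<Sum>w\<in>Poly_Mapping.keys G. Poly_Mapping.lookup G w * Poly_Mapping.lookup (app (\<rho> y) (T w)) z)"
    by (rule lookup_app) simp_all
  also have "\<dots> = (\<Sum>w\<in>Poly_Mapping.keys G. if w = z then evU (Ucls n y) z * Poly_Mapping.lookup G z else 0)"
    using assms by (intro sum.cong refl) (simp add: diagonal_def lookup_single when_def)
  also have "\<dots> = evU (Ucls n y) z * Poly_Mapping.lookup G z"
    by (simp add: sum.delta in_keys_iff)
  finally show ?thesis .
qed

lemma smult_Gamma:
  assumes "x \<in> carrier \<Gamma>" "lat G"
  obtains H where "lat H" "x \<odot>\<^bsub>V\<^esub> cl G = cl H" "\<And>z. Poly_Mapping.lookup H z = evU x z * Poly_Mapping.lookup G z"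
proof -
  obtain y where y: "diagonal y" "x = Ucls n y" using Gamma_diagonal[OF assms(1)] by blast
  then have f: "y \<in> free_letters n" by (simp add: diagonal_def)
  show thesis by (rule that[OF lat_rho[OF f assms(2)] smult_cl[OF f assms(2), folded y(2)]]) (simp add: lookup_diagonal[OF y(1)] y(2))
qed

lemma ideal_pow_carrier: "m \<subseteq> carrier \<Gamma> \<Longrightarrow> x \<in> ideal_pow \<Gamma> m N \<Longrightarrow> x \<in> carrier \<Gamma>"
proof (induction N arbitrary: x)
  case (Suc N)
  then have "x \<in> ideal_prod \<Gamma> m (ideal_pow \<Gamma> m N)" by simp
  then show ?case
  proof (induction rule: ideal_prod.induct)
    case (prod x y)
    then show ?case using Suc.IH[OF Suc.prems(1) prod(2)] Suc.prems(1) \<Gamma>.m_closed by blast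
  qed (rule \<Gamma>.a_closed)
qed simp

lemma GT_kill:
  assumes "lat G" "m \<subseteq> carrier \<Gamma>" "\<And>z. Poly_Mapping.lookup G z \<noteq> 0 \<Longrightarrow> Ker z = m"
  shows "cl G \<in> GT_space n V m"
  unfolding GT_space_def
\<comment> \<open>The exponent is 2 because elements of the square of the kernel act by multiples of
  t^2, which carry simple poles to series without terms up to t^0.\<close>
proof (intro CollectI conjI exI[of _ 2] ballI)
  show "cl G \<in> carrier V" using assms(1) by simp
  fix x assume x: "x \<in> ideal_pow \<Gamma> m 2"
  then have xc: "x \<in> carrier \<Gamma>" by (rule ideal_pow_carrier[OF assms(2)])
  obtain H where H: "lat H" "x \<odot>\<^bsub>V\<^esub> cl G = cl H" "\<And>z. Poly_Mapping.lookup H z = evU x z * Poly_Mapping.lookup G z"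
    by (rule smult_Gamma[OF xc assms(1)]) (rule that)
  have "H \<asymp> 0"
    unfolding eqv_def
  proof (intro allI)
    fix z
    show "fls_nth (Poly_Mapping.lookup H z) 0 = fls_nth (Poly_Mapping.lookup 0 z) 0 \<and> fls_nth (Poly_Mapping.lookup H z) (-1) = fls_nth (Poly_Mapping.lookup 0 z) (-1)"
    proof (cases "Poly_Mapping.lookup G z = 0")
      case True
      then show ?thesis by (simp add: H(3))
    next
      case False
      then have "ord_ge (evU x z) 2" using ideal_pow_ord[of x z 2] x assms(3)[of z] by simp
      then obtain g where g: "holo g" "evU x z = fls_X ^ 2 * g" unfolding ord_ge_def by blast
      have "holo (fls_X * Poly_Mapping.lookup G z)" using assms(1) by (simp add: lat_def pol_def)
      from holo_mult[OF g(1) this] have "holo (g * (fls_X * Poly_Mapping.lookup G z))" .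
      moreover have "Poly_Mapping.lookup H z = fls_X * (g * (fls_X * Poly_Mapping.lookup G z))" by (simp add: H(3) g(2) power2_eq_square ac_simps)
      ultimately show ?thesis by (simp add: holo_iff)
    qed
  qed
  then show "x \<odot>\<^bsub>V\<^esub> cl G = \<zero>\<^bsub>V\<^esub>" unfolding H(2) V_zero by (simp add: cl_eq H(1) lat_0)
qed

text \<open>Distinct maximal ideals leave an element of m outside \<open>Ker z\<close>. Its powers
  act at z by a unit, so a vector killed by a power of m cannot have a coefficient there that
  survives in V.\<close>

lemma GT_support:
  assumes "lat G" "cl G \<in> GT_space n V m" "maximalideal m \<Gamma>" "Ker z \<noteq> m"
  shows "fls_nth (Poly_Mapping.lookup G z) 0 = 0 \<and> fls_nth (Poly_Mapping.lookup G z) (-1) = 0"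
proof -
  obtain N where N: "\<And>x. x \<in> ideal_pow \<Gamma> m N \<Longrightarrow> x \<odot>\<^bsub>V\<^esub> cl G = \<zero>\<^bsub>V\<^esub>" using assms(2) unfolding GT_space_def by blast
  have mi: "ideal m \<Gamma>" using assms(3) by (simp add: maximalideal_def)
  have msub: "m \<subseteq> carrier \<Gamma>" using additive_subgroup.a_subset[OF ideal.axioms(1)[OF mi]] .
  have "\<not> m \<subseteq> Ker z"
  proof
    assume "m \<subseteq> Ker z"
    then have "Ker z = m \<or> Ker z = carrier \<Gamma>"
    proof (rule maximalideal.I_maximal[OF assms(3) ideal_Ker])
      show "Ker z \<subseteq> carrier \<Gamma>" by (auto simp: Ker_iff)
    qed
    then show False using assms(4) maximalideal.I_notcarr[OF maximal_Ker[of z]] by blast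
  qed
  then obtain x where x: "x \<in> m" "x \<notin> Ker z" by blast
  have xc: "x \<in> carrier \<Gamma>" using x msub by blast
  have c: "ch z x \<noteq> 0" using x xc by (simp add: Ker_iff)
  have "\<exists>w. w \<in> ideal_pow \<Gamma> m N \<and> w \<in> carrier \<Gamma> \<and> fls_nth (evU w z) 0 = ch z x ^ N"
  proof (induction N)
    case 0
    show ?case by (intro exI[of _ "\<one>\<^bsub>\<Gamma>\<^esub>"]) (simp add: evU_one)
  next
    case (Suc N)
    then obtain w where w: "w \<in> ideal_pow \<Gamma> m N" "w \<in> carrier \<Gamma>" "fls_nth (evU w z) 0 = ch z x ^ N" by blast
    have "x \<otimes>\<^bsub>\<Gamma>\<^esub> w \<in> ideal_pow \<Gamma> m (Suc N)" using ideal_prod.prod[OF x(1) w(1), of \<Gamma>] by simp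
    moreover have "fls_nth (evU (x \<otimes>\<^bsub>\<Gamma>\<^esub> w) z) 0 = ch z x ^ Suc N"
      by (simp add: evU_ops(2)[OF xc w(2)] holo_nth_mult[OF evU_ops(3)[OF xc xc] evU_ops(3)[OF w(2,2)]] w(3) ch_def)
    ultimately show ?case using \<Gamma>.m_closed[OF xc w(2)] by blast
  qed
  then obtain w where w: "w \<in> ideal_pow \<Gamma> m N" "w \<in> carrier \<Gamma>" "fls_nth (evU w z) 0 \<noteq> 0" using c by auto
  obtain H where H: "lat H" "w \<odot>\<^bsub>V\<^esub> cl G = cl H" "\<And>z. Poly_Mapping.lookup H z = evU w z * Poly_Mapping.lookup G z"
    by (rule smult_Gamma[OF w(2) assms(1)]) (rule that)
  have "cl H = cl 0" using N[OF w(1)] unfolding H(2) V_zero .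
  then have "H \<asymp> 0" using cl_eq[OF H(1) lat_0] by simp
  then have e: "fls_nth (evU w z * Poly_Mapping.lookup G z) 0 = 0" "fls_nth (evU w z * Poly_Mapping.lookup G z) (-1) = 0"
    by (simp_all add: eqv_def H(3)[symmetric])
  have "holo (fls_X * Poly_Mapping.lookup G z)" using assms(1) by (simp add: lat_def pol_def)
  from unit_cancel[OF evU_ops(3)[OF w(2,2)] w(3) this e] show ?thesis by simp
qed

section \<open>Decomposition into generalized weight spaces\<close>

definition block :: "gl_env set \<Rightarrow> (zvec \<Rightarrow>\<^sub>0 complex fls) \<Rightarrow> (zvec \<Rightarrow>\<^sub>0 complex fls)" where
  "block m G = (\<Sum>z\<in>Poly_Mapping.keys G. Poly_Mapping.single z (if Ker z = m then Poly_Mapping.lookup G z else 0))"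

lemma lookup_block: "Poly_Mapping.lookup (block m G) z = (if Ker z = m then Poly_Mapping.lookup G z else 0)"
  by (simp add: block_def lookup_sum lookup_single when_def sum.delta in_keys_iff)

lemma lat_block: assumes "lat G" shows "lat (block m G)"
proof -
  have "pol (block m G)" using assms unfolding lat_def pol_def pol_keys by (simp add: lookup_block holo_0)
  moreover have "flip (block m G) = block m G"
    by (rule poly_mapping_eqI) (simp add: lookup_block Ker_tau lat_lookup[OF assms] \<theta>_hom)
  ultimately show ?thesis by (simp add: lat_def)
qed

lemma finsum_cl:
  assumes "finite S" "\<And>p. p \<in> S \<Longrightarrow> lat (H p) \<and> f p = cl (H p)"
  shows "(\<Oplus>\<^bsub>V\<^esub>p\<in>S. f p) = cl (\<Sum>p\<in>S. H p)"
  using assms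
proof (induction S rule: finite_induct)
  case empty
  then show ?case by (simp add: V_zero)
next
  case (insert p S)
  have "f \<in> S \<rightarrow> carrier V" "f p \<in> carrier V" using insert.prems by auto
  then have "(\<Oplus>\<^bsub>V\<^esub>p\<in>insert p S. f p) = f p \<oplus>\<^bsub>V\<^esub> (\<Oplus>\<^bsub>V\<^esub>p\<in>S. f p)" using insert.hyps by (simp add: VA.finsum_insert)
  also have "(\<Oplus>\<^bsub>V\<^esub>p\<in>S. f p) = cl (\<Sum>p\<in>S. H p)" using insert by blast
  finally show ?case using insert by (simp add: V_add)
qed

text \<open>The components of a lattice vector are obtained by grouping its tableaux according to
  their characters. They are unique because a vector of one weight space is supported, in V, on the
  tableaux with that character.\<close>

lemma direct_sum: "internal_direct_sum V (Specm \<Gamma>) (GT_space n V)"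
  unfolding internal_direct_sum_def
proof (intro conjI ballI)
  show "GT_space n V p \<subseteq> carrier V" for p by (auto simp: GT_space_def)
  fix u assume "u \<in> carrier V"
  then obtain G where G: "lat G" "u = cl G" by (rule V_cases)
  define f where "f p = (if p \<in> Specm \<Gamma> then cl (block p G) else \<zero>\<^bsub>V\<^esub>)" for p
  define S where "S = {p. f p \<noteq> \<zero>\<^bsub>V\<^esub>}"
  have KS: "Ker z \<in> Specm \<Gamma>" for z by (simp add: Specm_def maximal_Ker)
  have "S \<subseteq> Ker ` Poly_Mapping.keys G"
  proof
    fix p assume p: "p \<in> S"
    show "p \<in> Ker ` Poly_Mapping.keys G"
    proof (rule ccontr)
      assume *: "p \<notin> Ker ` Poly_Mapping.keys G"
      have "block p G = 0"
      proof (rule poly_mapping_eqI)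
        fix z show "Poly_Mapping.lookup (block p G) z = Poly_Mapping.lookup 0 z"
          using * by (cases "z \<in> Poly_Mapping.keys G") (auto simp: lookup_block in_keys_iff)
      qed
      then show False using p by (simp add: S_def f_def V_zero split: if_splits)
    qed
  qed
  then have S: "finite S" by (rule finite_subset) simp
  have fS: "p \<in> S \<Longrightarrow> lat (block p G) \<and> f p = cl (block p G)" for p
    by (auto simp: S_def f_def lat_block[OF G(1)] split: if_splits)
  have lk: "Poly_Mapping.lookup (\<Sum>p\<in>S. block p G) z = (if Ker z \<in> S then Poly_Mapping.lookup G z else 0)" for z
    using S by (simp add: lookup_sum lookup_block sum.delta')
  have "G \<asymp> (\<Sum>p\<in>S. block p G)"
    unfolding eqv_def lk
  proof (intro allI)
    fix z
    show "fls_nth (Poly_Mapping.lookup G z) 0 = fls_nth (if Ker z \<in> S then Poly_Mapping.lookup G z else 0) 0 \<and>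
      fls_nth (Poly_Mapping.lookup G z) (-1) = fls_nth (if Ker z \<in> S then Poly_Mapping.lookup G z else 0) (-1)"
    proof (cases "Ker z \<in> S")
      case False
      then have "cl (block (Ker z) G) = cl 0" using KS[of z] by (simp add: S_def f_def V_zero)
      then have "block (Ker z) G \<asymp> 0" using cl_eq[OF lat_block[OF G(1)] lat_0] by simp
      then have "fls_nth (Poly_Mapping.lookup (block (Ker z) G) z) 0 = 0 \<and> fls_nth (Poly_Mapping.lookup (block (Ker z) G) z) (-1) = 0"
        unfolding eqv_def by simp
      then show ?thesis using False by (simp add: lookup_block)
    qed simp
  qed
  moreover have "lat (\<Sum>p\<in>S. block p G)" using fS by (intro lat_sum) simp
  ultimately have "cl G = cl (\<Sum>p\<in>S. block p G)" by (simp only: cl_eq[OF G(1)])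
  then have usum: "u = (\<Oplus>\<^bsub>V\<^esub>p\<in>S. f p)" by (simp only: G(2) finsum_cl[OF S fS])
  show "\<exists>!f. (\<forall>p\<in>Specm \<Gamma>. f p \<in> GT_space n V p) \<and> (\<forall>p. p \<notin> Specm \<Gamma> \<longrightarrow> f p = \<zero>\<^bsub>V\<^esub>) \<and>
      finite {p. f p \<noteq> \<zero>\<^bsub>V\<^esub>} \<and> u = (\<Oplus>\<^bsub>V\<^esub>p\<in>{p. f p \<noteq> \<zero>\<^bsub>V\<^esub>}. f p)"
  proof (rule ex1I[of _ f])
    have "cl (block p G) \<in> GT_space n V p" if "p \<in> Specm \<Gamma>" for p
    proof (rule GT_kill[OF lat_block[OF G(1)]])
      have "ideal p \<Gamma>" using that by (simp add: Specm_def maximalideal_def)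
      then show "p \<subseteq> carrier \<Gamma>" by (rule additive_subgroup.a_subset[OF ideal.axioms(1)])
    qed (simp add: lookup_block split: if_splits)
    then show "(\<forall>p\<in>Specm \<Gamma>. f p \<in> GT_space n V p) \<and> (\<forall>p. p \<notin> Specm \<Gamma> \<longrightarrow> f p = \<zero>\<^bsub>V\<^esub>) \<and>
      finite {p. f p \<noteq> \<zero>\<^bsub>V\<^esub>} \<and> u = (\<Oplus>\<^bsub>V\<^esub>p\<in>{p. f p \<noteq> \<zero>\<^bsub>V\<^esub>}. f p)"
      using S usum unfolding S_def by (simp add: f_def)
  next
    fix g assume g: "(\<forall>p\<in>Specm \<Gamma>. g p \<in> GT_space n V p) \<and> (\<forall>p. p \<notin> Specm \<Gamma> \<longrightarrow> g p = \<zero>\<^bsub>V\<^esub>) \<and>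
      finite {p. g p \<noteq> \<zero>\<^bsub>V\<^esub>} \<and> u = (\<Oplus>\<^bsub>V\<^esub>p\<in>{p. g p \<noteq> \<zero>\<^bsub>V\<^esub>}. g p)"
    have "\<exists>H. lat H \<and> g p = cl H" for p
    proof (cases "p \<in> Specm \<Gamma>")
      case True
      then have "g p \<in> carrier V" using g by (auto simp: GT_space_def)
      then show ?thesis by (auto simp: V_carrier)
    next
      case False
      then show ?thesis using g lat_0 V_zero by metis
    qed
    then obtain H where H: "\<And>p. lat (H p)" "\<And>p. g p = cl (H p)" by metis
    define R where "R = {p. g p \<noteq> \<zero>\<^bsub>V\<^esub>}"
    have R: "finite R" "u = (\<Oplus>\<^bsub>V\<^esub>p\<in>R. g p)" using g unfolding R_def by auto
    have "cl G = cl (\<Sum>p\<in>R. H p)" using R(2) finsum_cl[OF R(1), of H g] H G(2) by simp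
    moreover have "lat (\<Sum>p\<in>R. H p)" by (rule lat_sum) (rule H(1))
    ultimately have GH: "G \<asymp> (\<Sum>p\<in>R. H p)" by (simp only: cl_eq[OF G(1)])
    \<comment> \<open>Hence at a tableau z of character p only the component of p can contribute to
      the coefficient of G.\<close>
    have supp: "fls_nth (Poly_Mapping.lookup (H p) z) m = 0" if "p \<in> Specm \<Gamma>" "Ker z \<noteq> p" "m \<in> {0,-1}" for p z m
      using GT_support[OF H(1), of p p z] that g H(2)[of p] by (auto simp: Specm_def)
    have RS: "p \<in> Specm \<Gamma>" if "p \<in> R" for p using that g unfolding R_def by blast
    have nul: "fls_nth (Poly_Mapping.lookup (H p) z) m = 0" if "p \<notin> R" "m \<in> {0,-1}" for p z m
    proof -
      have "cl (H p) = cl 0" using that(1) H(2)[of p] by (simp add: R_def V_zero)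
      then have "H p \<asymp> 0" using cl_eq[OF H(1) lat_0] by simp
      then show ?thesis using that(2) by (auto simp: eqv_def)
    qed
    show "g = f"
    proof
      fix p
      show "g p = f p"
      proof (cases "p \<in> Specm \<Gamma>")
        case True
        have "fls_nth (Poly_Mapping.lookup (H p) z) m = fls_nth (Poly_Mapping.lookup (block p G) z) m" if m: "m \<in> {0,-1}" for z m
        proof (cases "Ker z = p")
          case False
          then show ?thesis using supp[OF True False m] by (simp add: lookup_block)
        next
          case Kz: True
          have "fls_nth (Poly_Mapping.lookup G z) m = (\<Sum>q\<in>R. fls_nth (Poly_Mapping.lookup (H q) z) m)"
            using GH m unfolding eqv_def lookup_sum by (auto simp: fls_nth_sum)
          also have "\<dots> = (\<Sum>q\<in>R. if q = p then fls_nth (Poly_Mapping.lookup (H p) z) m else 0)"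
            using supp[OF RS _ m, of _ z] Kz by (intro sum.cong refl) auto
          also have "\<dots> = fls_nth (Poly_Mapping.lookup (H p) z) m"
            using R(1) nul[OF _ m, of p z] by (simp add: sum.delta)
          finally show ?thesis using Kz by (simp add: lookup_block)
        qed
        then have "H p \<asymp> block p G" unfolding eqv_def by simp
        then show ?thesis using True cl_eq[OF H(1) lat_block[OF G(1)]] by (simp add: H(2) f_def)
      next
        case False
        then show ?thesis using g by (simp add: f_def)
      qed
    qed
  qed
qed

lemma zero_Zvecs: "(\<lambda>_. 0) \<in> Zvecs n" by (simp add: Zvecs_def)

lemma one_singular_witness:
  "\<exists>m\<in>Specm \<Gamma>. GT_space n V m \<noteq> {\<zero>\<^bsub>V\<^esub>} \<and>
        (\<exists>l ch. one_singular n l \<and> GT_character n ch \<and>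
           (\<forall>r s. 1 \<le> s \<and> s \<le> r \<and> r \<le> n \<longrightarrow> ch (c_env n r s) = rf_eval (gamma r s) l) \<and>
           m = a_kernel \<Gamma> complex_ring ch)"
\<comment> \<open>The witness is the character of the unshifted tableau, whose lower rows are v
  itself.\<close>
proof (rule bexI[of _ "Ker (\<lambda>_. 0)"], rule conjI)
  let ?z = "\<lambda>_. 0 :: int"
  show "Ker ?z \<in> Specm \<Gamma>" by (simp add: Specm_def maximal_Ker)
  let ?G = "T ?z + flip (T ?z)"
  have G: "lat ?G" by (intro lat_sym pol_T zero_Zvecs)
  have tz: "\<tau> ?z = ?z" by (simp add: swap_fixed_iff)
  have "cl ?G \<in> GT_space n V (Ker ?z)"
  proof (rule GT_kill[OF G])
    show "Ker ?z \<subseteq> carrier \<Gamma>" by (auto simp: Ker_iff)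
    fix w assume "Poly_Mapping.lookup ?G w \<noteq> 0"
    then have "w = ?z \<or> \<tau> w = ?z" by (auto simp: lookup_add lookup_single when_def \<theta>_hom split: if_splits)
    then show "Ker w = Ker ?z" using Ker_tau by metis
  qed
  moreover have "cl ?G \<noteq> \<zero>\<^bsub>V\<^esub>"
  proof
    assume "cl ?G = \<zero>\<^bsub>V\<^esub>"
    then have "?G \<asymp> 0" unfolding V_zero using cl_eq[OF G lat_0] by simp
    then have "fls_nth (Poly_Mapping.lookup ?G ?z) 0 = 0" unfolding eqv_def by simp
    then show False by (simp add: lookup_add tz \<theta>_hom)
  qed
  ultimately show "GT_space n V (Ker ?z) \<noteq> {\<zero>\<^bsub>V\<^esub>}" by blast
  let ?l = "\<lambda>u. val ?z (fst u) (snd u)"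
  have "{(r, s, u). 1 \<le> s \<and> s < u \<and> u \<le> r \<and> r \<le> n - 1 \<and> ?l (r,s) - ?l (r,u) \<in> \<int>} = {(k,i,j)}"
  proof (intro equalityI subsetI)
    fix x assume "x \<in> {(r, s, u). 1 \<le> s \<and> s < u \<and> u \<le> r \<and> r \<le> n - 1 \<and> ?l (r,s) - ?l (r,u) \<in> \<int>}"
    then obtain r s u where x: "x = (r,s,u)" "1 \<le> s" "s < u" "u \<le> r" "r \<le> n - 1" "?l (r,s) - ?l (r,u) \<in> \<int>" by blast
    have "r \<noteq> n" using x ij by auto
    then have "v (r,s) - v (r,u) \<in> \<int>" using x(6) by (simp add: val_def)
    then show "x \<in> {(k,i,j)}" using v_generic[OF x(2-5)] x(1) by blast
  next
    fix x assume "x \<in> {(k,i,j)}"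
    then show "x \<in> {(r, s, u). 1 \<le> s \<and> s < u \<and> u \<le> r \<and> r \<le> n - 1 \<and> ?l (r,s) - ?l (r,u) \<in> \<int>}"
      using ij v_eq kn(1) by (simp add: val_def)
  qed
  then have os: "one_singular n ?l" unfolding one_singular_def by simp
  have "ch ?z (c_env n r s) = rf_eval (gamma r s) ?l" if "1 \<le> s" "r \<le> n" for r s
    unfolding ch_def diagonal_c(2)[OF that] by (rule c_eigen[OF that, of ?z]) assumption
  then show "\<exists>l ch. one_singular n l \<and> GT_character n ch \<and>
           (\<forall>r s. 1 \<le> s \<and> s \<le> r \<and> r \<le> n \<longrightarrow> ch (c_env n r s) = rf_eval (gamma r s) l) \<and>
           Ker ?z = a_kernel \<Gamma> complex_ring ch"
    using os GT_character_ch[of ?z] by (intro exI[of _ ?l] exI[of _ "ch ?z"]) (simp add: Ker_def)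
qed

end

section \<open>Connecting all tableaux\<close>

lemma jet_const_specialization: "specialization (\<lambda>g c. jet g c 0)"
proof (unfold_locales, goal_cases)
  case (3 g c h e)
  then show ?case using jet_add[of g c 0 h e 0] by simp
next
  case (4 g c h e)
  then show ?case using jet_mult[of g c 0 h e 0] by simp
next
  case (5 g c)
  have "fls_const (- 1) * g = - g" by (rule fls_eqI) simp
  then show ?case using jet_mult[OF jet_const[of "- 1"] 5] by simp
next
  case (6 g c)
  then show ?case using jet_inverse[OF 6] jet_nth(1)[OF 6(1)] by auto
qed (use jet_const[of 0] jet_const[of 1] in auto)

text \<open>A path from g to f in which entries change in the order of \<open>rk\<close>; t is the
  time.\<close>

definition mix :: "('x \<Rightarrow> nat) \<Rightarrow> nat \<Rightarrow> ('x \<Rightarrow> int) \<Rightarrow> ('x \<Rightarrow> int) \<Rightarrow> 'x \<Rightarrow> int" where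
  "mix rk t f g = (\<lambda>x. if rk x < t then f x else g x)"

context singular_point
begin

interpretation gB: generic_tableau n eL by (rule line_generic)
interpretation ce: complex_embedding "fls_const :: complex \<Rightarrow> complex fls" by (rule complex_embedding_fls)
interpretation H0: specialization "\<lambda>g c. jet g c 0" by (rule jet_const_specialization)

text \<open>The entries i and j move with opposite speeds 1/2 and -1/2, so the linear power sum has
  derivative 0 and the quadratic one the difference of the two entries. Hence the Casimir element of
  gl(k) is not semisimple on T and DT exactly where the shifts at i and j differ.\<close>

lemma casimir_derivative: "\<exists>c. jet (mu k 2 z) c (of_int (z (k,i) - z (k,j)))"
proof -
  let ?W = "\<lambda>q. ent n eL z k q" and ?v = "\<lambda>q. val z k q"
  define \<delta> :: "nat \<Rightarrow> complex" where "\<delta> q = (if q = i then 1/2 else 0) + (if q = j then - 1/2 else 0)" for q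
  have J: "jet (?W q) (?v q) (\<delta> q)" for q
    using ent_jet[of z k q] kn(5) by (cases "q = i"; cases "q = j") (simp_all add: \<delta>_def)
  have J1: "jet (\<Sum>q=1..k. ?W q ^ 1) (\<Sum>q=1..k. ?v q) (\<Sum>q=1..k. \<delta> q)"
    using jet_sum[of "{1..k}" ?W ?v \<delta>, OF J] by simp
  have J2: "jet (\<Sum>q=1..k. ?W q ^ 2) (\<Sum>q=1..k. ?v q * ?v q) (\<Sum>q=1..k. ?v q * \<delta> q + \<delta> q * ?v q)"
    using jet_sum[of "{1..k}" "\<lambda>q. ?W q * ?W q", OF jet_mult[OF J J]] by (simp add: power2_eq_square)
  have nat: "jet (of_nat m) (of_nat m) 0" for m by (rule H0.R_of_nat)
  have two: "jet 2 2 0" "jet 6 6 0" using nat[of 2] nat[of 6] by simp_all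
  have K: "jet (of_nat k - 1) (of_nat k - 1) 0" by (intro H0.R_diff nat H0.R_1)
  have C: "jet (gB.casc k) (of_nat k * (of_nat k - 1) * (of_nat k - 2) / 6) 0"
    unfolding gB.casc_def by (intro H0.R_divide H0.R_mult H0.R_diff nat H0.R_1 two) simp
  have s1: "(\<Sum>q=1..k. \<delta> q) = 0" using kn by (simp add: \<delta>_def sum.distrib sum.delta)
  have s2: "(\<Sum>q=1..k. ?v q * \<delta> q + \<delta> q * ?v q) = ?v i - ?v j"
  proof -
    have "?v q * \<delta> q + \<delta> q * ?v q = (if q = i then ?v i else 0) + (if q = j then - ?v j else 0)" for q
      using kn(5) by (cases "q = i"; cases "q = j") (simp_all add: \<delta>_def)
    then show ?thesis using kn by (simp add: sum.distrib sum.delta)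
  qed
  have "?v i - ?v j = of_int (z (k,i) - z (k,j))" using v_eq kn(1) by (simp add: val_def)
  moreover have "mu k 2 z = (\<Sum>q=1..k. ?W q ^ 2) + (of_nat k - 1) * (\<Sum>q=1..k. ?W q ^ 1) + gB.casc k"
  proof -
    have "mu k 2 z = gB.kap k z" using kn by (intro mu_kap) simp_all
    then show ?thesis by (simp only: gB.kap_def)
  qed
  ultimately show ?thesis using jet_add[OF jet_add[OF J2 jet_mult[OF K J1]] C] unfolding s1 s2 by auto
qed

text \<open>The Casimir element minus its constant term maps the lift of DT to a non-zero multiple
  of the lift of T, up to terms that vanish in V.\<close>

lemma reach_start:
  assumes "z0 \<in> Zvecs n" "\<tau> z0 \<noteq> z0"
  shows "reach z0 z0"
proof -
  define D :: complex where "D = of_int (z0 (k,i) - z0 (k,j))"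
  have D: "D \<noteq> 0" using assms(2) by (simp add: D_def swap_fixed_iff)
  obtain c where J: "jet (mu k 2 z0) c D" using casimir_derivative[of z0] by (auto simp: D_def)
  define y where "y = c_free k 2 - Poly_Mapping.single 0 c"
  have kn': "k \<le> n" using kn by simp
  have y: "y \<in> free_letters n" unfolding y_def by (rule casimir_act(2)[OF kn'])
  have st: "gen z0 (symm (Poly_Mapping.single z0 fls_X_inv))" by (rule gen_start[OF assms(1)])
  have "gen z0 (app (\<rho> y) (symm (Poly_Mapping.single z0 fls_X_inv)))" by (rule gen_rho[OF assms(1) st y])
  moreover have "app (\<rho> y) (symm (Poly_Mapping.single z0 fls_X_inv)) = symm (Poly_Mapping.single z0 ((mu k 2 z0 - fls_const c) * fls_X_inv))"
    unfolding symm_rho[OF y] unfolding y_def casimir_act(1)[OF kn'] ..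
  ultimately have 1: "gen z0 (symm (Poly_Mapping.single z0 (fls_X_inv * (mu k 2 z0 - fls_const c))))" by (simp add: mult.commute)
  have "fls_nth (mu k 2 z0 - fls_const c) m = 0" if "m \<le> 0" for m
    using jet_nth[OF J] that by (cases "m = 0") auto
  then have "symm (Poly_Mapping.single z0 (fls_X_inv * (mu k 2 z0 - fls_const c))) \<asymp> symm (Poly_Mapping.single z0 (fls_const D))"
    using jet_nth[OF J] by (intro symm_single_eqv) (auto simp: holo_X_iff holo_iff)
  from gen_eqv[OF assms(1) 1 this] have "gen z0 (symm (Poly_Mapping.single z0 (fls_const D)))"
    using lat_symm_single[OF assms(1), of "fls_const D"] by (simp add: holo_X_iff)
  from gen_scale[OF assms(1) this, of "inverse D"] have "gen z0 (symm (T z0))"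
    using D by (simp add: symm_scale[symmetric] fls_const_mult_const)
  then show ?thesis using st assms(1) by (simp add: reach_def)
qed

lemma shift_step: "shift (shift z x s) x s' = shift z x (s + s')" "shift z x 0 = z"
  by (auto simp: shift_def)

lemma reach_up_iter:
  assumes "z0 \<in> Zvecs n" "reach z0 z" "q \<in> {1..p}" "p < n"
    "\<And>t. t < m \<Longrightarrow> p = k \<Longrightarrow> shift z (p,q) (int t) (k,i) \<noteq> shift z (p,q) (int t) (k,j)"
    "\<And>t u. t < m \<Longrightarrow> u \<in> {1..p+1} \<Longrightarrow> Re (val (shift z (p,q) (int t)) (p+1) u) < Re (val (shift z (p,q) (int t)) p q)"
  shows "reach z0 (shift z (p,q) (int m))"
  using assms(5,6)
proof (induction m)
  case 0
  then show ?case using assms(2) by (simp add: shift_step)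
next
  case (Suc m)
  have "reach z0 (shift (shift z (p,q) (int m)) (p,q) 1)"
    using Suc assms(1,3,4) by (intro move_up) (simp_all add: swap_fixed_iff)
  then show ?case by (simp add: shift_step add.commute)
qed

lemma reach_down_iter:
  assumes "z0 \<in> Zvecs n" "reach z0 z" "q \<in> {1..p}" "p < n"
    "\<And>t. t < m \<Longrightarrow> p = k \<Longrightarrow> shift z (p,q) (- int t) (k,i) \<noteq> shift z (p,q) (- int t) (k,j)"
    "\<And>t u. t < m \<Longrightarrow> u \<in> {1..p-1} \<Longrightarrow> Re (val (shift z (p,q) (- int t)) p q) < Re (val (shift z (p,q) (- int t)) (p-1) u)"
  shows "reach z0 (shift z (p,q) (- int m))"
  using assms(5,6)
proof (induction m)
  case 0
  then show ?case using assms(2) by (simp add: shift_step)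
next
  case (Suc m)
  have "reach z0 (shift (shift z (p,q) (- int m)) (p,q) (-1))"
    using Suc assms(1,3,4) by (intro move_down) (simp_all add: swap_fixed_iff)
  moreover have "- int m + - 1 = - int (Suc m)" by simp
  ultimately show ?case unfolding shift_step by (simp only:)
qed

section \<open>The order in which the entries are moved\<close>

definition pos :: "idx \<Rightarrow> bool" where
  "pos x \<longleftrightarrow> 1 \<le> snd x \<and> snd x \<le> fst x \<and> fst x < n"

text \<open>Within row k the entry (k,i) is raised first and lowered last, so that no singular tableau is
  met before all entries of that row have reached their targets.\<close>

definition rank :: "idx \<Rightarrow> nat" where
  "rank x = fst x * Suc n + (if x = (k,i) then 0 else snd x)"

lemma Zvecs_pos: "z \<in> Zvecs n \<longleftrightarrow> (\<forall>x. \<not> pos x \<longrightarrow> z x = 0)"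
proof -
  have "(r \<le> n - 1 \<and> 1 \<le> r) = (r < n \<and> 1 \<le> r)" for r by auto
  then show ?thesis unfolding Zvecs_def pos_def by (auto simp: le_diff_conv2) (metis Suc_leI diff_Suc_1 le_trans Suc_pred less_eq_Suc_le not_less_eq_eq)+
qed

lemma pos_kij: "pos (k,i)" "pos (k,j)"
  using ij kn by (simp_all add: pos_def)

lemma rank_bound: "pos x \<Longrightarrow> fst x * Suc n \<le> rank x \<and> rank x < Suc (fst x) * Suc n"
  by (auto simp: rank_def pos_def)

lemma rank_row: "pos x \<Longrightarrow> pos y \<Longrightarrow> fst x < fst y \<Longrightarrow> rank x < rank y"
  using rank_bound[of x] rank_bound[of y] mult_le_mono1[of "Suc (fst x)" "fst y" "Suc n"] by linarith

lemma rank_inj: "pos x \<Longrightarrow> pos y \<Longrightarrow> rank x = rank y \<Longrightarrow> x = y"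
proof -
  assume *: "pos x" "pos y" "rank x = rank y"
  then have f: "fst x = fst y" using rank_row[of x y] rank_row[of y x] by (metis less_irrefl linorder_neqE_nat)
  then have "(if x = (k,i) then 0 else snd x) = (if y = (k,i) then 0 else snd y)" using *(3) by (simp add: rank_def)
  then show "x = y" using * f by (auto simp: pos_def prod_eq_iff split: if_splits)
qed

lemma rank_ki: "pos (k,q) \<Longrightarrow> q \<noteq> i \<Longrightarrow> rank (k,i) < rank (k,q)"
  by (simp add: rank_def pos_def)

abbreviation "mixr \<equiv> mix rank"

lemma mix_step:
  assumes "f \<in> Zvecs n" "g \<in> Zvecs n"
  shows "\<not> (\<exists>x. pos x \<and> rank x = t) \<Longrightarrow> mixr (Suc t) f g = mixr t f g"
    and "pos x \<Longrightarrow> rank x = t \<Longrightarrow> mixr (Suc t) f g = shift (mixr t f g) x (f x - g x)"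
proof -
  have z: "\<not> pos y \<Longrightarrow> f y = 0 \<and> g y = 0" for y using assms unfolding Zvecs_pos by blast
  show "mixr (Suc t) f g = mixr t f g" if nx: "\<not> (\<exists>x. pos x \<and> rank x = t)"
  proof
    fix y
    have "f y = g y" if "rank y = t"
    proof -
      have "\<not> pos y" using that nx by blast
      then show ?thesis using z[of y] by simp
    qed
    then show "mixr (Suc t) f g y = mixr t f g y" by (auto simp: mix_def less_Suc_eq)
  qed
  show "mixr (Suc t) f g = shift (mixr t f g) x (f x - g x)" if x: "pos x" "rank x = t"
  proof
    fix y show "mixr (Suc t) f g y = shift (mixr t f g) x (f x - g x) y"
    proof (cases "y = x")
      case True
      then show ?thesis using x by (simp add: mix_def shift_def)
    next
      case False
      have "f y = g y" if "rank y = t"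
      proof -
        have "\<not> pos y"
        proof
          assume "pos y"
          then have "y = x" using rank_inj[OF _ x(1), of y] x(2) that by simp
          then show "False" using False by simp
        qed
        then show ?thesis using z[of y] by simp
      qed
      then show ?thesis using False by (auto simp: mix_def shift_def less_Suc_eq)
    qed
  qed
qed

lemma mix_ends:
  assumes "f \<in> Zvecs n" "g \<in> Zvecs n"
  shows "mixr 0 f g = g" "mixr (n * Suc n) f g = f"
proof -
  show "mixr 0 f g = g" by (simp add: mix_def)
  show "mixr (n * Suc n) f g = f"
  proof
    fix x show "mixr (n * Suc n) f g x = f x"
    proof (cases "pos x")
      case True
      then have "Suc (fst x) \<le> n" by (simp add: pos_def)
      then have "rank x < n * Suc n" using rank_bound[OF True] mult_le_mono1[of "Suc (fst x)" n "Suc n"] by linarith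
      then show ?thesis by (simp add: mix_def)
    next
      case False
      then have "f x = 0" "g x = 0" using assms unfolding Zvecs_pos by blast+
      then show ?thesis by (simp add: mix_def)
    qed
  qed
qed

lemma val_row: "r < n \<Longrightarrow> val z r s = v (r,s) + of_int (z (r,s))" "val z n s = a s"
  by (simp_all add: val_def)

text \<open>While row p is raised, row p + 1 is still in its initial position and therefore strictly
  below in real part, so no raising numerator vanishes.\<close>

lemma raise:
  assumes z0: "z0 \<in> Zvecs n" and r: "reach z0 z1" and Z: "z1 \<in> Zvecs n" "h \<in> Zvecs n" and le: "\<And>x. z1 x \<le> h x"
    and gap: "\<And>p q u. q \<in> {1..p} \<Longrightarrow> p < n \<Longrightarrow> u \<in> {1..p+1} \<Longrightarrow> Re (val z1 (p+1) u) < Re (val z1 p q)"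
    and d: "z1 (k,j) < z1 (k,i)" "h (k,j) < h (k,i)"
  shows "reach z0 h"
proof -
  have "reach z0 (mixr t h z1)" for t
  proof (induction t)
    case 0
    then show ?case using r mix_ends(1)[OF Z(2,1)] by simp
  next
    case (Suc t)
    show ?case
    proof (cases "\<exists>x. pos x \<and> rank x = t")
      case False
      then show ?thesis using Suc mix_step(1)[OF Z(2,1) False] by simp
    next
      case True
      then obtain p q where x: "pos (p,q)" "rank (p,q) = t" by auto
      have pq: "q \<in> {1..p}" "p < n" using x(1) by (auto simp: pos_def)
      define m where "m = nat (h (p,q) - z1 (p,q))"
      have m: "int m = h (p,q) - z1 (p,q)" using le[of "(p,q)"] by (simp add: m_def)
      have at: "shift (mixr t h z1) (p,q) (int s) y = (if y = (p,q) then z1 y + int s else mixr t h z1 y)" for s y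
        using x(2) by (simp add: shift_def mix_def)
      have "reach z0 (shift (mixr t h z1) (p,q) (int m))"
      proof (rule reach_up_iter[OF z0 Suc pq])
        fix s assume s: "s < m"
        \<comment> \<open>Entry i is raised first and entry j ends below it, so entry i stays
          strictly larger throughout.\<close>
        show "shift (mixr t h z1) (p,q) (int s) (k,i) \<noteq> shift (mixr t h z1) (p,q) (int s) (k,j)" if "p = k"
        proof -
          have ij': "rank (k,i) < rank (k,j)" using rank_ki[OF pos_kij(2)] kn(5) by simp
          consider "q = i" | "q = j" | "q \<noteq> i" "q \<noteq> j" by blast
          then show ?thesis
          proof cases
            case 1
            then show ?thesis unfolding at using that x(2) ij' kn(5) d by (auto simp: mix_def)
          next
            case 2
            then show ?thesis unfolding at using that x(2) ij' kn(5) d m s by (auto simp: mix_def)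
          next
            case 3
            then show ?thesis unfolding at using that ij' d le[of "(k,j)"] by (auto simp: mix_def)
          qed
        qed
        fix u assume u: "u \<in> {1..p+1}"
        have g: "Re (val z1 (p+1) u) < Re (val z1 p q)" by (rule gap[OF pq u])
        have "val (shift (mixr t h z1) (p,q) (int s)) (p+1) u = val z1 (p+1) u"
        proof (cases "p + 1 = n")
          case False
          then have "pos (p+1,u)" using pq u by (simp add: pos_def)
          then have "t < rank (p+1,u)" using rank_row[OF x(1), of "(p+1,u)"] x(2) by simp
          then show ?thesis using False pq by (simp add: val_row at) (simp add: mix_def)
        qed (simp add: val_def)
        moreover have "Re (val (shift (mixr t h z1) (p,q) (int s)) p q) = Re (val z1 p q) + real s"
          using pq by (simp add: val_row at)
        ultimately show "Re (val (shift (mixr t h z1) (p,q) (int s)) (p+1) u) < Re (val (shift (mixr t h z1) (p,q) (int s)) p q)"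
          using g by simp
      qed
      then show ?thesis using mix_step(2)[OF Z(2,1) x] m by simp
    qed
  qed
  then show ?thesis using mix_ends(2)[OF Z(2,1)] by metis
qed

text \<open>While row p is lowered, row p - 1 is still at its large values, so no lowering numerator
  vanishes. The induction runs along decreasing t and is therefore phrased as an implication towards
  w.\<close>

lemma lower:
  assumes z0: "z0 \<in> Zvecs n" and r: "reach z0 h" and Z: "w \<in> Zvecs n" "h \<in> Zvecs n" and le: "\<And>x. w x \<le> h x"
    and gap: "\<And>p q u. q \<in> {1..p} \<Longrightarrow> p < n \<Longrightarrow> u \<in> {1..p-1} \<Longrightarrow> Re (val h p q) < Re (val h (p-1) u)"
    and d: "w (k,j) \<le> w (k,i)" "h (k,j) < h (k,i)"
  shows "reach z0 w"
proof -
  have "reach z0 (mixr t h w) \<Longrightarrow> reach z0 w" for t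
  proof (induction t)
    case 0
    then show ?case using mix_ends(1)[OF Z(2,1)] by simp
  next
    case (Suc t)
    show ?case
    proof (cases "\<exists>x. pos x \<and> rank x = t")
      case False
      then show ?thesis using Suc mix_step(1)[OF Z(2,1) False] by simp
    next
      case True
      then obtain p q where x: "pos (p,q)" "rank (p,q) = t" by auto
      have pq: "q \<in> {1..p}" "p < n" using x(1) by (auto simp: pos_def)
      define m where "m = nat (h (p,q) - w (p,q))"
      have m: "int m = h (p,q) - w (p,q)" using le[of "(p,q)"] by (simp add: m_def)
      have at: "shift (mixr (Suc t) h w) (p,q) (- int s) y = (if y = (p,q) then h y - int s else mixr (Suc t) h w y)" for s y
        using x(2) by (simp add: shift_def mix_def)
      have "reach z0 (shift (mixr (Suc t) h w) (p,q) (- int m))"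
      proof (rule reach_down_iter[OF z0 Suc.prems pq])
        fix s assume s: "s < m"
        \<comment> \<open>Only the tableaux before a step in row k have to be non-singular. Entry i
          is lowered last in its row, so w may have equal singular entries: equality is attained
          only after the final step of the row.\<close>
        show "shift (mixr (Suc t) h w) (p,q) (- int s) (k,i) \<noteq> shift (mixr (Suc t) h w) (p,q) (- int s) (k,j)" if "p = k"
        proof -
          have ij': "rank (k,i) < rank (k,j)" using rank_ki[OF pos_kij(2)] kn(5) by simp
          consider "q = i" | "q = j" | "q \<noteq> i" "q \<noteq> j" by blast
          then show ?thesis
          proof cases
            case 1
            then show ?thesis unfolding at using that x(2) ij' kn(5) d m s by (auto simp: mix_def)
          next
            case 2
            then show ?thesis unfolding at using that x(2) ij' kn(5) d by (auto simp: mix_def)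
          next
            case 3
            then have "rank (k,i) < t" using rank_ki[of q] x that by simp
            then show ?thesis unfolding at using 3 that d le[of "(k,j)"] by (auto simp: mix_def)
          qed
        qed
        fix u assume u: "u \<in> {1..p-1}"
        have g: "Re (val h p q) < Re (val h (p-1) u)" by (rule gap[OF pq u])
        have "pos (p-1,u)" using pq u by (auto simp: pos_def)
        then have "rank (p-1,u) < t" using rank_row[of "(p-1,u)" "(p,q)"] x u by auto
        moreover have "p - 1 < n" "p - 1 \<noteq> p" using pq u by auto
        ultimately have "val (shift (mixr (Suc t) h w) (p,q) (- int s)) (p-1) u = val h (p-1) u"
          by (simp add: val_row at) (simp add: mix_def)
        moreover have "Re (val (shift (mixr (Suc t) h w) (p,q) (- int s)) p q) = Re (val h p q) - real s"
          using pq by (simp add: val_row at)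
        ultimately show "Re (val (shift (mixr (Suc t) h w) (p,q) (- int s)) p q) < Re (val (shift (mixr (Suc t) h w) (p,q) (- int s)) (p-1) u)"
          using g by simp
      qed
      moreover have "shift (mixr (Suc t) h w) (p,q) (- int m) = mixr t h w"
        using mix_step(2)[OF Z(2,1) x] m by (simp add: shift_step)
      ultimately show ?thesis using Suc.IH by simp
    qed
  qed
  then show ?thesis using mix_ends(2)[OF Z(2,1)] r by metis
qed

text \<open>The swap changes the lift of T not at all and the lift of DT by a sign.\<close>

lemma reach_tau: assumes "z0 \<in> Zvecs n" "reach z0 (\<tau> w)" shows "reach z0 w"
proof -
  have 1: "symm (T (\<tau> w)) = symm (T w)"
    by (rule poly_mapping_eqI) (auto simp: symm_def lookup_add lookup_single when_def \<theta>_hom tau_eq_iff)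
  have 2: "symm (Poly_Mapping.single (\<tau> w) fls_X_inv) = scale (fls_const (- 1)) (symm (Poly_Mapping.single w fls_X_inv))"
  proof (rule poly_mapping_eqI)
    have m: "fls_const (- 1) * g = - g" for g :: "complex fls" by (rule fls_eqI) simp
    fix y
    show "Poly_Mapping.lookup (symm (Poly_Mapping.single (\<tau> w) fls_X_inv)) y = Poly_Mapping.lookup (scale (fls_const (- 1)) (symm (Poly_Mapping.single w fls_X_inv))) y"
      by (auto simp: symm_def lookup_add lookup_single when_def \<theta>_hom tau_eq_iff theta_X_inv m)
  qed
  have "gen z0 (scale (fls_const (- 1)) (symm (Poly_Mapping.single (\<tau> w) fls_X_inv)))"
    using assms by (intro gen_scale) (simp_all add: reach_def)
  then have "gen z0 (symm (Poly_Mapping.single w fls_X_inv))"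
    unfolding 2 scale_scale by (simp add: fls_const_mult_const)
  then show ?thesis using assms 1 by (simp add: reach_def)
qed

text \<open>Row p of the starting tableau lies far above row p + 1, so that first raising the rows from
  top to bottom and then lowering them from bottom to top never meets a vanishing numerator.\<close>

definition tower :: "int \<Rightarrow> zvec" where
  "tower N x = (if pos x then (int n - int (fst x)) * N + (if x = (k,i) then 1 else 0) else 0)"

lemma tower_Zvecs: "tower N \<in> Zvecs n"
  by (simp add: Zvecs_pos tower_def)

lemma tower_kij: "tower N (k,j) < tower N (k,i)"
  using pos_kij kn(5) by (simp add: tower_def)

lemma all_reached: "\<exists>z0\<in>Zvecs n. \<forall>w\<in>Zvecs n. reach z0 w"
proof -
  define I where "I = {x :: idx. 1 \<le> snd x \<and> snd x \<le> fst x \<and> fst x \<le> n}"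
  have "I \<subseteq> {..n} \<times> {..n}" by (auto simp: I_def)
  then have fI: "finite I" by (rule finite_subset) simp
  define vv where "vv x = Re (val (\<lambda>_. 0) (fst x) (snd x))" for x
  define M where "M = (\<Sum>x\<in>I. \<bar>vv x\<bar>)"
  \<comment> \<open>An integer larger than the difference of the real parts of any two unshifted
    entries.\<close>
  define b where "b = \<lceil>2 * M\<rceil> + 1"
  have M: "\<bar>vv x\<bar> \<le> M" if "x \<in> I" for x unfolding M_def using that fI by (intro member_le_sum) auto
  have b: "vv x < vv y + of_int b" if "x \<in> I" "y \<in> I" for x y
  proof -
    have "2 * M \<le> of_int \<lceil>2 * M\<rceil>" by simp
    moreover have "real_of_int b = of_int \<lceil>2 * M\<rceil> + 1" by (simp add: b_def)
    ultimately show ?thesis using M[OF that(1)] M[OF that(2)] by linarith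
  qed
  have gap: "Re (val (tower N) (p+1) u) < Re (val (tower N) p q)"
    if N: "b + 1 \<le> N" and pq: "q \<in> {1..p}" "p < n" "u \<in> {1..p+1}" for N p q u
  proof -
    have B: "vv (p+1,u) < vv (p,q) + of_int b" using pq by (intro b) (auto simp: I_def)
    have e1: "Re (val (tower N) p q) = vv (p,q) + of_int (tower N (p,q))" using pq by (simp add: val_row vv_def)
    have t1: "(int n - int p) * N \<le> tower N (p,q)" using pq by (simp add: tower_def pos_def)
    show ?thesis
    proof (cases "p + 1 = n")
      case True
      then have "int n - int p = 1" by simp
      then have "b + 1 \<le> tower N (p,q)" using t1 N by simp
      then have "real_of_int b + 1 \<le> real_of_int (tower N (p,q))" by linarith
      moreover have "Re (val (tower N) (p+1) u) = vv (p+1,u)" using True by (simp add: vv_def val_def)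
      ultimately show ?thesis using B e1 by simp
    next
      case False
      have "tower N (p+1,u) \<le> (int n - int (p+1)) * N + 1" using pq False by (simp add: tower_def pos_def)
      also have "\<dots> = (int n - int p) * N - N + 1" by (simp add: algebra_simps)
      finally have "tower N (p+1,u) + b \<le> tower N (p,q)" using t1 N by linarith
      then have "real_of_int (tower N (p+1,u)) + real_of_int b \<le> real_of_int (tower N (p,q))" by linarith
      moreover have "Re (val (tower N) (p+1) u) = vv (p+1,u) + of_int (tower N (p+1,u))" using pq False by (simp add: val_row vv_def)
      ultimately show ?thesis using B e1 by simp
    qed
  qed
  \<comment> \<open>One more than b, to absorb the extra 1 that \<open>tower\<close> puts on the
    entry (k,i).\<close>
  define z0 where "z0 = tower (b + 1)"
  have z0: "z0 \<in> Zvecs n" by (simp add: z0_def tower_Zvecs)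
  have start: "reach z0 z0" using tower_kij[of "b + 1"] by (intro reach_start z0) (simp add: swap_fixed_iff z0_def)
  have up: "reach z0 (tower N)" if N: "b + 1 \<le> N" for N
  proof (rule raise[OF z0 start z0 tower_Zvecs])
    show "z0 x \<le> tower N x" for x
    proof -
      have "pos x \<Longrightarrow> (int n - int (fst x)) * (b + 1) \<le> (int n - int (fst x)) * N" using N by (intro mult_left_mono) (simp_all add: pos_def)
      then show ?thesis by (simp add: z0_def tower_def)
    qed
  qed (use gap[of "b + 1"] tower_kij in \<open>simp_all add: z0_def\<close>)
  have down: "reach z0 w" if w: "w \<in> Zvecs n" "w (k,j) \<le> w (k,i)" for w
  proof -
    \<comment> \<open>Large enough for the gaps between the rows and to dominate all entries of w,
      since every level of the tower is at least N.\<close>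
    define N where "N = \<bar>b\<bar> + 1 + (\<Sum>x\<in>I. \<bar>w x\<bar>)"
    have s: "0 \<le> (\<Sum>x\<in>I. \<bar>w x\<bar>)" by (rule sum_nonneg) simp
    have N: "b + 1 \<le> N" "0 \<le> N" using s unfolding N_def by linarith+
    show ?thesis
    proof (rule lower[OF z0 up[OF N(1)] w(1) tower_Zvecs])
      show "w x \<le> tower N x" for x
      proof (cases "pos x")
        case True
        then have "x \<in> I" by (simp add: I_def pos_def)
        then have "\<bar>w x\<bar> \<le> (\<Sum>x\<in>I. \<bar>w x\<bar>)" using fI by (intro member_le_sum) auto
        then have "w x \<le> N" by (simp add: N_def)
        also have "1 * N \<le> (int n - int (fst x)) * N" using True N(2) by (intro mult_right_mono) (simp_all add: pos_def)
        finally show ?thesis using True by (auto simp: tower_def)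
      next
        case False
        then have "w x = 0" using w(1) unfolding Zvecs_pos by blast
        then show ?thesis using False by (simp add: tower_def)
      qed
      fix p q u assume pq: "q \<in> {1..p}" "p < n" "u \<in> {1..p-1}"
      have "p - 1 + 1 = p" using pq by simp
      then show "Re (val (tower N) p q) < Re (val (tower N) (p-1) u)"
        using gap[OF N(1), of u "p - 1" q] pq by simp
    qed (use w(2) tower_kij in simp_all)
  qed
  have "reach z0 w" if w: "w \<in> Zvecs n" for w
  proof (cases "w (k,j) \<le> w (k,i)")
    case False
    have "reach z0 (\<tau> w)"
    proof (rule down)
      show "\<tau> w \<in> Zvecs n" using w by simp
      show "\<tau> w (k,j) \<le> \<tau> w (k,i)" using False kn(5) by (simp add: swap_def)
    qed
    then show ?thesis by (rule reach_tau[OF z0])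
  qed (rule down[OF w])
  then show ?thesis using z0 by blast
qed

text \<open>One generator suffices, the class of DT at z0: lifts of symbols span, and each of them
  has been reached.\<close>

lemma finitely_generated_V: "finitely_generated (Ugl n) V"
proof -
  interpret left_module "Ugl n" V by (rule left_module_V)
  obtain z0 where z0: "z0 \<in> Zvecs n" "\<And>w. w \<in> Zvecs n \<Longrightarrow> reach z0 w" using all_reached by blast
  define G0 where "G0 = symm (Poly_Mapping.single z0 fls_X_inv)"
  have G0: "lat G0" unfolding G0_def by (rule lat_start[OF z0(1)])
  have all: "gen z0 (Psi f)" if f: "f \<in> F0" for f
  proof -
    have b: "gen z0 (Psi (T b))" if "b \<in> Poly_Mapping.keys f" for b
    proof -
      have "b \<in> Tsym ` Zvecs n \<union> DTsym ` Zvecs n" using f that unfolding F0_def by blast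
      then obtain z where "z \<in> Zvecs n" "b = Tsym z \<or> b = DTsym z" by blast
      then show ?thesis using z0(1) z0(2)[of z] by (auto simp: Psi_T Psi_DT reach_def[OF z0(1)] symm_def[symmetric])
    qed
    show ?thesis by (subst Psi_symbols) (intro gen_sum[OF z0(1)] gen_scale[OF z0(1)] b)
  qed
  show ?thesis
    unfolding finitely_generated_def
  proof (intro exI[of _ "{cl G0}"] conjI ballI)
    show "finite {cl G0}" "{cl G0} \<subseteq> carrier V" using G0 by simp_all
    fix u assume "u \<in> carrier V"
    then obtain G where G: "lat G" "u = cl G" by (rule V_cases)
    have "gen z0 G" using gen_eqv[OF z0(1) all[OF half_Delta(1)[OF G(1)]] half_Delta(2)[OF G(1)] G(1)] .
    then obtain y where y: "y \<in> free_letters n" "G \<asymp> app (\<rho> y) G0" unfolding gen_def G0_def by blast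
    have u: "u = Ucls n y \<odot>\<^bsub>V\<^esub> cl G0"
      unfolding G(2) smult_cl[OF y(1) G0] using y(2) by (simp add: cl_eq[OF G(1) lat_rho[OF y(1) G0]])
    have "Ucls n y \<odot>\<^bsub>V\<^esub> cl G0 \<in> carrier V" using y(1) G0 by (simp add: smult_cl lat_rho)
    then have "u = (\<Oplus>\<^bsub>V\<^esub>b\<in>{cl G0}. Ucls n y \<odot>\<^bsub>V\<^esub> b)"
      unfolding u by (subst M.finsum_insert) auto
    then show "\<exists>x. x \<in> {cl G0} \<rightarrow> carrier (Ugl n) \<and> u = (\<Oplus>\<^bsub>V\<^esub>b\<in>{cl G0}. x b \<odot>\<^bsub>V\<^esub> b)"
      using y(1) by (intro exI[of _ "\<lambda>_. Ucls n y"]) auto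
  qed
qed

end

theorem theorem5p6:
  fixes n k i j :: nat and a :: "nat \<Rightarrow> complex" and v :: "nat \<times> nat \<Rightarrow> complex"
  assumes "1 \<le> i" and "i < j" and "j \<le> k" and "k \<le> n - 1"
    and "v (k,i) = v (k,j)"
    and "\<And>r s u. \<lbrakk>1 \<le> s; s < u; u \<le> r; r \<le> n - 1; (r, s, u) \<noteq> (k, i, j)\<rbrakk>
           \<Longrightarrow> v (r,s) - v (r,u) \<notin> \<int>"
  shows "one_singular_GT_module n (V_sing n k i j a v) \<and>
    (\<forall>z\<in>Zvecs n. \<forall>r s. 1 \<le> s \<and> s \<le> r \<and> r \<le> n \<longrightarrow>
      (regular_tab (scale (x_minus_y k i j) (gen_act n a (c_free r s) (gen_tab z))) v \<and>
       c_env n r s \<odot>\<^bsub>V_sing n k i j a v\<^esub> T_sing n k i j z =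
         Dtab n k i j v (scale (x_minus_y k i j) (gen_act n a (c_free r s) (gen_tab z)))) \<and>
      (z \<noteq> swap k i j z \<longrightarrow>
       regular_tab (gen_act n a (c_free r s) (gen_tab z)) v \<and>
       c_env n r s \<odot>\<^bsub>V_sing n k i j a v\<^esub> DT_sing n k i j z =
         Dtab n k i j v (gen_act n a (c_free r s) (gen_tab z))))"
proof -
  interpret singular_point n k i j a v
    by unfold_locales (use assms in auto)
  show ?thesis
    unfolding one_singular_GT_module_def GT_module_def
    by (intro conjI ballI allI impI left_module_V finitely_generated_V direct_sum one_singular_witness; elim conjE; rule c_action; assumption)
qed

end
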